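(* Let $D$ be a 2-dimensional regular local ring and let $M$ be a normal projective model over $D$. The closed points of the minimal desingularization of $M$ are precisely the points in $Q(D)$ that are minimal (with respect to inclusion in $Q(D)$) with respect to dominating a closed point in $M$.
   Context: $D$ is a 2-dimensional regular local ring with maximal ideal $\mathfrak m_D$ and quotient field $F$. For a 2-dimensional regular local ring $S$ with maximal ideal $\mathfrak m_S$, a local quadratic transform of $S$ is a localization of $S[\mathfrak m_S/a]$ (with $a\in\mathfrak m_S\setminus\mathfrak m_S^2$) at a height 2 maximal ideal. The quadratic tree $Q(D)$ is the set, partially ordered by inclusion, of all rings obtained from $D$ by a finite (possibly zero) number of successive local quadratic transforms; it is the set of all 2-dimensional regular local rings with quotient field $F$ that dominate $D$. A local ring $S$ dominates a local ring $R$ if $R\subseteq S$ and $\mathfrak m_S\cap R=\mathfrak m_R$. A projective model over $D$ is $\operatorname{Proj} D[Jt]$ for an $\mathfrak m_D$-primary ideal $J=(a_0,\ldots,a_n)D$ with all $a_i\ne 0$, identified with the set of all local rings $(A_i)_{\mathfrak p}$, $\mathfrak p\in\operatorname{Spec}A_i$, where $A_i=D[a_0/a_i,\ldots,a_n/a_i]$, $i=0,\ldots,n$. Its closed points are the local rings in it of dimension 2. It is normal (resp. nonsingular) if every local ring in it is a normal domain (resp. regular). A model $N$ dominates a model $M$ if each local ring in $N$ dominates a local ring in $M$. A desingularization of $M$ is a nonsingular projective model over $D$ that dominates $M$; the minimal desingularization of $M$ is the (unique) desingularization $N$ of $M$ such that every desingularization of $M$ dominates $N$. *)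

theory Defs
  imports "HOL-Algebra.Algebra" "HOL-Library.Extended_Nat"
begin

text \<open>
  All rings of the theory are subrings of one fixed field \<open>F\<close>. They are represented by their
  carriers, so that inclusion and equality of rings are inclusion and equality of sets; the ring
  structure on such a carrier \<open>S\<close> is the following one.
\<close>

abbreviation restr :: "('a, 'b) ring_scheme \<Rightarrow> 'a set \<Rightarrow> ('a, 'b) ring_scheme" (infixl "\<restriction>" 100)
  where "F \<restriction> S \<equiv> F\<lparr>carrier := S\<rparr>"

section \<open>Dimension and regularity\<close>

definition prime_chain :: "('a, 'b) ring_scheme \<Rightarrow> nat \<Rightarrow> (nat \<Rightarrow> 'a set) \<Rightarrow> bool" where
  "prime_chain R n P \<longleftrightarrow> (\<forall>i\<le>n. primeideal (P i) R) \<and> (\<forall>i<n. P i \<subset> P (Suc i))"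

definition krull_dim :: "('a, 'b) ring_scheme \<Rightarrow> enat" where
  "krull_dim R = Sup {enat n | n. \<exists>P. prime_chain R n P}"

definition height :: "('a, 'b) ring_scheme \<Rightarrow> 'a set \<Rightarrow> enat" where
  "height R \<pp> = Sup {enat n | n. \<exists>P. prime_chain R n P \<and> P n = \<pp>}"

definition local_ring :: "('a, 'b) ring_scheme \<Rightarrow> bool" where
  "local_ring R \<longleftrightarrow> cring R \<and> (\<exists>!\<mm>. maximalideal \<mm> R)"

definition max_ideal :: "('a, 'b) ring_scheme \<Rightarrow> 'a set" where
  "max_ideal R = (THE \<mm>. maximalideal \<mm> R)"

definition regular_local_ring :: "('a, 'b) ring_scheme \<Rightarrow> bool" where
  "regular_local_ring R \<longleftrightarrow> local_ring R \<and> noetherian_ring R \<and>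
     (\<exists>A \<subseteq> carrier R. finite A \<and> enat (card A) = krull_dim R \<and> max_ideal R = Idl\<^bsub>R\<^esub> A)"

section \<open>Fractions, localizations and normality inside a field\<close>

definition fractions :: "('a, 'b) ring_scheme \<Rightarrow> 'a set \<Rightarrow> 'a set" where
  "fractions F S = {x \<otimes>\<^bsub>F\<^esub> inv\<^bsub>F\<^esub> y | x y. x \<in> S \<and> y \<in> S - {\<zero>\<^bsub>F\<^esub>}}"

definition localize :: "('a, 'b) ring_scheme \<Rightarrow> 'a set \<Rightarrow> 'a set \<Rightarrow> 'a set" where
  "localize F S \<pp> = {x \<otimes>\<^bsub>F\<^esub> inv\<^bsub>F\<^esub> y | x y. x \<in> S \<and> y \<in> S - \<pp>}"

text \<open>In HOL-Algebra \<open>[]\<close> is the zero polynomial, and \<open>lead_coeff []\<close> is unspecified.\<close>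

definition integral_over :: "('a, 'b) ring_scheme \<Rightarrow> 'a set \<Rightarrow> 'a \<Rightarrow> bool" where
  "integral_over F S x \<longleftrightarrow>
     (\<exists>p \<in> carrier (S [X]\<^bsub>F\<^esub>). p \<noteq> [] \<and> lead_coeff p = \<one>\<^bsub>F\<^esub> \<and> ring.eval F p x = \<zero>\<^bsub>F\<^esub>)"

definition normal_domain :: "('a, 'b) ring_scheme \<Rightarrow> 'a set \<Rightarrow> bool" where
  "normal_domain F S \<longleftrightarrow>
     subdomain S F \<and> (\<forall>x \<in> fractions F S. integral_over F S x \<longrightarrow> x \<in> S)"

definition dominates :: "('a, 'b) ring_scheme \<Rightarrow> 'a set \<Rightarrow> 'a set \<Rightarrow> bool" where
  "dominates F S R \<longleftrightarrow> local_ring (F \<restriction> S) \<and> local_ring (F \<restriction> R) \<and>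
     R \<subseteq> S \<and> max_ideal (F \<restriction> S) \<inter> R = max_ideal (F \<restriction> R)"

section \<open>The quadratic tree\<close>

definition quadratic_transform :: "('a, 'b) ring_scheme \<Rightarrow> 'a set \<Rightarrow> 'a set \<Rightarrow> bool" where
  "quadratic_transform F S T \<longleftrightarrow>
     (let \<mm> = max_ideal (F \<restriction> S) in
      \<exists>a \<in> \<mm> - \<mm> \<cdot>\<^bsub>F \<restriction> S\<^esub> \<mm>.
        let A = generate_ring F (S \<union> {x \<otimes>\<^bsub>F\<^esub> inv\<^bsub>F\<^esub> a | x. x \<in> \<mm>}) in
        \<exists>\<nn>. maximalideal \<nn> (F \<restriction> A) \<and> height (F \<restriction> A) \<nn> = 2 \<and> T = localize F A \<nn>)"

inductive_set quadratic_tree :: "('a, 'b) ring_scheme \<Rightarrow> 'a set \<Rightarrow> 'a set set"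
  for F and D where
    base: "D \<in> quadratic_tree F D"
  | step: "\<lbrakk> S \<in> quadratic_tree F D; quadratic_transform F S T \<rbrakk> \<Longrightarrow> T \<in> quadratic_tree F D"

section \<open>Projective models\<close>

definition primary_ideal :: "('a, 'b) ring_scheme \<Rightarrow> 'a set \<Rightarrow> bool" where
  "primary_ideal R Q \<longleftrightarrow> ideal Q R \<and> Q \<noteq> carrier R \<and>
     (\<forall>x \<in> carrier R. \<forall>y \<in> carrier R.
        x \<otimes>\<^bsub>R\<^esub> y \<in> Q \<longrightarrow> x \<in> Q \<or> (\<exists>k::nat. y [^]\<^bsub>R\<^esub> k \<in> Q))"

definition radical :: "('a, 'b) ring_scheme \<Rightarrow> 'a set \<Rightarrow> 'a set" where
  "radical R Q = {x \<in> carrier R. \<exists>k::nat. x [^]\<^bsub>R\<^esub> k \<in> Q}"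

definition affine_chart ::
    "('a, 'b) ring_scheme \<Rightarrow> 'a set \<Rightarrow> nat \<Rightarrow> (nat \<Rightarrow> 'a) \<Rightarrow> nat \<Rightarrow> 'a set" where
  "affine_chart F D n a i =
     generate_ring F (D \<union> {a j \<otimes>\<^bsub>F\<^esub> inv\<^bsub>F\<^esub> (a i) | j. j \<le> n})"

text \<open>A model is the set of its local rings.\<close>

definition projective_model :: "('a, 'b) ring_scheme \<Rightarrow> 'a set \<Rightarrow> 'a set set \<Rightarrow> bool" where
  "projective_model F D M \<longleftrightarrow>
     (\<exists>n a. (\<forall>i\<le>n. a i \<in> D - {\<zero>\<^bsub>F\<^esub>}) \<and>
        primary_ideal (F \<restriction> D) (Idl\<^bsub>F \<restriction> D\<^esub> (a ` {..n})) \<and>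
        radical (F \<restriction> D) (Idl\<^bsub>F \<restriction> D\<^esub> (a ` {..n})) = max_ideal (F \<restriction> D) \<and>
        M = {localize F (affine_chart F D n a i) \<pp> | i \<pp>.
               i \<le> n \<and> primeideal \<pp> (F \<restriction> affine_chart F D n a i)})"

definition closed_points :: "('a, 'b) ring_scheme \<Rightarrow> 'a set set \<Rightarrow> 'a set set" where
  "closed_points F M = {S \<in> M. krull_dim (F \<restriction> S) = 2}"

definition normal_model :: "('a, 'b) ring_scheme \<Rightarrow> 'a set set \<Rightarrow> bool" where
  "normal_model F M \<longleftrightarrow> (\<forall>S \<in> M. normal_domain F S)"

definition nonsingular_model :: "('a, 'b) ring_scheme \<Rightarrow> 'a set set \<Rightarrow> bool" where
  "nonsingular_model F M \<longleftrightarrow> (\<forall>S \<in> M. regular_local_ring (F \<restriction> S))"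

definition model_dominates :: "('a, 'b) ring_scheme \<Rightarrow> 'a set set \<Rightarrow> 'a set set \<Rightarrow> bool" where
  "model_dominates F N M \<longleftrightarrow> (\<forall>S \<in> N. \<exists>R \<in> M. dominates F S R)"

definition desingularization ::
    "('a, 'b) ring_scheme \<Rightarrow> 'a set \<Rightarrow> 'a set set \<Rightarrow> 'a set set \<Rightarrow> bool" where
  "desingularization F D M N \<longleftrightarrow>
     projective_model F D N \<and> nonsingular_model F N \<and> model_dominates F N M"

definition minimal_desingularization ::
    "('a, 'b) ring_scheme \<Rightarrow> 'a set \<Rightarrow> 'a set set \<Rightarrow> 'a set set \<Rightarrow> bool" where
  "minimal_desingularization F D M N \<longleftrightarrow>
     desingularization F D M N \<and>
     (\<forall>N'. desingularization F D M N' \<longrightarrow> model_dominates F N' N)"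

definition dominates_closed_point :: "('a, 'b) ring_scheme \<Rightarrow> 'a set set \<Rightarrow> 'a set \<Rightarrow> bool" where
  "dominates_closed_point F M R \<longleftrightarrow> (\<exists>S \<in> closed_points F M. dominates F R S)"

end

theory Submission
  imports Defs "HOL-Computational_Algebra.Polynomial"
begin

text \<open>
  Let $M$ be the model of the ideal $I$. A local overring of $D$ dominates a point of a model if and
  only if the defining ideal becomes principal in it, and a point dominated by a two-dimensional
  regular local ring is closed. Let $N$ be the minimal desingularization. Its closed points are
  two-dimensional regular local rings, so they lie in $Q(D)$ by Abhyankar's factorization theorem, and
  they dominate closed points of $M$. Conversely, every $R \in Q(D)$ that dominates a closed point of
  $M$ dominates a point of some desingularization, and hence, by minimality, a closed point of $N$.
  For this, start with the model $N$ and follow the quadratic transforms from $D$ to $R$: at each of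
  them the part of the model above the transform can be changed without affecting the rest, and at
  $R$ itself, where $I$ is already principal, no further blowing up is needed. Finally, a local
  ring dominates at most one point of $N$, so the closed points of $N$ are exactly the minimal
  elements.
\<close>

section \<open>Subrings of a field and their ideals\<close>

text \<open>Minimality of N only compares it with other projective models. So for each R one ideal
  of D must be exhibited: its model is regular, I is principal in every point of it, and the ideal
  is principal in R. Changing a model over T alone is immediate for schemes, but here one global
  ideal has to do it: \<open>glue\<close> imposes conditions at all points of the blowup of the
  maximal ideal at once, and its result agrees with J only up to a power of the maximal ideal. That
  power is harmless, because a regular point of the model of J makes the maximal ideal of S
  principal as soon as J is not principal in S (\<open>sregular_fibre\<close>). The comparison of
  regular rings behind this, \<open>dominating_regular\<close>, also drives the factorization
  theorem. Overrings of D can fail to be Noetherian, so their dimension is bounded by counting: too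
  many monomials in numerators and denominators satisfy a relation with a unit coefficient, and such
  a relation cannot survive in a long chain of primes.\<close>

definition sring :: "'f::field set \<Rightarrow> bool" where
  "sring S \<longleftrightarrow> 1 \<in> S \<and> (\<forall>a\<in>S. \<forall>b\<in>S. a - b \<in> S \<and> a * b \<in> S)"

text \<open>Submodules of the whole field rather than of S: this covers fractional ideals, such as
  the set of all w with c * w in a given ideal, and lets one set be a module over several
  rings.\<close>

definition smod :: "'f::field set \<Rightarrow> 'f set \<Rightarrow> bool" where
  "smod S I \<longleftrightarrow> 0 \<in> I \<and> (\<forall>a\<in>I. \<forall>b\<in>I. a + b \<in> I) \<and> (\<forall>s\<in>S. \<forall>a\<in>I. s * a \<in> I)"

definition sideal :: "'f::field set \<Rightarrow> 'f set \<Rightarrow> bool" where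
  "sideal S I \<longleftrightarrow> smod S I \<and> I \<subseteq> S"

definition sprime :: "'f::field set \<Rightarrow> 'f set \<Rightarrow> bool" where
  "sprime S P \<longleftrightarrow> sideal S P \<and> 1 \<notin> P \<and> (\<forall>a\<in>S. \<forall>b\<in>S. a * b \<in> P \<longrightarrow> a \<in> P \<or> b \<in> P)"

definition smaximal :: "'f::field set \<Rightarrow> 'f set \<Rightarrow> bool" where
  "smaximal S M \<longleftrightarrow> sideal S M \<and> 1 \<notin> M \<and> (\<forall>I. sideal S I \<longrightarrow> M \<subseteq> I \<longrightarrow> 1 \<notin> I \<longrightarrow> I = M)"

text \<open>A need not lie in S. For an ideal A of a smaller ring this is the extension of A to
  S.\<close>

definition genid :: "'f::field set \<Rightarrow> 'f set \<Rightarrow> 'f set" where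
  "genid S A = \<Inter>{I. smod S I \<and> A \<subseteq> I}"

text \<open>Zero is listed separately because \<open>inverse 0 = 0\<close> belongs to every
  subring.\<close>

definition nonunits :: "'f::field set \<Rightarrow> 'f set" where
  "nonunits S = {a \<in> S. a = 0 \<or> inverse a \<notin> S}"

definition slocal :: "'f::field set \<Rightarrow> bool" where
  "slocal S \<longleftrightarrow> sring S \<and> (\<forall>a\<in>nonunits S. \<forall>b\<in>nonunits S. a + b \<in> nonunits S)"

definition snoeth :: "'f::field set \<Rightarrow> bool" where
  "snoeth S \<longleftrightarrow> (\<forall>I. sideal S I \<longrightarrow> (\<exists>A. finite A \<and> A \<subseteq> S \<and> I = genid S A))"

text \<open>Inclusion of the nonunits is enough: a unit of S stays a unit in T, so
  \<open>nonunits T \<inter> S = nonunits S\<close> follows (\<open>sdom_nonunits\<close>).\<close>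

definition sdom :: "'f::field set \<Rightarrow> 'f set \<Rightarrow> bool" where
  "sdom T S \<longleftrightarrow> slocal T \<and> slocal S \<and> S \<subseteq> T \<and> nonunits S \<subseteq> nonunits T"

definition locz :: "'f::field set \<Rightarrow> 'f set \<Rightarrow> 'f set" where
  "locz A P = {x / y | x y. x \<in> A \<and> y \<in> A - P}"

lemma sring_1: "sring S \<Longrightarrow> 1 \<in> S"
  and sring_diff: "sring S \<Longrightarrow> a \<in> S \<Longrightarrow> b \<in> S \<Longrightarrow> a - b \<in> S"
  and sring_mult: "sring S \<Longrightarrow> a \<in> S \<Longrightarrow> b \<in> S \<Longrightarrow> a * b \<in> S"
  by (auto simp: sring_def)

lemma sring_0: "sring S \<Longrightarrow> 0 \<in> S"
  using sring_diff[of S 1 1] sring_1 by auto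

lemma sring_minus: "sring S \<Longrightarrow> a \<in> S \<Longrightarrow> - a \<in> S"
  using sring_diff[of S 0 a] sring_0 by auto

lemma sring_add: "sring S \<Longrightarrow> a \<in> S \<Longrightarrow> b \<in> S \<Longrightarrow> a + b \<in> S"
  using sring_diff[of S a "- b"] sring_minus by auto

lemma sring_pow: "sring S \<Longrightarrow> a \<in> S \<Longrightarrow> a ^ n \<in> S"
  by (induction n) (auto simp: sring_1 sring_mult)

lemma sring_sum: "sring S \<Longrightarrow> (\<And>i. i \<in> V \<Longrightarrow> f i \<in> S) \<Longrightarrow> sum f V \<in> S"
  by (induction V rule: infinite_finite_induct) (auto simp: sring_0 sring_add)

lemmas sring_rules = sring_0 sring_1 sring_minus sring_diff sring_add sring_mult sring_pow

lemma smod_0: "smod S I \<Longrightarrow> 0 \<in> I"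
  and smod_add: "smod S I \<Longrightarrow> a \<in> I \<Longrightarrow> b \<in> I \<Longrightarrow> a + b \<in> I"
  and smod_mult: "smod S I \<Longrightarrow> s \<in> S \<Longrightarrow> a \<in> I \<Longrightarrow> s * a \<in> I"
  by (auto simp: smod_def)

lemma smod_mult2: "smod S I \<Longrightarrow> s \<in> S \<Longrightarrow> a \<in> I \<Longrightarrow> a * s \<in> I"
  using smod_mult by (metis mult.commute)

lemma smod_minus: "sring S \<Longrightarrow> smod S I \<Longrightarrow> a \<in> I \<Longrightarrow> - a \<in> I"
  using smod_mult[of S I "-1" a] sring_minus[of S 1] sring_1 by auto

lemma smod_diff: "sring S \<Longrightarrow> smod S I \<Longrightarrow> a \<in> I \<Longrightarrow> b \<in> I \<Longrightarrow> a - b \<in> I"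
  using smod_add[of S I a "-b"] smod_minus by auto

lemma smod_sum: "smod S I \<Longrightarrow> (\<And>i. i \<in> V \<Longrightarrow> f i \<in> I) \<Longrightarrow> sum f V \<in> I"
  by (induction V rule: infinite_finite_induct) (auto simp: smod_0 smod_add)

lemma smod_subring: "smod T I \<Longrightarrow> S \<subseteq> T \<Longrightarrow> smod S I"
  by (auto simp: smod_def)

lemma smod_self: "sring S \<Longrightarrow> smod S S"
  by (auto simp: smod_def sring_rules)

lemma sideal_smod: "sideal S I \<Longrightarrow> smod S I"
  and sideal_sub: "sideal S I \<Longrightarrow> I \<subseteq> S"
  by (auto simp: sideal_def)

lemma sideal_1: "sring S \<Longrightarrow> sideal S I \<Longrightarrow> 1 \<in> I \<Longrightarrow> I = S"
  using smod_mult[of S I _ 1] by (auto simp: sideal_def)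

lemma sprime_sideal: "sprime S P \<Longrightarrow> sideal S P"
  and sprime_1: "sprime S P \<Longrightarrow> 1 \<notin> P"
  and sprime_prime: "sprime S P \<Longrightarrow> a \<in> S \<Longrightarrow> b \<in> S \<Longrightarrow> a * b \<in> P \<Longrightarrow> a \<in> P \<or> b \<in> P"
  and sprime_smod: "sprime S P \<Longrightarrow> smod S P"
  and sprime_sub: "sprime S P \<Longrightarrow> P \<subseteq> S"
  by (auto simp: sprime_def sideal_def)

lemma sprime_pow: "sring S \<Longrightarrow> sprime S P \<Longrightarrow> a \<in> S \<Longrightarrow> a ^ n \<in> P \<Longrightarrow> a \<in> P"
proof (induction n)
  case (Suc n)
  then show ?case using sprime_prime[of S P a "a ^ n"] by (auto simp: sring_pow)
qed (auto dest: sprime_1)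

lemma sprime_contract: "sring S \<Longrightarrow> S \<subseteq> T \<Longrightarrow> sprime T P \<Longrightarrow> sprime S (P \<inter> S)"
  unfolding sprime_def sideal_def smod_def by (auto simp: sring_rules) (meson subsetD)+

lemma sprime_zero: "sring S \<Longrightarrow> sprime S {0}"
  by (auto simp: sprime_def sideal_def smod_def sring_0)

lemma genid_smod: "smod S (genid S A)"
  by (auto simp: genid_def smod_def)

lemma genid_incl: "A \<subseteq> genid S A"
  by (auto simp: genid_def)

lemma genid_in: "a \<in> A \<Longrightarrow> a \<in> genid S A"
  using genid_incl by auto

lemma genid_least: "smod S I \<Longrightarrow> A \<subseteq> I \<Longrightarrow> genid S A \<subseteq> I"
  by (auto simp: genid_def)

lemma genid_mono: "S \<subseteq> T \<Longrightarrow> A \<subseteq> B \<Longrightarrow> genid S A \<subseteq> genid T B"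
  using genid_least[OF smod_subring[OF genid_smod[of T B]], of S A] genid_incl[of B T] by auto

lemma genid_sideal: "sring S \<Longrightarrow> A \<subseteq> S \<Longrightarrow> sideal S (genid S A)"
  by (simp add: sideal_def genid_smod genid_least smod_self)

lemma genid_eq: "sideal S I \<Longrightarrow> genid S I = I"
  using genid_least[of S I I] genid_incl[of I S] by (auto simp: sideal_def)

lemma genid_empty: "genid S {} = {0}"
  using genid_least[of S "{0}" "{}"] smod_0[OF genid_smod[of S "{}"]] by (auto simp: smod_def)

lemma genid_insert:
  assumes "sring S"
  shows "genid S (insert a A) = {s * a + b | s b. s \<in> S \<and> b \<in> genid S A}" (is "_ = ?R")
proof
  have "smod S ?R"
    unfolding smod_def
  proof (intro conjI ballI)
    show "0 \<in> ?R" using sring_0[OF assms] smod_0[OF genid_smod] by force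
    fix u v assume "u \<in> ?R" "v \<in> ?R"
    then obtain s b s' b' where h: "u = s * a + b" "v = s' * a + b'" "s \<in> S" "s' \<in> S" "b \<in> genid S A" "b' \<in> genid S A"
      by blast
    have "u + v = (s + s') * a + (b + b')" using h by (simp add: algebra_simps)
    then show "u + v \<in> ?R" using h assms smod_add[OF genid_smod] sring_add by blast
  next
    fix r u assume r: "r \<in> S" and "u \<in> ?R"
    then obtain s b where h: "u = s * a + b" "s \<in> S" "b \<in> genid S A" by blast
    have "r * u = (r * s) * a + r * b" using h by (simp add: algebra_simps)
    then show "r * u \<in> ?R" using h r assms smod_mult[OF genid_smod] sring_mult by blast
  qed
  moreover have "insert a A \<subseteq> ?R"
  proof
    fix v assume "v \<in> insert a A"
    then show "v \<in> ?R"
    proof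
      assume "v = a" then have "v = 1 * a + 0" by simp
      then show ?thesis using sring_1[OF assms] smod_0[OF genid_smod] by blast
    next
      assume "v \<in> A" then have "v = 0 * a + v" "v \<in> genid S A" by (auto simp: genid_in)
      then show ?thesis using sring_0[OF assms] by blast
    qed
  qed
  ultimately show "genid S (insert a A) \<subseteq> ?R" by (rule genid_least)
  have "genid S A \<subseteq> genid S (insert a A)" by (rule genid_mono) auto
  moreover have "s * a \<in> genid S (insert a A)" if "s \<in> S" for s
    using smod_mult[OF genid_smod that] by (simp add: genid_in)
  ultimately show "?R \<subseteq> genid S (insert a A)"
    using smod_add[OF genid_smod, of _ S "insert a A"] by blast
qed

lemma genid_single: "sring S \<Longrightarrow> genid S {a} = {s * a | s. s \<in> S}"
  by (auto simp: genid_insert genid_empty)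

lemma genid_pair: "sring S \<Longrightarrow> genid S {a, b} = {s * a + t * b | s t. s \<in> S \<and> t \<in> S}"
  by (auto simp: genid_insert genid_single genid_empty)

lemma genid_scale: "c \<noteq> 0 \<Longrightarrow> (\<And>a. a \<in> A \<Longrightarrow> c * a \<in> genid S B) \<Longrightarrow> w \<in> genid S A \<Longrightarrow> c * w \<in> genid S B"
proof -
  assume h: "c \<noteq> 0" "\<And>a. a \<in> A \<Longrightarrow> c * a \<in> genid S B" "w \<in> genid S A"
  have "smod S {w. c * w \<in> genid S B}"
    using smod_0[OF genid_smod] smod_add[OF genid_smod] smod_mult[OF genid_smod]
    by (auto simp: smod_def distrib_left mult.left_commute)
  then have "genid S A \<subseteq> {w. c * w \<in> genid S B}" using h by (intro genid_least) auto
  then show ?thesis using h by auto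
qed

section \<open>Local rings and localizations\<close>

lemma slocal_sring: "slocal S \<Longrightarrow> sring S" by (simp add: slocal_def)

lemma nonunits_sub: "nonunits S \<subseteq> S" by (auto simp: nonunits_def)

lemma nonunits_0: "sring S \<Longrightarrow> 0 \<in> nonunits S" by (auto simp: nonunits_def sring_0)

lemma nonunits_1: "sring S \<Longrightarrow> 1 \<notin> nonunits S" by (auto simp: nonunits_def)

lemma unit_inverse: "a \<in> S \<Longrightarrow> a \<notin> nonunits S \<Longrightarrow> a \<noteq> 0 \<and> inverse a \<in> S"
  by (auto simp: nonunits_def)

lemma nonunits_mult: "sring S \<Longrightarrow> s \<in> S \<Longrightarrow> a \<in> nonunits S \<Longrightarrow> s * a \<in> nonunits S"
proof -
  assume h: "sring S" "s \<in> S" "a \<in> nonunits S"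
  { assume "s * a \<noteq> 0" "inverse (s * a) \<in> S"
    then have "s * inverse (s * a) \<in> S" "s * inverse (s * a) = inverse a"
      using h sring_mult[of S s "inverse (s * a)"] by simp_all
    then have "inverse a \<in> S" by metis
    then have False using h \<open>s * a \<noteq> 0\<close> by (auto simp: nonunits_def) }
  then show ?thesis using h by (auto simp: nonunits_def sring_mult)
qed

lemma nonunits_mult2: "sring S \<Longrightarrow> s \<in> S \<Longrightarrow> a \<in> nonunits S \<Longrightarrow> a * s \<in> nonunits S"
  using nonunits_mult by (metis mult.commute)

lemma nonunits_sideal: "slocal S \<Longrightarrow> sideal S (nonunits S)"
  using nonunits_0[of S] nonunits_mult[of S] nonunits_sub[of S] by (auto simp: slocal_def sideal_def smod_def)

lemma nonunits_smod: "slocal S \<Longrightarrow> smod S (nonunits S)"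
  using nonunits_sideal sideal_smod by auto

lemma nonunits_sprime: "slocal S \<Longrightarrow> sprime S (nonunits S)"
proof -
  assume S: "slocal S"
  have "a \<in> nonunits S \<or> b \<in> nonunits S" if "a \<in> S" "b \<in> S" "a * b \<in> nonunits S" for a b
  proof (rule ccontr)
    assume "\<not> ?thesis"
    then have "a \<noteq> 0" "b \<noteq> 0" "inverse a \<in> S" "inverse b \<in> S" using that unit_inverse by blast+
    then have "inverse (a * b) \<in> S" "a * b \<noteq> 0" using S by (auto simp: sring_mult slocal_sring)
    then show False using that(3) by (auto simp: nonunits_def)
  qed
  then show ?thesis using nonunits_sideal[OF S] nonunits_1[OF slocal_sring[OF S]] by (auto simp: sprime_def)
qed

lemma sideal_nonunits: "sring S \<Longrightarrow> sideal S I \<Longrightarrow> 1 \<notin> I \<Longrightarrow> I \<subseteq> nonunits S"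
proof
  fix a assume h: "sring S" "sideal S I" "1 \<notin> I" "a \<in> I"
  show "a \<in> nonunits S"
  proof (rule ccontr)
    assume "a \<notin> nonunits S"
    then have "a \<noteq> 0" "inverse a \<in> S" using h unit_inverse by (auto simp: sideal_def)
    then have "inverse a * a \<in> I" using h smod_mult[of S I "inverse a" a] by (simp add: sideal_def)
    then show False using h \<open>a \<noteq> 0\<close> by simp
  qed
qed

lemma one_minus_unit: "slocal S \<Longrightarrow> a \<in> nonunits S \<Longrightarrow> 1 - a \<notin> nonunits S"
  using nonunits_1[OF slocal_sring] by (metis diff_add_cancel slocal_def)

lemma one_plus_unit: "slocal S \<Longrightarrow> a \<in> nonunits S \<Longrightarrow> 1 + a \<notin> nonunits S"
  using one_minus_unit[of S "- a"] smod_minus[OF slocal_sring nonunits_smod] by fastforce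

lemma unit_plus: "slocal S \<Longrightarrow> u \<in> S \<Longrightarrow> u \<notin> nonunits S \<Longrightarrow> a \<in> nonunits S \<Longrightarrow> u + a \<notin> nonunits S"
  using smod_diff[OF slocal_sring nonunits_smod, of S "u + a" a] by auto

lemma unit_mult: "slocal S \<Longrightarrow> u \<in> S \<Longrightarrow> v \<in> S \<Longrightarrow> u \<notin> nonunits S \<Longrightarrow> v \<notin> nonunits S \<Longrightarrow> u * v \<notin> nonunits S"
  using sprime_prime[OF nonunits_sprime] by blast

lemma unit_pow: "slocal S \<Longrightarrow> u \<in> S \<Longrightarrow> u \<notin> nonunits S \<Longrightarrow> u ^ n \<notin> nonunits S"
  using sprime_pow[OF slocal_sring nonunits_sprime] by blast

lemma inverse_unit: "slocal S \<Longrightarrow> u \<in> S \<Longrightarrow> u \<notin> nonunits S \<Longrightarrow> inverse u \<in> S \<and> inverse u \<notin> nonunits S"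
  unfolding nonunits_def by auto

lemma div_unit: "slocal S \<Longrightarrow> a \<in> S \<Longrightarrow> u \<in> S \<Longrightarrow> u \<notin> nonunits S \<Longrightarrow> a / u \<in> S"
  using inverse_unit[of S u] by (auto simp: divide_inverse slocal_sring sring_mult)

lemma sdom_refl: "slocal S \<Longrightarrow> sdom S S" by (auto simp: sdom_def)

lemma sdom_trans: "sdom T S \<Longrightarrow> sdom S R \<Longrightarrow> sdom T R" by (auto simp: sdom_def)

lemma sdom_slocal: "sdom T S \<Longrightarrow> slocal T \<and> slocal S" by (auto simp: sdom_def)

lemma sdom_sub: "sdom T S \<Longrightarrow> S \<subseteq> T" by (auto simp: sdom_def)

lemma sdom_nonunits: "sdom T S \<Longrightarrow> nonunits T \<inter> S = nonunits S"
  unfolding sdom_def nonunits_def by auto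

lemma sdom_nonunit_iff: "sdom T S \<Longrightarrow> a \<in> S \<Longrightarrow> a \<in> nonunits T \<longleftrightarrow> a \<in> nonunits S"
  using sdom_nonunits by blast

lemma sdom_iff: "sdom T S \<longleftrightarrow> slocal T \<and> slocal S \<and> S \<subseteq> T \<and> nonunits T \<inter> S = nonunits S"
  using sdom_nonunits by (auto simp: sdom_def)

context
  fixes A P :: "'f::field set"
  assumes A: "sring A" and P: "sprime A P"
begin

lemma locz_denom: "y \<in> A - P \<Longrightarrow> y \<noteq> 0"
  using smod_0[OF sprime_smod[OF P]] by auto

lemma locz_denom_mult: "y \<in> A - P \<Longrightarrow> z \<in> A - P \<Longrightarrow> y * z \<in> A - P"
  using sprime_prime[OF P] sring_mult[OF A] by auto

lemma loczI: "x \<in> A \<Longrightarrow> y \<in> A - P \<Longrightarrow> x / y \<in> locz A P"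
  by (auto simp: locz_def)

lemma loczE: assumes "z \<in> locz A P" obtains x y where "z = x / y" "x \<in> A" "y \<in> A" "y \<notin> P" "y \<noteq> 0"
  using assms locz_denom by (auto simp: locz_def)

lemma locz_incl: "A \<subseteq> locz A P"
  using loczI[of _ 1] sring_1[OF A] sprime_1[OF P] by auto

lemma locz_sring: "sring (locz A P)"
  unfolding sring_def
proof (intro conjI ballI)
  show "1 \<in> locz A P" using locz_incl sring_1[OF A] by auto
  fix a b assume "a \<in> locz A P" "b \<in> locz A P"
  then obtain x y x' y' where h: "a = x / y" "x \<in> A" "y \<in> A - P" "b = x' / y'" "x' \<in> A" "y' \<in> A - P"
    unfolding locz_def by blast
  then have "y \<noteq> 0" "y' \<noteq> 0" using locz_denom by auto
  note h = h this
  have "a - b = (x * y' - x' * y) / (y * y')" "a * b = (x * x') / (y * y')"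
    using h by (auto simp: field_simps)
  moreover have "x * y' - x' * y \<in> A" "x * x' \<in> A" using h A by (auto simp: sring_rules)
  ultimately show "a - b \<in> locz A P" "a * b \<in> locz A P" using h loczI[OF _ locz_denom_mult[OF h(3,6)]] by simp_all
qed

text \<open>Cross-multiplying two representations of a fraction introduces only factors outside P,
  hence outside the smaller prime Q; so whether the numerator lies in Q does not depend on the
  representation.\<close>

lemma locz_frac_in: "x \<in> A \<Longrightarrow> y \<in> A - P \<Longrightarrow> x / y \<in> {x / y | x y. x \<in> Q \<and> y \<in> A - P} \<Longrightarrow> sprime A Q \<Longrightarrow> Q \<subseteq> P \<Longrightarrow> x \<in> Q"
proof -
  assume h: "x \<in> A" "y \<in> A - P" "x / y \<in> {x / y | x y. x \<in> Q \<and> y \<in> A - P}" "sprime A Q" "Q \<subseteq> P"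
  then obtain x' y' where h': "x / y = x' / y'" "x' \<in> Q" "y' \<in> A - P" by blast
  then have "x * y' = x' * y" using locz_denom h by (auto simp: field_simps)
  moreover have "x' * y \<in> Q" using h h' smod_mult2[OF sprime_smod] by auto
  ultimately have "x \<in> Q \<or> y' \<in> Q" using h h' sprime_prime by (metis DiffD1)
  then show ?thesis using h h' by auto
qed

lemma locz_sprime:
  assumes Q: "sprime A Q" "Q \<subseteq> P"
  shows "sprime (locz A P) {x / y | x y. x \<in> Q \<and> y \<in> A - P}" (is "sprime _ ?Q")
    and "{x / y | x y. x \<in> Q \<and> y \<in> A - P} \<inter> A = Q"
proof -
  have Q_iff: "x / y \<in> ?Q \<longleftrightarrow> x \<in> Q" if "x \<in> A" "y \<in> A - P" for x y
    using locz_frac_in[OF that _ Q] that by blast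
  have "smod (locz A P) ?Q" unfolding smod_def
  proof (intro conjI ballI)
    show "0 \<in> ?Q" using Q_iff[of 0 1] sring_1[OF A] sring_0[OF A] sprime_1[OF P] smod_0[OF sprime_smod[OF Q(1)]] by auto
    fix a b assume "a \<in> ?Q" "b \<in> ?Q"
    then obtain x y x' y' where h: "a = x / y" "x \<in> Q" "y \<in> A - P" "b = x' / y'" "x' \<in> Q" "y' \<in> A - P" by blast
    then have "a + b = (x * y' + x' * y) / (y * y')" using locz_denom by (auto simp: field_simps)
    moreover have "x * y' + x' * y \<in> Q" using h Q smod_mult2[OF sprime_smod] smod_add[OF sprime_smod] by (metis DiffD1)
    ultimately show "a + b \<in> ?Q" using h locz_denom_mult by blast
  next
    fix s a assume "s \<in> locz A P" "a \<in> ?Q"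
    then obtain x y x' y' where h: "s = x / y" "x \<in> A" "y \<in> A - P" "a = x' / y'" "x' \<in> Q" "y' \<in> A - P"
      unfolding locz_def by blast
    then have "s * a = (x * x') / (y * y')" by auto
    moreover have "x * x' \<in> Q" using h Q smod_mult[OF sprime_smod] by metis
    ultimately show "s * a \<in> ?Q" using h locz_denom_mult by blast
  qed
  moreover have "?Q \<subseteq> locz A P" using sprime_sub[OF Q(1)] loczI by blast
  moreover have "1 \<notin> ?Q" using Q_iff[of 1 1] sprime_1[OF Q(1)] sring_1[OF A] sprime_1[OF P] by auto
  moreover have "a \<in> ?Q \<or> b \<in> ?Q" if ab: "a \<in> locz A P" "b \<in> locz A P" "a * b \<in> ?Q" for a b
  proof -
    obtain x y where h: "a = x / y" "x \<in> A" "y \<in> A - P" using ab(1) unfolding locz_def by blast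
    obtain x' y' where h': "b = x' / y'" "x' \<in> A" "y' \<in> A - P" using ab(2) unfolding locz_def by blast
    note h = h h'
    have "(x * x') / (y * y') \<in> ?Q" using ab(3) h by simp
    then have "x * x' \<in> Q" using Q_iff[of "x * x'" "y * y'"] h locz_denom_mult sring_mult[OF A] by blast
    then show ?thesis using h sprime_prime[OF Q(1)] by blast
  qed
  ultimately show "sprime (locz A P) ?Q" unfolding sprime_def sideal_def by (intro conjI ballI impI)
  have "x \<in> ?Q \<longleftrightarrow> x \<in> Q" if "x \<in> A" for x
    using Q_iff[of x 1] that sring_1[OF A] sprime_1[OF P] by auto
  then show "?Q \<inter> A = Q" using sprime_sub[OF Q(1)] by blast
qed

lemma locz_nonunits: "nonunits (locz A P) = {x / y | x y. x \<in> P \<and> y \<in> A - P}" (is "_ = ?M")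
proof
  show "?M \<subseteq> nonunits (locz A P)"
    using locz_sprime[OF P order_refl] sideal_nonunits[OF locz_sring] sprime_sideal sprime_1 by blast
  show "nonunits (locz A P) \<subseteq> ?M"
  proof
    fix a assume a: "a \<in> nonunits (locz A P)"
    then obtain x y where h: "a = x / y" "x \<in> A" "y \<in> A - P" using nonunits_sub[of "locz A P"] loczE by (metis DiffI subsetD)
    show "a \<in> ?M"
    proof (rule ccontr)
      assume "a \<notin> ?M"
      then have "x \<notin> P" using h by blast
      then have "y / x \<in> locz A P" "x \<noteq> 0" using h loczI locz_denom by auto
      then show False using a h locz_denom[of y] by (auto simp: nonunits_def)
    qed
  qed
qed

lemma locz_slocal: "slocal (locz A P)"
  unfolding slocal_def
proof (intro conjI ballI)
  fix a b assume "a \<in> nonunits (locz A P)" "b \<in> nonunits (locz A P)"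
  then show "a + b \<in> nonunits (locz A P)"
    using locz_sprime(1)[OF P order_refl] smod_add[OF sprime_smod] unfolding locz_nonunits by blast
qed (rule locz_sring)

lemma locz_nonunits_int: "nonunits (locz A P) \<inter> A = P"
  using locz_sprime(2)[OF P order_refl] locz_nonunits by simp

lemma locz_least: "sring T \<Longrightarrow> A \<subseteq> T \<Longrightarrow> (\<And>y. y \<in> A - P \<Longrightarrow> y \<notin> nonunits T) \<Longrightarrow> locz A P \<subseteq> T"
proof
  fix a assume h: "sring T" "A \<subseteq> T" "\<And>y. y \<in> A - P \<Longrightarrow> y \<notin> nonunits T" "a \<in> locz A P"
  then obtain x y where "a = x / y" "x \<in> A" "y \<in> A - P" unfolding locz_def by blast
  then show "a \<in> T" using h unit_inverse[of y T] sring_mult[of T x "inverse y"] by (auto simp: divide_inverse)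
qed

end

text \<open>Localizing at the center of T inverts exactly those elements of A that are units in
  T.\<close>

lemma locz_sdom:
  assumes A: "sring A" and T: "slocal T" and AT: "A \<subseteq> T"
  shows "sprime A (nonunits T \<inter> A)" "sdom T (locz A (nonunits T \<inter> A))"
proof -
  show P: "sprime A (nonunits T \<inter> A)" using sprime_contract[OF A AT nonunits_sprime[OF T]] .
  have sub: "locz A (nonunits T \<inter> A) \<subseteq> T"
    using locz_least[OF A P slocal_sring[OF T] AT] by auto
  have "nonunits (locz A (nonunits T \<inter> A)) \<subseteq> nonunits T"
  proof
    fix a assume "a \<in> nonunits (locz A (nonunits T \<inter> A))"
    then obtain x y where h: "a = x / y" "x \<in> nonunits T" "y \<in> A - nonunits T"
      unfolding locz_nonunits[OF A P] by blast
    then have "inverse y \<in> T" using AT unit_inverse by blast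
    then show "a \<in> nonunits T" using h nonunits_mult2[OF slocal_sring[OF T]] by (auto simp: divide_inverse)
  qed
  then show "sdom T (locz A (nonunits T \<inter> A))" using T sub locz_slocal[OF A P] by (auto simp: sdom_def)
qed

section \<open>Noetherian rings\<close>

text \<open>Zorn's lemma applies, since the union of a chain is an ideal with finitely many
  generators, and these all lie in one member of the chain.\<close>

lemma snoeth_maximal:
  assumes S: "snoeth S" and ne: "C \<noteq> {}" and id: "\<And>I. I \<in> C \<Longrightarrow> sideal S I"
  shows "\<exists>M\<in>C. \<forall>I\<in>C. M \<subseteq> I \<longrightarrow> I = M"
proof -
  have "\<exists>U\<in>C. \<forall>V\<in>c. V \<subseteq> U" if c: "c \<in> chains C" for c
  proof (cases "c = {}")
    case True then show ?thesis using ne by auto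
  next
    case False
    have cC: "c \<subseteq> C" and ch: "\<And>V Y. V \<in> c \<Longrightarrow> Y \<in> c \<Longrightarrow> V \<subseteq> Y \<or> Y \<subseteq> V"
      using c by (auto simp: chains_def chain_subset_def)
    have mods: "\<And>V. V \<in> c \<Longrightarrow> smod S V" "\<And>V. V \<in> c \<Longrightarrow> V \<subseteq> S" using cC id by (auto simp: sideal_def)
    have "sideal S (\<Union>c)"
      unfolding sideal_def smod_def
    proof (intro conjI ballI)
      show "0 \<in> \<Union>c" using False mods smod_0 by blast
      fix a b assume "a \<in> \<Union>c" "b \<in> \<Union>c"
      then obtain V Y where "V \<in> c" "Y \<in> c" "a \<in> V" "b \<in> Y" by blast
      then obtain Z where "Z \<in> c" "a \<in> Z" "b \<in> Z" using ch by blast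
      then show "a + b \<in> \<Union>c" using mods(1) smod_add by blast
    qed (use mods smod_mult in blast)+
    then obtain A where A: "finite A" "\<Union>c = genid S A" using S by (auto simp: snoeth_def)
    then have "A \<subseteq> \<Union>c" using genid_incl by metis
    moreover have "subset.chain C c" using cC ch by (auto simp: subset_chain_def)
    ultimately obtain V where V: "V \<in> c" "A \<subseteq> V"
      using finite_subset_Union_chain[OF A(1), of c C] False by blast
    then have "\<Union>c \<subseteq> V" using A(2) genid_least mods by metis
    then show ?thesis using V cC by blast
  qed
  then show ?thesis using Zorn_Lemma2[of C] by blast
qed

lemma snoeth_chain:
  assumes "snoeth S" "\<And>n::nat. sideal S (I n)" "\<And>n. I n \<subseteq> I (Suc n)"
  shows "\<exists>N. \<forall>n\<ge>N. I n = I N"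
proof -
  obtain M where "M \<in> range I" "\<forall>J\<in>range I. M \<subseteq> J \<longrightarrow> J = M"
    using snoeth_maximal[of S "range I"] assms by blast
  then obtain N where "\<And>n. I N \<subseteq> I n \<Longrightarrow> I n = I N" by auto
  moreover have "n \<ge> N \<Longrightarrow> I N \<subseteq> I n" for n using lift_Suc_mono_le[of I N n] assms(3) by auto
  ultimately show ?thesis by blast
qed

text \<open>Passing from w to a proper divisor v strictly enlarges the principal ideal. This
  Noetherian induction takes the place of factorization into primes.\<close>

lemma snoeth_divisor_induct [consumes 4, case_names step]:
  assumes S: "sring S" "snoeth S" and w: "w \<in> S" "w \<noteq> 0"
    and step: "\<And>w. w \<in> S \<Longrightarrow> w \<noteq> 0 \<Longrightarrow> (\<And>c v. w = c * v \<Longrightarrow> c \<in> nonunits S \<Longrightarrow> v \<in> S \<Longrightarrow> Q v) \<Longrightarrow> Q w"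
  shows "Q w"
proof (rule ccontr)
  assume "\<not> Q w"
  let ?C = "{genid S {w} | w. w \<in> S \<and> w \<noteq> 0 \<and> \<not> Q w}"
  have "?C \<noteq> {}" using w \<open>\<not> Q w\<close> by blast
  moreover have "\<And>I. I \<in> ?C \<Longrightarrow> sideal S I" using genid_sideal[OF S(1)] by auto
  ultimately obtain M where M: "M \<in> ?C" "\<And>I. I \<in> ?C \<Longrightarrow> M \<subseteq> I \<Longrightarrow> I = M"
    using snoeth_maximal[OF S(2), of ?C] by meson
  then obtain v where v: "v \<in> S" "v \<noteq> 0" "\<not> Q v" "M = genid S {v}" by blast
  then obtain c u where u: "v = c * u" "c \<in> nonunits S" "u \<in> S" "\<not> Q u" using step[of v] by blast
  have "genid S {u} \<in> ?C" using u v by force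
  moreover have "M \<subseteq> genid S {u}"
    using u v nonunits_sub[of S] sring_mult[OF S(1)]
    by (auto intro!: genid_least[OF genid_smod] simp: genid_single[OF S(1)])
  ultimately have "genid S {u} = M" using M by blast
  then have "u \<in> genid S {v}" using v genid_in by blast
  then obtain s where "s \<in> S" "u = s * v" using genid_single[OF S(1)] by auto
  then have "s * c = 1" using u v by auto
  then have "inverse c = s" "c \<noteq> 0" by (auto simp: inverse_unique mult.commute)
  then show False using \<open>s \<in> S\<close> u by (auto simp: nonunits_def)
qed

text \<open>An ideal $J \supseteq L + xb$ is chosen
  maximal among those that do not contain $b$ modulo $L + xb$; it contains a power of $x$.\<close>

lemma krull_intersection:
  assumes S: "slocal S" "snoeth S" and L: "sideal S L" and x: "x \<in> nonunits S"
    and b: "\<And>n. \<exists>l\<in>L. \<exists>s\<in>S. b = l + x ^ n * s"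
  shows "b \<in> L"
proof -
  have R: "sring S" using S slocal_sring by auto
  have xS: "x \<in> S" using x nonunits_sub by auto
  have LS: "L \<subseteq> S" and Lm: "smod S L" using L by (auto simp: sideal_def)
  have bS: "b \<in> S" using b[of 0] LS by (auto simp: sring_add[OF R])
  define B where "B = {l + s * x * b | l s. l \<in> L \<and> s \<in> S}"
  have B_in: "l \<in> L \<Longrightarrow> s \<in> S \<Longrightarrow> l + s * x * b \<in> B" for l s by (auto simp: B_def)
  have Bm: "smod S B" unfolding smod_def
  proof (intro conjI ballI)
    show "0 \<in> B" using B_in[of 0 0] smod_0[OF Lm] sring_0[OF R] by simp
    fix a c assume "a \<in> B" "c \<in> B"
    then obtain l s l' s' where h: "a = l + s * x * b" "c = l' + s' * x * b" "l \<in> L" "l' \<in> L" "s \<in> S" "s' \<in> S"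
      unfolding B_def by blast
    then have "a + c = (l + l') + (s + s') * x * b" by (simp add: algebra_simps)
    then show "a + c \<in> B" using B_in h smod_add[OF Lm] sring_add[OF R] by metis
  next
    fix r a assume "r \<in> S" "a \<in> B"
    then obtain l s where h: "a = l + s * x * b" "l \<in> L" "s \<in> S" unfolding B_def by blast
    then have "r * a = r * l + (r * s) * x * b" by (simp add: algebra_simps)
    then show "r * a \<in> B" using B_in h \<open>r \<in> S\<close> smod_mult[OF Lm] sring_mult[OF R] by metis
  qed
  have Bid: "sideal S B" using Bm LS xS bS by (auto simp: sideal_def B_def intro!: sring_rules[OF R])
  \<comment> \<open>Membership in \<open>C\<close> says that the ideal contains B and meets L + S b
    in B only.\<close>
  define C where "C = {J. sideal S J \<and> B \<subseteq> J \<and> (\<forall>s\<in>S. \<forall>l\<in>L. l + s * b \<in> J \<longrightarrow> l + s * b \<in> B)}"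
  have "B \<in> C" using Bid by (auto simp: C_def)
  then obtain J where J: "J \<in> C" "\<And>I. I \<in> C \<Longrightarrow> J \<subseteq> I \<Longrightarrow> I = J"
    using snoeth_maximal[OF S(2), of C] by (metis (no_types, lifting) C_def empty_iff mem_Collect_eq)
  have Jid: "sideal S J" and BJ: "B \<subseteq> J" and Jb: "\<And>s l. s \<in> S \<Longrightarrow> l \<in> L \<Longrightarrow> l + s * b \<in> J \<Longrightarrow> l + s * b \<in> B"
    using J(1) by (auto simp: C_def)
  have Jm: "smod S J" and JS: "J \<subseteq> S" using Jid by (auto simp: sideal_def)
  \<comment> \<open>The colon ideals of J by the powers of x increase. At the exponent N where they
    become stationary, adding x ^ N to J brings in no new element of L + S b.\<close>
  define I where "I n = {r \<in> S. r * x ^ n \<in> J}" for n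
  have Iid: "sideal S (I n)" for n
    using smod_0[OF Jm] smod_add[OF Jm] smod_mult[OF Jm]
    by (auto simp: sideal_def smod_def I_def sring_rules[OF R] distrib_right mult.assoc)
  have Imono: "I n \<subseteq> I (Suc n)" for n
  proof
    fix r assume "r \<in> I n"
    then have "x * (r * x ^ n) \<in> J" "r \<in> S" using smod_mult[OF Jm xS] by (auto simp: I_def)
    then show "r \<in> I (Suc n)" by (simp add: I_def mult.left_commute)
  qed
  obtain N where N: "\<And>n. n \<ge> N \<Longrightarrow> I n = I N" using snoeth_chain[of S I] S(2) Iid Imono by metis
  define J' where "J' = {j + r * x ^ N | j r. j \<in> J \<and> r \<in> S}"
  have J'_in: "j \<in> J \<Longrightarrow> r \<in> S \<Longrightarrow> j + r * x ^ N \<in> J'" for j r by (auto simp: J'_def)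
  have "smod S J'" unfolding smod_def
  proof (intro conjI ballI)
    show "0 \<in> J'" using J'_in[of 0 0] smod_0[OF Jm] sring_0[OF R] by simp
    fix a c assume "a \<in> J'" "c \<in> J'"
    then obtain j r j' r' where h: "a = j + r * x ^ N" "c = j' + r' * x ^ N" "j \<in> J" "j' \<in> J" "r \<in> S" "r' \<in> S"
      unfolding J'_def by blast
    then have "a + c = (j + j') + (r + r') * x ^ N" by (simp add: algebra_simps)
    then show "a + c \<in> J'" using J'_in h smod_add[OF Jm] sring_add[OF R] by metis
  next
    fix q a assume "q \<in> S" "a \<in> J'"
    then obtain j r where h: "a = j + r * x ^ N" "j \<in> J" "r \<in> S" unfolding J'_def by blast
    then have "q * a = q * j + (q * r) * x ^ N" by (simp add: algebra_simps)
    then show "q * a \<in> J'" using J'_in h \<open>q \<in> S\<close> smod_mult[OF Jm] sring_mult[OF R] by metis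
  qed
  then have J'id: "sideal S J'" using JS xS by (auto simp: sideal_def J'_def intro!: sring_rules[OF R])
  have JJ': "J \<subseteq> J'" using J'_in[of _ 0] sring_0[OF R] by auto
  have "J' \<in> C" unfolding C_def
  proof (intro CollectI conjI ballI impI J'id)
    show "B \<subseteq> J'" using BJ JJ' by auto
    fix s l assume s: "s \<in> S" "l \<in> L" "l + s * b \<in> J'"
    then obtain j r where h: "l + s * b = j + r * x ^ N" "j \<in> J" "r \<in> S" unfolding J'_def by blast
    have "x * l + s * x * b \<in> J" using B_in[of "x * l" s] s smod_mult[OF Lm xS] BJ by auto
    moreover have "x * l + s * x * b = x * j + r * x ^ Suc N" using arg_cong[OF h(1), of "(*) x"]
      by (simp add: algebra_simps)
    ultimately have "(x * j + r * x ^ Suc N) - x * j \<in> J" using smod_diff[OF R Jm] smod_mult[OF Jm xS h(2)] by metis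
    then have "r \<in> I (Suc N)" using h by (auto simp: I_def)
    then have "r \<in> I N" using N[of "Suc N"] by auto
    then have "l + s * b \<in> J" using h smod_add[OF Jm] by (auto simp: I_def)
    then show "l + s * b \<in> B" using Jb s by auto
  qed
  then have "J' = J" using J JJ' by blast
  then have xN: "x ^ N \<in> J" using J'_in[of 0 1] smod_0[OF Jm] sring_1[OF R] by auto
  obtain l s where ls: "l \<in> L" "s \<in> S" "b = l + x ^ N * s" using b by blast
  have "l \<in> J" using B_in[of l 0] sring_0[OF R] ls BJ by auto
  then have "b \<in> J" using ls xN smod_add[OF Jm] smod_mult2[OF Jm] by metis
  \<comment> \<open>Now b = l + s x b for some l in L, and 1 - s x is a unit: Nakayama's lemma for
    one element.\<close>
  then have "b \<in> B" using Jb[of 1 0] smod_0[OF Lm] sring_1[OF R] by auto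
  then obtain l s where ls: "l \<in> L" "s \<in> S" "b = l + s * x * b" unfolding B_def by blast
  then have eq: "(1 - s * x) * b = l" by (simp add: algebra_simps)
  have "s * x \<in> nonunits S" using nonunits_mult[OF R ls(2) x] .
  then have u: "1 - s * x \<notin> nonunits S" "1 - s * x \<in> S" using one_minus_unit[OF S(1)] ls xS by (auto simp: sring_rules[OF R])
  then have "inverse (1 - s * x) \<in> S" "1 - s * x \<noteq> 0" using unit_inverse[OF u(2,1)] by auto
  then have "inverse (1 - s * x) * l \<in> L" "inverse (1 - s * x) * l = b"
    using smod_mult[OF Lm _ ls(1)] by (auto simp flip: eq)
  then show ?thesis by simp
qed

text \<open>The one-variable version is applied twice. Modulo (L, y ^ m) the exponent n + m leaves
  only a multiple of x ^ n; afterwards m varies.\<close>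

lemma krull_intersection2:
  assumes S: "slocal S" "snoeth S" and L: "sideal S L" and x: "x \<in> nonunits S" and y: "y \<in> nonunits S"
    and b: "\<And>n. \<exists>l\<in>L. \<exists>s\<in>S. \<exists>t\<in>S. b = l + x ^ n * s + y ^ n * t"
  shows "b \<in> L"
proof (rule krull_intersection[OF S L y])
  fix m
  have R: "sring S" using S slocal_sring by auto
  have xS: "x \<in> S" and yS: "y \<in> S" using x y nonunits_sub by auto
  have Lm: "smod S L" and LS: "L \<subseteq> S" using L by (auto simp: sideal_def)
  define K where "K = genid S (insert (y ^ m) L)"
  have KI: "K = {s * y ^ m + l | s l. s \<in> S \<and> l \<in> L}" unfolding K_def genid_insert[OF R] genid_eq[OF L] ..
  have "sideal S K" unfolding K_def using genid_sideal[OF R] LS sring_pow[OF R yS] by auto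
  then have "b \<in> K"
  proof (rule krull_intersection[OF S _ x])
    fix n
    obtain l s t where h: "l \<in> L" "s \<in> S" "t \<in> S" "b = l + x ^ (n + m) * s + y ^ (n + m) * t" using b by blast
    have "b = ((y ^ n * t) * y ^ m + l) + x ^ n * (x ^ m * s)" using h by (simp add: power_add algebra_simps)
    moreover have "(y ^ n * t) * y ^ m + l \<in> K" unfolding KI using h yS by (blast intro: sring_rules[OF R])
    ultimately show "\<exists>l\<in>K. \<exists>s\<in>S. b = l + x ^ n * s" using h xS by (blast intro: sring_rules[OF R])
  qed
  then show "\<exists>l\<in>L. \<exists>s\<in>S. b = l + y ^ m * s" unfolding KI by (auto simp: algebra_simps)
qed

section \<open>Two-dimensional regular local rings\<close>

definition sdvd :: "'f::field set \<Rightarrow> 'f \<Rightarrow> 'f \<Rightarrow> bool" where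
  "sdvd S a b \<longleftrightarrow> (\<exists>s\<in>S. b = a * s)"

definition sprime_elt :: "'f::field set \<Rightarrow> 'f \<Rightarrow> bool" where
  "sprime_elt S p \<longleftrightarrow> p \<in> nonunits S \<and> p \<noteq> 0 \<and>
     (\<forall>a\<in>S. \<forall>b\<in>S. sdvd S p (a * b) \<longrightarrow> sdvd S p a \<or> sdvd S p b)"

lemma sdvdI: "s \<in> S \<Longrightarrow> b = a * s \<Longrightarrow> sdvd S a b"
  by (auto simp: sdvd_def)

lemma sdvd_mult: "sring S \<Longrightarrow> sdvd S a b \<Longrightarrow> c \<in> S \<Longrightarrow> sdvd S a (b * c)"
  by (auto simp: sdvd_def mult.assoc intro: sring_mult)

lemma sdvd_mult2: "sring S \<Longrightarrow> sdvd S a b \<Longrightarrow> c \<in> S \<Longrightarrow> sdvd S a (c * b)"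
  using sdvd_mult by (metis mult.commute)

lemma sdvd_add: "sring S \<Longrightarrow> sdvd S a b \<Longrightarrow> sdvd S a c \<Longrightarrow> sdvd S a (b + c)"
  unfolding sdvd_def by (metis distrib_left sring_add)

lemma sdvd_diff: "sring S \<Longrightarrow> sdvd S a b \<Longrightarrow> sdvd S a c \<Longrightarrow> sdvd S a (b - c)"
  unfolding sdvd_def by (metis right_diff_distrib sring_diff)

lemma sdvd_self: "sring S \<Longrightarrow> c \<in> S \<Longrightarrow> sdvd S a (a * c)"
  by (auto simp: sdvd_def)

lemma sdvd_trans: "sring S \<Longrightarrow> sdvd S a b \<Longrightarrow> sdvd S b c \<Longrightarrow> sdvd S a c"
  by (auto simp: sdvd_def mult.assoc intro: sring_mult)

lemma sdvd_0: "sring S \<Longrightarrow> sdvd S a 0"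
  by (auto simp: sdvd_def intro: bexI[of _ 0] sring_0)

lemma sdvd_unit: "sring S \<Longrightarrow> a \<in> nonunits S \<Longrightarrow> b \<in> S \<Longrightarrow> sdvd S a b \<Longrightarrow> b \<in> nonunits S"
  by (auto simp: sdvd_def nonunits_mult2)

lemma sdvd_cancel: "a \<noteq> 0 \<Longrightarrow> sdvd S (a * b) (a * c) \<Longrightarrow> sdvd S b c"
  by (auto simp: sdvd_def)

lemma genid_sdvd: "sring S \<Longrightarrow> b \<in> genid S {a} \<longleftrightarrow> sdvd S a b"
  by (auto simp: genid_single sdvd_def mult.commute)

lemma sprime_elt_pow: "sring S \<Longrightarrow> sprime_elt S p \<Longrightarrow> a \<in> S \<Longrightarrow> sdvd S p (a ^ n) \<Longrightarrow> sdvd S p a"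
proof (induction n)
  case 0
  then have "1 \<in> nonunits S" using sdvd_unit[of S p 1] by (auto simp: sprime_elt_def sring_1)
  then show ?case using 0 nonunits_1 by blast
next
  case (Suc n)
  then have "sdvd S p a \<or> sdvd S p (a ^ n)" using sring_pow[of S a n] by (auto simp: sprime_elt_def)
  then show ?case using Suc by blast
qed

lemma sprime_genid:
  assumes "sring S" "sprime_elt S p"
  shows "sprime S (genid S {p})"
proof -
  have p: "p \<in> S" "p \<in> nonunits S" using assms nonunits_sub by (auto simp: sprime_elt_def)
  have "1 \<notin> genid S {p}" using sdvd_unit[OF assms(1) p(2), of 1] assms nonunits_1 sring_1 by (auto simp: genid_sdvd)
  then show ?thesis using assms p by (auto simp: sprime_def genid_sideal genid_sdvd sprime_elt_def)
qed

lemma sprime_elt_iff: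
  assumes "sring S" "p \<noteq> 0"
  shows "sprime_elt S p \<longleftrightarrow> sprime S (genid S {p})"
proof
  assume h: "sprime S (genid S {p})"
  have "p \<in> genid S {p}" by (simp add: genid_in)
  then have "p \<in> nonunits S" using h sideal_nonunits[OF assms(1) sprime_sideal[OF h] sprime_1[OF h]] by auto
  then show "sprime_elt S p" using h assms by (auto simp: sprime_def sprime_elt_def genid_sdvd)
qed (rule sprime_genid[OF assms(1)])

lemma binomial_mod: "sring S \<Longrightarrow> a \<in> S \<Longrightarrow> b \<in> S \<Longrightarrow> x \<in> S \<Longrightarrow> \<exists>c\<in>S. (x * a + b) ^ n = x * c + b ^ n"
proof (induction n)
  case 0 then show ?case using sring_0 by (intro bexI[of _ 0]) auto
next
  case (Suc n)
  then obtain c where c: "c \<in> S" "(x * a + b) ^ n = x * c + b ^ n" by blast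
  have "(x * a + b) ^ Suc n = x * (a * (x * c + b ^ n) + b * c) + b ^ Suc n"
    unfolding power_Suc c(2) by (simp add: algebra_simps)
  then show ?case using Suc c by (intro bexI[of _ "a * (x * c + b ^ n) + b * c"]) (auto simp: sring_rules)
qed

lemma sring_powsplit: "m \<le> n \<Longrightarrow> (x::'a::field) ^ n = x ^ m * x ^ (n - m)"
  by (simp flip: power_add)

text \<open>Krull's theorem bounds the powers of p that divide a, and the cofactor of the last one
  is not a multiple of p, hence a unit.\<close>

lemma dvr_factor:
  assumes S: "slocal S" "snoeth S" and m: "nonunits S = genid S {p}" and a: "a \<in> S" "a \<noteq> 0"
  shows "\<exists>u i. u \<in> S \<and> u \<notin> nonunits S \<and> a = u * p ^ i"
proof -
  have R: "sring S" using S slocal_sring by auto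
  have p: "p \<in> nonunits S" using m genid_in by auto
  have "sideal S {0}" using sprime_zero[OF R] sprime_sideal by auto
  then have "\<not> (\<forall>n. \<exists>s\<in>S. a = p ^ n * s)" using krull_intersection[OF S _ p, of "{0}" a] a by auto
  then obtain n where "\<not> (\<exists>s\<in>S. a = p ^ n * s)" by blast
  moreover have "\<exists>s\<in>S. a = p ^ 0 * s" using a by auto
  ultimately obtain i where i: "\<exists>s\<in>S. a = p ^ i * s" "\<not> (\<exists>s\<in>S. a = p ^ Suc i * s)"
    using nat_induct[of "\<lambda>i. \<exists>s\<in>S. a = p ^ i * s"] by blast
  then obtain u where u: "u \<in> S" "a = p ^ i * u" by blast
  have "u \<notin> nonunits S"
  proof
    assume "u \<in> nonunits S"
    then obtain s where "s \<in> S" "u = p * s" using m genid_sdvd[OF R] by (auto simp: sdvd_def)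
    then show False using i(2) u by (auto simp: mult.assoc)
  qed
  then show ?thesis using u by (intro exI[of _ u] exI[of _ i]) auto
qed

lemma dvr_total:
  assumes S: "slocal S" "snoeth S" and m: "nonunits S = genid S {p}" and a: "a \<in> S" "a \<noteq> 0" and b: "b \<in> S" "b \<noteq> 0"
  shows "a / b \<in> S \<or> b / a \<in> S"
proof -
  have R: "sring S" using S slocal_sring by auto
  have p: "p \<in> S" using m genid_in nonunits_sub by blast
  obtain u i v j where h: "u \<in> S" "u \<notin> nonunits S" "a = u * p ^ i" "v \<in> S" "v \<notin> nonunits S" "b = v * p ^ j"
    using dvr_factor[OF S m a] dvr_factor[OF S m b] by blast
  have uv: "u / v \<in> S" "v / u \<in> S" "u \<noteq> 0" "v \<noteq> 0" using h div_unit[OF S(1)] nonunits_0[OF R] by auto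
  show ?thesis
  proof (cases "i \<le> j")
    case True
    then have "b / a = (v / u) * p ^ (j - i)" using h a b uv sring_powsplit[OF True, of p] by (simp add: field_simps)
    moreover have "(v / u) * p ^ (j - i) \<in> S" using uv p R by (intro sring_rules)
    ultimately show ?thesis by simp
  next
    case False
    then have "a / b = (u / v) * p ^ (i - j)" using h a b uv sring_powsplit[of j i p] by (simp add: field_simps)
    moreover have "(u / v) * p ^ (i - j) \<in> S" using uv p R by (intro sring_rules)
    ultimately show ?thesis by simp
  qed
qed

text \<open>Dimension two is encoded as a prime strictly between 0 and the maximal ideal. This is
  easy to verify for quadratic transforms; longer chains are excluded later, by
  \<open>overring_dim_le_2\<close>.\<close>

locale regular2 =
  fixes S :: "'f::field set" and x y :: 'f
  assumes loc: "slocal S" and noeth: "snoeth S"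
    and max: "nonunits S = genid S {x, y}"
    and ex_prime: "\<exists>P. sprime S P \<and> P \<noteq> {0} \<and> P \<noteq> nonunits S"
begin

lemma R: "sring S" using loc slocal_sring by auto

lemma regular2_swap: "regular2 S y x"
  using loc noeth max ex_prime by unfold_locales (auto simp: insert_commute)

lemma max_iff: "a \<in> nonunits S \<longleftrightarrow> (\<exists>s\<in>S. \<exists>t\<in>S. a = x * s + y * t)"
  unfolding max genid_pair[OF R] by (auto simp: mult.commute)

lemma x_nonunit: "x \<in> nonunits S" and y_nonunit: "y \<in> nonunits S"
  using genid_incl[of "{x, y}" S] by (auto simp: max)

lemma x_in: "x \<in> S" and y_in: "y \<in> S"
  using x_nonunit y_nonunit nonunits_sub by auto

lemmas S_rules = sring_rules[OF R] x_in y_in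

text \<open>Modulo x the maximal ideal is generated by y alone, so the argument of
  \<open>dvr_factor\<close> works there, although x is not yet known to be prime.\<close>

lemma order_mod_x:
  assumes a: "a \<in> S" "\<not> sdvd S x a"
  shows "\<exists>i u c. u \<in> S \<and> u \<notin> nonunits S \<and> c \<in> S \<and> a = u * y ^ i + x * c"
proof -
  have "sideal S (genid S {x})" using genid_sideal[OF R] x_in by auto
  then have "\<not> (\<forall>n. \<exists>l\<in>genid S {x}. \<exists>s\<in>S. a = l + y ^ n * s)"
    using krull_intersection[OF loc noeth _ y_nonunit, of "genid S {x}" a] a genid_sdvd[OF R] by blast
  then obtain n where n: "\<not> (\<exists>c\<in>S. \<exists>s\<in>S. a = x * c + y ^ n * s)" using sdvd_self[OF R] genid_sdvd[OF R] by blast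
  have "a = x * 0 + y ^ 0 * a" by simp
  then have "\<exists>c\<in>S. \<exists>s\<in>S. a = x * c + y ^ 0 * s" using a sring_0[OF R] by blast
  then obtain i where i: "\<exists>c\<in>S. \<exists>s\<in>S. a = x * c + y ^ i * s" "\<not> (\<exists>c\<in>S. \<exists>s\<in>S. a = x * c + y ^ Suc i * s)"
    using n nat_induct[of "\<lambda>i. \<exists>c\<in>S. \<exists>s\<in>S. a = x * c + y ^ i * s"] by blast
  then obtain c u where u: "c \<in> S" "u \<in> S" "a = x * c + y ^ i * u" by blast
  have "u \<notin> nonunits S"
  proof
    assume "u \<in> nonunits S"
    then obtain s t where "s \<in> S" "t \<in> S" "u = x * s + y * t" using max_iff by blast
    then have "a = x * (c + y ^ i * s) + y ^ Suc i * t" using u by (simp add: algebra_simps)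
    moreover have "c + y ^ i * s \<in> S" using u \<open>s \<in> S\<close> by (auto intro: S_rules)
    ultimately show False using i(2) \<open>t \<in> S\<close> by blast
  qed
  then show ?thesis using u by (intro exI[of _ i] exI[of _ u] exI[of _ c]) (auto simp: algebra_simps)
qed

text \<open>An element of P with least order in y modulo x is a generator: it divides each element
  of P up to x times an element that is again in P, because x is outside P. Iterating this and
  applying Krull's theorem gives exact divisibility.\<close>

lemma prime_principal_x:
  assumes P: "sprime S P" "P \<noteq> {0}" and xP: "x \<notin> P"
  shows "\<exists>f. f \<noteq> 0 \<and> P = genid S {f}"
proof -
  have Pm: "smod S P" and PS: "P \<subseteq> S" using sprime_smod[OF P(1)] sprime_sub[OF P(1)] by auto
  have div: "c \<in> P" if "c \<in> S" "x * c \<in> P" for c using sprime_prime[OF P(1) x_in that] xP by auto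
  have Pz: "sideal S {0}" using sprime_zero[OF R] sprime_sideal by auto
  \<comment> \<open>Otherwise P = x P, so every element of P is divisible by all powers of x and
    vanishes.\<close>
  have "\<exists>f\<in>P. \<not> sdvd S x f"
  proof (rule ccontr)
    assume "\<not> ?thesis"
    then have all: "\<And>f. f \<in> P \<Longrightarrow> \<exists>c\<in>P. f = x * c" using div unfolding sdvd_def by metis
    have "\<exists>c\<in>P. f = x ^ n * c" if "f \<in> P" for f n
    proof (induction n)
      case 0 then show ?case using that by auto
    next
      case (Suc n)
      then obtain c where "c \<in> P" "f = x ^ n * c" by blast
      moreover then obtain d where "d \<in> P" "c = x * d" using all by blast
      ultimately show ?case by (auto intro!: bexI[of _ d])
    qed
    then have "f \<in> {0}" if "f \<in> P" for f
      using that krull_intersection[OF loc noeth Pz x_nonunit, of f] PS by fastforce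
    then show False using P(2) smod_0[OF Pm] by auto
  qed
  then have "\<exists>i. \<exists>f\<in>P. \<exists>u c. u \<in> S \<and> u \<notin> nonunits S \<and> c \<in> S \<and> f = u * y ^ i + x * c"
    using order_mod_x PS by (metis subsetD)
  then obtain i where i: "\<exists>f\<in>P. \<exists>u c. u \<in> S \<and> u \<notin> nonunits S \<and> c \<in> S \<and> f = u * y ^ i + x * c"
    and min: "\<And>j. j < i \<Longrightarrow> \<not> (\<exists>f\<in>P. \<exists>u c. u \<in> S \<and> u \<notin> nonunits S \<and> c \<in> S \<and> f = u * y ^ j + x * c)"
    using exists_least_iff[of "\<lambda>i. \<exists>f\<in>P. \<exists>u c. u \<in> S \<and> u \<notin> nonunits S \<and> c \<in> S \<and> f = u * y ^ i + x * c"] by blast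
  then obtain f u c where f: "f \<in> P" "u \<in> S" "u \<notin> nonunits S" "c \<in> S" "f = u * y ^ i + x * c" by blast
  have iu: "inverse u \<in> S" "u \<noteq> 0" using f unit_inverse by auto
  have step: "\<exists>s\<in>S. \<exists>h\<in>P. g = f * s + x * h" if g: "g \<in> P" for g
  proof (cases "sdvd S x g")
    case True
    then obtain d where "d \<in> S" "g = x * d" by (auto simp: sdvd_def)
    then show ?thesis using div[of d] g sring_0[OF R] by (intro bexI[of _ 0] bexI[of _ d]) auto
  next
    case False
    then obtain j v d where h: "v \<in> S" "v \<notin> nonunits S" "d \<in> S" "g = v * y ^ j + x * d" using order_mod_x g PS by blast
    then have "\<exists>f\<in>P. \<exists>u c. u \<in> S \<and> u \<notin> nonunits S \<and> c \<in> S \<and> f = u * y ^ j + x * c" using g by blast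
    then have "i \<le> j" using min[of j] by (meson not_le)
    define s where "s = v * inverse u * y ^ (j - i)"
    have s: "s \<in> S" using h iu by (auto simp: s_def intro!: S_rules)
    have "u * y ^ i * s = v * y ^ j" using iu sring_powsplit[OF \<open>i \<le> j\<close>, of y] by (simp add: s_def)
    then have eq: "g - f * s = x * (d - c * s)" using f h by (simp add: algebra_simps)
    have "g - f * s \<in> P" using smod_diff[OF R Pm g smod_mult2[OF Pm s f(1)]] .
    then have "d - c * s \<in> P" using div eq f h s S_rules by metis
    moreover have "g = f * s + x * (d - c * s)" using eq by (simp add: algebra_simps)
    ultimately show ?thesis using s by blast
  qed
  have iter: "\<exists>l\<in>genid S {f}. \<exists>h\<in>P. g = l + x ^ n * h" if g: "g \<in> P" for g n
  proof (induction n)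
    case 0 then show ?case using g smod_0[OF genid_smod] by (intro bexI[of _ 0] bexI[of _ g]) auto
  next
    case (Suc n)
    then obtain l h where h: "l \<in> genid S {f}" "h \<in> P" "g = l + x ^ n * h" by blast
    obtain s h' where s: "s \<in> S" "h' \<in> P" "h = f * s + x * h'" using step h by blast
    have "f * (x ^ n * s) \<in> genid S {f}" using s genid_sdvd[OF R] by (auto intro!: sdvd_self[OF R] S_rules)
    then have "l + f * (x ^ n * s) \<in> genid S {f}" using h smod_add[OF genid_smod] by blast
    moreover have "g = (l + f * (x ^ n * s)) + x ^ Suc n * h'" using h s by (simp add: algebra_simps)
    ultimately show ?case using s by blast
  qed
  have fid: "sideal S (genid S {f})" using f(1) PS by (intro genid_sideal[OF R]) auto
  have "P \<subseteq> genid S {f}"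
  proof
    fix g assume "g \<in> P"
    from iter[OF this] show "g \<in> genid S {f}" using PS by (intro krull_intersection[OF loc noeth fid x_nonunit]) blast
  qed
  moreover have "genid S {f} \<subseteq> P" using genid_least[OF Pm] f by auto
  moreover have "f \<noteq> 0"
  proof
    assume "f = 0"
    then have "P = {0}" using calculation sring_0[OF R] by (auto simp: genid_single[OF R])
    then show False using P by simp
  qed
  ultimately show ?thesis by blast
qed

lemma max_subset:
  assumes h: "x \<in> P" "y \<in> P" "sprime S P"
  shows "P = nonunits S"
proof
  show "nonunits S \<subseteq> P" unfolding max using h genid_least[OF sprime_smod[OF h(3)], of "{x, y}"] by simp
  show "P \<subseteq> nonunits S" using h sideal_nonunits[OF R sprime_sideal sprime_1] by blast
qed

text \<open>The intermediate prime P forces x and y to be independent. If x divides y ^ n, then x is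
  outside P, so P = (f) with f = x s + y t, and x divides f ^ n. Since the prime f does not divide
  x, cancelling f repeatedly ends with x dividing 1.\<close>

lemma y_pow_not_dvd: "\<not> sdvd S x (y ^ n)"
proof
  assume yn: "sdvd S x (y ^ n)"
  obtain P where P: "sprime S P" "P \<noteq> {0}" "P \<noteq> nonunits S" using ex_prime by blast
  have xP: "x \<notin> P"
  proof
    assume "x \<in> P"
    then have "y ^ n \<in> P" using yn smod_mult2[OF sprime_smod[OF P(1)]] by (auto simp: sdvd_def)
    then have "y \<in> P" using sprime_pow[OF R P(1) y_in] by blast
    then show False using max_subset \<open>x \<in> P\<close> P by blast
  qed
  obtain f where f: "f \<noteq> 0" "P = genid S {f}" using prime_principal_x[OF P(1,2) xP] by blast
  have fP: "sprime_elt S f" using f P sprime_elt_iff[OF R] by auto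
  then have "f \<in> nonunits S" by (auto simp: sprime_elt_def)
  then obtain s t where st: "s \<in> S" "t \<in> S" "f = x * s + y * t" using max_iff by blast
  then obtain c where c: "c \<in> S" "f ^ n = x * c + (y * t) ^ n" using binomial_mod[OF R, of s "y * t" x n] by (auto intro: S_rules)
  have "sdvd S x (x * c + y ^ n * t ^ n)" using c st yn by (intro sdvd_add[OF R] sdvd_mult[OF R yn] sdvd_self[OF R] S_rules)
  then have xf: "sdvd S x (f ^ n)" using c by (simp add: power_mult_distrib)
  have xnf: "\<not> sdvd S f x" using xP f genid_sdvd[OF R] by auto
  have "\<not> sdvd S x (f ^ k)" for k
  proof (induction k)
    case 0
    show ?case using sdvd_unit[OF R x_nonunit, of 1] nonunits_1[OF R] sring_1[OF R] by auto
  next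
    case (Suc k)
    show ?case
    proof
      assume "sdvd S x (f ^ Suc k)"
      then obtain a where a: "a \<in> S" "f ^ Suc k = x * a" by (auto simp: sdvd_def)
      have "sdvd S f (f * f ^ k)" using \<open>f \<in> nonunits S\<close> nonunits_sub by (intro sdvd_self[OF R] sring_pow[OF R]) auto
      then have "sdvd S f (x * a)" using a by simp
      then have "sdvd S f a" using fP a xnf x_in by (auto simp: sprime_elt_def)
      then obtain b where "b \<in> S" "a = f * b" by (auto simp: sdvd_def)
      then have "f ^ k = x * b" using a f by simp
      then show False using Suc \<open>b \<in> S\<close> by (auto simp: sdvd_def)
    qed
  qed
  then show False using xf by blast
qed

lemma x_neq_0: "x \<noteq> 0"
  using regular2.y_pow_not_dvd[OF regular2_swap, of 1] sdvd_0[OF R] by auto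

lemma y_neq_0: "y \<noteq> 0"
  using y_pow_not_dvd[of 1] sdvd_0[OF R] by auto

text \<open>Modulo x every nonzero element is a unit times a power of y; this form is stable under
  products, and no power of y vanishes there.\<close>

lemma x_prime: "sprime_elt S x"
  unfolding sprime_elt_def
proof (intro conjI ballI impI x_nonunit x_neq_0)
  fix a b assume h: "a \<in> S" "b \<in> S" "sdvd S x (a * b)"
  show "sdvd S x a \<or> sdvd S x b"
  proof (rule ccontr)
    assume "\<not> ?thesis"
    then obtain i u c j v d where g: "u \<in> S" "u \<notin> nonunits S" "c \<in> S" "a = u * y ^ i + x * c"
      "v \<in> S" "v \<notin> nonunits S" "d \<in> S" "b = v * y ^ j + x * d" using h order_mod_x by meson
    define w where "w = inverse u * inverse v"
    have uv: "u \<noteq> 0" "v \<noteq> 0" "inverse u \<in> S" "inverse v \<in> S" using g unit_inverse by blast+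
    then have w: "w \<in> S" unfolding w_def by (intro S_rules)
    have w1: "u * v * w = 1" using uv by (simp add: w_def field_simps)
    have "a * b = u * v * y ^ (i + j) + x * (u * y ^ i * d + c * v * y ^ j + x * c * d)"
      using g by (simp add: power_add algebra_simps)
    then have "u * v * y ^ (i + j) = a * b - x * (u * y ^ i * d + c * v * y ^ j + x * c * d)" by simp
    moreover have "sdvd S x (a * b - x * (u * y ^ i * d + c * v * y ^ j + x * c * d))"
      using g by (intro sdvd_diff[OF R h(3)] sdvd_self[OF R] S_rules)
    ultimately have "sdvd S x (w * (u * v * y ^ (i + j)))" using sdvd_mult2[OF R _ w] by simp
    moreover have "w * (u * v * y ^ (i + j)) = y ^ (i + j)" using w1 by (metis mult.assoc mult.commute mult_1)
    ultimately have "sdvd S x (y ^ (i + j))" by simp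
    then show False using y_pow_not_dvd by blast
  qed
qed

lemma prime_principal:
  assumes P: "sprime S P" "P \<noteq> {0}" "P \<noteq> nonunits S"
  shows "\<exists>f. sprime_elt S f \<and> P = genid S {f}"
proof -
  have "x \<notin> P \<or> y \<notin> P" using max_subset P by blast
  then have "\<exists>f. f \<noteq> 0 \<and> P = genid S {f}"
    using prime_principal_x[OF P(1,2)] regular2.prime_principal_x[OF regular2_swap P(1,2)] by blast
  then show ?thesis using sprime_elt_iff[OF R] P by auto
qed

text \<open>If a divides a power of x, then x divides a. Otherwise an ideal maximal among those that
  contain a but no power of x is prime, and it is neither 0 nor the maximal ideal, hence
  principal.\<close>

lemma prime_divisor:
  assumes a: "a \<in> nonunits S" "a \<noteq> 0"
  shows "\<exists>f. sprime_elt S f \<and> sdvd S f a"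
proof (cases "\<exists>n. sdvd S a (x ^ n)")
  case True
  then obtain n where "sdvd S a (x ^ n)" by blast
  moreover have "sdvd S x a" if "sdvd S a (x ^ n)" for n
    using that
  proof (induction n)
    case 0
    then show ?case using sdvd_unit[OF R a(1), of 1] nonunits_1[OF R] sring_1[OF R] by auto
  next
    case (Suc n)
    then obtain b where b: "b \<in> S" "x ^ Suc n = a * b" by (auto simp: sdvd_def)
    have "sdvd S x (x * x ^ n)" by (intro sdvd_self[OF R] S_rules)
    then have "sdvd S x (a * b)" using b by simp
    then have "sdvd S x a \<or> sdvd S x b" using x_prime a b nonunits_sub[of S] by (auto simp: sprime_elt_def)
    moreover have "sdvd S x a" if xb: "sdvd S x b"
    proof -
      obtain d where "d \<in> S" "b = x * d" using xb by (auto simp: sdvd_def)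
      then have "x ^ n = a * d" using b x_neq_0 by simp
      then show ?thesis using Suc \<open>d \<in> S\<close> by (auto simp: sdvd_def)
    qed
    ultimately show ?case by blast
  qed
  ultimately show ?thesis using x_prime by blast
next
  case False
  define C where "C = {I. sideal S I \<and> a \<in> I \<and> (\<forall>n. x ^ n \<notin> I)}"
  have aS: "a \<in> S" using a nonunits_sub by auto
  have "genid S {a} \<in> C" using False genid_sideal[OF R, of "{a}"] aS genid_in[of a "{a}" S] by (simp add: C_def genid_sdvd[OF R])
  then obtain I where I: "I \<in> C" "\<And>J. J \<in> C \<Longrightarrow> I \<subseteq> J \<Longrightarrow> J = I"
    using snoeth_maximal[OF noeth, of C] by (metis (no_types, lifting) C_def empty_iff mem_Collect_eq)
  have Iid: "sideal S I" "a \<in> I" "\<And>n. x ^ n \<notin> I" using I by (auto simp: C_def)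
  have Im: "smod S I" and IS: "I \<subseteq> S" using Iid by (auto simp: sideal_def)
  have grow: "\<exists>n s i. s \<in> S \<and> i \<in> I \<and> x ^ n = s * u + i" if u: "u \<in> S" "u \<notin> I" for u
  proof -
    have "sideal S (genid S (insert u I))" using genid_sideal[OF R] u IS by auto
    moreover have "I \<subseteq> genid S (insert u I)" "u \<in> genid S (insert u I)" using genid_incl[of "insert u I" S] by auto
    ultimately have "\<exists>n. x ^ n \<in> genid S (insert u I)" using I(2)[of "genid S (insert u I)"] Iid u by (auto simp: C_def)
    then show ?thesis unfolding genid_insert[OF R] genid_eq[OF Iid(1)] by blast
  qed
  have P: "sprime S I" unfolding sprime_def
  proof (intro conjI ballI impI Iid(1))
    show "1 \<notin> I" using Iid(3)[of 0] by simp
    fix u v assume h: "u \<in> S" "v \<in> S" "u * v \<in> I"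
    show "u \<in> I \<or> v \<in> I"
    proof (rule ccontr)
      assume "\<not> ?thesis"
      then obtain n s i m t j where g: "s \<in> S" "i \<in> I" "x ^ n = s * u + i" "t \<in> S" "j \<in> I" "x ^ m = t * v + j"
        using grow h by meson
      have "x ^ (n + m) = (s * t) * (u * v) + ((s * u) * j + (t * v + j) * i)" using g by (simp add: power_add algebra_simps)
      moreover have "\<dots> \<in> I" using g h IS by (intro smod_add[OF Im] smod_mult[OF Im _ h(3)] smod_mult[OF Im _ g(2)] smod_mult[OF Im _ g(5)] S_rules) auto
      ultimately show False using Iid(3) by metis
    qed
  qed
  have "I \<noteq> {0}" "I \<noteq> nonunits S" using Iid a x_nonunit Iid(3)[of 1] by auto
  then obtain f where "sprime_elt S f" "I = genid S {f}" using prime_principal[OF P] by blast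
  then show ?thesis using Iid genid_sdvd[OF R] by auto
qed

text \<open>A denominator d whose principal ideal is as large as possible has no prime factor in
  common with its numerator. The conclusion, that c is a nonzerodivisor modulo d, is the form of
  coprimality used in \<open>residually_transcendental\<close>.\<close>

lemma lowest_terms:
  assumes a: "a \<in> S" and b: "b \<in> S" "b \<noteq> 0"
  shows "\<exists>c\<in>S. \<exists>d\<in>S. d \<noteq> 0 \<and> a / b = c / d \<and> (\<forall>r\<in>S. sdvd S d (r * c) \<longrightarrow> sdvd S d r)"
proof -
  define C where "C = {genid S {d} | d. d \<in> S \<and> d \<noteq> 0 \<and> d * (a / b) \<in> S}"
  have "genid S {b} \<in> C" using a b by (auto simp: C_def)
  moreover have "I \<in> C \<Longrightarrow> sideal S I" for I using genid_sideal[OF R] by (auto simp: C_def)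
  ultimately obtain I where I: "I \<in> C" "\<And>J. J \<in> C \<Longrightarrow> I \<subseteq> J \<Longrightarrow> J = I"
    using snoeth_maximal[OF noeth, of C] by (metis empty_iff)
  then obtain d where d: "d \<in> S" "d \<noteq> 0" "d * (a / b) \<in> S" "I = genid S {d}" by (auto simp: C_def)
  define c where "c = d * (a / b)"
  have cop: False if f: "sprime_elt S f" "sdvd S f d" "sdvd S f c" for f
  proof -
    obtain d' c' where h: "d' \<in> S" "d = f * d'" "c' \<in> S" "c = f * c'" using f by (auto simp: sdvd_def)
    have f0: "f \<noteq> 0" "f \<in> nonunits S" using f by (auto simp: sprime_elt_def)
    have "f * (d' * (a / b)) = f * c'" using h(2,4) unfolding c_def by (metis mult.assoc)
    then have "d' * (a / b) = c'" using f0 by (metis mult_cancel_left)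
    then have "genid S {d'} \<in> C" using h d by (auto simp: C_def)
    moreover have "I \<subseteq> genid S {d'}"
      using d h f0 nonunits_sub[of S] genid_least[OF genid_smod[of S "{d'}"], of "{d}"]
      by (auto simp: genid_sdvd[OF R] sdvd_def mult.commute)
    ultimately have "genid S {d'} = I" using I by blast
    then have "sdvd S d d'" using genid_in[of d' "{d'}" S] d genid_sdvd[OF R] by auto
    then obtain s where s: "s \<in> S" "d' = d * s" by (auto simp: sdvd_def)
    then have "d * 1 = d * (f * s)" using h by (simp add: mult.assoc mult.left_commute)
    then have "f * s = 1" using d by (metis mult_cancel_left)
    then show False using nonunits_mult2[OF R s(1) f0(2)] nonunits_1[OF R] by simp
  qed
  \<comment> \<open>The claim is generalized to all divisors w of d, so that one prime factor at a
    time can be removed.\<close>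
  have "\<forall>w'. \<forall>r\<in>S. w' \<in> S \<longrightarrow> w * w' = d \<longrightarrow> sdvd S w (r * c) \<longrightarrow> sdvd S w r" if "w \<in> S" "w \<noteq> 0" for w
    using R noeth that
  proof (induction w rule: snoeth_divisor_induct)
    case (step w)
    show ?case
    proof (intro allI ballI impI)
      fix w' r assume h: "r \<in> S" "w' \<in> S" "w * w' = d" "sdvd S w (r * c)"
      show "sdvd S w r"
      proof (cases "w \<in> nonunits S")
        case False
        then have "r = w * (r / w)" "r / w \<in> S" using step.hyps div_unit[OF loc h(1) step.hyps(1)] by auto
        then show ?thesis unfolding sdvd_def by blast
      next
        case True
        then obtain f where f: "sprime_elt S f" "sdvd S f w" using prime_divisor step by blast
        then obtain v where v: "v \<in> S" "w = f * v" by (auto simp: sdvd_def)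
        have f0: "f \<noteq> 0" "f \<in> nonunits S" "f \<in> S" using f nonunits_sub by (auto simp: sprime_elt_def)
        have "sdvd S f d" using f h sdvd_mult[OF R f(2) h(2)] by simp
        then have nc: "\<not> sdvd S f c" using cop f by blast
        have "sdvd S f (r * c)" using sdvd_trans[OF R f(2) h(4)] .
        moreover have "c \<in> S" using d c_def by simp
        ultimately have "sdvd S f r" using nc f(1) h(1) unfolding sprime_elt_def by blast
        then obtain r' where r': "r' \<in> S" "r = f * r'" by (auto simp: sdvd_def)
        have "sdvd S (f * v) (f * (r' * c))" using h(4) v r' by (simp add: mult.assoc)
        then have "sdvd S v (r' * c)" using sdvd_cancel f0 by blast
        moreover have "v * (f * w') = d" using h v by (simp add: algebra_simps)
        moreover have "f * w' \<in> S" using f0 h sring_mult[OF R] by auto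
        ultimately have "sdvd S v r'" using step.IH[OF v(2) f0(2) v(1)] r' by blast
        then show ?thesis using v r' by (auto simp: sdvd_def mult.assoc)
      qed
    qed
  qed
  from this[OF d(1,2)] have "\<forall>r\<in>S. sdvd S d (r * c) \<longrightarrow> sdvd S d r" using sring_1[OF R] by (metis mult.right_neutral)
  moreover have "a / b = c / d" using d by (simp add: c_def)
  ultimately show ?thesis using d c_def by blast
qed

lemma y_coprime: "r \<in> S \<Longrightarrow> sdvd S x (r * y) \<Longrightarrow> sdvd S x r"
  using x_prime y_pow_not_dvd[of 1] y_in by (auto simp: sprime_elt_def)

text \<open>A single generator would be an associate of the prime x, and x would divide y.\<close>

lemma max_not_principal: "\<not> (\<exists>z. nonunits S = genid S {z})"
proof
  assume "\<exists>z. nonunits S = genid S {z}"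
  then obtain z where z: "nonunits S = genid S {z}" by blast
  then have zx: "sdvd S z x" "sdvd S z y" using x_nonunit y_nonunit genid_sdvd[OF R] by auto
  have zS: "z \<in> nonunits S" "z \<in> S" using z genid_in nonunits_sub by blast+
  obtain c where c: "c \<in> S" "x = z * c" using zx by (auto simp: sdvd_def)
  have "sdvd S x (z * c)" using c sdvd_self[OF R sring_1[OF R], of x] by simp
  then have "sdvd S x z \<or> sdvd S x c" using x_prime c zS by (auto simp: sprime_elt_def)
  moreover have "\<not> sdvd S x c"
  proof
    assume "sdvd S x c"
    then obtain d where "d \<in> S" "c = x * d" by (auto simp: sdvd_def)
    then have "x * 1 = x * (z * d)" using c by (simp add: mult.left_commute)
    then have "z * d = 1" using x_neq_0 by (metis mult_cancel_left)
    then show False using nonunits_mult2[OF R \<open>d \<in> S\<close> zS(1)] nonunits_1[OF R] by simp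
  qed
  ultimately have "sdvd S x y" using zx sdvd_trans[OF R] by blast
  then show False using y_pow_not_dvd[of 1] by simp
qed

lemma x_prime_genid: "sprime S (genid S {x})" "genid S {x} \<noteq> {0}" "genid S {x} \<noteq> nonunits S"
  using sprime_genid[OF R x_prime] x_neq_0 genid_in[of x "{x}" S] max_not_principal by auto

end

section \<open>Adjoining an element\<close>

text \<open>The coefficient set can be an ideal: over \<open>nonunits S\<close> these are the
  polynomials over S that vanish in the polynomial ring over the residue field.\<close>

definition polys_over :: "'f::field set \<Rightarrow> 'f poly set" where
  "polys_over S = {p. \<forall>i. poly.coeff p i \<in> S}"

definition adjoin :: "'f::field set \<Rightarrow> 'f \<Rightarrow> 'f set" where
  "adjoin S t = {poly p t | p. p \<in> polys_over S}"

lemma polys_overD: "p \<in> polys_over S \<Longrightarrow> poly.coeff p i \<in> S"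
  by (simp add: polys_over_def)

lemma polys_over_mono: "S \<subseteq> T \<Longrightarrow> polys_over S \<subseteq> polys_over T"
  by (auto simp: polys_over_def)

lemma polys_over_0: "0 \<in> S \<Longrightarrow> 0 \<in> polys_over S"
  by (simp add: polys_over_def)

lemma polys_over_const: "0 \<in> S \<Longrightarrow> a \<in> S \<Longrightarrow> [:a:] \<in> polys_over S"
  by (auto simp: polys_over_def coeff_pCons split: nat.split)

lemma polys_over_pCons: "a \<in> S \<Longrightarrow> p \<in> polys_over S \<Longrightarrow> pCons a p \<in> polys_over S"
  by (auto simp: polys_over_def coeff_pCons split: nat.split)

lemma polys_over_monom: "0 \<in> S \<Longrightarrow> a \<in> S \<Longrightarrow> Polynomial.monom a n \<in> polys_over S"
  by (auto simp: polys_over_def)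

lemma polys_over_add: "smod S I \<Longrightarrow> p \<in> polys_over I \<Longrightarrow> q \<in> polys_over I \<Longrightarrow> p + q \<in> polys_over I"
  by (auto simp: polys_over_def smod_add)

lemma polys_over_diff: "sring S \<Longrightarrow> smod S I \<Longrightarrow> p \<in> polys_over I \<Longrightarrow> q \<in> polys_over I \<Longrightarrow> p - q \<in> polys_over I"
  by (auto simp: polys_over_def smod_diff)

lemma polys_over_mult: "smod S I \<Longrightarrow> p \<in> polys_over S \<Longrightarrow> q \<in> polys_over I \<Longrightarrow> p * q \<in> polys_over I"
  by (auto simp: polys_over_def Polynomial.coeff_mult smod_mult intro!: smod_sum)

lemma polys_over_smult: "smod S I \<Longrightarrow> a \<in> S \<Longrightarrow> p \<in> polys_over I \<Longrightarrow> Polynomial.smult a p \<in> polys_over I"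
  by (auto simp: polys_over_def smod_mult)

lemma polys_over_smult2: "smod S I \<Longrightarrow> a \<in> I \<Longrightarrow> p \<in> polys_over S \<Longrightarrow> Polynomial.smult a p \<in> polys_over I"
  by (auto simp: polys_over_def smod_mult2)

lemma polys_over_poly: "smod T I \<Longrightarrow> p \<in> polys_over I \<Longrightarrow> sring T \<Longrightarrow> t \<in> T \<Longrightarrow> poly p t \<in> I"
  unfolding poly_altdef by (auto simp: polys_over_def intro!: smod_sum smod_mult2 sring_pow)

context
  fixes S :: "'f::field set" and t :: 'f
  assumes R: "sring S"
begin

lemma adjoinI: "p \<in> polys_over S \<Longrightarrow> poly p t \<in> adjoin S t"
  by (auto simp: adjoin_def)

lemma adjoin_sring: "sring (adjoin S t)"
  unfolding sring_def
proof (intro conjI ballI)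
  have "[:1:] \<in> polys_over S" using R by (simp add: polys_over_const sring_rules)
  then show "1 \<in> adjoin S t" using adjoinI by fastforce
  fix a b assume "a \<in> adjoin S t" "b \<in> adjoin S t"
  then obtain p q where "p \<in> polys_over S" "q \<in> polys_over S" "a = poly p t" "b = poly q t" by (auto simp: adjoin_def)
  then show "a - b \<in> adjoin S t" "a * b \<in> adjoin S t"
    using adjoinI[of "p - q"] adjoinI[of "p * q"] polys_over_diff[OF R smod_self[OF R]] polys_over_mult[OF smod_self[OF R]] by auto
qed

lemma adjoin_incl: "S \<subseteq> adjoin S t"
proof
  fix a assume "a \<in> S"
  then show "a \<in> adjoin S t" using adjoinI[OF polys_over_const[of S a]] sring_0[OF R] by auto
qed

lemma adjoin_gen: "t \<in> adjoin S t"
  using adjoinI[OF polys_over_pCons[of 0 S "[:1:]"]] polys_over_const[of S 1] R by (auto simp: sring_rules)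

lemma adjoin_least: "sring T \<Longrightarrow> S \<subseteq> T \<Longrightarrow> t \<in> T \<Longrightarrow> adjoin S t \<subseteq> T"
  using polys_over_poly[OF smod_self, of T _ t] polys_over_mono[of S T] by (auto simp: adjoin_def)

text \<open>Hilbert's basis theorem, by the ideals of leading coefficients.\<close>

lemma snoeth_adjoin:
  assumes N: "snoeth S"
  shows "snoeth (adjoin S t)"
  unfolding snoeth_def
proof (intro allI impI)
  fix K assume "sideal (adjoin S t) K"
  then have Km: "smod (adjoin S t) K" and KA: "K \<subseteq> adjoin S t" by (auto simp: sideal_def)
  have A: "sring (adjoin S t)" by (rule adjoin_sring)
  have SA: "S \<subseteq> adjoin S t" by (rule adjoin_incl)
  have tn: "t ^ n \<in> adjoin S t" for n using adjoin_gen sring_pow[OF A] by auto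
  \<comment> \<open>An element of K can have many representing polynomials, as t may be algebraic
    over S; the leading coefficients of all of them are collected.\<close>
  define L where "L n = {c. \<exists>p\<in>polys_over S. Polynomial.degree p \<le> n \<and> poly.coeff p n = c \<and> poly p t \<in> K}" for n
  have Lid: "sideal S (L n)" for n
    unfolding sideal_def smod_def
  proof (intro conjI ballI)
    show "0 \<in> L n" using polys_over_0[of S] sring_0[OF R] smod_0[OF Km] by (auto simp: L_def intro!: bexI[of _ 0])
    show "L n \<subseteq> S" by (auto simp: L_def polys_over_def)
    fix a b assume "a \<in> L n" "b \<in> L n"
    then obtain p q where "p \<in> polys_over S" "q \<in> polys_over S" "Polynomial.degree p \<le> n" "Polynomial.degree q \<le> n"
      "a = poly.coeff p n" "b = poly.coeff q n" "poly p t \<in> K" "poly q t \<in> K" by (auto simp: L_def)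
    then show "a + b \<in> L n" using polys_over_add[OF smod_self[OF R], of p q] smod_add[OF Km, of "poly p t" "poly q t"]
      by (auto simp: L_def Polynomial.degree_add_le intro!: bexI[of _ "p + q"])
  next
    fix s a assume s: "s \<in> S" and "a \<in> L n"
    then obtain p where "p \<in> polys_over S" "Polynomial.degree p \<le> n" "a = poly.coeff p n" "poly p t \<in> K" by (auto simp: L_def)
    then show "s * a \<in> L n" using s polys_over_smult[OF smod_self[OF R], of s p] smod_mult[OF Km, of s "poly p t"] SA
        Polynomial.degree_smult_le[of s p]
      by (auto simp: L_def intro!: bexI[of _ "Polynomial.smult s p"])
  qed
  have Lmono: "L n \<subseteq> L (Suc n)" for n
  proof
    fix a assume "a \<in> L n"
    then obtain p where "p \<in> polys_over S" "Polynomial.degree p \<le> n" "a = poly.coeff p n" "poly p t \<in> K" by (auto simp: L_def)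
    then show "a \<in> L (Suc n)" using polys_over_pCons[of 0 S p] sring_0[OF R] smod_mult[OF Km adjoin_gen, of "poly p t"]
      by (auto simp: L_def intro!: bexI[of _ "pCons 0 p"] split: if_splits)
  qed
  obtain N where Ns: "\<And>n. n \<ge> N \<Longrightarrow> L n = L N" using snoeth_chain[of S L] assms Lid Lmono by metis
  have "\<exists>B. finite B \<and> B \<subseteq> S \<and> L n = genid S B" for n using assms Lid by (auto simp: snoeth_def)
  then obtain B where B: "\<And>n. finite (B n)" "\<And>n. B n \<subseteq> S" "\<And>n. L n = genid S (B n)" by metis
  have "\<exists>p\<in>polys_over S. Polynomial.degree p \<le> n \<and> poly.coeff p n = b \<and> poly p t \<in> K" if "b \<in> B n" for n b
    using that B(3)[of n] genid_in[of b "B n" S] by (auto simp: L_def)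
  then have "\<forall>n. \<forall>b. \<exists>p. b \<in> B n \<longrightarrow> p \<in> polys_over S \<and> Polynomial.degree p \<le> n \<and> poly.coeff p n = b \<and> poly p t \<in> K"
    by blast
  then obtain p where "\<forall>n b. b \<in> B n \<longrightarrow> p n b \<in> polys_over S \<and> Polynomial.degree (p n b) \<le> n \<and>
      poly.coeff (p n b) n = b \<and> poly (p n b) t \<in> K" by metis
  then have p: "\<And>n b. b \<in> B n \<Longrightarrow> p n b \<in> polys_over S \<and> Polynomial.degree (p n b) \<le> n \<and>
      poly.coeff (p n b) n = b \<and> poly (p n b) t \<in> K" by blast
  define G where "G = (\<Union>n\<le>N. (\<lambda>b. poly (p n b) t) ` B n)"
  have Gf: "finite G" using B by (auto simp: G_def)
  have GK: "G \<subseteq> K" using p by (auto simp: G_def)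
  have GA: "genid (adjoin S t) G \<subseteq> K" using genid_least[OF Km GK] .
  have lead: "\<exists>q\<in>polys_over S. Polynomial.degree q \<le> n \<and> poly.coeff q n = c \<and> poly q t \<in> genid (adjoin S t) G"
    if n: "n \<le> N" and c: "c \<in> L n" for n c
  proof -
    define W where "W = {c. \<exists>q\<in>polys_over S. Polynomial.degree q \<le> n \<and> poly.coeff q n = c \<and> poly q t \<in> genid (adjoin S t) G}"
    have "smod S W" unfolding smod_def
    proof (intro conjI ballI)
      show "0 \<in> W" using polys_over_0[of S] sring_0[OF R] smod_0[OF genid_smod] by (auto simp: W_def intro!: bexI[of _ 0])
      fix a b assume "a \<in> W" "b \<in> W"
      then obtain p q where "p \<in> polys_over S" "q \<in> polys_over S" "Polynomial.degree p \<le> n" "Polynomial.degree q \<le> n"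
        "a = poly.coeff p n" "b = poly.coeff q n" "poly p t \<in> genid (adjoin S t) G" "poly q t \<in> genid (adjoin S t) G" by (auto simp: W_def)
      then show "a + b \<in> W" using polys_over_add[OF smod_self[OF R], of p q] smod_add[OF genid_smod, of "poly p t" _ _ "poly q t"]
        by (auto simp: W_def Polynomial.degree_add_le intro!: bexI[of _ "p + q"])
    next
      fix s a assume s: "s \<in> S" and "a \<in> W"
      then obtain p where "p \<in> polys_over S" "Polynomial.degree p \<le> n" "a = poly.coeff p n" "poly p t \<in> genid (adjoin S t) G" by (auto simp: W_def)
      then show "s * a \<in> W" using s polys_over_smult[OF smod_self[OF R], of s p] smod_mult[OF genid_smod, of s _ "poly p t"] SA
        Polynomial.degree_smult_le[of s p]
        by (auto simp: W_def intro!: bexI[of _ "Polynomial.smult s p"])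
    qed
    moreover have "B n \<subseteq> W"
    proof
      fix b assume b: "b \<in> B n"
      then have "poly (p n b) t \<in> G" using n by (auto simp: G_def)
      then show "b \<in> W" using p[OF b] genid_in by (auto simp: W_def intro!: bexI[of _ "p n b"])
    qed
    ultimately have "L n \<subseteq> W" unfolding B(3) by (rule genid_least)
    then show ?thesis using c by (auto simp: W_def)
  qed
  have all: "q \<in> polys_over S \<Longrightarrow> Polynomial.degree q \<le> m \<Longrightarrow> poly q t \<in> K \<Longrightarrow> poly q t \<in> genid (adjoin S t) G" for q m
  proof (induction m arbitrary: q)
    case 0
    then have "poly.coeff q 0 \<in> L 0" by (auto simp: L_def)
    then obtain p where "p \<in> polys_over S" "Polynomial.degree p \<le> 0" "poly.coeff p 0 = poly.coeff q 0"
      "poly p t \<in> genid (adjoin S t) G" using lead by blast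
    moreover then have "p = q" using 0 by (intro poly_eqI) (metis Polynomial.coeff_eq_0 gr_zeroI le_zero_eq)
    ultimately show ?case by simp
  next
    case (Suc m)
    \<comment> \<open>Above degree N no new leading coefficients appear, so a polynomial of degree
      at most N is multiplied by a power of the variable.\<close>
    define n where "n = min (Suc m) N"
    have n: "n \<le> N" "n \<le> Suc m" by (auto simp: n_def)
    have "poly.coeff q (Suc m) \<in> L (Suc m)" using Suc by (auto simp: L_def)
    moreover have "L (Suc m) = L n" using Ns[of "Suc m"] by (auto simp: n_def min_def)
    ultimately obtain p where p: "p \<in> polys_over S" "Polynomial.degree p \<le> n" "poly.coeff p n = poly.coeff q (Suc m)"
      "poly p t \<in> genid (adjoin S t) G" using lead[OF n(1)] by blast
    define r where "r = q - Polynomial.monom 1 (Suc m - n) * p"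
    have pG: "t ^ (Suc m - n) * poly p t \<in> genid (adjoin S t) G" using smod_mult[OF genid_smod tn p(4)] .
    have "r \<in> polys_over S" unfolding r_def using Suc.prems p R
      by (intro polys_over_diff[OF R smod_self[OF R]] polys_over_mult[OF smod_self[OF R]] polys_over_monom sring_rules) auto
    moreover have "Polynomial.degree r \<le> m"
    proof (rule Polynomial.degree_le, intro allI impI)
      fix i assume "m < i"
      then show "poly.coeff r i = 0"
      proof (cases "i = Suc m")
        case True
        then show ?thesis using p n by (simp add: r_def Polynomial.coeff_monom_mult)
      next
        case False
        then have "poly.coeff q i = 0" using Suc.prems \<open>m < i\<close> by (intro Polynomial.coeff_eq_0) auto
        moreover have "poly.coeff p (i - (Suc m - n)) = 0" using p n \<open>m < i\<close> False by (intro Polynomial.coeff_eq_0) auto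
        ultimately show ?thesis by (simp add: r_def Polynomial.coeff_monom_mult)
      qed
    qed
    moreover have rt: "poly r t = poly q t - t ^ (Suc m - n) * poly p t" by (simp add: r_def poly_monom)
    then have "poly r t \<in> K" using smod_diff[OF A Km] Suc.prems pG GA by auto
    ultimately have "poly r t \<in> genid (adjoin S t) G" using Suc.IH by blast
    then have "poly r t + t ^ (Suc m - n) * poly p t \<in> genid (adjoin S t) G" using pG smod_add[OF genid_smod] by blast
    then show ?case using rt by simp
  qed
  have "K \<subseteq> genid (adjoin S t) G"
  proof
    fix k assume "k \<in> K"
    then obtain q where "q \<in> polys_over S" "k = poly q t" using KA by (auto simp: adjoin_def)
    then show "k \<in> genid (adjoin S t) G" using all[of q "Polynomial.degree q"] \<open>k \<in> K\<close> by auto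
  qed
  then show "\<exists>G. finite G \<and> G \<subseteq> adjoin S t \<and> K = genid (adjoin S t) G" using Gf GK KA GA by blast
qed

end

text \<open>The generators of the contraction to A generate I. That they lie in A matters for
  \<open>glue\<close>, where they are written as polynomials in t.\<close>

lemma locz_ideal_gen:
  assumes A: "sring A" and P: "sprime A P" and N: "snoeth A" and I: "sideal (locz A P) I"
  shows "\<exists>G. finite G \<and> G \<subseteq> A \<and> G \<subseteq> I \<and> I = genid (locz A P) G"
proof -
  have Im: "smod (locz A P) I" and IL: "I \<subseteq> locz A P" using I by (auto simp: sideal_def)
  have AL: "A \<subseteq> locz A P" using locz_incl[OF A P] .
  have "smod A I" using smod_subring[OF Im AL] .
  then have "sideal A (I \<inter> A)" using A by (auto simp: sideal_def smod_def sring_rules)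
  then obtain G where G: "finite G" "G \<subseteq> A" "I \<inter> A = genid A G" using N by (auto simp: snoeth_def)
  have GI: "G \<subseteq> I" using G genid_incl[of G A] by auto
  have "I \<subseteq> genid (locz A P) G"
  proof
    fix w assume w: "w \<in> I"
    then obtain a b where ab: "w = a / b" "a \<in> A" "b \<in> A" "b \<notin> P" "b \<noteq> 0" using IL loczE[OF A P] by blast
    then have "a = b * w" by simp
    then have "a \<in> I \<inter> A" using smod_mult[OF Im, of b w] AL ab w by auto
    then have "a \<in> genid (locz A P) G" using G genid_mono[OF AL order_refl, of G] by auto
    moreover have "1 / b \<in> locz A P" using loczI[OF A P sring_1[OF A]] ab by auto
    ultimately have "1 / b * a \<in> genid (locz A P) G" using smod_mult[OF genid_smod] by blast
    then show "w \<in> genid (locz A P) G" using ab by simp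
  qed
  then have "I = genid (locz A P) G" using genid_least[OF Im GI] by (rule subset_antisym)
  then show ?thesis using G GI by blast
qed

lemma snoeth_locz:
  assumes A: "sring A" and P: "sprime A P" and N: "snoeth A"
  shows "snoeth (locz A P)"
  unfolding snoeth_def
proof (intro allI impI)
  fix I assume "sideal (locz A P) I"
  then obtain G where "finite G" "G \<subseteq> A" "I = genid (locz A P) G" using locz_ideal_gen[OF A P N] by blast
  moreover then have "G \<subseteq> locz A P" using locz_incl[OF A P] by blast
  ultimately show "\<exists>G. finite G \<and> G \<subseteq> locz A P \<and> I = genid (locz A P) G" by blast
qed

section \<open>Residual transcendence, leading forms, and the chart of the blowup of the maximal
  ideal\<close>

lemma coprime_pow:
  assumes "sring S" "y \<in> S" "\<And>r. r \<in> S \<Longrightarrow> sdvd S x (r * y) \<Longrightarrow> sdvd S x r"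
  shows "r \<in> S \<Longrightarrow> sdvd S x (r * y ^ n) \<Longrightarrow> sdvd S x r"
proof (induction n)
  case (Suc n)
  have "sdvd S x ((r * y ^ n) * y)" using Suc.prems by (simp add: mult.assoc mult.commute[of y])
  moreover have "r * y ^ n \<in> S" using Suc.prems assms by (intro sring_rules)
  ultimately show ?case using Suc assms(3) by blast
qed simp

lemma poly_altdef_le: "Polynomial.degree (p :: 'f::field poly) \<le> n \<Longrightarrow> poly p t = (\<Sum>i\<le>n. poly.coeff p i * t ^ i)"
  unfolding poly_altdef by (intro sum.mono_neutral_left) (auto intro: Polynomial.coeff_eq_0)

lemma homogenize:
  assumes "(x::'f::field) \<noteq> 0" "Polynomial.degree p \<le> r"
  shows "x ^ r * poly p (y / x) = (\<Sum>i\<le>r. poly.coeff p i * x ^ (r - i) * y ^ i)"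
proof -
  have "x ^ r * (poly.coeff p i * (y / x) ^ i) = poly.coeff p i * x ^ (r - i) * y ^ i" if "i \<le> r" for i
    using assms sring_powsplit[OF that, of x] by (simp add: power_divide)
  moreover have "poly p (y / x) = (\<Sum>i\<le>r. poly.coeff p i * (y / x) ^ i)"
    using poly_altdef_le[OF assms(2)] .
  ultimately show ?thesis unfolding sum_distrib_left by (simp only: sum_distrib_left) (intro sum.cong, auto)
qed

text \<open>Multiplying by x ^ n shows that x divides c * y ^ n for the leading coefficient c, so c
  = x * e. Replacing c X ^ n by e * y X ^ (n - 1) keeps the value at y / x, changes coefficients
  only by elements of (x, y), and lowers the degree.\<close>

lemma residually_transcendental:
  assumes R: "sring S" and x: "x \<in> S" "x \<noteq> 0" and y: "y \<in> S"
    and cop: "\<And>r. r \<in> S \<Longrightarrow> sdvd S x (r * y) \<Longrightarrow> sdvd S x r"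
  shows "p \<in> polys_over S \<Longrightarrow> poly p (y / x) = 0 \<Longrightarrow> p \<in> polys_over (genid S {x, y})"
proof (induction "Polynomial.degree p" arbitrary: p rule: less_induct)
  case less
  define n where "n = Polynomial.degree p"
  define I where "I = genid S {x, y}"
  have Im: "smod S I" unfolding I_def by (rule genid_smod)
  have xyI: "x \<in> I" "y \<in> I" using genid_incl[of "{x, y}" S] by (auto simp: I_def)
  show ?case
  proof (cases "n = 0")
    case True
    then obtain c where "p = [:c:]" using degree_eq_zeroE n_def by metis
    then have "p = 0" using less.prems by simp
    then show ?thesis using polys_over_0 smod_0[OF genid_smod] by blast
  next
    case False
    then obtain m where m: "n = Suc m" by (cases n) auto
    define c where "c = poly.coeff p n"
    have cS: "poly.coeff p i \<in> S" for i using less.prems by (auto simp: polys_over_def)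
    have "0 = (\<Sum>i\<le>n. poly.coeff p i * x ^ (n - i) * y ^ i)"
      using homogenize[OF x(2), of p n y] less.prems by (simp add: n_def)
    also have "\<dots> = c * y ^ n + (\<Sum>i\<le>m. poly.coeff p i * x ^ (n - i) * y ^ i)"
      by (simp add: m c_def)
    also have "(\<Sum>i\<le>m. poly.coeff p i * x ^ (n - i) * y ^ i) = x * (\<Sum>i\<le>m. poly.coeff p i * x ^ (m - i) * y ^ i)"
      by (simp add: m sum_distrib_left Suc_diff_le algebra_simps)
    finally have "c * y ^ n = x * (- (\<Sum>i\<le>m. poly.coeff p i * x ^ (m - i) * y ^ i))"
      by (simp add: eq_neg_iff_add_eq_0)
    moreover have "- (\<Sum>i\<le>m. poly.coeff p i * x ^ (m - i) * y ^ i) \<in> S"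
      using cS x y by (intro sring_minus[OF R] sring_sum[OF R] sring_rules[OF R]) auto
    ultimately have "sdvd S x (c * y ^ n)" unfolding sdvd_def by blast
    then have "sdvd S x c" using coprime_pow[OF R y cop] cS c_def by blast
    then obtain e where e: "e \<in> S" "c = x * e" by (auto simp: sdvd_def)
    define q where "q = p - Polynomial.monom c n + Polynomial.monom (e * y) m"
    have d: "Polynomial.monom c n - Polynomial.monom (e * y) m \<in> polys_over I"
      using e y xyI smod_mult[OF Im] smod_mult2[OF Im] smod_0[OF Im]
      by (intro polys_over_diff[OF R Im] polys_over_monom) auto
    have "q \<in> polys_over S" unfolding q_def using less.prems e(1) y x cS[of n, folded c_def] sring_0[OF R]
      by (intro polys_over_add[OF smod_self[OF R]] polys_over_diff[OF R smod_self[OF R]] polys_over_monom sring_rules[OF R]) auto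
    moreover have "Polynomial.degree q \<le> m"
    proof (rule Polynomial.degree_le, intro allI impI)
      fix i assume "m < i"
      then show "poly.coeff q i = 0" using Polynomial.coeff_eq_0[of p i] n_def m by (cases "i = n") (auto simp: q_def c_def)
    qed
    moreover have "poly q (y / x) = 0"
      using less.prems e x by (simp add: q_def poly_monom m)
    ultimately have "q \<in> polys_over I" using less.hyps[of q] m n_def I_def by auto
    then have "q + (Polynomial.monom c n - Polynomial.monom (e * y) m) \<in> polys_over I" using d polys_over_add[OF Im] by blast
    then show ?thesis by (simp add: q_def I_def)
  qed
qed

text \<open>If both polynomials have coefficients outside P, the product of the first such
  coefficients survives modulo P in the coefficient of index i + j.\<close>

lemma gauss_content:
  assumes R: "sring S" and P: "sprime S P" and p: "p \<in> polys_over S" and q: "q \<in> polys_over S"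
    and pq: "p * q \<in> polys_over P"
  shows "p \<in> polys_over P \<or> q \<in> polys_over P"
proof (rule ccontr)
  assume "\<not> ?thesis"
  then have "\<exists>i. poly.coeff p i \<notin> P" "\<exists>j. poly.coeff q j \<notin> P" by (auto simp: polys_over_def)
  then obtain i j where i: "poly.coeff p i \<notin> P" "\<And>k. k < i \<Longrightarrow> poly.coeff p k \<in> P"
    and j: "poly.coeff q j \<notin> P" "\<And>k. k < j \<Longrightarrow> poly.coeff q k \<in> P"
    using exists_least_iff[of "\<lambda>i. poly.coeff p i \<notin> P"] exists_least_iff[of "\<lambda>i. poly.coeff q i \<notin> P"] by metis
  have Pm: "smod S P" using sprime_smod[OF P] .
  have "poly.coeff (p * q) (i + j) = (\<Sum>k\<le>i + j. poly.coeff p k * poly.coeff q (i + j - k))"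
    by (rule Polynomial.coeff_mult)
  also have "\<dots> = poly.coeff p i * poly.coeff q j + (\<Sum>k\<in>{..i + j} - {i}. poly.coeff p k * poly.coeff q (i + j - k))"
    by (subst sum.remove[of _ i]) auto
  finally have eq: "poly.coeff p i * poly.coeff q j = poly.coeff (p * q) (i + j) -
    (\<Sum>k\<in>{..i + j} - {i}. poly.coeff p k * poly.coeff q (i + j - k))" by simp
  have "poly.coeff p k * poly.coeff q (i + j - k) \<in> P" if "k \<in> {..i + j} - {i}" for k
  proof (cases "k < i")
    case True then show ?thesis using i smod_mult2[OF Pm] polys_overD[OF q] by auto
  next
    case False
    then have "i + j - k < j" using that by auto
    then show ?thesis using j smod_mult[OF Pm] polys_overD[OF p] by auto
  qed
  then have "poly.coeff p i * poly.coeff q j \<in> P" unfolding eq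
    using pq by (intro smod_diff[OF R Pm] smod_sum[OF Pm]) (auto simp: polys_over_def)
  then show False using sprime_prime[OF P polys_overD[OF p] polys_overD[OF q]] i j by blast
qed

context regular2
begin

lemma smod_S: "smod S S" using smod_self[OF R] .

lemma max_smod: "smod S (nonunits S)" using nonunits_smod[OF loc] .

lemma polys_max_split:
  assumes q: "q \<in> polys_over (nonunits S)"
  shows "\<exists>q1\<in>polys_over S. \<exists>q2\<in>polys_over S. q = Polynomial.smult x q1 + Polynomial.smult y q2 \<and>
    Polynomial.degree q1 \<le> Polynomial.degree q \<and> Polynomial.degree q2 \<le> Polynomial.degree q"
proof -
  have "\<forall>i. \<exists>s t. s \<in> S \<and> t \<in> S \<and> poly.coeff q i = x * s + y * t" using q max_iff by (simp add: polys_over_def) blast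
  then obtain s t where st: "\<And>i. s i \<in> S" "\<And>i. t i \<in> S" "\<And>i. poly.coeff q i = x * s i + y * t i" by metis
  define n where "n = Polynomial.degree q"
  define P where "P f = (\<Sum>i\<le>n. Polynomial.monom (f i) i)" for f :: "nat \<Rightarrow> 'f"
  have Pc: "poly.coeff (P f) i = (if i \<le> n then f i else 0)" for f i
    by (simp add: P_def Polynomial.coeff_sum)
  have PS: "P f \<in> polys_over S" if "\<And>i. f i \<in> S" for f using that sring_0[OF R] by (auto simp: polys_over_def Pc)
  have "q = Polynomial.smult x (P s) + Polynomial.smult y (P t)"
  proof (rule poly_eqI)
    fix i show "poly.coeff q i = poly.coeff (Polynomial.smult x (P s) + Polynomial.smult y (P t)) i"
      using st(3)[of i] Polynomial.coeff_eq_0[of q i] by (auto simp: Pc n_def)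
  qed
  moreover have "Polynomial.degree (P f) \<le> n" for f by (rule Polynomial.degree_le) (simp add: Pc)
  ultimately show ?thesis using PS[of s] PS[of t] st by (metis n_def)
qed

lemma homogenize_in: "q \<in> polys_over S \<Longrightarrow> Polynomial.degree q \<le> r \<Longrightarrow> x ^ r * poly q (y / x) \<in> S"
  using homogenize[OF x_neq_0, of q r y] polys_overD[of q S] by (auto intro!: sring_sum[OF R] S_rules)

text \<open>Coefficients in (x, y) yield one more factor x because y = x * (y / x); a form of degree
  r is rewritten as one of degree r + 1.\<close>

lemma order_step:
  assumes q: "q \<in> polys_over (nonunits S)" "Polynomial.degree q \<le> r"
  shows "\<exists>q'\<in>polys_over S. Polynomial.degree q' \<le> Suc r \<and> poly q (y / x) = x * poly q' (y / x)"
proof -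
  obtain q1 q2 where h: "q1 \<in> polys_over S" "q2 \<in> polys_over S" "q = Polynomial.smult x q1 + Polynomial.smult y q2"
    "Polynomial.degree q1 \<le> r" "Polynomial.degree q2 \<le> r" using polys_max_split[OF q(1)] q(2) le_trans by blast
  have "q1 + pCons 0 q2 \<in> polys_over S" using h polys_over_add[OF smod_S] polys_over_pCons sring_0[OF R] by blast
  moreover have "Polynomial.degree (q1 + pCons 0 q2) \<le> Suc r"
    using h by (intro Polynomial.degree_add_le) (auto intro: le_trans[OF Polynomial.degree_pCons_le])
  moreover have "poly q (y / x) = x * poly (q1 + pCons 0 q2) (y / x)"
    using h x_neq_0 by (simp add: algebra_simps)
  ultimately show ?thesis by blast
qed

text \<open>In a monomial of degree at least 2 n, one of x and y has exponent at least n.\<close>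

lemma form_split:
  assumes q: "q \<in> polys_over S" "Polynomial.degree q \<le> r" "n + n \<le> r"
  shows "\<exists>s\<in>S. \<exists>t\<in>S. x ^ r * poly q (y / x) = x ^ n * s + y ^ n * t"
proof -
  define s where "s = (\<Sum>i<n. poly.coeff q i * x ^ (r - n - i) * y ^ i)"
  define t where "t = (\<Sum>i=n..r. poly.coeff q i * x ^ (r - i) * y ^ (i - n))"
  have cS: "poly.coeff q i \<in> S" for i using q by (auto simp: polys_over_def)
  have "x ^ r * poly q (y / x) = (\<Sum>i\<le>r. poly.coeff q i * x ^ (r - i) * y ^ i)" using homogenize[OF x_neq_0 q(2)] .
  also have "\<dots> = (\<Sum>i<n. poly.coeff q i * x ^ (r - i) * y ^ i) + (\<Sum>i=n..r. poly.coeff q i * x ^ (r - i) * y ^ i)"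
    using q(3) by (subst sum.union_disjoint[symmetric]) (auto intro!: sum.cong)
  also have "(\<Sum>i<n. poly.coeff q i * x ^ (r - i) * y ^ i) = x ^ n * s"
    unfolding s_def sum_distrib_left
  proof (rule sum.cong[OF refl])
    fix i assume "i \<in> {..<n}"
    then have "x ^ (r - i) = x ^ n * x ^ (r - n - i)" using q(3) by (auto simp flip: power_add)
    then show "poly.coeff q i * x ^ (r - i) * y ^ i = x ^ n * (poly.coeff q i * x ^ (r - n - i) * y ^ i)" by simp
  qed
  also have "(\<Sum>i=n..r. poly.coeff q i * x ^ (r - i) * y ^ i) = y ^ n * t"
    unfolding t_def sum_distrib_left
  proof (rule sum.cong[OF refl])
    fix i assume "i \<in> {n..r}"
    then have "y ^ i = y ^ n * y ^ (i - n)" by (auto simp flip: power_add)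
    then show "poly.coeff q i * x ^ (r - i) * y ^ i = y ^ n * (poly.coeff q i * x ^ (r - i) * y ^ (i - n))" by simp
  qed
  finally have "x ^ r * poly q (y / x) = x ^ n * s + y ^ n * t" .
  moreover have "s \<in> S" "t \<in> S" unfolding s_def t_def using cS by (auto intro!: sring_sum[OF R] S_rules)
  ultimately show ?thesis by blast
qed

text \<open>Here r is the order of f in the powers of the maximal ideal, and q represents its
  dehomogenized leading form. If q could never be chosen with a unit coefficient,
  \<open>order_step\<close> would put f into every power of the maximal ideal.\<close>

lemma leading_form:
  assumes f: "f \<in> S" "f \<noteq> 0"
  shows "\<exists>r. \<exists>q\<in>polys_over S. Polynomial.degree q \<le> r \<and> f = x ^ r * poly q (y / x) \<and> q \<notin> polys_over (nonunits S)"
proof (rule ccontr)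
  assume neg: "\<not> ?thesis"
  have all: "\<exists>q\<in>polys_over S. Polynomial.degree q \<le> r \<and> f = x ^ r * poly q (y / x)" for r
  proof (induction r)
    case 0
    show ?case using f polys_over_const[of S f] sring_0[OF R] by (intro bexI[of _ "[:f:]"]) auto
  next
    case (Suc r)
    then obtain q where q: "q \<in> polys_over S" "Polynomial.degree q \<le> r" "f = x ^ r * poly q (y / x)" by blast
    then have "q \<in> polys_over (nonunits S)" using neg by blast
    then show ?case using order_step[of q r] q by (auto simp: mult.assoc mult.left_commute)
  qed
  have "f \<in> {0}"
  proof (rule krull_intersection2[OF loc noeth _ x_nonunit y_nonunit])
    show "sideal S {0}" using sprime_sideal[OF sprime_zero[OF R]] .
    fix n
    obtain q where q: "q \<in> polys_over S" "Polynomial.degree q \<le> n + n" "f = x ^ (n + n) * poly q (y / x)" using all by blast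
    then show "\<exists>l\<in>{0}. \<exists>s\<in>S. \<exists>t\<in>S. f = l + x ^ n * s + y ^ n * t" using form_split[of q "n + n" n] by auto
  qed
  then show False using f by simp
qed

lemma poly_zero_max:
  "p \<in> polys_over S \<Longrightarrow> poly p (y / x) = 0 \<Longrightarrow> p \<in> polys_over (nonunits S)"
  unfolding max by (rule residually_transcendental[OF R x_in x_neq_0 y_in y_coprime])

lemma chart_sring: "sring (adjoin S (y / x))"
  and chart_incl: "S \<subseteq> adjoin S (y / x)"
  and chart_t: "y / x \<in> adjoin S (y / x)"
  using adjoin_sring[OF R] adjoin_incl[OF R] adjoin_gen[OF R] by auto

text \<open>This identifies the exceptional fibre: modulo x the chart is the polynomial ring in y /
  x over the residue field. From left to right it is residual transcendence applied to q - x
  q'.\<close>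

lemma chart_sdvd_x:
  assumes q: "q \<in> polys_over S"
  shows "sdvd (adjoin S (y / x)) x (poly q (y / x)) \<longleftrightarrow> q \<in> polys_over (nonunits S)"
proof
  assume "q \<in> polys_over (nonunits S)"
  then obtain q' where "q' \<in> polys_over S" "poly q (y / x) = x * poly q' (y / x)" using order_step by blast
  then show "sdvd (adjoin S (y / x)) x (poly q (y / x))" using adjoinI[OF R] by (auto simp: sdvd_def)
next
  assume "sdvd (adjoin S (y / x)) x (poly q (y / x))"
  then obtain q' where q': "q' \<in> polys_over S" "poly q (y / x) = x * poly q' (y / x)" by (auto simp: sdvd_def adjoin_def)
  have xq: "Polynomial.smult x q' \<in> polys_over (nonunits S)" using polys_over_smult2[OF max_smod x_nonunit q'(1)] .
  then have "q - Polynomial.smult x q' \<in> polys_over S"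
    using q polys_over_diff[OF R smod_S q] polys_over_mono[OF nonunits_sub] by blast
  then have "q - Polynomial.smult x q' \<in> polys_over (nonunits S)" using poly_zero_max q' by simp
  then have "(q - Polynomial.smult x q') + Polynomial.smult x q' \<in> polys_over (nonunits S)"
    using xq polys_over_add[OF max_smod] by blast
  then show "q \<in> polys_over (nonunits S)" by simp
qed

lemma chart_x_prime: "sprime_elt (adjoin S (y / x)) x"
  unfolding sprime_elt_def
proof (intro conjI ballI impI x_neq_0)
  have "\<not> sdvd (adjoin S (y / x)) x (poly [:1:] (y / x))"
    using chart_sdvd_x[of "[:1:]"] polys_over_const[of S 1] sring_0[OF R] sring_1[OF R] nonunits_1[OF R] polys_overD[of "[:1:]" "nonunits S" 0] by auto
  then have "\<not> sdvd (adjoin S (y / x)) x 1" by simp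
  then have "inverse x \<notin> adjoin S (y / x)" using sdvdI[of "inverse x" _ 1 x] x_neq_0 by auto
  then show "x \<in> nonunits (adjoin S (y / x))" using chart_incl x_in by (auto simp: nonunits_def)
  fix a b assume "a \<in> adjoin S (y / x)" "b \<in> adjoin S (y / x)" and ab: "sdvd (adjoin S (y / x)) x (a * b)"
  then obtain p q where h: "p \<in> polys_over S" "a = poly p (y / x)" "q \<in> polys_over S" "b = poly q (y / x)" by (auto simp: adjoin_def)
  have "p * q \<in> polys_over S" using h polys_over_mult[OF smod_S] by auto
  then have "p * q \<in> polys_over (nonunits S)" using ab h chart_sdvd_x[of "p * q"] by simp
  then show "sdvd (adjoin S (y / x)) x a \<or> sdvd (adjoin S (y / x)) x b"
    using gauss_content[OF R nonunits_sprime[OF loc] h(1,3)] chart_sdvd_x h by blast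
qed

lemma chart_denom: "h \<in> adjoin S (y / x) \<Longrightarrow> \<exists>N. x ^ N * h \<in> S"
  using homogenize_in by (auto simp: adjoin_def)

text \<open>A power x ^ N clears the denominators of h, and the leading form of x ^ N * h gives its
  order j. It is at least N, as otherwise x would divide the value of a polynomial with a unit
  coefficient.\<close>

lemma chart_order:
  assumes h: "h \<in> adjoin S (y / x)" "h \<noteq> 0"
  shows "\<exists>k. \<exists>g\<in>adjoin S (y / x). h = x ^ k * g \<and> \<not> sdvd (adjoin S (y / x)) x g"
proof -
  obtain N where N: "x ^ N * h \<in> S" using chart_denom h by blast
  have "x ^ N * h \<noteq> 0" using x_neq_0 h by simp
  then obtain j q where q: "q \<in> polys_over S" "x ^ N * h = x ^ j * poly q (y / x)" "q \<notin> polys_over (nonunits S)"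
    using leading_form[OF N] by blast
  have nd: "\<not> sdvd (adjoin S (y / x)) x (poly q (y / x))" using chart_sdvd_x q by blast
  have "N \<le> j"
  proof (rule ccontr)
    assume "\<not> N \<le> j"
    then have "x ^ N = x ^ j * (x * x ^ (N - j - 1))" using sring_powsplit[of j N x] by (cases "N - j") (auto simp: Suc_diff_Suc)
    then have "x ^ j * (x * (x ^ (N - j - 1) * h)) = x ^ j * poly q (y / x)" using q by (simp add: mult.assoc)
    then have "poly q (y / x) = x * (x ^ (N - j - 1) * h)" using x_neq_0 by simp
    moreover have "x ^ (N - j - 1) * h \<in> adjoin S (y / x)"
      using h chart_incl x_in by (auto intro!: sring_rules[OF chart_sring])
    ultimately show False using nd by (auto simp: sdvd_def)
  qed
  then have "x ^ N * h = x ^ N * (x ^ (j - N) * poly q (y / x))" using sring_powsplit[of N j x] q by (simp add: mult.assoc)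
  then have "h = x ^ (j - N) * poly q (y / x)" using x_neq_0 by simp
  then show ?thesis using nd adjoinI[OF R q(1)] by blast
qed

end

section \<open>The dimension of overrings\<close>

context regular2
begin

text \<open>The valuation of a in the discrete valuation ring S / x S, normalized by giving y the
  value 1.\<close>

definition yorder :: "nat \<Rightarrow> 'f \<Rightarrow> bool" where
  "yorder s a \<longleftrightarrow> (\<exists>u c. u \<in> S \<and> u \<notin> nonunits S \<and> c \<in> S \<and> a = u * y ^ s + x * c)"

lemma yorder_ex: "a \<in> S \<Longrightarrow> \<not> sdvd S x a \<Longrightarrow> \<exists>s. yorder s a"
  using order_mod_x unfolding yorder_def by blast

lemma yorder_mult:
  assumes "yorder s a" "yorder s' b"
  shows "yorder (s + s') (a * b)"
proof -
  obtain u c u' c' where h: "u \<in> S" "u \<notin> nonunits S" "c \<in> S" "a = u * y ^ s + x * c" "u' \<in> S" "u' \<notin> nonunits S" "c' \<in> S" "b = u' * y ^ s' + x * c'"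
    using assms unfolding yorder_def by blast
  have "a * b = (u * u') * y ^ (s + s') + x * (u * y ^ s * c' + c * b)" using h by (simp add: power_add algebra_simps)
  moreover have "u * y ^ s * c' + c * b \<in> S" unfolding h(8) using h by (intro S_rules)
  ultimately show ?thesis unfolding yorder_def using h unit_mult[OF loc h(1,5)] sring_mult[OF R] by blast
qed

lemma yorder_1: "yorder 0 1"
  unfolding yorder_def using sring_1[OF R] sring_0[OF R] nonunits_1[OF R] by (intro exI[of _ 1] exI[of _ 0]) auto

lemma yorder_pow: "yorder s a \<Longrightarrow> yorder (n * s) (a ^ n)"
  by (induction n) (auto simp: yorder_1 yorder_mult)

text \<open>An ideal that contains an element of $y$-order $s$ modulo $x$ has at most $s + 1$ minimal
  generators; the coefficient of a redundant generator is a unit.\<close>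

lemma unit_relation:
  assumes "p \<in> S" "yorder s p" "finite V" "card V \<ge> Suc s" "\<And>i. i \<in> V \<Longrightarrow> w i \<in> S"
  shows "\<exists>c. (\<forall>i\<in>V. c i \<in> S) \<and> (\<exists>j\<in>V. c j \<notin> nonunits S) \<and> sdvd S p (\<Sum>i\<in>V. c i * w i)"
  using assms
proof (induction s arbitrary: p V w rule: less_induct)
  case (less s)
  note p = less.prems(1,2) and V = less.prems(3,4) and w = less.prems(5)
  show ?case
  proof (cases "\<exists>j\<in>V. sdvd S p (w j)")
    case True
    then obtain j where j: "j \<in> V" "sdvd S p (w j)" by blast
    have "(\<Sum>i\<in>V. (if i = j then 1 else 0) * w i) = w j" using j V by (simp add: if_distrib[of "\<lambda>c. c * _"] cong: if_cong)
    then show ?thesis using j sring_0[OF R] sring_1[OF R] nonunits_1[OF R]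
      by (intro exI[of _ "\<lambda>i. if i = j then 1 else 0"]) auto
  next
    case False
    \<comment> \<open>\<open>W e\<close> says that modulo p every w i is divisible by x ^ e. Krull's
      theorem gives a largest such e, and for it some cofactor b j lies outside (p, x).\<close>
    define W where "W e \<longleftrightarrow> (\<forall>i\<in>V. \<exists>a\<in>S. \<exists>b\<in>S. w i = p * a + x ^ e * b)" for e
    have "\<not> (\<forall>e. W e)"
    proof
      assume all: "\<forall>e. W e"
      obtain i where i: "i \<in> V" using V by fastforce
      have pid: "sideal S (genid S {p})" using p genid_sideal[OF R] by auto
      have "\<exists>l\<in>genid S {p}. \<exists>b\<in>S. w i = l + x ^ n * b" for n
        using all i sdvd_self[OF R] unfolding W_def genid_sdvd[OF R, symmetric] by blast
      then have "w i \<in> genid S {p}" by (rule krull_intersection[OF loc noeth pid x_nonunit])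
      then show False using False i genid_sdvd[OF R] by blast
    qed
    moreover have "W 0" unfolding W_def
    proof
      fix i assume "i \<in> V"
      then have "w i = p * 0 + x ^ 0 * w i" "w i \<in> S" using w by auto
      then show "\<exists>a\<in>S. \<exists>b\<in>S. w i = p * a + x ^ 0 * b" using sring_0[OF R] by blast
    qed
    ultimately obtain e where e: "W e" "\<not> W (Suc e)" using nat_induct[of W] by blast
    then obtain a b where ab: "\<And>i. i \<in> V \<Longrightarrow> a i \<in> S \<and> b i \<in> S \<and> w i = p * a i + x ^ e * b i"
      unfolding W_def by metis
    have "\<exists>j\<in>V. \<forall>a'\<in>S. \<forall>b'\<in>S. b j \<noteq> p * a' + x * b'"
    proof (rule ccontr)
      assume neg: "\<not> ?thesis"
      have "\<exists>a\<in>S. \<exists>b\<in>S. w i = p * a + x ^ Suc e * b" if i: "i \<in> V" for i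
      proof -
        obtain a' b' where h: "a' \<in> S" "b' \<in> S" "b i = p * a' + x * b'" using neg i by blast
        have "w i = p * (a i + x ^ e * a') + x ^ Suc e * b'" using ab[OF i] h by (simp add: algebra_simps)
        moreover have "a i + x ^ e * a' \<in> S" using ab[OF i] h by (intro S_rules) auto
        ultimately show ?thesis using h by blast
      qed
      then show False using e(2) by (simp add: W_def)
    qed
    then obtain j where j: "j \<in> V" "\<And>a' b'. a' \<in> S \<Longrightarrow> b' \<in> S \<Longrightarrow> b j \<noteq> p * a' + x * b'" by blast
    have bj: "b j \<in> S" using ab j by blast
    have "\<not> sdvd S x (b j)" using j(2)[of 0] sring_0[OF R] by (auto simp: sdvd_def)
    then obtain s' where s': "yorder s' (b j)" using yorder_ex bj by blast
    \<comment> \<open>Otherwise p would divide b j modulo x. So the induction hypothesis applies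
      with b j in the role of p and the index j removed.\<close>
    have "s' < s"
    proof (rule ccontr)
      assume "\<not> s' < s"
      then have le: "s \<le> s'" by simp
      obtain u c where u: "u \<in> S" "u \<notin> nonunits S" "c \<in> S" "p = u * y ^ s + x * c" using p unfolding yorder_def by blast
      obtain u' c' where u': "u' \<in> S" "c' \<in> S" "b j = u' * y ^ s' + x * c'" using s' unfolding yorder_def by blast
      define k where "k = u' * inverse u * y ^ (s' - s)"
      have iu: "inverse u \<in> S" "u \<noteq> 0" using unit_inverse[OF u(1,2)] by auto
      have kS: "k \<in> S" unfolding k_def using iu u' by (intro S_rules)
      have "u * y ^ s * k = u' * y ^ s'" using iu sring_powsplit[OF le, of y] by (simp add: k_def)
      then have "b j = p * k + x * (c' - c * k)" using u u' by (simp add: algebra_simps)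
      moreover have "c' - c * k \<in> S" using u u' kS by (intro S_rules)
      ultimately show False using j(2) kS by blast
    qed
    have V': "finite (V - {j})" "card (V - {j}) \<ge> Suc s'" using V j \<open>s' < s\<close> by auto
    obtain c where c: "\<And>i. i \<in> V - {j} \<Longrightarrow> c i \<in> S" "\<exists>k\<in>V - {j}. c k \<notin> nonunits S" "sdvd S (b j) (\<Sum>i\<in>V - {j}. c i * b i)"
      using less.IH[OF \<open>s' < s\<close> bj s' V', of b] ab by blast
    then obtain d where d: "d \<in> S" "(\<Sum>i\<in>V - {j}. c i * b i) = b j * d" by (auto simp: sdvd_def)
    \<comment> \<open>The coefficient at j turns the congruence modulo b j into an exact relation
      among the b i, which makes the relation among the w i a multiple of p.\<close>
    define c' where "c' i = (if i = j then - d else c i)" for i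
    have c'S: "c' i \<in> S" if "i \<in> V" for i using that c d by (auto simp: c'_def sring_minus[OF R])
    have "(\<Sum>i\<in>V. c' i * b i) = c' j * b j + (\<Sum>i\<in>V - {j}. c' i * b i)" using V j by (simp add: sum.remove)
    also have "(\<Sum>i\<in>V - {j}. c' i * b i) = (\<Sum>i\<in>V - {j}. c i * b i)" by (intro sum.cong) (auto simp: c'_def)
    finally have z: "(\<Sum>i\<in>V. c' i * b i) = 0" using d by (simp add: c'_def)
    have "(\<Sum>i\<in>V. c' i * w i) = (\<Sum>i\<in>V. p * (c' i * a i) + x ^ e * (c' i * b i))"
      using ab by (intro sum.cong) (auto simp: algebra_simps)
    also have "\<dots> = p * (\<Sum>i\<in>V. c' i * a i)" using z by (simp add: sum.distrib flip: sum_distrib_left)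
    finally have "sdvd S p (\<Sum>i\<in>V. c' i * w i)" using c'S ab by (auto intro!: sdvd_self[OF R] sring_sum[OF R] sring_mult[OF R])
    moreover have "\<exists>k\<in>V. c' k \<notin> nonunits S" using c(2) by (auto simp: c'_def)
    ultimately show ?thesis using c'S by blast
  qed
qed

text \<open>One of the elements plays the role of p, and its own coefficient absorbs the multiple of
  p that is left; hence one more element than in \<open>unit_relation\<close>.\<close>

lemma unit_relation_zero:
  assumes "finite V" "k \<in> V" "yorder s (w k)" "card V \<ge> s + 2" "\<And>i. i \<in> V \<Longrightarrow> w i \<in> S"
  shows "\<exists>c. (\<forall>i\<in>V. c i \<in> S) \<and> (\<exists>j\<in>V. c j \<notin> nonunits S) \<and> (\<Sum>i\<in>V. c i * w i) = 0"
proof -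
  have "card (V - {k}) \<ge> Suc s" using assms by auto
  then obtain c where c: "\<And>i. i \<in> V - {k} \<Longrightarrow> c i \<in> S" "\<exists>j\<in>V - {k}. c j \<notin> nonunits S" "sdvd S (w k) (\<Sum>i\<in>V - {k}. c i * w i)"
    using unit_relation[of "w k" s "V - {k}" w] assms by auto
  then obtain d where d: "d \<in> S" "(\<Sum>i\<in>V - {k}. c i * w i) = w k * d" by (auto simp: sdvd_def)
  define c' where "c' i = (if i = k then - d else c i)" for i
  have "(\<Sum>i\<in>V. c' i * w i) = c' k * w k + (\<Sum>i\<in>V - {k}. c' i * w i)" using assms by (simp add: sum.remove)
  also have "(\<Sum>i\<in>V - {k}. c' i * w i) = (\<Sum>i\<in>V - {k}. c i * w i)" by (intro sum.cong) (auto simp: c'_def)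
  finally have "(\<Sum>i\<in>V. c' i * w i) = 0" using d by (simp add: c'_def)
  moreover have "\<exists>j\<in>V. c' j \<notin> nonunits S" using c(2) by (auto simp: c'_def)
  moreover have "c' i \<in> S" if "i \<in> V" for i using that c d by (auto simp: c'_def sring_minus[OF R])
  ultimately show ?thesis by blast
qed

end

text \<open>Since z is in p', the constant term of q is in p', hence in p by assumption; since z is
  not in p, it can be cancelled from the rest, and the argument repeats.\<close>

lemma coeffs_in_prime:
  assumes T: "sring T" and p: "sprime T p" "sprime T p'" "p \<subseteq> p'" and z: "z \<in> p'" "z \<notin> p"
  shows "q \<in> polys_over T \<Longrightarrow> (\<And>i. poly.coeff q i \<in> p' \<Longrightarrow> poly.coeff q i \<in> p) \<Longrightarrow> poly q z \<in> p \<Longrightarrow> q \<in> polys_over p"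
proof (induction q)
  case 0
  then show ?case using polys_over_0 smod_0[OF sprime_smod[OF p(1)]] by blast
next
  case (pCons a q)
  have zT: "z \<in> T" using z sprime_sub[OF p(2)] by auto
  have m': "smod T p'" "smod T p" using p sprime_smod by auto
  have qT: "q \<in> polys_over T" "a \<in> T"
    using polys_overD[OF pCons.prems(1), of "Suc _"] polys_overD[OF pCons.prems(1), of 0] by (auto simp: polys_over_def)
  have qz: "poly q z \<in> T" using polys_over_poly[OF smod_self[OF T] qT(1) T zT] .
  have h: "a + z * poly q z \<in> p" using pCons.prems by simp
  then have "(a + z * poly q z) - z * poly q z \<in> p'" using p(3) smod_mult2[OF m'(1) qz z(1)] by (intro smod_diff[OF T m'(1)]) auto
  then have "a \<in> p" using pCons.prems(2)[of 0] by simp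
  then have "z * poly q z \<in> p" using smod_diff[OF T m'(2) h, of a] by simp
  then have "poly q z \<in> p" using sprime_prime[OF p(1) zT qz] z by auto
  moreover have "poly.coeff q i \<in> p" if "poly.coeff q i \<in> p'" for i using pCons.prems(2)[of "Suc i"] that by simp
  ultimately have "q \<in> polys_over p" using pCons.IH qT by blast
  then show ?case using \<open>a \<in> p\<close> polys_over_pCons by blast
qed

definition quot_full :: "'f::field set \<Rightarrow> bool" where
  "quot_full S \<longleftrightarrow> (\<forall>z. \<exists>a\<in>S. \<exists>b\<in>S. b \<noteq> 0 \<and> z = a / b)"

lemma quot_fullE:
  assumes "quot_full S" obtains a b where "a \<in> S" "b \<in> S" "b \<noteq> 0" "z = a / b"
  using assms unfolding quot_full_def by blast

lemma quot_full_mono: "quot_full S \<Longrightarrow> S \<subseteq> T \<Longrightarrow> quot_full T"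
  unfolding quot_full_def by blast

lemma quot_full_ideal:
  assumes "quot_full S" "S \<subseteq> T" "smod S I" "I \<noteq> {0}"
  shows "\<exists>a\<in>I \<inter> S. a \<noteq> 0"
proof -
  obtain z where z: "z \<in> I" "z \<noteq> 0" using assms smod_0 by blast
  obtain a b where "a \<in> S" "b \<in> S" "b \<noteq> 0" "z = a / b" using assms(1) by (rule quot_fullE)
  then have "b * z = a" "a \<noteq> 0" using z(2) by auto
  then show ?thesis using smod_mult[OF assms(3) \<open>b \<in> S\<close> z(1)] \<open>a \<in> S\<close> by auto
qed

locale regular2_frac = regular2 +
  assumes quot: "quot_full S"
begin

lemma regular2_frac_swap: "regular2_frac S y x"
  using regular2_swap quot by (simp add: regular2_frac_def regular2_frac_axioms_def)

lemma fraction: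
  "\<exists>c\<in>S. \<exists>d\<in>S. d \<noteq> 0 \<and> z = c / d \<and> (\<forall>r\<in>S. sdvd S d (r * c) \<longrightarrow> sdvd S d r)"
proof -
  obtain a b where "a \<in> S" "b \<in> S" "b \<noteq> 0" "z = a / b" using quot by (rule quot_fullE)
  then show ?thesis using lowest_terms by metis
qed

lemma fraction_no_common:
  assumes cd: "c \<in> S" "d \<in> S" "d \<noteq> 0" "\<forall>r\<in>S. sdvd S d (r * c) \<longrightarrow> sdvd S d r" and f: "f \<in> nonunits S"
  shows "\<not> (sdvd S f c \<and> sdvd S f d)"
proof
  assume "sdvd S f c \<and> sdvd S f d"
  then obtain c' d' where h: "c' \<in> S" "c = f * c'" "d' \<in> S" "d = f * d'" by (auto simp: sdvd_def)
  have "d' * c = d * c'" using h by simp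
  then have "sdvd S d (d' * c)" using h by (auto simp: sdvd_def)
  then have "sdvd S d d'" using cd h by blast
  then obtain s where s: "s \<in> S" "d' = d * s" by (auto simp: sdvd_def)
  then have "d * 1 = d * (f * s)" using h(4) by (simp add: mult.left_commute)
  then have "f * s = 1" using cd by (metis mult_cancel_left)
  then show False using nonunits_mult2[OF R s(1) f] nonunits_1[OF R] by simp
qed

context
  fixes T assumes T: "sring T" and ST: "S \<subseteq> T"
begin

lemma contract_nonzero: "sprime T p \<Longrightarrow> p \<noteq> {0} \<Longrightarrow> p \<inter> S \<noteq> {0}"
  using quot_full_ideal[OF quot ST, of p] smod_subring[OF sprime_smod ST] by blast

lemma contract_sprime: "sprime T p \<Longrightarrow> sprime S (p \<inter> S)"
  using sprime_contract[OF R ST] .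

lemma contract_sub: "sprime T p \<Longrightarrow> p \<inter> S \<subseteq> nonunits S"
  using contract_sprime sideal_nonunits[OF R sprime_sideal sprime_1] by blast

text \<open>A nonzero prime of an overring that does not lie over the maximal ideal is the center of a
  discrete valuation ring, so it has height one.\<close>

lemma second_prime_over_max:
  assumes p1: "sprime T p1" "p1 \<noteq> {0}" and p2: "sprime T p2" "p1 \<subset> p2"
  shows "nonunits S \<subseteq> p2"
proof (rule ccontr)
  assume neg: "\<not> nonunits S \<subseteq> p2"
  have q1: "sprime S (p1 \<inter> S)" "p1 \<inter> S \<noteq> {0}" "p1 \<inter> S \<noteq> nonunits S"
    using contract_sprime[OF p1(1)] contract_nonzero[OF p1] neg p2(2) by auto
  have q2: "sprime S (p2 \<inter> S)" "p2 \<inter> S \<noteq> {0}" "p2 \<inter> S \<noteq> nonunits S"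
    using contract_sprime[OF p2(1)] contract_nonzero[OF p2(1)] neg p2(2) p1(2) smod_0[OF sprime_smod[OF p1(1)]] by auto
  obtain a where a: "sprime_elt S a" "p1 \<inter> S = genid S {a}" using prime_principal[OF q1] by blast
  obtain b where b: "sprime_elt S b" "p2 \<inter> S = genid S {b}" using prime_principal[OF q2] by blast
  have bS: "b \<in> S" "b \<in> nonunits S" "a \<in> S" "a \<noteq> 0" using a b nonunits_sub by (auto simp: sprime_elt_def)
  have "a \<in> p2 \<inter> S" using a(2) genid_in[of a "{a}" S] p2 by auto
  then obtain c where c: "c \<in> S" "a = b * c" using b(2) genid_sdvd[OF R] by (auto simp: sdvd_def)
  have "sdvd S a (b * c)" using c sdvd_self[OF R sring_1[OF R], of a] by simp
  then have "sdvd S a b \<or> sdvd S a c" using a bS c by (auto simp: sprime_elt_def)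
  moreover have "\<not> sdvd S a c"
  proof
    assume "sdvd S a c"
    then obtain d where "d \<in> S" "c = a * d" by (auto simp: sdvd_def)
    then have "a * 1 = a * (b * d)" using c by (simp add: mult.left_commute)
    then have "b * d = 1" using bS by (metis mult_cancel_left)
    then show False using nonunits_mult2[OF R \<open>d \<in> S\<close> bS(2)] nonunits_1[OF R] by simp
  qed
  ultimately have "b \<in> p1 \<inter> S" using a genid_sdvd[OF R] by blast
  \<comment> \<open>Both primes contract to (b). For z in p2 but not in p1, written in lowest terms,
    the numerator is then in p1 and the denominator outside p2, which is absurd.\<close>
  then have sub: "p2 \<inter> S \<subseteq> p1" unfolding b(2) using genid_least[OF smod_subring[OF sprime_smod[OF p1(1)] ST], of "{b}"] by auto
  obtain z where z: "z \<in> p2" "z \<notin> p1" using p2 by blast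
  obtain f g where fg: "f \<in> S" "g \<in> S" "g \<noteq> 0" "z = f / g" "\<forall>r\<in>S. sdvd S g (r * f) \<longrightarrow> sdvd S g r" using fraction by blast
  have f: "f = z * g" using fg by simp
  have gT: "g \<in> T" "z \<in> T" using fg ST z sprime_sub[OF p2(1)] by auto
  have "z * g \<in> p2" using smod_mult2[OF sprime_smod[OF p2(1)] gT(1) z(1)] .
  then have "f \<in> p2 \<inter> S" using fg(1) f by blast
  moreover have "g \<notin> p2"
    using fraction_no_common[OF fg(1,2,3,5) bS(2)] calculation fg b(2) genid_sdvd[OF R] by blast
  ultimately have "z * g \<in> p1" "g \<notin> p1" using sub f p2 by auto
  then show False using sprime_prime[OF p1(1) gT(2,1)] z by auto
qed

lemma coeffs_over_max:
  assumes p: "sprime T p" "sprime T p'" "p \<subseteq> p'" "nonunits S \<subseteq> p" and z: "z \<in> p'" "z \<notin> p"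
    and q: "q \<in> polys_over S" "poly q z \<in> p"
  shows "q \<in> polys_over (nonunits S)"
proof -
  have "poly.coeff q i \<in> p" if "poly.coeff q i \<in> p'" for i
    using that contract_sub[OF p(2)] polys_overD[OF q(1), of i] p(4) by blast
  then have "q \<in> polys_over p" using coeffs_in_prime[OF T p(1,2,3) z _ _ q(2)] polys_over_mono[OF ST] q(1) by blast
  then show ?thesis using contract_sub[OF p(1)] q(1) by (auto simp: polys_over_def)
qed

lemma fraction_not_x:
  "\<exists>f\<in>S. \<exists>g\<in>S. g \<noteq> 0 \<and> z = f / g \<and> (\<exists>h s. h \<in> {f, g} \<and> yorder s h)"
proof -
  obtain f g where fg: "f \<in> S" "g \<in> S" "g \<noteq> 0" "z = f / g" "\<forall>r\<in>S. sdvd S g (r * f) \<longrightarrow> sdvd S g r" using fraction by blast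
  have "\<not> sdvd S x f \<or> \<not> sdvd S x g" using fraction_no_common[OF fg(1,2,3,5) x_nonunit] by blast
  then have "\<exists>h s. h \<in> {f, g} \<and> yorder s h" using yorder_ex fg by blast
  then show ?thesis using fg by blast
qed

text \<open>Two elements of an overring are algebraically dependent over the residue field modulo
  any prime over the maximal ideal: the products of powers of their numerators and denominators
  are too many to be minimal generators.\<close>

lemma no_chain_over_max:
  assumes p1: "sprime T p1" "nonunits S \<subseteq> p1" and p2: "sprime T p2" "p1 \<subset> p2" and p3: "sprime T p3" "p2 \<subset> p3"
  shows False
proof -
  obtain z1 where z1: "z1 \<in> p2" "z1 \<notin> p1" using p2 by blast
  obtain z2 where z2: "z2 \<in> p3" "z2 \<notin> p2" using p3 by blast
  have zT: "z1 \<in> T" "z2 \<in> T" using z1 z2 sprime_sub[OF p2(1)] sprime_sub[OF p3(1)] by auto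
  obtain f1 g1 h1 s1 where 1: "f1 \<in> S" "g1 \<in> S" "g1 \<noteq> 0" "z1 = f1 / g1" "h1 \<in> {f1, g1}" "yorder s1 h1" using fraction_not_x by blast
  obtain f2 g2 h2 s2 where 2: "f2 \<in> S" "g2 \<in> S" "g2 \<noteq> 0" "z2 = f2 / g2" "h2 \<in> {f2, g2}" "yorder s2 h2" using fraction_not_x by blast
  \<comment> \<open>With this N the (N + 1) ^ 2 monomials exceed N * (s1 + s2), the order of h1 ^ N
    * h2 ^ N, by at least 2.\<close>
  define N where "N = s1 + s2 + 1"
  define w where "w = (\<lambda>(i, j). (f1 ^ i * g1 ^ (N - i)) * (f2 ^ j * g2 ^ (N - j)))"
  define V where "V = {..N} \<times> {..N}"
  have V: "finite V" "card V = (N + 1) * (N + 1)" by (auto simp: V_def)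
  \<comment> \<open>The index of the monomial h1 ^ N * h2 ^ N, the one whose order is known.\<close>
  define k where "k = (if h1 = g1 then 0 else N, if h2 = g2 then 0 else N)"
  have k: "k \<in> V" "w k = h1 ^ N * h2 ^ N" using 1 2 by (auto simp: k_def V_def w_def)
  have "yorder (N * s1 + N * s2) (w k)" unfolding k(2) using 1 2 by (intro yorder_mult yorder_pow) auto
  moreover have "N * s1 + N * s2 + 2 \<le> card V" unfolding V by (simp add: N_def algebra_simps)
  moreover have "w i \<in> S" if "i \<in> V" for i using 1 2 by (auto simp: w_def split: prod.split intro!: S_rules)
  ultimately obtain c where c: "\<And>i. i \<in> V \<Longrightarrow> c i \<in> S" "\<exists>j\<in>V. c j \<notin> nonunits S" "(\<Sum>i\<in>V. c i * w i) = 0"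
    using unit_relation_zero[OF V(1) k(1)] by blast
  define q where "q i = (\<Sum>j\<le>N. Polynomial.monom (c (i, j)) j)" for i
  have qc: "poly.coeff (q i) j = (if j \<le> N then c (i, j) else 0)" for i j by (simp add: q_def Polynomial.coeff_sum)
  have qS: "q i \<in> polys_over S" if "i \<le> N" for i using that c(1) sring_0[OF R] by (auto simp: polys_over_def qc V_def)
  \<comment> \<open>The relation is read as a polynomial in z1 whose coefficients are polynomials in
    z2. The step from p1 to p2 then treats z1, and the step from p2 to p3 treats z2.\<close>
  define Q where "Q = (\<Sum>i\<le>N. Polynomial.monom (poly (q i) z2) i)"
  have Qc: "poly.coeff Q i = (if i \<le> N then poly (q i) z2 else 0)" for i by (simp add: Q_def Polynomial.coeff_sum)
  have qT: "poly (q i) z2 \<in> T" if "i \<le> N" for i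
    using polys_over_poly[OF smod_self[OF T] _ T zT(2)] polys_over_mono[OF ST] qS[OF that] by blast
  have "c (i, j) * w (i, j) = g1 ^ N * g2 ^ N * (c (i, j) * z1 ^ i * z2 ^ j)" if "(i, j) \<in> V" for i j
  proof -
    have "g1 ^ N = g1 ^ i * g1 ^ (N - i)" "g2 ^ N = g2 ^ j * g2 ^ (N - j)" using that by (auto simp: V_def simp flip: power_add)
    then show ?thesis using 1 2 by (simp add: w_def power_divide)
  qed
  then have "0 = (\<Sum>(i,j)\<in>V. g1 ^ N * g2 ^ N * (c (i, j) * z1 ^ i * z2 ^ j))"
    unfolding c(3)[symmetric] by (intro sum.cong) auto
  also have "\<dots> = g1 ^ N * g2 ^ N * (\<Sum>(i,j)\<in>V. c (i, j) * z1 ^ i * z2 ^ j)"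
    by (simp add: sum_distrib_left split_def)
  also have "(\<Sum>(i,j)\<in>V. c (i, j) * z1 ^ i * z2 ^ j) = (\<Sum>i\<le>N. \<Sum>j\<le>N. c (i, j) * z1 ^ i * z2 ^ j)"
    unfolding V_def by (rule sum.cartesian_product[symmetric])
  also have "\<dots> = poly Q z1"
    by (simp add: Q_def q_def poly_sum poly_monom sum_distrib_right sum_distrib_left mult.commute mult.left_commute)
  finally have "poly Q z1 = 0" using 1 2 by simp
  then have Qz: "poly Q z1 \<in> p1" using smod_0[OF sprime_smod[OF p1(1)]] by simp
  have p23: "nonunits S \<subseteq> p2" using p1 p2 by auto
  have inner: "poly (q i) z2 \<in> p2 \<Longrightarrow> i \<le> N \<Longrightarrow> q i \<in> polys_over (nonunits S)" for i
    using coeffs_over_max[OF p2(1) p3(1) _ p23 z2 qS] p3(2) by blast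
  have Q_in: "poly.coeff Q i \<in> p1" if "poly.coeff Q i \<in> p2" for i
  proof (cases "i \<le> N")
    case True
    then have "q i \<in> polys_over p1" using inner[of i] that polys_over_mono[OF p1(2)] by (auto simp: Qc)
    then show ?thesis using polys_over_poly[OF sprime_smod[OF p1(1)] _ T zT(2)] True by (auto simp: Qc)
  qed (use smod_0[OF sprime_smod[OF p1(1)]] in \<open>auto simp: Qc\<close>)
  have "Q \<in> polys_over T" using qT sring_0[OF T] by (auto simp: polys_over_def Qc)
  then have "Q \<in> polys_over p1" using coeffs_in_prime[OF T p1(1) p2(1) _ z1 _ Q_in Qz] p2(2) by blast
  then have "poly (q i) z2 \<in> p2" if "i \<le> N" for i using that p2(2) polys_overD[of Q p1 i] by (auto simp: Qc)
  then have "q i \<in> polys_over (nonunits S)" if "i \<le> N" for i using that inner by blast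
  then have "c (i, j) \<in> nonunits S" if "(i, j) \<in> V" for i j using that polys_overD[of "q i" _ j] by (auto simp: qc V_def)
  then show False using c(2) by auto
qed

text \<open>Since p lies in p1, a relation modulo p suffices, and the s + 1 forms of degree s in the
  numerator and denominator of a single z have one. This z comes from the upper step of the chain,
  where both primes lie over the maximal ideal.\<close>

lemma no_chain_over_prime_x:
  assumes p1: "sprime T p1" "p1 \<inter> S = genid S {p}" "p \<in> nonunits S" "\<not> sdvd S x p"
    and p2: "sprime T p2" "p1 \<subset> p2" "nonunits S \<subseteq> p2" and p3: "sprime T p3" "p2 \<subset> p3"
  shows False
proof -
  obtain z where z: "z \<in> p3" "z \<notin> p2" using p3 by blast
  have zT: "z \<in> T" using z sprime_sub[OF p3(1)] by auto
  have p1m: "smod T p1" using sprime_smod[OF p1(1)] .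
  have pS: "p \<in> S" "p \<in> p1" using p1 nonunits_sub[of S] genid_in[of p "{p}" S] by auto
  obtain f g where fg: "f \<in> S" "g \<in> S" "g \<noteq> 0" "z = f / g" "\<forall>r\<in>S. sdvd S g (r * f) \<longrightarrow> sdvd S g r" using fraction by blast
  have "g \<notin> p1"
  proof
    assume g: "g \<in> p1"
    have "f = z * g" using fg by simp
    moreover have "z * g \<in> p1" using smod_mult[OF p1m zT g] .
    ultimately have "f \<in> p1 \<inter> S" using fg(1) by blast
    then show False using g fg p1 fraction_no_common[OF fg(1,2,3,5) p1(3)] genid_sdvd[OF R] by blast
  qed
  obtain s where s: "yorder s p" using yorder_ex p1 pS by blast
  define w where "w i = f ^ i * g ^ (s - i)" for i
  have "w i \<in> S" for i unfolding w_def using fg by (intro S_rules)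
  then obtain c where c: "\<And>i. i \<le> s \<Longrightarrow> c i \<in> S" "\<exists>j\<le>s. c j \<notin> nonunits S" "sdvd S p (\<Sum>i\<le>s. c i * w i)"
    using unit_relation[OF pS(1) s, of "{..s}" w] by auto
  define q where "q = (\<Sum>j\<le>s. Polynomial.monom (c j) j)"
  have qc: "poly.coeff q j = (if j \<le> s then c j else 0)" for j by (simp add: q_def Polynomial.coeff_sum)
  have qS: "q \<in> polys_over S" using c(1) sring_0[OF R] by (auto simp: polys_over_def qc)
  have "c i * w i = g ^ s * (c i * z ^ i)" if "i \<le> s" for i
    using fg sring_powsplit[OF that, of g] by (simp add: w_def power_divide)
  then have "(\<Sum>i\<le>s. c i * w i) = g ^ s * (\<Sum>i\<le>s. c i * z ^ i)" unfolding sum_distrib_left by (intro sum.cong) auto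
  also have "(\<Sum>i\<le>s. c i * z ^ i) = poly q z" by (simp add: q_def poly_sum poly_monom)
  finally obtain d where d: "d \<in> S" "g ^ s * poly q z = p * d" using c(3) by (auto simp: sdvd_def)
  have "g ^ s * poly q z \<in> p1" unfolding d(2) using smod_mult2[OF p1m _ pS(2)] d ST by auto
  moreover have "g ^ s \<in> T" "g ^ s \<notin> p1" using fg ST sring_pow[OF T] sprime_pow[OF T p1(1)] \<open>g \<notin> p1\<close> by blast+
  moreover have "poly q z \<in> T" using polys_over_poly[OF smod_self[OF T] _ T zT] polys_over_mono[OF ST] qS by blast
  ultimately have "poly q z \<in> p1" using sprime_prime[OF p1(1)] by blast
  then have "q \<in> polys_over (nonunits S)" using coeffs_over_max[OF p2(1) p3(1) _ p2(3) z qS] p2(2) p3(2) by blast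
  then have "c j \<in> nonunits S" if "j \<le> s" for j using that polys_overD[of q _ j] by (auto simp: qc)
  then show False using c(2) by blast
qed

end

text \<open>Either p1 contains the maximal ideal of S, or p2 does and p1 lies over a prime element
  a. Such an a is not divisible by both parameters, so after a possible exchange it has an order
  modulo the first one.\<close>

lemma overring_dim_le_2:
  assumes T: "sring T" "S \<subseteq> T" and p1: "sprime T p1" "p1 \<noteq> {0}" and p2: "sprime T p2" "p1 \<subset> p2" and p3: "sprime T p3" "p2 \<subset> p3"
  shows False
proof (cases "nonunits S \<subseteq> p1")
  case True
  then show ?thesis using no_chain_over_max[OF T p1(1) _ p2 p3] by blast
next
  case False
  have p2m: "nonunits S \<subseteq> p2" using second_prime_over_max[OF T p1 p2] .
  have q1: "sprime S (p1 \<inter> S)" "p1 \<inter> S \<noteq> {0}" "p1 \<inter> S \<noteq> nonunits S"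
    using contract_sprime[OF T p1(1)] contract_nonzero[OF T p1] False by auto
  obtain a where a: "sprime_elt S a" "p1 \<inter> S = genid S {a}" using prime_principal[OF q1] by blast
  then have an: "a \<in> nonunits S" by (auto simp: sprime_elt_def)
  have "\<not> (sdvd S x a \<and> sdvd S y a)"
  proof
    assume h: "sdvd S x a \<and> sdvd S y a"
    then obtain c where c: "c \<in> S" "a = y * c" by (auto simp: sdvd_def)
    then have "sdvd S x c" using h y_coprime[of c] by (simp add: mult.commute)
    then obtain d where d: "d \<in> S" "c = x * d" by (auto simp: sdvd_def)
    have "a \<noteq> 0" using a by (auto simp: sprime_elt_def)
    have xd: "x * d \<in> S" using d c by simp
    have "sdvd S a (y * (x * d))" using c d sdvd_self[OF R sring_1[OF R], of a] by simp
    then have "sdvd S a y \<or> sdvd S a (x * d)" using a(1) y_in xd by (auto simp: sprime_elt_def)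
    moreover have "\<not> sdvd S a (x * d)"
    proof
      assume "sdvd S a (x * d)"
      then obtain e where e: "e \<in> S" "x * d = a * e" by (auto simp: sdvd_def)
      then have "a * 1 = a * (y * e)" using c d by (metis mult.left_commute mult_1_right)
      then have "y * e = 1" using \<open>a \<noteq> 0\<close> by (metis mult_cancel_left)
      then show False using nonunits_mult2[OF R e(1) y_nonunit] nonunits_1[OF R] by simp
    qed
    ultimately have "sdvd S x y" using h sdvd_trans[OF R] by blast
    then show False using y_pow_not_dvd[of 1] by simp
  qed
  then show ?thesis using no_chain_over_prime_x[OF T p1(1) a(2) an _ p2 p2m p3]
      regular2_frac.no_chain_over_prime_x[OF regular2_frac_swap T p1(1) a(2) an _ p2 p2m p3] by blast
qed

end

section \<open>Infinitely many primes, and rings dominated by a regular one\<close>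

context regular2
begin

lemma regular2_shift: "n \<ge> 1 \<Longrightarrow> regular2 S (x + y ^ n) y"
proof unfold_locales
  assume n: "n \<ge> 1"
  then obtain m where m: "n = Suc m" by (cases n) auto
  have ym: "y ^ n = y ^ m * y" by (simp add: m mult.commute)
  show "nonunits S = genid S {x + y ^ n, y}"
  proof
    show "genid S {x + y ^ n, y} \<subseteq> nonunits S"
      using x_nonunit y_nonunit smod_add[OF max_smod x_nonunit] smod_mult[OF max_smod sring_pow[OF R y_in] y_nonunit, of m] ym
      by (intro genid_least max_smod) auto
    have g: "x + y ^ n \<in> genid S {x + y ^ n, y}" "y \<in> genid S {x + y ^ n, y}" by (auto intro: genid_in)
    have "(x + y ^ n) - y ^ m * y \<in> genid S {x + y ^ n, y}"
      using g by (intro smod_diff[OF R genid_smod] smod_mult[OF genid_smod] S_rules)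
    then have "x \<in> genid S {x + y ^ n, y}" using ym by simp
    then show "nonunits S \<subseteq> genid S {x + y ^ n, y}" unfolding max using g by (intro genid_least genid_smod) auto
  qed
qed (use loc noeth ex_prime in auto)

text \<open>The elements x + y ^ n are prime by \<open>regular2_shift\<close>, and none divides
  another, because a difference of two is a unit times a power of y. A nonzero element cannot be
  divisible by almost all of them.\<close>

lemma prime_not_dividing:
  assumes a: "a \<in> S" "a \<noteq> 0"
  shows "\<exists>f. sprime_elt S f \<and> \<not> sdvd S f a"
proof -
  define z where "z n = x + y ^ n" for n
  have z: "sprime_elt S (z n)" "\<not> sdvd S (z n) (y ^ k)" if "n \<ge> 1" for n k
    using regular2.x_prime[OF regular2_shift[OF that]] regular2.y_pow_not_dvd[OF regular2_shift[OF that]] by (auto simp: z_def)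
  have zS: "z n \<in> nonunits S" "z n \<in> S" "z n \<noteq> 0" if "n \<ge> 1" for n using z(1)[OF that] nonunits_sub[of S] by (auto simp: sprime_elt_def)
  have zz: "\<not> sdvd S (z n) (z m)" if "1 \<le> m" "m < n" for m n
  proof
    assume "sdvd S (z n) (z m)"
    moreover have "sdvd S (z n) (z n)" using sdvd_self[OF R sring_1[OF R], of "z n"] by simp
    ultimately have d0: "sdvd S (z n) (z m - z n)" using sdvd_diff[OF R] by blast
    have eq: "z m - z n = y ^ m * (1 - y ^ (n - m))" using sring_powsplit[of m n y] that by (simp add: z_def algebra_simps)
    have "y ^ (n - m) \<in> nonunits S"
      using smod_mult[OF max_smod sring_pow[OF R y_in] y_nonunit, of "n - m - 1"] power_minus_mult[of "n - m" y] that by simp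
    then have u: "1 - y ^ (n - m) \<notin> nonunits S" "1 - y ^ (n - m) \<in> S" using one_minus_unit[OF loc] by (auto intro!: S_rules)
    have d: "sdvd S (z n) (y ^ m * (1 - y ^ (n - m)) * inverse (1 - y ^ (n - m)))"
      using sdvd_mult[OF R d0[unfolded eq]] unit_inverse[OF u(2,1)] by blast
    have "(1 - y ^ (n - m)) * inverse (1 - y ^ (n - m)) = 1"
      using unit_inverse[OF u(2,1)] by (intro right_inverse) blast
    then have "y ^ m * (1 - y ^ (n - m)) * inverse (1 - y ^ (n - m)) = y ^ m" by (metis mult.assoc mult_1_right)
    with d have "sdvd S (z n) (y ^ m)" by (simp only:)
    then show False using z that by auto
  qed
  \<comment> \<open>Indices beyond an arbitrary bound N are claimed, so that the prime just divided
    out can be avoided for the cofactor.\<close>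
  have "\<forall>N\<ge>1. \<exists>n\<ge>N. \<not> sdvd S (z n) a"
    using R noeth a
  proof (induction a rule: snoeth_divisor_induct)
    case (step a)
    show ?case
    proof (intro allI impI, rule ccontr)
      fix N :: nat assume N: "1 \<le> N" and "\<not> (\<exists>n\<ge>N. \<not> sdvd S (z n) a)"
      then have all: "\<And>n. n \<ge> N \<Longrightarrow> sdvd S (z n) a" by blast
      then obtain v where v: "v \<in> S" "a = z N * v" by (auto simp: sdvd_def)
      then obtain n where n: "n \<ge> Suc N" "\<not> sdvd S (z n) v" using step.IH[OF v(2) zS(1)[OF N] v(1)] by auto
      have "sdvd S (z n) (z N * v)" using all n v by simp
      then have "sdvd S (z n) (z N)" using n z(1)[of n] zS(2)[OF N] v by (auto simp: sprime_elt_def)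
      then show False using zz N n by auto
    qed
  qed
  then obtain n where "n \<ge> 1" "\<not> sdvd S (z n) a" by auto
  then show ?thesis using z(1) by blast
qed

text \<open>A prime element of S that does not divide a chosen nonunit a of T generates an ideal
  whose contraction misses a and is nonzero, since T has the full quotient field. This is why points
  dominated by regular rings of dimension two are closed.\<close>

lemma dominated_ex_prime:
  assumes T: "sdom S T" "quot_full T"
  shows "\<exists>P. sprime T P \<and> P \<noteq> {0} \<and> P \<noteq> nonunits T"
proof -
  have RT: "sring T" "slocal T" and TS: "T \<subseteq> S" using T slocal_sring by (auto simp: sdom_def)
  have "\<exists>a\<in>nonunits T. a \<noteq> 0"
  proof -
    obtain b c where bc: "b \<in> T" "c \<in> T" "c \<noteq> 0" "x = b / c" using T(2) by (rule quot_fullE)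
    show ?thesis
    proof (cases "c \<in> nonunits T")
      case False
      then have "x \<in> T" using bc div_unit[OF RT(2)] by auto
      then show ?thesis using sdom_nonunits[OF T(1)] x_nonunit x_neq_0 by blast
    qed (use bc in auto)
  qed
  then obtain a where a: "a \<in> nonunits T" "a \<noteq> 0" by blast
  then have "a \<in> S" using nonunits_sub TS by blast
  then obtain f where f: "sprime_elt S f" "\<not> sdvd S f a" using prime_not_dividing a by blast
  have P: "sprime T (genid S {f} \<inter> T)" using sprime_contract[OF RT(1) TS sprime_genid[OF R f(1)]] .
  obtain b c where bc: "b \<in> T" "c \<in> T" "c \<noteq> 0" "f = b / c" using T(2) by (rule quot_fullE)
  have "b = f * c" using bc by simp
  moreover have "f \<noteq> 0" "c \<in> S" "b \<noteq> 0" using f(1) bc TS by (auto simp: sprime_elt_def)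
  ultimately have "sdvd S f b" "b \<noteq> 0" unfolding sdvd_def by blast+
  then have "b \<in> genid S {f} \<inter> T" "b \<noteq> 0" using bc genid_sdvd[OF R] by auto
  moreover have "a \<notin> genid S {f} \<inter> T" using f genid_sdvd[OF R] by auto
  ultimately show ?thesis using P a by blast
qed

end

section \<open>Models and quadratic transforms\<close>

text \<open>For local $T$: the extension $JT$ is principal.\<close>

definition spr :: "'f::field set \<Rightarrow> 'f set \<Rightarrow> bool" where
  "spr J T \<longleftrightarrow> (\<exists>a\<in>J. a \<noteq> 0 \<and> (\<forall>b\<in>J. b / a \<in> T))"

definition ringgen :: "'f::field set \<Rightarrow> 'f set" where
  "ringgen H = \<Inter>{S. sring S \<and> H \<subseteq> S}"

text \<open>The local rings of $\mathrm{Proj}\, D[Jt]$, without charts: the local overrings in which $J$ becomes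
  principal, minimal with respect to domination.\<close>

definition blowup :: "'f::field set \<Rightarrow> 'f set \<Rightarrow> 'f set set" where
  "blowup D J = {T. slocal T \<and> D \<subseteq> T \<and> spr J T \<and>
     (\<forall>T'. slocal T' \<longrightarrow> D \<subseteq> T' \<longrightarrow> spr J T' \<longrightarrow> sdom T T' \<longrightarrow> T' = T)}"

definition chart :: "'f::field set \<Rightarrow> 'f set \<Rightarrow> 'f \<Rightarrow> 'f set" where
  "chart D J a = ringgen (D \<union> {b / a | b. b \<in> J})"

text \<open>Height two of n is expressed by a nonzero prime strictly inside it;
  \<open>overring_sheight_2\<close> gives the equivalence.\<close>

definition quadt :: "'f::field set \<Rightarrow> 'f set \<Rightarrow> bool" where
  "quadt S T \<longleftrightarrow> (\<exists>a\<in>nonunits S. a \<notin> genid S {b * c | b c. b \<in> nonunits S \<and> c \<in> nonunits S} \<and>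
     (\<exists>n. smaximal (chart S (nonunits S) a) n \<and> (\<exists>P. sprime (chart S (nonunits S) a) P \<and> P \<noteq> {0} \<and> P \<subset> n) \<and>
       T = locz (chart S (nonunits S) a) n))"

lemma ringgen_sring: "sring (ringgen H)"
  by (auto simp: ringgen_def sring_def)

lemma ringgen_incl: "H \<subseteq> ringgen H"
  by (auto simp: ringgen_def)

lemma ringgen_least: "sring S \<Longrightarrow> H \<subseteq> S \<Longrightarrow> ringgen H \<subseteq> S"
  by (auto simp: ringgen_def)

lemma chart_ring: "sring (chart D J a)"
  and chart_sub: "D \<subseteq> chart D J a"
  and chart_frac: "b \<in> J \<Longrightarrow> b / a \<in> chart D J a"
proof -
  show "sring (chart D J a)" unfolding chart_def by (rule ringgen_sring)
  have "D \<union> {b / a | b. b \<in> J} \<subseteq> chart D J a" unfolding chart_def by (rule ringgen_incl)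
  then show "D \<subseteq> chart D J a" "b \<in> J \<Longrightarrow> b / a \<in> chart D J a" by auto
qed

lemma chart_least: "sring T \<Longrightarrow> D \<subseteq> T \<Longrightarrow> (\<And>b. b \<in> J \<Longrightarrow> b / a \<in> T) \<Longrightarrow> chart D J a \<subseteq> T"
  unfolding chart_def by (rule ringgen_least) auto

lemma spr_mono: "spr J T \<Longrightarrow> T \<subseteq> T' \<Longrightarrow> spr J T'"
  unfolding spr_def by blast

text \<open>The hypotheses say that V T = c W T. Since \<open>spr\<close> asks for a generator
  inside the set itself, the point is that over a local ring a generator of a principal module can
  be found in any generating set.\<close>

lemma spr_transfer:
  assumes T: "slocal T" and c: "c \<noteq> 0" and XY: "\<And>f. f \<in> V \<Longrightarrow> f / c \<in> genid T W"
    and YX: "\<And>w. w \<in> W \<Longrightarrow> c * w \<in> genid T V" and V: "spr V T"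
  shows "spr W T"
proof -
  have R: "sring T" using T slocal_sring by auto
  obtain a where a: "a \<in> V" "a \<noteq> 0" "\<And>b. b \<in> V \<Longrightarrow> b / a \<in> T" using V by (auto simp: spr_def)
  have "smod T {w. w / a \<in> T}" by (auto simp: smod_def add_divide_distrib sring_rules[OF R] simp flip: times_divide_eq_right)
  then have "genid T V \<subseteq> {w. w / a \<in> T}" using a by (intro genid_least) auto
  then have WT: "c * w / a \<in> T" if "w \<in> W" for w using YX[OF that] by auto
  \<comment> \<open>Otherwise c W T would lie in a times the maximal ideal, and so would a
    itself.\<close>
  have "\<exists>w\<in>W. c * w / a \<notin> nonunits T"
  proof (rule ccontr)
    assume neg: "\<not> ?thesis"
    have "smod T {w. c * w / a \<in> nonunits T}"
      unfolding smod_def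
    proof (intro conjI ballI)
      fix s w assume s: "s \<in> T" "w \<in> {w. c * w / a \<in> nonunits T}"
      then have "s * (c * w / a) \<in> nonunits T" using nonunits_mult[OF R] by blast
      moreover have "s * (c * w / a) = c * (s * w) / a" by simp
      ultimately show "s * w \<in> {w. c * w / a \<in> nonunits T}" by (simp only: mem_Collect_eq)
    qed (use smod_add[OF nonunits_smod[OF T]] nonunits_0[OF R] in \<open>auto simp: add_divide_distrib distrib_left\<close>)
    then have "genid T W \<subseteq> {w. c * w / a \<in> nonunits T}" using neg by (intro genid_least) auto
    then have "c * (a / c) / a \<in> nonunits T" using XY[OF a(1)] by auto
    then show False using a c nonunits_1[OF R] by simp
  qed
  then obtain w where w: "w \<in> W" "c * w / a \<notin> nonunits T" by blast
  then have iw: "inverse (c * w / a) \<in> T" "c * w / a \<noteq> 0" using unit_inverse[OF WT[OF w(1)]] by auto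
  have "v / w \<in> T" if "v \<in> W" for v
  proof -
    have "v / w = (c * v / a) * inverse (c * w / a)" using c a iw by (simp add: field_simps)
    then show ?thesis using sring_mult[OF R WT[OF that] iw(1)] by simp
  qed
  then show ?thesis using w iw by (auto simp: spr_def)
qed

lemma spr_genid:
  assumes "slocal T" "D \<subseteq> T"
  shows "spr (genid D G) T \<longleftrightarrow> spr G T"
proof -
  have sub: "genid D G \<subseteq> genid T G" using genid_mono[OF assms(2) order_refl] .
  have "f / 1 \<in> genid T G" if "f \<in> genid D G" for f using that sub by auto
  moreover have "1 * f \<in> genid T (genid D G)" if "f \<in> G" for f using that genid_in genid_in[of f G D] by auto
  moreover have "f / 1 \<in> genid T (genid D G)" if "f \<in> G" for f using that genid_in genid_in[of f G D] by auto
  moreover have "1 * f \<in> genid T G" if "f \<in> genid D G" for f using that sub by auto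
  ultimately show ?thesis using spr_transfer[OF assms(1), of 1] by (metis one_neq_zero)
qed

lemma blowup_genid: "blowup D (genid D G) = blowup D G"
  unfolding blowup_def using spr_genid by blast

lemma blowupD:
  assumes "T \<in> blowup D J"
  shows "slocal T" "D \<subseteq> T" "spr J T"
  using assms by (auto simp: blowup_def)

lemma blowup_min: "T \<in> blowup D J \<Longrightarrow> slocal T' \<Longrightarrow> D \<subseteq> T' \<Longrightarrow> spr J T' \<Longrightarrow> sdom T T' \<Longrightarrow> T' = T"
  unfolding blowup_def by blast

text \<open>For a generator a' of J S, the quotient a / a' lies in S and is a unit of T, hence a
  unit of S by domination. So a generates J S as well.\<close>

lemma spr_dominated:
  assumes "sdom T S" "a \<in> J" "a \<noteq> 0" "\<And>b. b \<in> J \<Longrightarrow> b / a \<in> T" "spr J S" "b \<in> J"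
  shows "b / a \<in> S"
proof -
  obtain a' where a': "a' \<in> J" "a' \<noteq> 0" "\<And>b. b \<in> J \<Longrightarrow> b / a' \<in> S" using assms(5) by (auto simp: spr_def)
  have "inverse (a / a') \<in> T" using assms(4)[OF a'(1)] by simp
  then have "a / a' \<notin> nonunits T" using assms a' by (auto simp: nonunits_def)
  then have "a / a' \<notin> nonunits S" using assms(1) by (auto simp: sdom_def)
  then have "inverse (a / a') \<in> S" using unit_inverse a'(3)[OF assms(2)] by blast
  then have "(b / a') * inverse (a / a') \<in> S"
    using a'(3)[OF assms(6)] assms(1) by (intro sring_mult) (auto simp: sdom_def slocal_def)
  moreover have "(b / a') * inverse (a / a') = b / a" using a'(2) by simp
  ultimately show ?thesis by (simp only:)
qed

text \<open>The localization of the chart of a at the center of T is minimal for domination, because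
  any ring below it in which J is principal contains the whole chart by
  \<open>spr_dominated\<close>.\<close>

lemma center:
  assumes T: "slocal T" "D \<subseteq> T" and a: "a \<in> J" "a \<noteq> 0" "\<And>b. b \<in> J \<Longrightarrow> b / a \<in> T"
  defines "A \<equiv> chart D J a"
  shows "locz A (nonunits T \<inter> A) \<in> blowup D J" "sdom T (locz A (nonunits T \<inter> A))"
proof -
  let ?S = "locz A (nonunits T \<inter> A)"
  have A: "sring A" "D \<subseteq> A" unfolding A_def by (rule chart_ring, rule chart_sub)
  have AT: "A \<subseteq> T" unfolding A_def using chart_least[OF slocal_sring[OF T(1)] T(2) a(3)] .
  note S = locz_sdom[OF A(1) T(1) AT]
  show "sdom T ?S" using S by simp
  have AS: "A \<subseteq> ?S" using locz_incl[OF A(1) S(1)] .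
  then have Ja: "b \<in> J \<Longrightarrow> b / a \<in> ?S" for b using chart_frac[of b J a D] by (auto simp: A_def)
  have "spr J ?S" using Ja a by (auto simp: spr_def)
  moreover have "T' = ?S" if T': "slocal T'" "D \<subseteq> T'" "spr J T'" "sdom ?S T'" for T'
  proof
    show "T' \<subseteq> ?S" using T' sdom_sub by auto
    have "b / a \<in> T'" if "b \<in> J" for b using spr_dominated[OF T'(4) a(1,2) Ja T'(3) that] .
    then have AT': "A \<subseteq> T'" unfolding A_def using chart_least[OF slocal_sring[OF T'(1)] T'(2)] by blast
    show "?S \<subseteq> T'"
    proof (rule locz_least[OF A(1) S(1) slocal_sring[OF T'(1)] AT'])
      fix y assume y: "y \<in> A - nonunits T \<inter> A"
      then have "y \<notin> nonunits ?S" using locz_nonunits_int[OF A(1) S(1)] by auto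
      then show "y \<notin> nonunits T'" using T'(4) by (auto simp: sdom_def)
    qed
  qed
  ultimately show "?S \<in> blowup D J" using S A AS sdom_slocal[OF S(2)] by (auto simp: blowup_def)
qed

lemma ex_center:
  assumes "slocal T" "D \<subseteq> T" "spr J T"
  shows "\<exists>S\<in>blowup D J. sdom T S"
proof -
  obtain a where "a \<in> J" "a \<noteq> 0" "\<And>b. b \<in> J \<Longrightarrow> b / a \<in> T" using assms(3) unfolding spr_def by blast
  then show ?thesis using center[OF assms(1,2)] by meson
qed

text \<open>Separatedness of the model: the point dominated by T is recovered from T and any
  generator of J T.\<close>

lemma center_unique:
  assumes S: "S \<in> blowup D J" "sdom T S" and a: "a \<in> J" "a \<noteq> 0" "\<And>b. b \<in> J \<Longrightarrow> b / a \<in> T"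
  defines "A \<equiv> chart D J a"
  shows "S = locz A (nonunits T \<inter> A)"
proof -
  have Ja: "b / a \<in> S" if "b \<in> J" for b using spr_dominated[OF S(2) a blowupD(3)[OF S(1)] that] .
  have AS: "A \<subseteq> S" unfolding A_def using chart_least[OF slocal_sring[OF blowupD(1)[OF S(1)]] blowupD(2)[OF S(1)] Ja] .
  have "nonunits S \<inter> A = nonunits T \<inter> A" using sdom_nonunits[OF S(2)] AS by auto
  moreover have "locz A (nonunits S \<inter> A) = S"
    using center[OF blowupD(1,2)[OF S(1)] a(1,2) Ja] blowup_min[OF S(1)] blowupD(1,2,3) unfolding A_def by blast
  ultimately show ?thesis by simp
qed

lemma blowup_unique: "S \<in> blowup D J \<Longrightarrow> S' \<in> blowup D J \<Longrightarrow> sdom T S \<Longrightarrow> sdom T S' \<Longrightarrow> S = S'"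
proof -
  assume h: "S \<in> blowup D J" "S' \<in> blowup D J" "sdom T S" "sdom T S'"
  have "spr J T" using blowupD(3)[OF h(1)] sdom_sub[OF h(3)] by (rule spr_mono)
  then obtain a where a: "a \<in> J" "a \<noteq> 0" "\<And>b. b \<in> J \<Longrightarrow> b / a \<in> T" unfolding spr_def by blast
  show ?thesis using center_unique[OF h(1,3) a] center_unique[OF h(2,4) a] by simp
qed

lemma blowup_charts:
  "blowup D J = {locz (chart D J a) p | a p. a \<in> J \<and> a \<noteq> 0 \<and> sprime (chart D J a) p}"
proof (intro equalityI subsetI)
  fix T assume T: "T \<in> blowup D J"
  obtain a where a: "a \<in> J" "a \<noteq> 0" "\<And>b. b \<in> J \<Longrightarrow> b / a \<in> T" using blowupD(3)[OF T] unfolding spr_def by blast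
  have AT: "chart D J a \<subseteq> T" using chart_least[OF slocal_sring[OF blowupD(1)[OF T]] blowupD(2)[OF T] a(3)] .
  have "T = locz (chart D J a) (nonunits T \<inter> chart D J a)"
    using center_unique[OF T sdom_refl[OF blowupD(1)[OF T]] a] .
  then show "T \<in> {locz (chart D J a) p | a p. a \<in> J \<and> a \<noteq> 0 \<and> sprime (chart D J a) p}"
    using a locz_sdom(1)[OF chart_ring blowupD(1)[OF T] AT] by blast
next
  fix T assume "T \<in> {locz (chart D J a) p | a p. a \<in> J \<and> a \<noteq> 0 \<and> sprime (chart D J a) p}"
  then obtain a p where h: "T = locz (chart D J a) p" "a \<in> J" "a \<noteq> 0" "sprime (chart D J a) p" by blast
  have AT: "chart D J a \<subseteq> T" unfolding h(1) using locz_incl[OF chart_ring h(4)] .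
  have "nonunits T \<inter> chart D J a = p" unfolding h(1) using locz_nonunits_int[OF chart_ring h(4)] .
  moreover have "slocal T" unfolding h(1) using locz_slocal[OF chart_ring h(4)] .
  ultimately show "T \<in> blowup D J" using center(1)[of T D a J] h AT chart_sub chart_frac[of _ J a D] by (metis subset_iff)
qed

lemma smaximal_sprime:
  assumes A: "sring A" and M: "smaximal A M"
  shows "sprime A M"
  unfolding sprime_def
proof (intro conjI ballI impI)
  show id: "sideal A M" and "1 \<notin> M" using M by (auto simp: smaximal_def)
  have Mm: "smod A M" and MA: "M \<subseteq> A" using id by (auto simp: sideal_def)
  fix a b assume h: "a \<in> A" "b \<in> A" "a * b \<in> M"
  show "a \<in> M \<or> b \<in> M"
  proof (rule ccontr)
    assume n: "\<not> ?thesis"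
    have "sideal A (genid A (insert a M))" using genid_sideal[OF A] h MA by auto
    moreover have "M \<subseteq> genid A (insert a M)" "genid A (insert a M) \<noteq> M" using genid_incl[of "insert a M" A] n by auto
    ultimately have "1 \<in> genid A (insert a M)" using M unfolding smaximal_def by blast
    then obtain s m where s: "s \<in> A" "m \<in> M" "1 = s * a + m" unfolding genid_insert[OF A] genid_eq[OF id] by blast
    have "b = s * (a * b) + b * m" using arg_cong[OF s(3), of "(*) b"] by (simp add: algebra_simps)
    moreover have "s * (a * b) + b * m \<in> M" using smod_add[OF Mm smod_mult[OF Mm s(1) h(3)] smod_mult[OF Mm h(2) s(2)]] .
    ultimately show False using n by simp
  qed
qed

lemma ex_smaximal:
  assumes A: "sring A" "snoeth A" and I: "sideal A I" "1 \<notin> I"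
  shows "\<exists>M. smaximal A M \<and> I \<subseteq> M"
proof -
  define C where "C = {K. sideal A K \<and> 1 \<notin> K \<and> I \<subseteq> K}"
  have "I \<in> C" using I by (auto simp: C_def)
  then obtain M where M: "M \<in> C" "\<forall>K\<in>C. M \<subseteq> K \<longrightarrow> K = M"
    using snoeth_maximal[OF A(2), of C] unfolding C_def by blast
  then have "smaximal A M" unfolding smaximal_def C_def by blast
  then show ?thesis using M by (auto simp: C_def)
qed

context regular2
begin

text \<open>Outside the square of the maximal ideal, a has a unit coefficient at x or y and can
  replace that parameter.\<close>

lemma ex_cofactor:
  assumes a: "a \<in> nonunits S" "a \<notin> genid S {b * c | b c. b \<in> nonunits S \<and> c \<in> nonunits S}"
  shows "\<exists>b. regular2 S a b"
proof -
  let ?Q = "genid S {b * c | b c. b \<in> nonunits S \<and> c \<in> nonunits S}"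
  obtain s t where st: "s \<in> S" "t \<in> S" "a = x * s + y * t" using a max_iff by blast
  have "s \<notin> nonunits S \<or> t \<notin> nonunits S"
  proof (rule ccontr)
    assume "\<not> ?thesis"
    then have "x * s \<in> ?Q" "y * t \<in> ?Q" using x_nonunit y_nonunit by (auto intro!: genid_in)
    then show False using a st smod_add[OF genid_smod] by blast
  qed
  then show ?thesis
  proof
    assume u: "s \<notin> nonunits S"
    have iu: "inverse s \<in> S" "s \<noteq> 0" using unit_inverse[OF st(1) u] by auto
    have "nonunits S = genid S {a, y}"
    proof
      show "genid S {a, y} \<subseteq> nonunits S" using a y_nonunit by (intro genid_least max_smod) auto
      have g: "a \<in> genid S {a, y}" "y \<in> genid S {a, y}" by (auto intro: genid_in)
      have "x = inverse s * (a - t * y)" using st iu by (simp add: field_simps)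
      moreover have "inverse s * (a - t * y) \<in> genid S {a, y}"
        using g iu st by (intro smod_mult[OF genid_smod] smod_diff[OF R genid_smod])
      ultimately show "nonunits S \<subseteq> genid S {a, y}" unfolding max using g by (intro genid_least genid_smod) auto
    qed
    then have "regular2 S a y" using loc noeth ex_prime by unfold_locales
    then show ?thesis by blast
  next
    assume u: "t \<notin> nonunits S"
    have iu: "inverse t \<in> S" "t \<noteq> 0" using unit_inverse[OF st(2) u] by auto
    have "nonunits S = genid S {a, x}"
    proof
      show "genid S {a, x} \<subseteq> nonunits S" using a x_nonunit by (intro genid_least max_smod) auto
      have g: "a \<in> genid S {a, x}" "x \<in> genid S {a, x}" by (auto intro: genid_in)
      have "y = inverse t * (a - s * x)" using st iu by (simp add: field_simps)
      moreover have "inverse t * (a - s * x) \<in> genid S {a, x}"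
        using g iu st by (intro smod_mult[OF genid_smod] smod_diff[OF R genid_smod])
      ultimately show "nonunits S \<subseteq> genid S {a, x}" unfolding max using g by (intro genid_least genid_smod) auto
    qed
    then have "regular2 S a x" using loc noeth ex_prime by unfold_locales
    then show ?thesis by blast
  qed
qed

lemma chart_adjoin: "chart S (nonunits S) x = adjoin S (y / x)"
proof
  show "chart S (nonunits S) x \<subseteq> adjoin S (y / x)"
  proof (rule chart_least[OF chart_sring chart_incl])
    fix b assume "b \<in> nonunits S"
    then obtain s t where st: "s \<in> S" "t \<in> S" "b = x * s + y * t" using max_iff by blast
    then have "b / x = s + (y / x) * t" using x_neq_0 by (simp add: field_simps)
    moreover have "s + (y / x) * t \<in> adjoin S (y / x)"
      using st chart_incl chart_t by (intro sring_add[OF chart_sring] sring_mult[OF chart_sring]) auto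
    ultimately show "b / x \<in> adjoin S (y / x)" by simp
  qed
  show "adjoin S (y / x) \<subseteq> chart S (nonunits S) x"
    using adjoin_least[OF R chart_ring chart_sub] chart_frac[OF y_nonunit] by blast
qed

text \<open>In the chart all products of two nonunits of S are multiples of x ^ 2, so 1 would be a
  multiple of x.\<close>

lemma x_not_in_square: "x \<notin> genid S {b * c | b c. b \<in> nonunits S \<and> c \<in> nonunits S}" (is "_ \<notin> genid S ?Q")
proof
  assume "x \<in> genid S ?Q"
  moreover have "smod S {w. w / x \<in> genid (adjoin S (y / x)) {x}}"
    using smod_subring[OF genid_smod[of "adjoin S (y / x)" "{x}"] chart_incl]
    by (auto simp: smod_def add_divide_distrib simp flip: times_divide_eq_right)
  moreover have "?Q \<subseteq> {w. w / x \<in> genid (adjoin S (y / x)) {x}}"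
  proof clarsimp
    fix b c assume h: "b \<in> nonunits S" "c \<in> nonunits S"
    have "b / x \<in> adjoin S (y / x)" "c / x \<in> adjoin S (y / x)" using h chart_frac[of _ "nonunits S" x S] by (auto simp: chart_adjoin)
    then have "(b / x * (c / x)) * x \<in> genid (adjoin S (y / x)) {x}"
      by (intro smod_mult[OF genid_smod] genid_in sring_mult[OF chart_sring]) auto
    moreover have "(b / x * (c / x)) * x = b * c / x" using x_neq_0 by simp
    ultimately show "b * c / x \<in> genid (adjoin S (y / x)) {x}" by (simp only:)
  qed
  ultimately have "x / x \<in> genid (adjoin S (y / x)) {x}" using genid_least by blast
  then have "1 \<in> genid (adjoin S (y / x)) {x}" using x_neq_0 by simp
  then show False using sprime_1[OF sprime_genid[OF chart_sring chart_x_prime]] by blast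
qed

lemma spr_chart:
  assumes T: "slocal T" "S \<subseteq> T" "spr (nonunits S) T"
  shows "y / x \<in> T \<or> x / y \<in> T"
proof -
  have "spr {x, y} T" using T spr_genid[OF T(1,2), of "{x, y}"] max by simp
  then show ?thesis by (auto simp: spr_def)
qed

end

lemma quadt_iff:
  assumes "regular2 S u v"
  shows "quadt S T \<longleftrightarrow> (\<exists>x y n. regular2 S x y \<and> smaximal (adjoin S (y / x)) n \<and>
    (\<exists>P. sprime (adjoin S (y / x)) P \<and> P \<noteq> {0} \<and> P \<subset> n) \<and> T = locz (adjoin S (y / x)) n)" (is "_ \<longleftrightarrow> ?R")
proof
  assume "quadt S T"
  then obtain a n P where h: "a \<in> nonunits S" "a \<notin> genid S {b * c | b c. b \<in> nonunits S \<and> c \<in> nonunits S}"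
    "smaximal (chart S (nonunits S) a) n" "sprime (chart S (nonunits S) a) P" "P \<noteq> {0}" "P \<subset> n" "T = locz (chart S (nonunits S) a) n"
    unfolding quadt_def by blast
  obtain b where b: "regular2 S a b" using regular2.ex_cofactor[OF assms h(1,2)] by blast
  have c: "chart S (nonunits S) a = adjoin S (b / a)" using regular2.chart_adjoin[OF b] .
  show ?R using b h(3-7) unfolding c by blast
next
  assume ?R
  then obtain x y n P where h: "regular2 S x y" "smaximal (adjoin S (y / x)) n" "sprime (adjoin S (y / x)) P" "P \<noteq> {0}" "P \<subset> n"
    "T = locz (adjoin S (y / x)) n" by blast
  have c: "chart S (nonunits S) x = adjoin S (y / x)" using regular2.chart_adjoin[OF h(1)] .
  show "quadt S T" unfolding quadt_def
    using regular2.x_nonunit[OF h(1)] regular2.x_not_in_square[OF h(1)] h(2-6) unfolding c[symmetric] by blast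
qed

section \<open>Structure of a quadratic transform\<close>

context regular2_frac
begin

text \<open>Modulo x, n becomes a nonzero maximal ideal of a polynomial ring over the residue field;
  p lifts its monic generator without raising the degree. Minimality of the degree stands in for
  irreducibility.\<close>

lemma quadt_structure:
  assumes n: "smaximal (adjoin S (y / x)) n" and P: "sprime (adjoin S (y / x)) P" "P \<noteq> {0}" "P \<subset> n"
  defines "A \<equiv> adjoin S (y / x)"
  shows "\<exists>p\<in>polys_over S. lead_coeff p = 1 \<and> Polynomial.degree p \<ge> 1 \<and> n = genid A {x, poly p (y / x)} \<and>
    regular2_frac (locz A n) x (poly p (y / x)) \<and> sdom (locz A n) S"
proof -
  define t where "t = y / x"
  have A: "sring A" "S \<subseteq> A" "t \<in> A" unfolding A_def t_def by (rule chart_sring, rule chart_incl, rule chart_t)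
  have nA: "smaximal A n" "sprime A P" using n P A_def by auto
  have np: "sprime A n" using smaximal_sprime[OF A(1) nA(1)] .
  have nm: "smod A n" using sprime_smod[OF np] .
  \<comment> \<open>The smaller prime P puts n over the maximal ideal of S.\<close>
  have over: "nonunits S \<subseteq> n" using second_prime_over_max[OF A(1,2) nA(2) P(2) np P(3)] .
  have xn: "x \<in> n" using over x_nonunit by blast
  have xprime: "sprime_elt A x" using chart_x_prime by (simp add: A_def)
  have xdvd: "sdvd A x (poly q t) \<longleftrightarrow> q \<in> polys_over (nonunits S)" if "q \<in> polys_over S" for q
    using chart_sdvd_x[OF that] by (simp add: A_def t_def)
  \<comment> \<open>If n were contained in x A, a nonzero element of P could be freed of its factors
    x without leaving P, which contradicts that P lies in n.\<close>
  have ex_unit: "\<exists>q\<in>polys_over S. q \<notin> polys_over (nonunits S) \<and> poly q t \<in> n"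
  proof (rule ccontr)
    assume neg: "\<not> ?thesis"
    have nx: "\<And>h. h \<in> n \<Longrightarrow> sdvd A x h"
    proof -
      fix h assume h: "h \<in> n"
      then obtain q where "q \<in> polys_over S" "h = poly q t" using sprime_sub[OF np] by (auto simp: A_def adjoin_def t_def)
      then show "sdvd A x h" using neg h xdvd by blast
    qed
    have "x \<notin> P"
    proof
      assume "x \<in> P"
      then have "n \<subseteq> P" using nx smod_mult2[OF sprime_smod[OF nA(2)]] by (auto simp: sdvd_def)
      then show False using P by blast
    qed
    obtain h where h: "h \<in> P" "h \<noteq> 0" using P(2) smod_0[OF sprime_smod[OF nA(2)]] by blast
    then have "h \<in> A" using sprime_sub[OF nA(2)] by auto
    then obtain k g where g: "g \<in> A" "h = x ^ k * g" "\<not> sdvd A x g" using chart_order[of h] h(2) by (auto simp: A_def)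
    have "x \<in> A" using A x_in by auto
    then have "g \<in> P" using sprime_prime[OF nA(2) sring_pow[OF A(1), of x k] g(1)] h g sprime_pow[OF A(1) nA(2)] \<open>x \<notin> P\<close> by blast
    then show False using nx P g by blast
  qed
  have monic: "\<exists>q\<in>polys_over S. lead_coeff q = 1 \<and> Polynomial.degree q \<le> Polynomial.degree q0 \<and> poly q t \<in> n"
    if q0: "q0 \<in> polys_over S" "q0 \<notin> polys_over (nonunits S)" "poly q0 t \<in> n" for q0
    using q0
  proof (induction "Polynomial.degree q0" arbitrary: q0 rule: less_induct)
    case less
    define d where "d = Polynomial.degree q0"
    define c where "c = lead_coeff q0"
    have cS: "c \<in> S" using less.prems by (auto simp: c_def polys_over_def)
    show ?case
    proof (cases "c \<in> nonunits S")
      case False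
      then have ic: "inverse c \<in> S" "c \<noteq> 0" using unit_inverse[OF cS] by auto
      have "Polynomial.smult (inverse c) q0 \<in> polys_over S" using polys_over_smult[OF smod_S ic(1)] less.prems by blast
      moreover have "poly (Polynomial.smult (inverse c) q0) t \<in> n" using smod_mult[OF nm] ic A less.prems by auto
      moreover have "lead_coeff (Polynomial.smult (inverse c) q0) = 1" using ic by (simp add: c_def)
      ultimately show ?thesis using Polynomial.degree_smult_le by (intro bexI[of _ "Polynomial.smult (inverse c) q0"]) auto
    next
      case True
      have mon: "Polynomial.monom c d \<in> polys_over (nonunits S)" using True nonunits_0[OF R] by (simp add: polys_over_monom)
      define q1 where "q1 = q0 - Polynomial.monom c d"
      have monS: "Polynomial.monom c d \<in> polys_over S" using mon polys_over_mono[OF nonunits_sub] by blast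
      have q1S: "q1 \<in> polys_over S" unfolding q1_def using less.prems monS polys_over_diff[OF R smod_S] by blast
      have q1n: "q1 \<notin> polys_over (nonunits S)" using less.prems polys_over_add[OF max_smod mon, of q1] by (auto simp: q1_def)
      have "c * t ^ d \<in> n" using True over sring_pow[OF A(1,3)] by (intro smod_mult2[OF nm]) auto
      then have q1t: "poly q1 t \<in> n" using smod_diff[OF A(1) nm] less.prems by (auto simp: q1_def poly_monom)
      have "Polynomial.degree q1 < d"
      proof -
        have "d \<noteq> 0"
        proof
          assume "d = 0"
          then obtain c' where "q0 = [:c':]" using degree_eq_zeroE[of q0] unfolding d_def by metis
          then have "q0 = [:c:]" by (simp add: c_def)
          then have "q0 \<in> polys_over (nonunits S)" using mon \<open>d = 0\<close> by (simp add: monom_0)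
          then show False using less.prems by blast
        qed
        moreover have "Polynomial.degree q1 \<le> d - 1"
        proof (rule Polynomial.degree_le, intro allI impI)
          fix i assume "d - 1 < i"
          then show "poly.coeff q1 i = 0" using Polynomial.coeff_eq_0[of q0 i] \<open>d \<noteq> 0\<close> by (cases "i = d") (auto simp: q1_def c_def d_def)
        qed
        ultimately show ?thesis by linarith
      qed
      then obtain q where "q \<in> polys_over S" "lead_coeff q = 1" "Polynomial.degree q \<le> Polynomial.degree q1" "poly q t \<in> n"
        using less.hyps[of q1] q1S q1n q1t by (auto simp: d_def)
      then show ?thesis using \<open>Polynomial.degree q1 < d\<close> by (intro bexI[of _ q]) (auto simp: d_def)
    qed
  qed
  define G where "G d \<longleftrightarrow> (\<exists>q\<in>polys_over S. lead_coeff q = 1 \<and> Polynomial.degree q = d \<and> poly q t \<in> n)" for d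
  have "\<exists>d. G d" using ex_unit monic unfolding G_def by blast
  then obtain d where d: "G d" "\<And>e. e < d \<Longrightarrow> \<not> G e" using exists_least_iff[of G] by blast
  then obtain p where p: "p \<in> polys_over S" "lead_coeff p = 1" "Polynomial.degree p = d" "poly p t \<in> n" unfolding G_def by blast
  have d1: "d \<ge> 1"
  proof (rule ccontr)
    assume "\<not> d \<ge> 1"
    then obtain c where "p = [:c:]" using p(3) degree_eq_zeroE[of p] by (metis One_nat_def less_one not_le)
    then have "p = [:1:]" using p(2) by simp
    then have "1 \<in> n" using p by simp
    then show False using sprime_1[OF np] by blast
  qed
  have small: "q \<in> polys_over (nonunits S)" if q: "q \<in> polys_over S" "Polynomial.degree q < d" "poly q t \<in> n" for q
  proof (rule ccontr)
    assume "q \<notin> polys_over (nonunits S)"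
    then obtain q' where "q' \<in> polys_over S" "lead_coeff q' = 1" "Polynomial.degree q' \<le> Polynomial.degree q" "poly q' t \<in> n"
      using monic q by blast
    then have "G (Polynomial.degree q')" "Polynomial.degree q' < d" using q unfolding G_def by auto
    then show False using d by blast
  qed
  have division: "\<exists>q1\<in>polys_over S. \<exists>r\<in>polys_over S. q = p * q1 + r \<and> Polynomial.degree r < d" if "q \<in> polys_over S" for q
    using that
  proof (induction "Polynomial.degree q" arbitrary: q rule: less_induct)
    case less
    show ?case
    proof (cases "Polynomial.degree q < d")
      case True
      then show ?thesis using less.prems polys_over_0 sring_0[OF R] by (intro bexI[of _ 0] bexI[of _ q]) auto
    next
      case False
      define e where "e = Polynomial.degree q"
      define m where "m = Polynomial.monom (lead_coeff q) (e - d)"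
      have mS: "m \<in> polys_over S" unfolding m_def by (intro polys_over_monom sring_0[OF R] polys_overD less.prems)
      define q' where "q' = q - p * m"
      have q'S: "q' \<in> polys_over S" unfolding q'_def using less.prems p mS polys_over_diff[OF R smod_S] polys_over_mult[OF smod_S] by blast
      have "Polynomial.degree q' \<le> e - 1"
      proof (rule Polynomial.degree_le, intro allI impI)
        fix i assume i: "e - 1 < i"
        have pm: "poly.coeff (p * m) i = (if i < e - d then 0 else lead_coeff q * poly.coeff p (i - (e - d)))"
          by (simp add: m_def mult.commute[of p] Polynomial.coeff_monom_mult)
        show "poly.coeff q' i = 0"
        proof (cases "i = e")
          case True
          have "e - (e - d) = d" using False by (simp add: e_def)
          then show ?thesis using True p pm by (simp add: q'_def e_def)
        next
          case ne: False
          then have "i > e" using i d1 by linarith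
          then have "d < i - (e - d)" using False by (simp add: e_def)
          then have "poly.coeff p (i - (e - d)) = 0" using p(3) by (intro Polynomial.coeff_eq_0) auto
          then show ?thesis using \<open>i > e\<close> pm Polynomial.coeff_eq_0[of q i] by (simp add: q'_def e_def)
        qed
      qed
      then have "Polynomial.degree q' < e" using False d1 by (simp add: e_def)
      then obtain q1 r where h: "q1 \<in> polys_over S" "r \<in> polys_over S" "q' = p * q1 + r" "Polynomial.degree r < d"
        using less.hyps[of q'] q'S by (auto simp: e_def)
      have "q = p * (q1 + m) + r" using h(3) by (simp add: q'_def algebra_simps)
      then show ?thesis using h mS polys_over_add[OF smod_S] by blast
    qed
  qed
  have ngen: "n = genid A {x, poly p t}"
  proof
    show "genid A {x, poly p t} \<subseteq> n" using xn p by (intro genid_least nm) auto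
    show "n \<subseteq> genid A {x, poly p t}"
    proof
      fix h assume h: "h \<in> n"
      then obtain q where q: "q \<in> polys_over S" "h = poly q t" using sprime_sub[OF np] by (auto simp: A_def adjoin_def t_def)
      obtain q1 r where r: "q1 \<in> polys_over S" "r \<in> polys_over S" "q = p * q1 + r" "Polynomial.degree r < d" using division[OF q(1)] by blast
      have q1A: "poly q1 t \<in> A" using adjoinI[OF R r(1)] by (simp add: A_def t_def)
      have "poly r t = h - poly q1 t * poly p t" using q r by (simp add: mult.commute)
      then have "poly r t \<in> n" using smod_diff[OF A(1) nm h smod_mult[OF nm q1A p(4)]] by simp
      then have "sdvd A x (poly r t)" using small r xdvd by blast
      then obtain s where s: "s \<in> A" "poly r t = x * s" by (auto simp: sdvd_def)
      have "h = s * x + poly q1 t * poly p t" using q r s by (simp add: algebra_simps)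
      then show "h \<in> genid A {x, poly p t}" unfolding genid_pair[OF A(1)] using s q1A by blast
    qed
  qed
  let ?T = "locz A n"
  have TL: "slocal ?T" using locz_slocal[OF A(1) np] .
  have AT: "A \<subseteq> ?T" using locz_incl[OF A(1) np] .
  have nT: "nonunits ?T \<inter> A = n" using locz_nonunits_int[OF A(1) np] .
  have "nonunits ?T = genid ?T {x, poly p t}"
  proof
    show "genid ?T {x, poly p t} \<subseteq> nonunits ?T" using xn p nT by (intro genid_least nonunits_smod TL) auto
    show "nonunits ?T \<subseteq> genid ?T {x, poly p t}"
    proof
      fix z assume "z \<in> nonunits ?T"
      then obtain h b where h: "z = h / b" "h \<in> n" "b \<in> A - n" unfolding locz_nonunits[OF A(1) np] by blast
      have "h \<in> genid ?T {x, poly p t}" using h ngen genid_mono[OF AT order_refl] by blast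
      moreover have "1 / b \<in> ?T" using loczI[OF A(1) np sring_1[OF A(1)] h(3)] .
      ultimately have "1 / b * h \<in> genid ?T {x, poly p t}" using smod_mult[OF genid_smod] by blast
      then show "z \<in> genid ?T {x, poly p t}" using h by simp
    qed
  qed
  moreover have "snoeth ?T" using snoeth_locz[OF A(1) np] snoeth_adjoin[OF R noeth] by (simp add: A_def)
  moreover have "\<exists>Q. sprime ?T Q \<and> Q \<noteq> {0} \<and> Q \<noteq> nonunits ?T"
  proof -
    let ?Q = "{x / y | x y. x \<in> P \<and> y \<in> A - n}"
    have Q: "sprime ?T ?Q" "?Q \<inter> A = P" using locz_sprime[OF A(1) np nA(2)] P(3) by auto
    have "P \<noteq> n" using P by blast
    then have "?Q \<noteq> nonunits ?T" using Q(2) nT by metis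
    moreover have "?Q \<noteq> {0}" using Q(2) P(2) sring_0[OF A(1)] by auto
    ultimately show ?thesis using Q(1) by blast
  qed
  moreover have ST: "S \<subseteq> ?T" using A AT by auto
  moreover have "quot_full ?T" using quot_full_mono[OF quot ST] .
  ultimately have reg: "regular2_frac ?T x (poly p t)" using TL by unfold_locales
  have "nonunits S \<subseteq> nonunits ?T" using over nT A(2) nonunits_sub by blast
  then have "sdom ?T S" using TL loc ST by (auto simp: sdom_def)
  then show ?thesis using p d1 ngen reg by (auto simp: t_def)
qed

end

lemma quadt_obtain:
  assumes "regular2_frac S u v" "quadt S T"
  obtains x y n p where "regular2_frac S x y" "smaximal (adjoin S (y / x)) n" "T = locz (adjoin S (y / x)) n"
    "p \<in> polys_over S" "lead_coeff p = 1" "Polynomial.degree p \<ge> 1"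
    "n = genid (adjoin S (y / x)) {x, poly p (y / x)}" "regular2_frac T x (poly p (y / x))" "sdom T S"
proof -
  interpret U: regular2_frac S u v by fact
  obtain x y n P where h: "regular2 S x y" "smaximal (adjoin S (y / x)) n" "sprime (adjoin S (y / x)) P" "P \<noteq> {0}" "P \<subset> n"
    "T = locz (adjoin S (y / x)) n" using assms(2) unfolding quadt_iff[OF U.regular2_axioms] by metis
  have reg: "regular2_frac S x y" using h(1) U.quot by (simp add: regular2_frac_def regular2_frac_axioms_def)
  then show ?thesis using that regular2_frac.quadt_structure[OF reg h(2-5)] h by metis
qed

lemma quadt_regular: "regular2_frac S u v \<Longrightarrow> quadt S T \<Longrightarrow> \<exists>x y. regular2_frac T x y"
  and quadt_sdom: "regular2_frac S u v \<Longrightarrow> quadt S T \<Longrightarrow> sdom T S"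
  by (metis quadt_obtain)+

section \<open>Dimension and regularity\<close>

definition schain :: "'f::field set \<Rightarrow> nat \<Rightarrow> (nat \<Rightarrow> 'f set) \<Rightarrow> bool" where
  "schain S n P \<longleftrightarrow> (\<forall>i\<le>n. sprime S (P i)) \<and> (\<forall>i<n. P i \<subset> P (Suc i))"

definition kdim :: "'f::field set \<Rightarrow> enat" where
  "kdim S = Sup {enat n | n. \<exists>P. schain S n P}"

definition sregular :: "'f::field set \<Rightarrow> bool" where
  "sregular S \<longleftrightarrow> slocal S \<and> snoeth S \<and> (\<exists>A\<subseteq>S. finite A \<and> enat (card A) = kdim S \<and> nonunits S = genid S A)"

lemma kdim_le: "(\<And>n P. schain S n P \<Longrightarrow> n \<le> k) \<Longrightarrow> kdim S \<le> enat k"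
  unfolding kdim_def by (rule Sup_least) auto

lemma kdim_ge: "schain S n P \<Longrightarrow> enat n \<le> kdim S"
  unfolding kdim_def by (rule Sup_upper) auto

lemma kdim_ge_2:
  assumes S: "slocal S" and P: "sprime S P" "P \<noteq> {0}" "P \<noteq> nonunits S"
  shows "enat 2 \<le> kdim S"
proof (rule kdim_ge[of S 2 "\<lambda>i. if i = 0 then {0} else if i = 1 then P else nonunits S"])
  have "{0} \<subset> P" using P smod_0[OF sprime_smod[OF P(1)]] by auto
  moreover have "P \<subset> nonunits S" using P sideal_nonunits[OF slocal_sring[OF S] sprime_sideal sprime_1] by blast
  ultimately show "schain S 2 (\<lambda>i. if i = 0 then {0} else if i = 1 then P else nonunits S)"
    using P(1) sprime_zero[OF slocal_sring[OF S]] nonunits_sprime[OF S] by (auto simp: schain_def less_Suc_eq numeral_2_eq_2)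
qed

lemma kdim_le_1:
  assumes S: "slocal S" and no: "\<not> (\<exists>P. sprime S P \<and> P \<noteq> {0} \<and> P \<noteq> nonunits S)"
  shows "kdim S \<le> enat 1"
proof (rule kdim_le, rule ccontr)
  fix n P assume c: "schain S n P" and "\<not> n \<le> 1"
  then have n: "n \<ge> 2" by simp
  have pr: "sprime S (P 0)" "sprime S (P 1)" "sprime S (P 2)" "P 0 \<subset> P 1" "P 1 \<subset> P 2"
    using c n by (auto simp: schain_def numeral_2_eq_2)
  have "P 1 \<noteq> {0}" using pr(4) smod_0[OF sprime_smod[OF pr(1)]] by auto
  moreover have "P 1 \<noteq> nonunits S" using pr(5) sideal_nonunits[OF slocal_sring[OF S] sprime_sideal[OF pr(3)] sprime_1[OF pr(3)]] by auto
  ultimately show False using no pr by blast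
qed

lemma sregular_principal:
  assumes S: "sregular S" and "kdim S \<le> enat 1"
  shows "\<exists>p. nonunits S = genid S {p}"
proof -
  obtain A where A: "finite A" "A \<subseteq> S" "enat (card A) = kdim S" "nonunits S = genid S A" using S by (auto simp: sregular_def)
  then have "card A \<le> 1" using assms(2) by (metis enat_ord_simps(1))
  \<comment> \<open>In dimension 0 the generating set is empty, and 0 serves as the
    generator.\<close>
  then consider "A = {}" | p where "A = {p}" using A(1) by (metis One_nat_def card_1_singletonE card_eq_0_iff le_Suc_eq le_zero_eq)
  then show ?thesis
  proof cases
    case 1
    have "sring S" using S slocal_sring by (auto simp: sregular_def)
    then have "genid S {0} = genid S {}" using sring_0 by (auto simp: genid_single genid_empty)
    then show ?thesis using 1 A(4) by (intro exI[of _ 0]) simp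
  qed (use A in blast)
qed

context regular2_frac
begin

lemma overring_kdim_le:
  assumes T: "sring T" "S \<subseteq> T"
  shows "kdim T \<le> enat 2"
proof (rule kdim_le, rule ccontr)
  fix n P assume c: "schain T n P" and "\<not> n \<le> 2"
  then have n: "n \<ge> 3" by simp
  have pr: "sprime T (P 0)" "sprime T (P 1)" "sprime T (P 2)" "sprime T (P 3)" "P 0 \<subset> P 1" "P 1 \<subset> P 2" "P 2 \<subset> P 3"
    using c n by (auto simp: schain_def numeral_3_eq_3 numeral_2_eq_2)
  have "P 1 \<noteq> {0}" using pr(5) smod_0[OF sprime_smod[OF pr(1)]] by auto
  then show False using overring_dim_le_2[OF T pr(2) _ pr(3,6) pr(4,7)] by blast
qed

lemma overring_kdim_2:
  assumes "slocal T" "S \<subseteq> T"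
  shows "kdim T = enat 2 \<longleftrightarrow> (\<exists>P. sprime T P \<and> P \<noteq> {0} \<and> P \<noteq> nonunits T)"
  using kdim_ge_2[OF assms(1)] kdim_le_1[OF assms(1)] overring_kdim_le[OF slocal_sring[OF assms(1)] assms(2)]
  by (metis enat_ord_simps(1) one_le_numeral order_antisym_conv not_less_eq_eq one_add_one plus_1_eq_Suc le_refl)

lemma kdim_S: "kdim S = enat 2"
  using overring_kdim_2[OF loc order_refl] ex_prime by blast

lemma sregular_S: "sregular S"
  unfolding sregular_def
proof (intro conjI exI[of _ "{x, y}"] loc noeth max)
  have "x \<noteq> y" using y_pow_not_dvd[of 1] sdvd_self[OF R sring_1[OF R], of x] by auto
  then show "enat (card {x, y}) = kdim S" by (simp add: kdim_S)
qed (use x_in y_in in auto)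

lemma overring_regular2:
  assumes T: "sregular T" "S \<subseteq> T" "kdim T = enat 2"
  shows "\<exists>u v. regular2_frac T u v"
proof -
  have T': "slocal T" "snoeth T" using T by (auto simp: sregular_def)
  obtain A where A: "card A = 2" "nonunits T = genid T A" using T by (auto simp: sregular_def)
  then obtain u v where "A = {u, v}" by (auto simp: card_2_iff)
  moreover have "\<exists>P. sprime T P \<and> P \<noteq> {0} \<and> P \<noteq> nonunits T" using overring_kdim_2[OF T'(1) T(2)] T by simp
  ultimately have "regular2_frac T u v" using A T' quot_full_mono[OF quot T(2)] by unfold_locales auto
  then show ?thesis by blast
qed

text \<open>In T the prime (u) lies strictly between 0 and the maximal ideal, and the top of such a
  chain contains the maximal ideal of S by \<open>second_prime_over_max\<close>.\<close>

lemma overring_sdom: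
  assumes T: "regular2_frac T u v" "S \<subseteq> T"
  shows "sdom T S"
proof -
  interpret B: regular2_frac T u v by fact
  have xp: "sprime T (genid T {u})" "genid T {u} \<noteq> {0}" "genid T {u} \<subset> nonunits T"
    using B.x_prime_genid sideal_nonunits[OF B.R sprime_sideal sprime_1] by blast+
  have "nonunits S \<subseteq> nonunits T"
    using second_prime_over_max[OF B.R T(2) xp(1,2) nonunits_sprime[OF B.loc] xp(3)] .
  then show ?thesis using T B.loc loc by (auto simp: sdom_def)
qed

lemma dominated_kdim:
  assumes T: "regular2_frac T u v" "sdom T R'" "S \<subseteq> R'"
  shows "kdim R' = enat 2"
proof -
  interpret B: regular2_frac T u v by fact
  show ?thesis using B.dominated_ex_prime[OF T(2) quot_full_mono[OF quot T(3)]] overring_kdim_2[of R'] T by (auto simp: sdom_def)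
qed

lemma spr_of_frac:
  assumes T: "sring T" "S \<subseteq> T" "y / x \<in> T"
  shows "spr (nonunits S) T"
  unfolding spr_def
proof (intro bexI[of _ x] conjI ballI x_neq_0 x_nonunit)
  fix b assume "b \<in> nonunits S"
  then have "b / x \<in> adjoin S (y / x)" using chart_frac[of b "nonunits S" x S] by (simp add: chart_adjoin)
  then show "b / x \<in> T" using adjoin_least[OF R T] by blast
qed

lemma spr_dvr:
  assumes T: "slocal T" "snoeth T" "nonunits T = genid T {p}" "S \<subseteq> T"
  shows "spr (nonunits S) T"
proof -
  have "y / x \<in> T \<or> x / y \<in> T" using dvr_total[OF T(1-3), of y x] T(4) x_in y_in x_neq_0 y_neq_0 by auto
  then show ?thesis using spr_of_frac[OF slocal_sring[OF T(1)] T(4)]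
      regular2_frac.spr_of_frac[OF regular2_frac_swap slocal_sring[OF T(1)] T(4)] by blast
qed

section \<open>Domination between regular local rings\<close>

text \<open>If the maximal ideal of $S$ does not become principal in a dominating regular $B$, then
  $y/x$ is residually transcendental over $B$. Comparing the leading forms of $f$ and $g$ in
  $z = f/g \in B$ then shows that $z$ is congruent to an element of $S$ modulo the maximal ideal of
  $S$, and iterating this gives $z \in S$.\<close>

lemma dominating_regular:
  assumes B: "regular2_frac B u v" "sdom B S" and npr: "\<not> spr (nonunits S) B"
  shows "B = S"
proof
  show "S \<subseteq> B" using B sdom_sub by blast
  note SB = this
  interpret B: regular2_frac B u v by fact
  define t where "t = y / x"
  have nSB: "a \<in> nonunits S" if "a \<in> nonunits B" "a \<in> S" for a using sdom_nonunit_iff[OF B(2)] that by blast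
  have nBS: "a \<in> nonunits B" if "a \<in> nonunits S" for a using that B(2) by (auto simp: sdom_def)
  have xB: "x \<in> nonunits B" "y \<in> nonunits B" "x \<in> B" "y \<in> B" using nBS x_nonunit y_nonunit x_in y_in SB by auto
  obtain c d where cd: "c \<in> B" "d \<in> B" "d \<noteq> 0" "t = c / d" "\<And>r. r \<in> B \<Longrightarrow> sdvd B d (r * c) \<Longrightarrow> sdvd B d r"
    using B.fraction[of t] by blast
  have tn: "t \<notin> B" using npr spr_of_frac[OF B.R SB] by (auto simp: t_def)
  have it: "x / y \<notin> B" using npr regular2_frac.spr_of_frac[OF regular2_frac_swap B.R SB] by blast
  have dn: "d \<in> nonunits B" using tn cd div_unit[OF B.loc cd(1,2)] by blast
  have cn: "c \<in> nonunits B"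
  proof (rule ccontr)
    assume "c \<notin> nonunits B"
    then have "d / c \<in> B" using div_unit[OF B.loc cd(2,1)] by blast
    moreover have "inverse t = d / c" "inverse t = x / y" by (simp add: cd(4), simp add: t_def)
    ultimately show False using it by simp
  qed
  \<comment> \<open>Both c and d are nonunits, so t is residually transcendental over B: a
    polynomial over B that vanishes at t has its coefficients in I, hence in the maximal
    ideal.\<close>
  define I where "I = genid B {d, c}"
  have Im: "smod B I" unfolding I_def by (rule genid_smod)
  have In: "I \<subseteq> nonunits B" unfolding I_def using cn dn by (intro genid_least B.max_smod) auto
  have RT: "p \<in> polys_over I" if "p \<in> polys_over B" "poly p t = 0" for p
    using residually_transcendental[OF B.R cd(2,3,1,5) that(1)] that(2) by (simp add: cd(4) I_def)
  have pSB: "p \<in> polys_over S \<Longrightarrow> p \<in> polys_over B" for p using polys_over_mono[OF SB] by blast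
  have pB: "p \<in> polys_over B \<Longrightarrow> q \<in> polys_over B \<Longrightarrow> p - q \<in> polys_over B" for p q
    using polys_over_diff[OF B.R B.smod_S] .
  have sB: "a \<in> B \<Longrightarrow> p \<in> polys_over B \<Longrightarrow> Polynomial.smult a p \<in> polys_over B" for a p
    using polys_over_smult[OF B.smod_S] .
  have unit_coeff: "\<exists>i. poly.coeff q i \<notin> nonunits B" if "q \<in> polys_over S" "q \<notin> polys_over (nonunits S)" for q
    using that nSB polys_overD[OF that(1)] by (auto simp: polys_over_def)
  \<comment> \<open>A leading form over S gains no factor from the maximal ideal of B, so orders
    computed in S stay valid in B.\<close>
  have high: False if q: "q \<in> polys_over S" "q \<notin> polys_over (nonunits S)" "p \<in> polys_over B" "a \<in> nonunits B" "poly q t = a * poly p t" for q p a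
  proof -
    have aB: "a \<in> B" using q nonunits_sub by blast
    have "q - Polynomial.smult a p \<in> polys_over I" using q by (intro RT pB[OF pSB[OF q(1)] sB[OF aB q(3)]]) auto
    then have "poly.coeff q i - a * poly.coeff p i \<in> nonunits B" for i using polys_overD[of _ I i] In by fastforce
    moreover have "a * poly.coeff p i \<in> nonunits B" for i using nonunits_mult2[OF B.R polys_overD[OF q(3)] q(4)] .
    ultimately have "(poly.coeff q i - a * poly.coeff p i) + a * poly.coeff p i \<in> nonunits B" for i using smod_add[OF B.max_smod] by blast
    then show False using unit_coeff[OF q(1,2)] by simp
  qed
  have forms: "\<exists>k. \<exists>q\<in>polys_over S. \<exists>q'\<in>polys_over S. q \<notin> polys_over (nonunits S) \<and> q' \<notin> polys_over (nonunits S) \<and>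
      x ^ k * poly q' t = z * poly q t" if z: "z \<in> B" "z \<noteq> 0" for z
  proof -
    obtain f g where fg: "f \<in> S" "g \<in> S" "g \<noteq> 0" "z = f / g" using quot by (rule quot_fullE)
    have "f \<noteq> 0" using fg z by auto
    then obtain r' q' where q': "q' \<in> polys_over S" "f = x ^ r' * poly q' t" "q' \<notin> polys_over (nonunits S)"
      using leading_form[OF fg(1)] by (auto simp: t_def)
    obtain r q where q: "q \<in> polys_over S" "g = x ^ r * poly q t" "q \<notin> polys_over (nonunits S)"
      using leading_form[OF fg(2,3)] by (auto simp: t_def)
    have eq: "x ^ r' * poly q' t = z * (x ^ r * poly q t)" using fg q q' by simp
    have "r \<le> r'"
    proof (rule ccontr)
      assume "\<not> r \<le> r'"
      then have "x ^ r = x ^ r' * (x * x ^ (r - r' - 1))" using sring_powsplit[of r' r x] by (cases "r - r'") (auto simp: Suc_diff_Suc)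
      then have "x ^ r' * poly q' t = x ^ r' * ((x * (x ^ (r - r' - 1) * z)) * poly q t)" using eq by (simp add: algebra_simps)
      then have "poly q' t = (x * (x ^ (r - r' - 1) * z)) * poly q t" using x_neq_0 by simp
      moreover have "x * (x ^ (r - r' - 1) * z) \<in> nonunits B" using xB z by (intro nonunits_mult2[OF B.R] sring_rules[OF B.R])
      ultimately show False using high q q' pSB by blast
    qed
    then have "x ^ r * (x ^ (r' - r) * poly q' t) = x ^ r * (z * poly q t)" using eq sring_powsplit[of r r' x] by (simp add: algebra_simps)
    then have "x ^ (r' - r) * poly q' t = z * poly q t" using x_neq_0 by simp
    then show ?thesis using q q' by blast
  qed
  \<comment> \<open>The polynomial x ^ k q' - z q vanishes at t, so its coefficients are in I; at an
    index where q has a unit coefficient this can be solved for z.\<close>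
  have decomp: "\<exists>a\<in>S. \<exists>w\<in>I. z = a + w" if z: "z \<in> B" for z
  proof (cases "z = 0")
    case True
    then show ?thesis using sring_0[OF R] smod_0[OF Im] by (intro bexI[of _ 0]) auto
  next
    case False
    then obtain k q q' where q: "q \<in> polys_over S" "q' \<in> polys_over S" "q \<notin> polys_over (nonunits S)" "x ^ k * poly q' t = z * poly q t"
      using forms[OF z] by blast
    have "Polynomial.smult (x ^ k) q' - Polynomial.smult z q \<in> polys_over I" using q z xB by (intro RT pB sB pSB sring_pow[OF B.R]) auto
    then have d: "x ^ k * poly.coeff q' i - z * poly.coeff q i \<in> I" for i using polys_overD[of _ I i] by fastforce
    obtain i where i: "poly.coeff q i \<notin> nonunits S" using q(3) by (auto simp: polys_over_def)
    define w where "w = inverse (poly.coeff q i)"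
    have w: "w \<in> S" "poly.coeff q i \<noteq> 0" using unit_inverse[OF polys_overD[OF q(1)] i] by (auto simp: w_def)
    have "z = w * x ^ k * poly.coeff q' i + (- w) * (x ^ k * poly.coeff q' i - z * poly.coeff q i)"
      using w by (simp add: w_def algebra_simps)
    moreover have "w * x ^ k * poly.coeff q' i \<in> S" using w polys_overD[OF q(2)] by (intro S_rules)
    moreover have "(- w) * (x ^ k * poly.coeff q' i - z * poly.coeff q i) \<in> I"
      using w SB by (intro smod_mult[OF Im] d sring_minus[OF B.R]) auto
    ultimately show ?thesis by blast
  qed
  have "sdvd B d x"
  proof (rule cd(5)[OF xB(3)])
    have "x * c = d * y" using cd(3,4) x_neq_0 by (simp add: t_def field_simps)
    then show "sdvd B d (x * c)" using xB by (auto simp: sdvd_def)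
  qed
  then obtain e where e: "e \<in> B" "x = d * e" by (auto simp: sdvd_def)
  \<comment> \<open>If e is a unit, then I = (x, y) B. If not, the forms obtained for z = d
    contradict \<open>high\<close>, directly for k = 0 and after cancelling d for positive
    k.\<close>
  have eu: "e \<notin> nonunits B"
  proof
    assume en: "e \<in> nonunits B"
    obtain k q q' where q: "q \<in> polys_over S" "q' \<in> polys_over S" "q \<notin> polys_over (nonunits S)" "q' \<notin> polys_over (nonunits S)"
      "x ^ k * poly q' t = d * poly q t"
      using forms[OF cd(2,3)] by blast
    show False
    proof (cases k)
      case 0
      then show False using high[OF q(2,4) pSB[OF q(1)] dn] q(5) by simp
    next
      case (Suc l)
      have "d * poly q t = x ^ k * poly q' t" using q(5) by simp
      also have "\<dots> = (d * e) * x ^ l * poly q' t" unfolding Suc e(2)[symmetric] by simp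
      finally have "d * poly q t = d * ((x ^ l * e) * poly q' t)" by (simp add: mult_ac)
      then have "poly q t = (x ^ l * e) * poly q' t" using cd(3) by (metis mult_cancel_left)
      moreover have "x ^ l * e \<in> nonunits B" using nonunits_mult[OF B.R sring_pow[OF B.R xB(3)] en] .
      ultimately show False using high[OF q(1,3) pSB[OF q(2)]] by blast
    qed
  qed
  have ie: "inverse e \<in> B" "e \<noteq> 0" using unit_inverse[OF e(1) eu] by auto
  have "d = inverse e * x" using e ie by simp
  moreover have "c = inverse e * y" using cd(3,4) e ie x_neq_0 by (simp add: t_def field_simps)
  moreover have "inverse e * x \<in> genid B {x, y}" "inverse e * y \<in> genid B {x, y}"
    by (rule smod_mult[OF genid_smod ie(1)], simp add: genid_in)+
  ultimately have "I \<subseteq> genid B {x, y}" unfolding I_def by (intro genid_least genid_smod) auto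
  then have decomp': "\<exists>a\<in>S. \<exists>r\<in>B. \<exists>s\<in>B. z = a + x * r + y * s" if "z \<in> B" for z
    using decomp[OF that] unfolding genid_pair[OF B.R] by (fastforce simp: mult.commute add.assoc)
  \<comment> \<open>Iterating \<open>decomp'\<close> gives B = S + m ^ n B for all n, with m the
    maximal ideal of S; elements of m ^ n B are written as forms of degree n with coefficients in
    B.\<close>
  have approx: "\<exists>a\<in>S. \<exists>q\<in>polys_over B. Polynomial.degree q \<le> n \<and> z = a + x ^ n * poly q t" if z: "z \<in> B" for z n
  proof (induction n)
    case 0
    show ?case using z sring_0[OF R] polys_over_const[of B z] sring_0[OF B.R] by (intro bexI[of _ 0] bexI[of _ "[:z:]"]) auto
  next
    case (Suc n)
    then obtain a q where h: "a \<in> S" "q \<in> polys_over B" "Polynomial.degree q \<le> n" "z = a + x ^ n * poly q t" by blast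
    have "\<forall>i. \<exists>b r s. b \<in> S \<and> r \<in> B \<and> s \<in> B \<and> poly.coeff q i = b + x * r + y * s" using decomp' polys_overD[OF h(2)] by meson
    then obtain b r s where brs: "\<And>i. b i \<in> S" "\<And>i. r i \<in> B" "\<And>i. s i \<in> B" "\<And>i. poly.coeff q i = b i + x * r i + y * s i" by metis
    define P where "P f = (\<Sum>i\<le>n. Polynomial.monom (f i) i)" for f :: "nat \<Rightarrow> 'a"
    have Pc: "poly.coeff (P f) i = (if i \<le> n then f i else 0)" for f i
      by (simp add: P_def Polynomial.coeff_sum)
    have PS: "P f \<in> polys_over T" if "\<And>i. f i \<in> T" "0 \<in> T" for f T using that by (auto simp: polys_over_def Pc)
    have Pd: "Polynomial.degree (P f) \<le> n" for f by (rule Polynomial.degree_le) (simp add: Pc)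
    have qe: "q = P b + Polynomial.smult x (P r) + Polynomial.smult y (P s)"
    proof (rule poly_eqI)
      fix i show "poly.coeff q i = poly.coeff (P b + Polynomial.smult x (P r) + Polynomial.smult y (P s)) i"
        using brs(4)[of i] Polynomial.coeff_eq_0[of q i] h(3) by (auto simp: Pc)
    qed
    have "x ^ n * poly (P b) t \<in> S" using homogenize_in[OF PS[OF brs(1) sring_0[OF R]] Pd] by (simp add: t_def)
    then have "a + x ^ n * poly (P b) t \<in> S" using h sring_add[OF R] by blast
    moreover have "P r + pCons 0 (P s) \<in> polys_over B"
      using brs sring_0[OF B.R] by (intro polys_over_add[OF B.smod_S] polys_over_pCons PS) auto
    moreover have "Polynomial.degree (P r + pCons 0 (P s)) \<le> Suc n"
      using Pd by (intro Polynomial.degree_add_le) (auto intro: le_trans[OF Polynomial.degree_pCons_le] simp: le_SucI)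
    moreover have "poly q t = poly (P b) t + x * poly (P r + pCons 0 (P s)) t"
      using x_neq_0 by (simp add: qe t_def algebra_simps)
    then have "z = (a + x ^ n * poly (P b) t) + x ^ Suc n * poly (P r + pCons 0 (P s)) t" using h(4) by (simp add: algebra_simps)
    ultimately show ?case by blast
  qed
  show "B \<subseteq> S"
  proof
    fix z assume z: "z \<in> B"
    obtain f g where fg: "f \<in> S" "g \<in> S" "g \<noteq> 0" "z = f / g" using quot by (rule quot_fullE)
    have gid: "sideal S (genid S {g})" using genid_sideal[OF R] fg by auto
    have "f \<in> genid S {g}"
    proof (rule krull_intersection2[OF loc noeth gid x_nonunit y_nonunit])
      fix n
      \<comment> \<open>The exponent n + n is taken because a form of degree 2 n over S lies in (x ^
        n, y ^ n); \<open>high\<close> ensures that the error, an element of S, has at least this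
        order in S too.\<close>
      obtain a q where h: "a \<in> S" "q \<in> polys_over B" "z = a + x ^ (n + n) * poly q t" using approx[OF z, of "n + n"] by blast
      define k where "k = f - g * a"
      have kS: "k \<in> S" unfolding k_def using fg h by (intro S_rules)
      have k: "k = x ^ (n + n) * poly (Polynomial.smult g q) t"
        using h(3) fg by (simp add: k_def field_simps)
      have "\<exists>s\<in>S. \<exists>t\<in>S. k = x ^ n * s + y ^ n * t"
      proof (cases "k = 0")
        case True
        then show ?thesis using sring_0[OF R] by (intro bexI[of _ 0]) auto
      next
        case False
        obtain j p where p: "p \<in> polys_over S" "Polynomial.degree p \<le> j" "k = x ^ j * poly p t" "p \<notin> polys_over (nonunits S)"
          using leading_form[OF kS False] by (auto simp: t_def)
        have "n + n \<le> j"
        proof (rule ccontr)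
          assume "\<not> n + n \<le> j"
          then have "x ^ (n + n) = x ^ j * (x * x ^ (n + n - j - 1))" using sring_powsplit[of j "n + n" x] by (cases "n + n - j") (auto simp: Suc_diff_Suc)
          then have "x ^ j * poly p t = x ^ j * ((x * x ^ (n + n - j - 1)) * poly (Polynomial.smult g q) t)" using k p(3) by (simp add: mult.assoc)
          then have "poly p t = (x * x ^ (n + n - j - 1)) * poly (Polynomial.smult g q) t" using x_neq_0 by simp
          moreover have "x * x ^ (n + n - j - 1) \<in> nonunits B" using xB by (intro nonunits_mult2[OF B.R] sring_rules[OF B.R])
          ultimately show False using high[OF p(1,4) sB[of g q]] h fg SB by blast
        qed
        then show ?thesis using form_split[OF p(1,2)] p(3) by (simp add: t_def)
      qed
      moreover have "f = g * a + k" by (simp add: k_def)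
      moreover have "g * a \<in> genid S {g}" using genid_sdvd[OF R] sdvd_self[OF R h(1)] by blast
      ultimately show "\<exists>l\<in>genid S {g}. \<exists>s\<in>S. \<exists>t\<in>S. f = l + x ^ n * s + y ^ n * t" by (metis add.assoc)
    qed
    then obtain s where "s \<in> S" "f = g * s" using genid_sdvd[OF R] by (auto simp: sdvd_def)
    then show "z \<in> S" using fg by simp
  qed
qed

text \<open>The candidate is the localization of a chart at the center of B. By
  \<open>dominated_ex_prime\<close> a nonzero prime lies strictly inside that center, and then the
  dimension inequality leaves no room above it, so it is maximal.\<close>

lemma dominates_quadt:
  assumes B: "regular2_frac B u v" "sdom B S" and pr: "spr (nonunits S) B"
  shows "\<exists>T. quadt S T \<and> sdom B T"
proof -
  interpret B: regular2_frac B u v by fact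
  have SB: "S \<subseteq> B" using B sdom_sub by blast
  have key: "\<exists>T. quadt S T \<and> sdom B T" if r: "regular2_frac S x y" "y / x \<in> B" for x y
  proof -
    interpret C: regular2_frac S x y by fact
    define A where "A = adjoin S (y / x)"
    have A: "sring A" "S \<subseteq> A" unfolding A_def by (rule C.chart_sring, rule C.chart_incl)
    have AB: "A \<subseteq> B" unfolding A_def using adjoin_least[OF R B.R SB r(2)] .
    define n where "n = nonunits B \<inter> A"
    define T where "T = locz A n"
    note T = locz_sdom[OF A(1) B.loc AB, folded n_def, folded T_def]
    have AT: "A \<subseteq> T" unfolding T_def using locz_incl[OF A(1) T(1)] .
    have nT: "nonunits T \<inter> A = n" unfolding T_def using locz_nonunits_int[OF A(1) T(1)] .
    have RT: "sring T" using T sdom_slocal slocal_sring by blast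
    have qA: "quot_full A" using quot_full_mono[OF quot A(2)] .
    obtain P where P: "sprime T P" "P \<noteq> {0}" "P \<noteq> nonunits T"
      using B.dominated_ex_prime[OF T(2) quot_full_mono[OF qA AT]] by blast
    have PA: "sprime A (P \<inter> A)" using sprime_contract[OF A(1) AT P(1)] .
    have "P \<subseteq> nonunits T" using sideal_nonunits[OF RT sprime_sideal[OF P(1)] sprime_1[OF P(1)]] .
    then have sub: "P \<inter> A \<subseteq> n" using nT by blast
    have "P \<inter> A \<noteq> n"
    proof
      assume e: "P \<inter> A = n"
      have "nonunits T \<subseteq> P"
      proof
        fix z assume "z \<in> nonunits T"
        then obtain a b where ab: "z = a / b" "a \<in> n" "b \<in> A - n" unfolding T_def locz_nonunits[OF A(1) T(1)] by blast
        then have "a \<in> P" "1 / b \<in> T" using e loczI[OF A(1) T(1) sring_1[OF A(1)], of b] by (auto simp: T_def)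
        then have "1 / b * a \<in> P" using smod_mult[OF sprime_smod[OF P(1)]] by blast
        then show "z \<in> P" using ab by simp
      qed
      then show False using P(3) \<open>P \<subseteq> nonunits T\<close> by blast
    qed
    have P0: "P \<inter> A \<noteq> {0}"
      using quot_full_ideal[OF qA AT smod_subring[OF sprime_smod[OF P(1)] AT] P(2)] by blast
    have "smaximal A n"
      unfolding smaximal_def
    proof (intro conjI allI impI)
      show "sideal A n" "1 \<notin> n" using T(1) sprime_sideal sprime_1 by auto
      fix I assume I: "sideal A I" "n \<subseteq> I" "1 \<notin> I"
      have "snoeth A" unfolding A_def using snoeth_adjoin[OF R noeth] .
      then obtain M where M: "smaximal A M" "I \<subseteq> M" using ex_smaximal[OF A(1) _ I(1,3)] by blast
      have Mp: "sprime A M" using smaximal_sprime[OF A(1) M(1)] .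
      have "\<not> n \<subset> M" using overring_dim_le_2[OF A PA P0 T(1) _ Mp] sub \<open>P \<inter> A \<noteq> n\<close> by blast
      then show "I = n" using M I by blast
    qed
    then have "quadt S T" unfolding quadt_iff[OF regular2_axioms] using C.regular2_axioms PA P0 sub \<open>P \<inter> A \<noteq> n\<close>
      unfolding T_def A_def by blast
    then show ?thesis using T by blast
  qed
  have "y / x \<in> B \<or> x / y \<in> B" using spr_chart[OF B.loc SB pr] .
  then show ?thesis using key[of x y] key[of y x] regular2_frac_swap regular2_frac_axioms by blast
qed

end

section \<open>Factorization into quadratic transforms\<close>

lemma quadt_param:
  assumes "regular2_frac S u v" "quadt S T"
  shows "\<exists>x\<in>nonunits T. x \<noteq> 0 \<and> x \<in> nonunits S \<and> (\<forall>b\<in>nonunits S. b / x \<in> T)"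
proof -
  obtain x y n p where h: "regular2_frac S x y" "smaximal (adjoin S (y / x)) n" "T = locz (adjoin S (y / x)) n"
    "regular2_frac T x (poly p (y / x))" using quadt_obtain[OF assms] by metis
  interpret S: regular2_frac S x y by fact
  interpret T: regular2_frac T x "poly p (y / x)" by fact
  have "sprime (adjoin S (y / x)) n" using smaximal_sprime[OF S.chart_sring h(2)] .
  then have "adjoin S (y / x) \<subseteq> T" unfolding h(3) using locz_incl[OF S.chart_sring] by blast
  then have "b / x \<in> T" if "b \<in> nonunits S" for b using chart_frac[OF that, of x S] by (auto simp: S.chart_adjoin)
  then show ?thesis using T.x_nonunit S.x_nonunit S.x_neq_0 by blast
qed

lemma quadts_regular: "quadt\<^sup>*\<^sup>* D R \<Longrightarrow> \<exists>x y. regular2_frac D x y \<Longrightarrow> (\<exists>x y. regular2_frac R x y) \<and> sdom R D"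
proof (induction rule: rtranclp_induct)
  case base
  then show ?case using sdom_refl regular2.loc regular2_frac.axioms(1) by blast
next
  case (step T R)
  then show ?case using quadt_regular quadt_sdom sdom_trans by meson
qed

text \<open>Abhyankar's factorization theorem: the sequence of quadratic transforms of $D$ along $R$ is finite.
  Otherwise, by the ascending chain condition in $R$, the union of the sequence is $R$; but every
  parameter of $R$ in some term is divisible by a nonunit in the next.\<close>

theorem factorization:
  assumes D: "\<exists>x y. regular2_frac D x y" and R: "regular2_frac R u v" and dom: "sdom R D"
  shows "quadt\<^sup>*\<^sup>* D R"
proof (rule ccontr)
  assume neg: "\<not> quadt\<^sup>*\<^sup>* D R"
  interpret R: regular2_frac R u v by fact
  define Q where "Q S \<longleftrightarrow> quadt\<^sup>*\<^sup>* D S \<and> sdom R S" for S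
  have "\<exists>T. Q T \<and> quadt S T" if "Q S" for S
  proof -
    have S: "quadt\<^sup>*\<^sup>* D S" "sdom R S" using that by (auto simp: Q_def)
    then obtain x y where "regular2_frac S x y" using quadts_regular D by blast
    then interpret S: regular2_frac S x y .
    have "spr (nonunits S) R" using S.dominating_regular[OF R S(2)] S(1) neg by blast
    then obtain T where "quadt S T" "sdom R T" using S.dominates_quadt[OF R S(2)] by blast
    then show ?thesis using S rtranclp.rtrancl_into_rtrancl[of quadt] unfolding Q_def by blast
  qed
  then obtain f where f: "\<And>n. Q (f n)" "\<And>n. quadt (f n) (f (Suc n))"
    using dependent_nat_choice[of "\<lambda>n. Q" "\<lambda>n. quadt"] dom by (auto simp: Q_def)
  have freg: "\<exists>x y. regular2_frac (f n) x y" for n using quadts_regular[of D "f n"] D f(1)[of n] by (auto simp: Q_def)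
  have fdom: "sdom R (f n)" for n using f(1) by (auto simp: Q_def)
  have floc: "slocal (f n)" for n using fdom sdom_slocal by blast
  have param: "\<exists>x. x \<noteq> 0 \<and> x \<in> nonunits R \<and> (\<forall>b\<in>nonunits (f n). b / x \<in> f (Suc n))" for n
  proof -
    obtain x y where "regular2_frac (f n) x y" using freg by blast
    then obtain a where "a \<in> nonunits (f (Suc n))" "a \<noteq> 0" "\<forall>b\<in>nonunits (f n). b / a \<in> f (Suc n)"
      using quadt_param[OF _ f(2)] by blast
    then show ?thesis using fdom[of "Suc n"] unfolding sdom_def by blast
  qed
  have "\<exists>m. z \<in> f m" if z: "z \<in> R" for z
  proof -
    \<comment> \<open>Here g is a denominator of z. If g is a nonunit of f n, so is the numerator z
      * g, and both can be divided by the nonunit a of R in the next ring; the induction over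
      divisors in R makes this stop.\<close>
    have "\<forall>n. g \<in> f n \<longrightarrow> z * g \<in> f n \<longrightarrow> (\<exists>m. z \<in> f m)" if "g \<in> R" "g \<noteq> 0" for g
      using R.R R.noeth that
    proof (induction g rule: snoeth_divisor_induct)
      case (step g)
      show ?case
      proof (intro allI impI)
        fix n assume h: "g \<in> f n" "z * g \<in> f n"
        show "\<exists>m. z \<in> f m"
        proof (cases "g \<in> nonunits (f n)")
          case False
          then have "z * g / g \<in> f n" using div_unit[OF floc h(2,1)] by blast
          then show ?thesis using step by auto
        next
          case True
          obtain a where a: "a \<noteq> 0" "a \<in> nonunits R" "\<forall>b\<in>nonunits (f n). b / a \<in> f (Suc n)" using param by blast
          have "g \<in> nonunits R" using True fdom by (auto simp: sdom_def)
          then have "z * g \<in> nonunits R" using nonunits_mult[OF R.R z] by blast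
          then have "z * g \<in> nonunits (f n)" using sdom_nonunit_iff[OF fdom h(2)] by blast
          then have v: "g / a \<in> f (Suc n)" "z * (g / a) \<in> f (Suc n)" using True a by auto
          have "g / a \<in> R" using v fdom sdom_sub by blast
          moreover have "g = a * (g / a)" using a by simp
          ultimately show ?thesis using step.IH[OF _ a(2)] v by blast
        qed
      qed
    qed
    moreover obtain a b where ab: "a \<in> f 0" "b \<in> f 0" "b \<noteq> 0" "z = a / b" using freg[of 0] regular2_frac.quot quot_fullE by metis
    moreover have "z * b \<in> f 0" using ab by simp
    ultimately show ?thesis using fdom[of 0] sdom_sub by blast
  qed
  note union = this
  have mono: "m \<le> n \<Longrightarrow> f m \<subseteq> f n" for m n
    using lift_Suc_mono_le[of f] quadt_sdom[OF _ f(2)] freg sdom_sub by metis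
  obtain m1 m2 where m: "u \<in> f m1" "v \<in> f m2" using union R.x_in R.y_in by blast
  define n where "n = max m1 m2"
  have "u \<in> f n" "v \<in> f n" using m mono[of m1 n] mono[of m2 n] by (auto simp: n_def)
  then have uv: "u \<in> nonunits (f n)" "v \<in> nonunits (f n)" using sdom_nonunit_iff[OF fdom] R.x_nonunit R.y_nonunit by auto
  obtain a where a: "a \<noteq> 0" "a \<in> nonunits R" "\<forall>b\<in>nonunits (f n). b / a \<in> f (Suc n)" using param by blast
  have "u / a \<in> R" "v / a \<in> R" using a uv fdom sdom_sub by blast+
  then have "sdvd R a u" "sdvd R a v" using a by (auto simp: sdvd_def intro!: bexI[of _ "_ / a"])
  then have "nonunits R \<subseteq> genid R {a}" unfolding R.max by (intro genid_least genid_smod) (auto simp: genid_sdvd[OF R.R])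
  moreover have "genid R {a} \<subseteq> nonunits R" using a by (intro genid_least R.max_smod) auto
  ultimately show False using R.max_not_principal by blast
qed

section \<open>Ideals primary to the maximal ideal\<close>

text \<open>Both the ideals primary to the maximal ideal and the unit ideal.\<close>

definition cofin :: "'f::field set \<Rightarrow> 'f set \<Rightarrow> bool" where
  "cofin S J \<longleftrightarrow> sideal S J \<and> (\<forall>z\<in>nonunits S. \<exists>k::nat. z ^ k \<in> J)"

lemma cofin_smod: "cofin S J \<Longrightarrow> smod S J"
  and cofin_sub: "cofin S J \<Longrightarrow> J \<subseteq> S"
  and cofin_pow: "cofin S J \<Longrightarrow> z \<in> nonunits S \<Longrightarrow> \<exists>k. z ^ k \<in> J"
  by (auto simp: cofin_def sideal_def)

lemma sring_of_nat: "sring S \<Longrightarrow> of_nat n \<in> S"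
  by (induction n) (auto simp: sring_rules)

lemma smod_pow_le: "sring S \<Longrightarrow> smod S J \<Longrightarrow> z \<in> S \<Longrightarrow> z ^ k \<in> J \<Longrightarrow> k \<le> l \<Longrightarrow> z ^ l \<in> J"
  using sring_powsplit[of k l z] smod_mult2 sring_pow by metis

context regular2
begin

text \<open>In the expansion of (x s + y t) ^ (k + l) every term contains x ^ k or y ^ l.\<close>

lemma cofinI:
  assumes J: "sideal S J" and k: "x ^ k \<in> J" and l: "y ^ l \<in> J"
  shows "cofin S J"
  unfolding cofin_def
proof (intro conjI ballI J)
  fix z assume "z \<in> nonunits S"
  then obtain s t where st: "s \<in> S" "t \<in> S" "z = x * s + y * t" using max_iff by blast
  have Jm: "smod S J" using J by (simp add: sideal_def)
  have "z ^ (k + l) = (\<Sum>i\<le>k + l. of_nat ((k + l) choose i) * (x * s) ^ i * (y * t) ^ (k + l - i))"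
    unfolding st(3) by (rule binomial_ring)
  also have "\<dots> \<in> J"
  proof (rule smod_sum[OF Jm])
    fix i assume "i \<in> {..k + l}"
    show "of_nat ((k + l) choose i) * (x * s) ^ i * (y * t) ^ (k + l - i) \<in> J"
    proof (cases "k \<le> i")
      case True
      have "(of_nat ((k + l) choose i) * s ^ i * (y * t) ^ (k + l - i)) * x ^ i \<in> J"
        using st by (intro smod_mult[OF Jm _ smod_pow_le[OF R Jm x_in k True]] S_rules sring_of_nat[OF R])
      then show ?thesis by (simp add: power_mult_distrib mult_ac)
    next
      case False
      then have "l \<le> k + l - i" by simp
      then have "(of_nat ((k + l) choose i) * (x * s) ^ i * t ^ (k + l - i)) * y ^ (k + l - i) \<in> J"
        using st by (intro smod_mult[OF Jm _ smod_pow_le[OF R Jm y_in l]] S_rules sring_of_nat[OF R])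
      then show ?thesis by (simp add: power_mult_distrib mult_ac)
    qed
  qed
  finally show "\<exists>k. z ^ k \<in> J" by blast
qed

text \<open>Modulo x, g is a unit times y ^ i, so y ^ i is a multiple of g plus a multiple of x; in
  its k-th power the second part becomes a multiple of x ^ k.\<close>

lemma cofinI_not_dvd:
  assumes J: "sideal S J" and k: "x ^ k \<in> J" and g: "g \<in> J" "\<not> sdvd S x g"
  shows "cofin S J"
proof -
  have Jm: "smod S J" and JS: "J \<subseteq> S" using J by (auto simp: sideal_def)
  obtain i u c where u: "u \<in> S" "u \<notin> nonunits S" "c \<in> S" "g = u * y ^ i + x * c" using order_mod_x g JS by blast
  have iu: "inverse u \<in> S" "u \<noteq> 0" using unit_inverse u by auto
  have "y ^ i = g * inverse u + x * (- (c * inverse u))" using u iu by (simp add: field_simps)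
  moreover obtain e where e: "e \<in> S" "(g * inverse u + x * (- (c * inverse u))) ^ k = g * e + (x * (- (c * inverse u))) ^ k"
    using binomial_mod[OF R, of "inverse u" "x * (- (c * inverse u))" g k] u iu g JS by (auto intro: S_rules)
  ultimately have "y ^ (i * k) = g * e + x ^ k * (- (c * inverse u)) ^ k" unfolding power_mult by (metis power_mult_distrib)
  also have "\<dots> \<in> J" using e u iu g k by (intro smod_add[OF Jm] smod_mult2[OF Jm] S_rules)
  finally show ?thesis using cofinI[OF J k] by blast
qed

text \<open>The least order r of an element of J is attained by q; the leading forms of the other
  elements show that x ^ r divides all of J in the chart.\<close>

lemma cofin_order:
  assumes J: "cofin S J"
  shows "\<exists>r. \<exists>q\<in>polys_over S. Polynomial.degree q \<le> r \<and> x ^ r * poly q (y / x) \<in> J \<and> q \<notin> polys_over (nonunits S) \<and>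
    (\<forall>j\<in>J. j / x ^ r \<in> adjoin S (y / x))"
proof -
  define G where "G r \<longleftrightarrow> (\<exists>q\<in>polys_over S. Polynomial.degree q \<le> r \<and> x ^ r * poly q (y / x) \<in> J \<and> q \<notin> polys_over (nonunits S))" for r
  have JS: "J \<subseteq> S" using cofin_sub J by auto
  have form: "\<exists>r. \<exists>q\<in>polys_over S. G r \<and> j = x ^ r * poly q (y / x)" if j: "j \<in> J" "j \<noteq> 0" for j
    using leading_form[of j] j JS unfolding G_def by blast
  obtain k where "x ^ k \<in> J" using cofin_pow[OF J x_nonunit] by blast
  then have "\<exists>r. G r" using form[of "x ^ k"] x_neq_0 by auto
  then obtain r where r: "G r" "\<And>s. s < r \<Longrightarrow> \<not> G s" using exists_least_iff[of G] by blast
  have "j / x ^ r \<in> adjoin S (y / x)" if j: "j \<in> J" for j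
  proof (cases "j = 0")
    case False
    then obtain s q where q: "q \<in> polys_over S" "G s" "j = x ^ s * poly q (y / x)" using form j by blast
    then have "r \<le> s" using r(2) not_le by blast
    then have "j / x ^ r = x ^ (s - r) * poly q (y / x)" using q(3) sring_powsplit[of r s x] x_neq_0 by simp
    moreover have "x ^ (s - r) * poly q (y / x) \<in> adjoin S (y / x)"
      using adjoinI[OF R q(1)] chart_incl x_in by (intro sring_mult[OF chart_sring] sring_pow[OF chart_sring]) auto
    ultimately show ?thesis by simp
  qed (use sring_0[OF chart_sring] in simp)
  then show ?thesis using r(1) unfolding G_def by blast
qed

text \<open>A prime factor of a generator divides a power of every nonunit, hence every nonunit, and
  would generate the maximal ideal.\<close>

lemma cofin_principal:
  assumes I: "cofin S I" "1 \<notin> I"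
  shows "\<not> spr I S"
proof
  assume "spr I S"
  then obtain a where a: "a \<in> I" "a \<noteq> 0" "\<And>b. b \<in> I \<Longrightarrow> b / a \<in> S" unfolding spr_def by blast
  have "sideal S I" using I by (simp add: cofin_def)
  then have "a \<in> nonunits S" using sideal_nonunits[OF R _ I(2)] a by blast
  then obtain f where f: "sprime_elt S f" "sdvd S f a" using prime_divisor a by blast
  have fz: "sdvd S f z" if z: "z \<in> nonunits S" for z
  proof -
    obtain k where "z ^ k \<in> I" using cofin_pow[OF I(1) z] by blast
    then have "sdvd S a (z ^ k)" using a by (intro sdvdI[of "z ^ k / a"]) auto
    then have "sdvd S f (z ^ k)" using sdvd_trans[OF R f(2)] by blast
    then show ?thesis using sprime_elt_pow[OF R f(1)] z nonunits_sub by blast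
  qed
  have "nonunits S = genid S {f}"
  proof
    show "nonunits S \<subseteq> genid S {f}" using fz genid_sdvd[OF R] by blast
    show "genid S {f} \<subseteq> nonunits S" using f by (intro genid_least max_smod) (auto simp: sprime_elt_def)
  qed
  then show False using max_not_principal by blast
qed

end

lemma genid_locz:
  assumes A: "sring A" and P: "sprime A P" and w: "w \<in> genid (locz A P) J"
  shows "\<exists>e\<in>A - P. e * w \<in> genid A J"
proof -
  have "smod (locz A P) {w. \<exists>e\<in>A - P. e * w \<in> genid A J}"
    unfolding smod_def
  proof (intro conjI ballI)
    have "1 \<in> A - P" using sring_1[OF A] sprime_1[OF P] by blast
    then show "0 \<in> {w. \<exists>e\<in>A - P. e * w \<in> genid A J}" using smod_0[OF genid_smod] by force
    fix a b assume "a \<in> {w. \<exists>e\<in>A - P. e * w \<in> genid A J}" "b \<in> {w. \<exists>e\<in>A - P. e * w \<in> genid A J}"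
    then obtain e e' where h: "e \<in> A - P" "e * a \<in> genid A J" "e' \<in> A - P" "e' * b \<in> genid A J" by blast
    then have "e' * (e * a) + e * (e' * b) \<in> genid A J"
      by (intro smod_add[OF genid_smod] smod_mult[OF genid_smod _ h(2)] smod_mult[OF genid_smod _ h(4)]) auto
    then have "(e * e') * (a + b) \<in> genid A J" by (simp add: algebra_simps)
    then show "a + b \<in> {w. \<exists>e\<in>A - P. e * w \<in> genid A J}" using locz_denom_mult[OF A P h(1,3)] by blast
  next
    fix s a assume "s \<in> locz A P" "a \<in> {w. \<exists>e\<in>A - P. e * w \<in> genid A J}"
    then obtain b c e where h: "s = b / c" "b \<in> A" "c \<in> A - P" "e \<in> A - P" "e * a \<in> genid A J" unfolding locz_def by blast
    have "b * (e * a) \<in> genid A J" using smod_mult[OF genid_smod h(2,5)] .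
    moreover have "(c * e) * (s * a) = b * (e * a)" using h locz_denom[OF A P h(3)] by simp
    ultimately show "s * a \<in> {w. \<exists>e\<in>A - P. e * w \<in> genid A J}" using locz_denom_mult[OF A P h(3,4)] by (metis (mono_tags, lifting) mem_Collect_eq)
  qed
  moreover have "J \<subseteq> {w. \<exists>e\<in>A - P. e * w \<in> genid A J}"
  proof
    fix j assume "j \<in> J"
    then have "1 * j \<in> genid A J" "1 \<in> A - P" using genid_in sring_1[OF A] sprime_1[OF P] by auto
    then show "j \<in> {w. \<exists>e\<in>A - P. e * w \<in> genid A J}" by blast
  qed
  ultimately show ?thesis using genid_least w by blast
qed

section \<open>Modifying a model over one quadratic transform\<close>

text \<open>The data of \<open>quadt_obtain\<close>: the quadratic transform T of S, with parameters
  x and \<pi>, where n = (x, \<pi>) is its center on the chart A.\<close>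

locale quadratic = regular2_frac S x y for S :: "'f::field set" and x y +
  fixes n :: "'f set" and p :: "'f poly"
  assumes n_max: "smaximal (adjoin S (y / x)) n"
    and p_over: "p \<in> polys_over S" and p_monic: "lead_coeff p = 1"
    and n_gen: "n = genid (adjoin S (y / x)) {x, poly p (y / x)}"
    and T_reg: "regular2_frac (locz (adjoin S (y / x)) n) x (poly p (y / x))"
    and T_dom: "sdom (locz (adjoin S (y / x)) n) S"
begin

abbreviation "t \<equiv> y / x"
abbreviation "A \<equiv> adjoin S t"
abbreviation "T \<equiv> locz A n"
abbreviation "\<pi> \<equiv> poly p t"
abbreviation "d \<equiv> Polynomial.degree p"

sublocale T: regular2_frac T x \<pi> by (rule T_reg)

lemma n_prime: "sprime A n" using smaximal_sprime[OF chart_sring n_max] .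

lemma AT: "A \<subseteq> T" using locz_incl[OF chart_sring n_prime] .

lemma ST: "S \<subseteq> T" using sdom_sub[OF T_dom] .

lemma xA: "x \<in> A" using chart_incl x_in by blast

lemma piA: "\<pi> \<in> A" using adjoinI[OF R p_over] .

lemma unit_of_not_n: "e \<in> A \<Longrightarrow> e \<notin> n \<Longrightarrow> e \<notin> nonunits T \<and> e \<noteq> 0 \<and> inverse e \<in> T"
  using locz_nonunits_int[OF chart_sring n_prime] AT unit_inverse[of e T] by blast

lemma T_blowup: "T \<in> blowup S (nonunits S)"
  unfolding blowup_charts mem_Collect_eq using n_prime chart_adjoin x_nonunit x_neq_0 by metis

lemma T_spr: "spr (nonunits S) T"
  using blowupD(3)[OF T_blowup] .

text \<open>The weak transform of $J$ at $T$; $r$ is the order of $J$.\<close>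

definition weak :: "nat \<Rightarrow> 'f set \<Rightarrow> 'f set" where
  "weak r J = {w. x ^ r * w \<in> genid T J}"

text \<open>The weak transform contains a power of x as well as the value of q at t, and x does not
  divide that value in T: it is prime in A and divides neither the value there nor any denominator
  outside n.\<close>

lemma weak_cofin:
  assumes J: "cofin S J"
    and q: "q \<in> polys_over S" "x ^ r * poly q t \<in> J" "q \<notin> polys_over (nonunits S)"
    and r: "\<And>j. j \<in> J \<Longrightarrow> j / x ^ r \<in> A"
  shows "cofin T (weak r J)"
proof -
  obtain k where k: "x ^ k \<in> J" using cofin_pow[OF J x_nonunit] by blast
  show ?thesis
  proof (rule T.cofinI_not_dvd[of _ k])
  have "smod T {w. w / x ^ r \<in> T}"
    by (auto simp: smod_def add_divide_distrib T.S_rules simp flip: times_divide_eq_right)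
  then have sub: "genid T J \<subseteq> {w. w / x ^ r \<in> T}" using r AT by (intro genid_least) auto
  have "weak r J \<subseteq> T"
  proof
    fix w assume "w \<in> weak r J"
    then have "x ^ r * w / x ^ r \<in> T" using sub by (auto simp: weak_def)
    then show "w \<in> T" using x_neq_0 by simp
  qed
  moreover have "smod T (weak r J)" using genid_smod[of T J] by (auto simp: weak_def smod_def distrib_left mult.left_commute)
  ultimately show "sideal T (weak r J)" by (simp add: sideal_def)
  have "x ^ r * x ^ k \<in> genid T J" using T.x_in k by (intro smod_mult[OF genid_smod] genid_in T.S_rules)
  then show "x ^ k \<in> weak r J" by (simp add: weak_def)
  show "poly q t \<in> weak r J" using q genid_in by (simp add: weak_def)
  show "\<not> sdvd T x (poly q t)"
  proof
    assume "sdvd T x (poly q t)"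
    then obtain a b where ab: "a \<in> A" "b \<in> A" "b \<notin> n" "poly q t = x * (a / b)" unfolding sdvd_def locz_def by blast
    have "b \<noteq> 0" using unit_of_not_n ab by blast
    then have "b * poly q t = x * a" using ab by simp
    then have "sdvd A x (b * poly q t)" using ab by (auto simp: sdvd_def)
    then have "sdvd A x b \<or> sdvd A x (poly q t)" using chart_x_prime ab(2) adjoinI[OF R q(1)] unfolding sprime_elt_def by blast
    moreover have "\<not> sdvd A x b"
    proof
      assume "sdvd A x b"
      then have "b \<in> n" using n_gen genid_in[of x "{x, \<pi>}" A] smod_mult2[OF genid_smod] by (auto simp: sdvd_def)
      then show False using ab by blast
    qed
    ultimately show False using chart_sdvd_x[OF q(1)] q(3) by blast
  qed
  qed
qed

text \<open>If \<pi> were a nonunit of B, the center of B on A would contain n = (x, \<pi>), hence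
  equal it by maximality, and B would be T.\<close>

lemma other_unit:
  assumes B: "B \<in> blowup S (nonunits S)" "B \<noteq> T" and over: "nonunits S \<subseteq> nonunits B" and tB: "t \<in> B"
  shows "A \<subseteq> B" "\<pi> \<in> B" "\<pi> \<notin> nonunits B"
proof -
  have RB: "sring B" using blowupD(1)[OF B(1)] slocal_sring by blast
  show AB: "A \<subseteq> B" using adjoin_least[OF R RB blowupD(2)[OF B(1)] tB] .
  then show "\<pi> \<in> B" using piA by blast
  show "\<pi> \<notin> nonunits B"
  proof
    assume pn: "\<pi> \<in> nonunits B"
    have id: "sideal A (nonunits B \<inter> A)" "1 \<notin> nonunits B \<inter> A"
      using sprime_sideal sprime_1 sprime_contract[OF chart_sring AB nonunits_sprime[OF blowupD(1)[OF B(1)]]] by auto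
    have "smod A (nonunits B \<inter> A)" using id by (simp add: sideal_def)
    moreover have "{x, \<pi>} \<subseteq> nonunits B \<inter> A" using pn piA xA over x_nonunit by auto
    ultimately have "n \<subseteq> nonunits B \<inter> A" unfolding n_gen by (rule genid_least)
    then have "nonunits B \<inter> A = n" using n_max id unfolding smaximal_def by blast
    moreover have "B = locz (chart S (nonunits S) x) (nonunits B \<inter> chart S (nonunits S) x)"
      using center_unique[OF B(1) sdom_refl[OF blowupD(1)[OF B(1)]] x_nonunit x_neq_0] AB chart_frac[of _ "nonunits S" x S]
      by (simp add: chart_adjoin subset_iff)
    ultimately show False using B(2) by (simp add: chart_adjoin)
  qed
qed

lemma hom_p: "x ^ d * \<pi> = (\<Sum>i\<le>d. poly.coeff p i * x ^ (d - i) * y ^ i)"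
  using homogenize[OF x_neq_0 order_refl] .

text \<open>Divided by y ^ d, the homogenization of the monic p is 1 plus multiples of the nonunit x
  / y.\<close>

lemma at_infinity:
  assumes B: "slocal B" "S \<subseteq> B" "x / y \<in> B" and s: "x / y \<in> nonunits B"
  shows "x ^ d * \<pi> / y ^ d \<in> B" "x ^ d * \<pi> / y ^ d \<notin> nonunits B"
proof -
  have RB: "sring B" using B slocal_sring by blast
  have c: "poly.coeff p i \<in> B" for i using polys_overD[OF p_over] B by blast
  have "x ^ d * \<pi> / y ^ d = (\<Sum>i\<le>d. poly.coeff p i * (x / y) ^ (d - i))"
    unfolding hom_p sum_divide_distrib
  proof (rule sum.cong[OF refl])
    fix i assume "i \<in> {..d}"
    then have "y ^ d = y ^ (d - i) * y ^ i" by (auto simp flip: power_add)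
    then show "poly.coeff p i * x ^ (d - i) * y ^ i / y ^ d = poly.coeff p i * (x / y) ^ (d - i)"
      using y_neq_0 by (simp add: power_divide)
  qed
  also have "\<dots> = 1 + (\<Sum>i<d. poly.coeff p i * (x / y) ^ (d - i))"
    using p_monic by (simp add: lessThan_Suc_atMost[symmetric])
  finally have eq: "x ^ d * \<pi> / y ^ d = 1 + (\<Sum>i<d. poly.coeff p i * (x / y) ^ (d - i))" .
  have "(\<Sum>i<d. poly.coeff p i * (x / y) ^ (d - i)) \<in> nonunits B"
  proof (rule smod_sum[OF nonunits_smod[OF B(1)]])
    fix i assume "i \<in> {..<d}"
    then obtain k where "d - i = Suc k" by (metis lessThan_iff Suc_diff_Suc)
    then have "(x / y) ^ (d - i) \<in> nonunits B" using nonunits_mult2[OF RB sring_pow[OF RB B(3)] s, of k] by simp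
    then show "poly.coeff p i * (x / y) ^ (d - i) \<in> nonunits B" using nonunits_mult[OF RB c] by blast
  qed
  then show "x ^ d * \<pi> / y ^ d \<in> B" "x ^ d * \<pi> / y ^ d \<notin> nonunits B"
    unfolding eq using one_plus_unit[OF B(1)] nonunits_sub sring_add[OF RB sring_1[OF RB]] by blast+
qed

text \<open>Let i be the last index where q has a unit coefficient, and s = x / y. The form equals y
  ^ r * (s ^ (r - i) * v + y * w) with v a unit, since the nonunit coefficients of S are divisible
  by y in B. A k-th power disposes of y * w, as y ^ k is in J; the bound r * k works for every
  i.\<close>

lemma order_at_infinity:
  assumes B: "slocal B" "S \<subseteq> B" "x / y \<in> B" and s: "x / y \<in> nonunits B"
    and J: "J \<subseteq> S" "y ^ k \<in> J"
    and q: "q \<in> polys_over S" "Polynomial.degree q \<le> r" "x ^ r * poly q t \<in> J" "q \<notin> polys_over (nonunits S)"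
    and a: "a \<ge> r * k"
  shows "y ^ r * (x / y) ^ a \<in> genid B J"
proof -
  have RB: "sring B" using B slocal_sring by blast
  have c: "poly.coeff q i \<in> B" for i using polys_overD[OF q(1)] B by blast
  have yB: "y \<in> B" using B y_in by blast
  obtain i where i: "poly.coeff q i \<notin> nonunits S" "\<And>l. l > i \<Longrightarrow> poly.coeff q l \<in> nonunits S"
  proof -
    define V where "V = {l. poly.coeff q l \<notin> nonunits S}"
    have "l \<le> Polynomial.degree q" if "l \<in> V" for l
    proof (rule ccontr)
      assume "\<not> ?thesis"
      then have "poly.coeff q l = 0" by (intro Polynomial.coeff_eq_0) simp
      then show False using that nonunits_0[OF R] by (simp add: V_def)
    qed
    then have fin: "finite V" by (intro finite_subset[of V "{..Polynomial.degree q}"]) auto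
    have ne: "V \<noteq> {}" using q(4) by (auto simp: V_def polys_over_def)
    have "\<exists>i. i \<in> V \<and> (\<forall>l>i. l \<notin> V)" using Max_in[OF fin ne] Max_ge[OF fin] by (metis not_le)
    then show thesis using that unfolding V_def by blast
  qed
  have ir: "i \<le> r" using i(1) Polynomial.coeff_eq_0[of q i] q(2) nonunits_0[OF R] by (metis le_trans not_le)
  define s where "s = x / y"
  have sn: "s \<in> nonunits B" "s \<in> B" using s B by (auto simp: s_def)
  define v where "v = (\<Sum>l\<le>i. poly.coeff q l * s ^ (i - l))"
  define w where "w = (\<Sum>l=i+1..r. (poly.coeff q l / y) * s ^ (r - l))"
  have x_eq: "x = s * y" using y_neq_0 by (simp add: s_def)
  have "x ^ r * poly q t = (\<Sum>l\<le>r. poly.coeff q l * x ^ (r - l) * y ^ l)" using homogenize[OF x_neq_0 q(2)] .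
  also have "\<dots> = (\<Sum>l\<le>r. y ^ r * (poly.coeff q l * s ^ (r - l)))"
  proof (rule sum.cong[OF refl])
    fix l assume "l \<in> {..r}"
    then have "y ^ r = y ^ (r - l) * y ^ l" by (auto simp flip: power_add)
    then show "poly.coeff q l * x ^ (r - l) * y ^ l = y ^ r * (poly.coeff q l * s ^ (r - l))" by (simp add: x_eq power_mult_distrib)
  qed
  also have "\<dots> = y ^ r * ((\<Sum>l\<le>i. poly.coeff q l * s ^ (r - l)) + (\<Sum>l=i+1..r. poly.coeff q l * s ^ (r - l)))"
    unfolding sum_distrib_left[symmetric] using ir by (subst sum.union_disjoint[symmetric]) (auto intro!: arg_cong[of _ _ "(*) (y ^ r)"] sum.cong)
  also have "(\<Sum>l\<le>i. poly.coeff q l * s ^ (r - l)) = s ^ (r - i) * v" unfolding v_def sum_distrib_left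
  proof (rule sum.cong[OF refl])
    fix l assume "l \<in> {..i}"
    then have "s ^ (r - l) = s ^ (r - i) * s ^ (i - l)" using ir by (simp flip: power_add)
    then show "poly.coeff q l * s ^ (r - l) = s ^ (r - i) * (poly.coeff q l * s ^ (i - l))" by simp
  qed
  also have "(\<Sum>l=i+1..r. poly.coeff q l * s ^ (r - l)) = y * w" unfolding w_def sum_distrib_left using y_neq_0 by simp
  finally have j0: "x ^ r * poly q t = y ^ r * (s ^ (r - i) * v + y * w)" .
  have vB: "v \<in> B" unfolding v_def using c sn by (intro sring_sum[OF RB] sring_rules[OF RB])
  have wB: "w \<in> B" unfolding w_def
  proof (rule sring_sum[OF RB])
    fix l assume "l \<in> {i+1..r}"
    then have "poly.coeff q l \<in> nonunits S" using i(2) by auto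
    then have "poly.coeff q l / y \<in> adjoin S (x / y)"
      using chart_frac[of _ "nonunits S" y S] regular2.chart_adjoin[OF regular2_swap] by auto
    then have "poly.coeff q l / y \<in> B" using adjoin_least[OF R RB B(2,3)] by blast
    then show "poly.coeff q l / y * s ^ (r - l) \<in> B" using sn by (intro sring_rules[OF RB])
  qed
  have vu: "v \<notin> nonunits B"
  proof -
    have "v = poly.coeff q i + (\<Sum>l<i. poly.coeff q l * s ^ (i - l))" unfolding v_def by (simp add: lessThan_Suc_atMost[symmetric])
    moreover have "(\<Sum>l<i. poly.coeff q l * s ^ (i - l)) \<in> nonunits B"
    proof (rule smod_sum[OF nonunits_smod[OF B(1)]])
      fix l assume "l \<in> {..<i}"
      then obtain m where "i - l = Suc m" by (metis lessThan_iff Suc_diff_Suc)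
      then have "s ^ (i - l) \<in> nonunits B" using nonunits_mult2[OF RB sring_pow[OF RB sn(2)] sn(1), of m] by simp
      then show "poly.coeff q l * s ^ (i - l) \<in> nonunits B" using nonunits_mult[OF RB c] by blast
    qed
    moreover have "poly.coeff q i \<notin> nonunits B"
    proof -
      have "poly.coeff q i \<noteq> 0" "inverse (poly.coeff q i) \<in> B" using unit_inverse[OF polys_overD[OF q(1)] i(1)] B by auto
      then show ?thesis by (auto simp: nonunits_def)
    qed
    ultimately show ?thesis using unit_plus[OF B(1) c] by auto
  qed
  define g where "g = s ^ (r - i) * v + y * w"
  have gB: "g \<in> B" unfolding g_def using sn vB wB yB by (intro sring_rules[OF RB])
  obtain e where e: "e \<in> B" "(g * 1 + - (y * w)) ^ k = g * e + (- (y * w)) ^ k"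
    using binomial_mod[OF RB sring_1[OF RB] sring_minus[OF RB sring_mult[OF RB yB wB]] gB] by blast
  have "(s ^ (r - i) * v) ^ k = g * e + y ^ k * (- w) ^ k"
  proof -
    have "g * 1 + - (y * w) = s ^ (r - i) * v" by (simp add: g_def)
    moreover have "(- (y * w)) ^ k = y ^ k * (- w) ^ k" by (metis mult_minus_right power_mult_distrib)
    ultimately show ?thesis using e(2) by simp
  qed
  then have "y ^ r * (s ^ (r - i) * v) ^ k = e * (x ^ r * poly q t) + (y ^ r * (- w) ^ k) * y ^ k"
    unfolding j0 g_def[symmetric] by (simp add: algebra_simps)
  also have "\<dots> \<in> genid B J" using e wB yB q J
    by (intro smod_add[OF genid_smod] smod_mult[OF genid_smod] genid_in sring_rules[OF RB])
  finally have 1: "y ^ r * (s ^ (r - i) * v) ^ k \<in> genid B J" .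
  have "(r - i) * k \<le> a" using a by (meson diff_le_self le_trans mult_le_mono1)
  then have "s ^ a = s ^ ((r - i) * k) * s ^ (a - (r - i) * k)" by (rule sring_powsplit)
  moreover have "inverse v \<in> B" "v \<noteq> 0" using unit_inverse[OF vB vu] by auto
  ultimately have eq: "y ^ r * s ^ a = (inverse v ^ k * s ^ (a - (r - i) * k)) * (y ^ r * (s ^ (r - i) * v) ^ k)"
    by (simp add: power_mult_distrib mult_ac flip: power_mult) (simp add: field_simps)
  have "inverse v ^ k * s ^ (a - (r - i) * k) \<in> B" using \<open>inverse v \<in> B\<close> sn by (intro sring_rules[OF RB])
  then show ?thesis unfolding s_def[symmetric] eq using smod_mult[OF genid_smod _ 1] by blast
qed

text \<open>The ideal below induces $J_1$ on $T$ and agrees with $J$, up to a power of the maximal ideal, on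
  all the other points of the blowup of the maximal ideal. The element $e$ separates the point $T$
  from the other points where $J$ is not principal.\<close>

lemma glue:
  assumes J: "cofin S J"
    and q: "q \<in> polys_over S" "Polynomial.degree q \<le> r" "x ^ r * poly q t \<in> J" "q \<notin> polys_over (nonunits S)"
    and r: "\<And>j. j \<in> J \<Longrightarrow> j / x ^ r \<in> A"
    and J1: "cofin T J1"
  shows "\<exists>N J'. cofin S J' \<and> (\<forall>f\<in>J'. f / x ^ N \<in> J1) \<and> (\<forall>w\<in>J1. x ^ N * w \<in> genid T J') \<and>
    (\<forall>B\<in>blowup S (nonunits S). B \<noteq> T \<longrightarrow> (\<exists>c. c \<noteq> 0 \<and> (\<forall>f\<in>J'. f / c \<in> genid B J) \<and> (\<forall>j\<in>J. c * j \<in> genid B J')))"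
proof -
  note JS = cofin_sub[OF J]
  have J1m: "smod T J1" and J1T: "J1 \<subseteq> T" using cofin_smod[OF J1] cofin_sub[OF J1] by auto
  obtain k where yk: "y ^ k \<in> J" using cofin_pow[OF J y_nonunit] by blast
  obtain k0 where xk: "x ^ k0 \<in> J" using cofin_pow[OF J x_nonunit] by blast
  obtain K1 K2 where "x ^ K1 \<in> J1" "\<pi> ^ K2 \<in> J1" using cofin_pow[OF J1 T.x_nonunit] cofin_pow[OF J1 T.y_nonunit] by blast
  then have K: "x ^ (K1 + K2) \<in> J1" "\<pi> ^ (K1 + K2) \<in> J1" using smod_pow_le[OF T.R J1m] T.x_in T.y_in by (meson le_add1 le_add2)+
  define K where "K = K1 + K2"
  note K = K[folded K_def]
  \<comment> \<open>Up to the factor e, a unit of T, the element x ^ r * \<pi> ^ L lies in J A. So a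
    multiple of e lands in the twisted J at every point of the chart where \<pi> is a unit.\<close>
  obtain L where L: "x ^ r * \<pi> ^ L \<in> genid T J"
    using cofin_pow[OF weak_cofin[OF J q(1,3,4) r] T.y_nonunit] by (auto simp: weak_def)
  obtain e where e: "e \<in> A" "e \<notin> n" "e * (x ^ r * \<pi> ^ L) \<in> genid A J" using genid_locz[OF chart_sring n_prime L] by blast
  have "sideal T J1" using J1 by (simp add: cofin_def)
  then obtain C where C: "finite C" "C \<subseteq> A" "C \<subseteq> J1" "J1 = genid T C"
    using locz_ideal_gen[OF chart_sring n_prime snoeth_adjoin[OF R noeth]] by blast
  have "\<forall>c\<in>C. \<exists>q\<in>polys_over S. e * c = poly q t"
  proof
    fix c assume "c \<in> C"
    then have "e * c \<in> A" using C e sring_mult[OF chart_sring] by blast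
    then show "\<exists>q\<in>polys_over S. e * c = poly q t" by (auto simp: adjoin_def)
  qed
  then obtain Q where Q: "\<And>c. c \<in> C \<Longrightarrow> Q c \<in> polys_over S \<and> e * c = poly (Q c) t" by metis
  \<comment> \<open>A bound for the degrees in t of the elements e * c: for N at least m, x ^ N * (e
    * c) is in S.\<close>
  define m where "m = Max (insert 0 (Polynomial.degree ` Q ` C))"
  have m: "Polynomial.degree (Q c) \<le> m" if "c \<in> C" for c unfolding m_def using C that by (intro Max_ge) auto
  \<comment> \<open>The summand m is for the degrees just bounded, and r * k is the exponent that
    \<open>order_at_infinity\<close> requires.\<close>
  define M where "M = m + r * k"
  \<comment> \<open>Over T the new ideal is to become x ^ N J1, elsewhere J times the power N - r of
    the maximal ideal. Of the order N, the part r comes from J and d * K from the K-th power of a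
    form of degree d.\<close>
  define N where "N = r + d * K + M"
  have NrM: "N - r = d * K + M" "N = r + (N - r)" "m \<le> N" "r * k \<le> N - m" by (auto simp: N_def M_def)
  \<comment> \<open>B runs through the points of the blowup other than T, and \<mu> generates the
    extension of the maximal ideal to B; division by \<mu> ^ (N - r) undoes the twist there.\<close>
  define adm where "adm B \<mu> \<longleftrightarrow> B \<in> blowup S (nonunits S) \<and> B \<noteq> T \<and> \<mu> \<in> nonunits S \<and> \<mu> \<noteq> 0 \<and> (\<forall>b\<in>nonunits S. b / \<mu> \<in> B)" for B \<mu>
  define J' where "J' = {f \<in> S. f / x ^ N \<in> J1 \<and> (\<forall>B \<mu>. adm B \<mu> \<longrightarrow> f / \<mu> ^ (N - r) \<in> genid B J)}"
  have admD: "slocal B" "sring B" "S \<subseteq> B" "\<mu> \<in> nonunits S" "\<mu> \<in> S" "\<mu> \<in> B" "\<mu> \<noteq> 0" "B \<noteq> T" "B \<in> blowup S (nonunits S)" "b \<in> nonunits S \<Longrightarrow> b / \<mu> \<in> B"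
    if "adm B \<mu>" for B \<mu> b
    using that blowupD[of B S "nonunits S"] nonunits_sub[of S] slocal_sring unfolding adm_def by blast+
  have J'id: "sideal S J'"
    unfolding sideal_def smod_def
  proof (intro conjI ballI)
    show "0 \<in> J'" using sring_0[OF R] smod_0[OF J1m] smod_0[OF genid_smod[of _ J]] by (simp add: J'_def)
    show "J' \<subseteq> S" by (auto simp: J'_def)
    fix a b assume "a \<in> J'" "b \<in> J'"
    then show "a + b \<in> J'" using smod_add[OF J1m] smod_add[OF genid_smod[of _ J]] sring_add[OF R] by (simp add: J'_def add_divide_distrib)
  next
    fix s a assume s: "s \<in> S" "a \<in> J'"
    have "s * (a / x ^ N) \<in> J1" using s ST by (intro smod_mult[OF J1m]) (auto simp: J'_def)
    moreover have "s * (a / \<mu> ^ (N - r)) \<in> genid B J" if h: "adm B \<mu>" for B \<mu> using s h admD(3)[OF h] by (intro smod_mult[OF genid_smod]) (auto simp: J'_def)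
    ultimately show "s * a \<in> J'" using s sring_mult[OF R] by (simp add: J'_def)
  qed
  have J'I: "j * w \<in> J'" if j: "j \<in> J" and w: "w \<in> S" "j * w / x ^ N \<in> J1" "\<And>B \<mu>. adm B \<mu> \<Longrightarrow> w / \<mu> ^ (N - r) \<in> B" for j w
  proof -
    have "(w / \<mu> ^ (N - r)) * j \<in> genid B J" if "adm B \<mu>" for B \<mu> using w(3)[OF that] j by (intro smod_mult[OF genid_smod] genid_in)
    then show ?thesis using w j JS sring_mult[OF R] by (auto simp: J'_def mult.commute)
  qed
  have xmu: "x / \<mu> \<in> B" "y / \<mu> \<in> B" if "adm B \<mu>" for B \<mu> using admD(10)[OF that] x_nonunit y_nonunit by auto
  have jA: "j / x ^ r \<in> T" if "j \<in> J" for j using r[OF that] AT by blast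
  have tT: "t \<in> T" using chart_t AT by blast
  have piT: "\<pi> \<in> T" using piA AT by blast
  \<comment> \<open>The homogenization of p: an element of S that is a power of x times \<pi> in the
    chart and a unit times y ^ d at infinity.\<close>
  define H where "H = x ^ d * \<pi>"
  have HS: "H \<in> S" unfolding H_def using homogenize_in[OF p_over order_refl] .
  have Hmu: "H / \<mu> ^ d \<in> B" if h: "adm B \<mu>" for B \<mu>
  proof -
    have "H / \<mu> ^ d = (\<Sum>i\<le>d. poly.coeff p i * (x / \<mu>) ^ (d - i) * (y / \<mu>) ^ i)"
      unfolding H_def hom_p sum_divide_distrib
    proof (rule sum.cong[OF refl])
      fix i assume "i \<in> {..d}"
      then have "\<mu> ^ d = \<mu> ^ (d - i) * \<mu> ^ i" by (auto simp flip: power_add)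
      then show "poly.coeff p i * x ^ (d - i) * y ^ i / \<mu> ^ d = poly.coeff p i * (x / \<mu>) ^ (d - i) * (y / \<mu>) ^ i"
        by (simp add: power_divide)
    qed
    also have "\<dots> \<in> B" using polys_overD[OF p_over] admD(2,3)[OF h] xmu[OF h] by (intro sring_sum sring_rules) auto
    finally show ?thesis .
  qed
  \<comment> \<open>The factor \<pi> ^ K inside H ^ K puts these elements into x ^ N J1 over T. At
    the other points over the maximal ideal they generate the twisted J, with z = x in the chart of
    t and z = y at infinity.\<close>
  have E2: "j * (H ^ K * z ^ M) \<in> J'" if j: "j \<in> J" and z: "z = x \<or> z = y" for j z
  proof (rule J'I[OF j])
    have zS: "z \<in> S" using z x_in y_in by auto
    then show "H ^ K * z ^ M \<in> S" using HS by (intro sring_rules[OF R])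
    have "z / x \<in> T" using z tT x_neq_0 sring_1[OF T.R] by auto
    then have "(j / x ^ r * (z / x) ^ M) * \<pi> ^ K \<in> J1" using jA[OF j] K by (intro smod_mult[OF J1m] sring_rules[OF T.R])
    moreover have "x ^ N = x ^ r * (x ^ d) ^ K * x ^ M" by (simp add: N_def power_add power_mult)
    then have "j * (H ^ K * z ^ M) / x ^ N = (j / x ^ r * (z / x) ^ M) * \<pi> ^ K"
      using x_neq_0 by (simp add: H_def power_mult_distrib power_divide field_simps)
    ultimately show "j * (H ^ K * z ^ M) / x ^ N \<in> J1" by simp
    fix B \<mu> assume h: "adm B \<mu>"
    have "(H / \<mu> ^ d) ^ K * (z / \<mu>) ^ M \<in> B" using Hmu[OF h] xmu[OF h] z by (intro sring_rules admD(2)[OF h]) auto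
    then show "H ^ K * z ^ M / \<mu> ^ (N - r) \<in> B" unfolding NrM(1) by (simp add: power_add power_mult power_divide)
  qed
  \<comment> \<open>These serve the points B not over the maximal ideal, where x or y is a unit, and
    provide the powers of x and y that make J' primary.\<close>
  have E3: "j * z ^ (N - r + K) \<in> J'" if j: "j \<in> J" and z: "z = x \<or> z = y" for j z
  proof (rule J'I[OF j])
    have zS: "z \<in> S" using z x_in y_in by auto
    then show "z ^ (N - r + K) \<in> S" by (intro sring_rules[OF R])
    have "z / x \<in> T" using z tT x_neq_0 sring_1[OF T.R] by auto
    then have "(j / x ^ r * (z / x) ^ (N - r + K)) * x ^ K \<in> J1" using jA[OF j] K by (intro smod_mult[OF J1m] sring_rules[OF T.R])
    moreover have "x ^ N = x ^ r * x ^ (N - r)" using NrM(2) by (metis power_add)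
    then have "j * z ^ (N - r + K) / x ^ N = (j / x ^ r * (z / x) ^ (N - r + K)) * x ^ K"
      using x_neq_0 by (simp add: power_divide power_add)
    ultimately show "j * z ^ (N - r + K) / x ^ N \<in> J1" by simp
    fix B \<mu> assume h: "adm B \<mu>"
    have "(z / \<mu>) ^ (N - r) * z ^ K \<in> B" using xmu[OF h] z zS admD(3)[OF h] by (intro sring_rules admD(2)[OF h]) auto
    then show "z ^ (N - r + K) / \<mu> ^ (N - r) \<in> B" by (simp add: power_add power_divide)
  qed
  \<comment> \<open>Over T these elements generate x ^ N J1, as e is a unit there. At the other
    points three cases remain: J becomes the unit ideal; \<pi> is a unit, so that the choice of e
    helps; or B lies at infinity, where N - m is large enough.\<close>
  have E1: "x ^ N * (e * c) \<in> J'" if c: "c \<in> C" for c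
  proof -
    have qc: "Q c \<in> polys_over S" "e * c = poly (Q c) t" "Polynomial.degree (Q c) \<le> N" using Q[OF c] m[OF c] NrM(3) by auto
    have fS: "x ^ N * (e * c) \<in> S" unfolding qc(2) using homogenize_in[OF qc(1,3)] .
    moreover have "x ^ N * (e * c) / x ^ N \<in> J1"
    proof -
      have "e * c \<in> J1" using smod_mult[OF J1m] c C e AT by blast
      then show ?thesis using x_neq_0 by simp
    qed
    moreover have "x ^ N * (e * c) / \<mu> ^ (N - r) \<in> genid B J" if h: "adm B \<mu>" for B \<mu>
    proof -
      note B = admD[OF h]
      show ?thesis
      proof (cases "nonunits S \<subseteq> nonunits B")
        case False
        then obtain z where z: "z \<in> nonunits S" "z \<notin> nonunits B" by blast
        then have zB: "z \<in> B" using B(3) nonunits_sub[of S] by blast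
        have iz: "z \<noteq> 0" "inverse z \<in> B" using unit_inverse[OF zB z(2)] by auto
        obtain l where "z ^ l \<in> J" using cofin_pow[OF J z(1)] by blast
        then have "inverse z ^ l * z ^ l \<in> genid B J" using smod_mult[OF genid_smod sring_pow[OF B(2) iz(2)] genid_in] by blast
        then have one: "1 \<in> genid B J" using iz by (simp flip: power_mult_distrib)
        have "(z / \<mu>) * inverse z \<in> B" using B(10)[OF z(1)] iz by (intro sring_rules B(2))
        then have "inverse \<mu> \<in> B" using iz by (simp add: field_simps)
        then have "x ^ N * (e * c) * inverse \<mu> ^ (N - r) \<in> B" using sring_mult[OF B(2) _ sring_pow[OF B(2)]] fS B(3) by blast
        then have "(x ^ N * (e * c) * inverse \<mu> ^ (N - r)) * 1 \<in> genid B J" using one by (intro smod_mult[OF genid_smod])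
        then show ?thesis by (simp add: field_simps)
      next
        case over: True
        show ?thesis
        proof (cases "t \<in> B")
          case True
          note o = other_unit[OF B(9,8) over True]
          have pu: "inverse \<pi> \<in> B" "\<pi> \<noteq> 0" using unit_inverse[OF o(2,3)] by auto
          have eJ: "e * (x ^ r * \<pi> ^ L) \<in> genid B J" using e(3) genid_mono[OF o(1) order_refl] by blast
          have "(inverse \<pi> ^ L * c * (x / \<mu>) ^ (N - r)) * (e * (x ^ r * \<pi> ^ L)) \<in> genid B J"
            using pu c C(2) o(1) xmu[OF h] by (intro smod_mult[OF genid_smod _ eJ] sring_rules B(2)) auto
          moreover have "x ^ N = x ^ r * x ^ (N - r)" using NrM(2) by (metis power_add)
          then have "(inverse \<pi> ^ L * c * (x / \<mu>) ^ (N - r)) * (e * (x ^ r * \<pi> ^ L)) = x ^ N * (e * c) / \<mu> ^ (N - r)"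
            using pu by (simp add: power_divide field_simps)
          ultimately show ?thesis by simp
        next
          case False
          have "spr (nonunits S) B" using blowupD(3)[OF B(9)] .
          then have sB: "x / y \<in> B" using spr_chart[OF B(1,3)] False by blast
          have sn: "x / y \<in> nonunits B"
          proof (rule ccontr)
            assume "x / y \<notin> nonunits B"
            then have "inverse (x / y) \<in> B" using unit_inverse[OF sB] by blast
            then show False using False by simp
          qed
          define s where "s = x / y"
          have x_eq: "x = s * y" using y_neq_0 by (simp add: s_def)
          have inf: "y ^ r * s ^ (N - m) \<in> genid B J"
            unfolding s_def using order_at_infinity[OF B(1,3) sB sn JS yk q NrM(4)] .
          define W where "W = (\<Sum>i\<le>m. poly.coeff (Q c) i * s ^ (m - i))"
          have WB: "W \<in> B" unfolding W_def using polys_overD[OF qc(1)] B(3) sB by (intro sring_sum sring_rules B(2)) (auto simp: s_def)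
          have "x ^ N * (e * c) = (\<Sum>i\<le>m. x ^ N * (poly.coeff (Q c) i * t ^ i))"
            unfolding qc(2) poly_altdef_le[OF m[OF c]] by (simp add: sum_distrib_left)
          also have "\<dots> = (\<Sum>i\<le>m. y ^ N * s ^ (N - m) * (poly.coeff (Q c) i * s ^ (m - i)))"
          proof (rule sum.cong[OF refl])
            fix i assume "i \<in> {..m}"
            then have "s ^ N = s ^ (N - m) * s ^ (m - i) * s ^ i" using NrM(3) by (simp flip: power_add)
            moreover have "s * t = 1" using x_neq_0 y_neq_0 by (simp add: s_def)
            then have "s ^ i * t ^ i = 1" by (simp flip: power_mult_distrib)
            ultimately have "s ^ N * t ^ i = s ^ (N - m) * s ^ (m - i)" by (metis mult.assoc mult_1_right)
            moreover have "(s * y) ^ N * (poly.coeff (Q c) i * t ^ i) = y ^ N * poly.coeff (Q c) i * (s ^ N * t ^ i)"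
              unfolding power_mult_distrib by (simp only: mult_ac)
            ultimately have "(s * y) ^ N * (poly.coeff (Q c) i * t ^ i) = y ^ N * s ^ (N - m) * (poly.coeff (Q c) i * s ^ (m - i))"
              by (simp only: mult_ac)
            then show "x ^ N * (poly.coeff (Q c) i * t ^ i) = y ^ N * s ^ (N - m) * (poly.coeff (Q c) i * s ^ (m - i))"
              using x_eq by simp
          qed
          also have "\<dots> = y ^ N * s ^ (N - m) * W" by (simp add: W_def sum_distrib_left)
          finally have f: "x ^ N * (e * c) = y ^ N * s ^ (N - m) * W" .
          have "(W * (y / \<mu>) ^ (N - r)) * (y ^ r * s ^ (N - m)) \<in> genid B J"
            using WB xmu[OF h] by (intro smod_mult[OF genid_smod _ inf] sring_rules B(2))
          moreover have "y ^ N = y ^ r * y ^ (N - r)" using NrM(2) by (metis power_add)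
          then have "(W * (y / \<mu>) ^ (N - r)) * (y ^ r * s ^ (N - m)) = x ^ N * (e * c) / \<mu> ^ (N - r)"
            unfolding f by (simp add: power_divide mult_ac)
          ultimately show ?thesis by simp
        qed
      qed
    qed
    ultimately show ?thesis by (simp add: J'_def)
  qed
  have "cofin S J'"
  proof (rule cofinI[OF J'id])
    show "x ^ (k0 + (N - r + K)) \<in> J'" using E3[OF xk, of x] by (simp add: power_add)
    show "y ^ (k + (N - r + K)) \<in> J'" using E3[OF yk, of y] by (simp add: power_add)
  qed
  moreover have "f / x ^ N \<in> J1" if "f \<in> J'" for f using that by (simp add: J'_def)
  moreover have "x ^ N * w \<in> genid T J'" if w: "w \<in> J1" for w
  proof (rule genid_scale)
    show "w \<in> genid T C" using C w by simp
    show "x ^ N \<noteq> 0" using x_neq_0 by simp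
    fix c assume c: "c \<in> C"
    have ie: "e \<noteq> 0" "inverse e \<in> T" using unit_of_not_n e by auto
    then have "inverse e * (x ^ N * (e * c)) \<in> genid T J'" using E1[OF c] by (intro smod_mult[OF genid_smod] genid_in)
    then show "x ^ N * c \<in> genid T J'" using ie by (simp add: field_simps)
  qed
  moreover have "\<exists>c. c \<noteq> 0 \<and> (\<forall>f\<in>J'. f / c \<in> genid B J) \<and> (\<forall>j\<in>J. c * j \<in> genid B J')"
    if BB: "B \<in> blowup S (nonunits S)" "B \<noteq> T" for B
  proof -
    obtain \<mu> where "\<mu> \<in> nonunits S" "\<mu> \<noteq> 0" "\<forall>b\<in>nonunits S. b / \<mu> \<in> B" using blowupD(3)[OF BB(1)] by (auto simp: spr_def)
    then have h: "adm B \<mu>" using BB by (simp add: adm_def)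
    note B = admD[OF h]
    have "\<mu> ^ (N - r) * j \<in> genid B J'" if j: "j \<in> J" for j
    proof (cases "nonunits S \<subseteq> nonunits B")
      case False
      have "x \<notin> nonunits B \<or> y \<notin> nonunits B"
      proof (rule ccontr)
        assume "\<not> ?thesis"
        then have "nonunits S \<subseteq> nonunits B" unfolding max using smod_subring[OF nonunits_smod[OF B(1)] B(3)] by (intro genid_least) auto
        then show False using False by blast
      qed
      then obtain z where z: "z = x \<or> z = y" "z \<notin> nonunits B" by blast
      then have "z \<in> B" using x_in y_in B(3) by auto
      then have iz: "z \<noteq> 0" "inverse z \<in> B" using unit_inverse z by auto
      have "(\<mu> ^ (N - r) * inverse z ^ (N - r + K)) * (j * z ^ (N - r + K)) \<in> genid B J'"
        using iz B(6) by (intro smod_mult[OF genid_smod _ genid_in[OF E3[OF j z(1)]]] sring_rules B(2))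
      then show ?thesis using iz by (simp add: field_simps)
    next
      case over: True
      show ?thesis
      proof (cases "t \<in> B")
        case True
        note o = other_unit[OF B(9,8) over True]
        have pu: "inverse \<pi> \<in> B" "\<pi> \<noteq> 0" using unit_inverse[OF o(2,3)] by auto
        have "\<mu> / x \<in> B" using chart_frac[OF B(4), of x S] o(1) by (auto simp: chart_adjoin)
        then have "((\<mu> / x) ^ (N - r) * inverse \<pi> ^ K) * (j * (H ^ K * x ^ M)) \<in> genid B J'"
          using pu by (intro smod_mult[OF genid_smod _ genid_in[OF E2[OF j, of x, simplified]]] sring_rules B(2)) auto
        moreover have "((\<mu> / x) ^ (N - r) * inverse \<pi> ^ K) * (j * (H ^ K * x ^ M)) = \<mu> ^ (N - r) * j"
          unfolding NrM(1) H_def using pu x_neq_0 by (simp add: power_mult_distrib power_add power_divide field_simps flip: power_mult)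
        ultimately show ?thesis by simp
      next
        case False
        have "spr (nonunits S) B" using blowupD(3)[OF B(9)] .
        then have sB: "x / y \<in> B" using spr_chart[OF B(1,3)] False by blast
        have sn: "x / y \<in> nonunits B"
        proof (rule ccontr)
          assume "x / y \<notin> nonunits B"
          then have "inverse (x / y) \<in> B" using unit_inverse[OF sB] by blast
          then show False using False by simp
        qed
        define E where "E = H / y ^ d"
        have E: "E \<in> B" "E \<notin> nonunits B" using at_infinity[OF B(1,3) sB sn] by (auto simp: E_def H_def)
        have iE: "inverse E \<in> B" "E \<noteq> 0" using unit_inverse[OF E] by auto
        have HE: "H = E * y ^ d" using y_neq_0 by (simp add: E_def)
        have "\<mu> / y \<in> adjoin S (x / y)" using chart_frac[OF B(4), of y S] regular2.chart_adjoin[OF regular2_swap] by auto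
        then have "\<mu> / y \<in> B" using adjoin_least[OF R B(2,3) sB] by blast
        then have "((\<mu> / y) ^ (N - r) * inverse E ^ K) * (j * (H ^ K * y ^ M)) \<in> genid B J'"
          using iE by (intro smod_mult[OF genid_smod _ genid_in[OF E2[OF j, of y, simplified]]] sring_rules B(2)) auto
        moreover have "((\<mu> / y) ^ (N - r) * inverse E ^ K) * (j * (H ^ K * y ^ M)) = \<mu> ^ (N - r) * j"
          unfolding NrM(1) HE using iE y_neq_0 by (simp add: power_mult_distrib power_add power_divide field_simps flip: power_mult)
        ultimately show ?thesis by simp
      qed
    qed
    moreover have "f / \<mu> ^ (N - r) \<in> genid B J" if "f \<in> J'" for f using that h by (simp add: J'_def)
    moreover have "\<mu> ^ (N - r) \<noteq> 0" using B(7) by simp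
    ultimately show ?thesis by blast
  qed
  ultimately show ?thesis by blast
qed

end

text \<open>The model of a product is thus the join of the models of the factors.\<close>

lemma spr_prod:
  assumes T: "sring T" and ne: "\<exists>a\<in>V. a \<noteq> 0" "\<exists>b\<in>W. b \<noteq> 0"
  shows "spr {a * b | a b. a \<in> V \<and> b \<in> W} T \<longleftrightarrow> spr V T \<and> spr W T" (is "spr ?P T \<longleftrightarrow> _")
proof
  assume "spr ?P T"
  then obtain a b where ab: "a \<in> V" "b \<in> W" "a * b \<noteq> 0" and h: "\<And>c. c \<in> ?P \<Longrightarrow> c / (a * b) \<in> T" unfolding spr_def by blast
  have "v / a \<in> T" if "v \<in> V" for v
  proof -
    have "v * b / (a * b) \<in> T" using h[of "v * b"] that ab by blast
    then show ?thesis using ab by simp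
  qed
  moreover have "w / b \<in> T" if "w \<in> W" for w
  proof -
    have "a * w / (a * b) \<in> T" using h[of "a * w"] that ab by blast
    then show ?thesis using ab by simp
  qed
  ultimately show "spr V T \<and> spr W T" using ab by (auto simp: spr_def)
next
  assume "spr V T \<and> spr W T"
  then obtain a b where ab: "a \<in> V" "a \<noteq> 0" "\<And>v. v \<in> V \<Longrightarrow> v / a \<in> T" "b \<in> W" "b \<noteq> 0" "\<And>w. w \<in> W \<Longrightarrow> w / b \<in> T"
    unfolding spr_def by blast
  have "c / (a * b) \<in> T" if c: "c \<in> ?P" for c
  proof -
    obtain v w where vw: "c = v * w" "v \<in> V" "w \<in> W" using c by blast
    then have "(v / a) * (w / b) \<in> T" using ab by (intro sring_mult[OF T])
    then show ?thesis using vw by simp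
  qed
  then show "spr ?P T" unfolding spr_def using ab by (intro bexI[of _ "a * b"]) auto
qed

context regular2_frac
begin

text \<open>A two-dimensional T dominates S; if the maximal ideal of S were not principal in it,
  \<open>dominating_regular\<close> would give T = S, where J is not principal. In smaller dimension
  T is a field or a discrete valuation ring.\<close>

lemma sregular_fibre:
  assumes T: "T \<in> blowup S J" "sregular T" and J: "\<not> spr J S"
  shows "spr (nonunits S) T"
proof (cases "kdim T = enat 2")
  case True
  obtain u v where uv: "regular2_frac T u v" using overring_regular2[OF T(2) blowupD(2)[OF T(1)] True] by blast
  have "sdom T S" using overring_sdom[OF uv blowupD(2)[OF T(1)]] .
  then show ?thesis using dominating_regular[OF uv] blowupD(3)[OF T(1)] J by blast
next
  case False
  have T': "slocal T" "S \<subseteq> T" "snoeth T" using T blowupD(2)[OF T(1)] by (auto simp: sregular_def)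
  have "\<not> (\<exists>P. sprime T P \<and> P \<noteq> {0} \<and> P \<noteq> nonunits T)" using False overring_kdim_2[OF T'(1,2)] by blast
  then have "kdim T \<le> enat 1" using kdim_le_1[OF T'(1)] by blast
  then obtain z where "nonunits T = genid T {z}" using sregular_principal[OF T(2)] by blast
  then show ?thesis using spr_dvr T' by blast
qed

text \<open>Blowing up the unit ideal gives the localizations of S, and by
  \<open>prime_principal\<close> these are the quotient field, discrete valuation rings and S
  itself. This model is the one chosen at the end of the tree path in
  \<open>desing_through\<close>.\<close>

lemma localization_regular:
  assumes T: "T \<in> blowup S S"
  shows "sregular T"
proof -
  define P where "P = nonunits T \<inter> S"
  have T': "slocal T" "S \<subseteq> T" using blowupD[OF T] by auto
  note L = locz_sdom[OF R T', folded P_def]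
  have SL: "S \<subseteq> locz S P" using locz_incl[OF R L(1)] .
  have "spr S (locz S P)" unfolding spr_def using SL sring_1[OF R] by (intro bexI[of _ 1]) auto
  then have TL: "T = locz S P" using blowup_min[OF T _ SL _ L(2)] sdom_slocal[OF L(2)] by blast
  have N: "snoeth T" unfolding TL using snoeth_locz[OF R L(1) noeth] .
  have RT: "sring T" using T' slocal_sring by blast
  have nT: "nonunits T = {a / b | a b. a \<in> P \<and> b \<in> S - P}" unfolding TL using locz_nonunits[OF R L(1)] .
  consider "P = {0}" | "P = nonunits S" | f where "sprime_elt S f" "P = genid S {f}" using prime_principal[OF L(1)] by blast
  then show ?thesis
  proof cases
    case 1
    have "1 \<in> S - P" using sring_1[OF R] 1 by simp
    then have n0: "nonunits T = {0}" unfolding nT 1 by auto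
    have "kdim T \<le> enat 0"
    proof (rule kdim_le, rule ccontr)
      fix n Q assume c: "schain T n Q" "\<not> n \<le> 0"
      then have "Q 0 \<subset> Q 1" "sprime T (Q 0)" "sprime T (Q 1)" by (auto simp: schain_def)
      moreover have "Q 1 \<subseteq> {0}" using sideal_nonunits[OF RT sprime_sideal sprime_1] calculation n0 by metis
      ultimately show False using smod_0[OF sprime_smod] by blast
    qed
    then have "kdim T = enat (card {})" by (simp add: enat_0)
    then show ?thesis unfolding sregular_def using T'(1) N n0 by (intro conjI exI[of _ "{}"]) (auto simp: genid_empty)
  next
    case 2
    have "locz S P \<subseteq> S" using locz_least[OF R L(1) R order_refl] 2 by blast
    then have "T = S" using TL SL by blast
    then show ?thesis using sregular_S by simp
  next
    case 3
    have f0: "f \<noteq> 0" using 3 by (auto simp: sprime_elt_def)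
    have fP: "f \<in> P" using 3 genid_in by auto
    then have fT: "f \<in> nonunits T" by (auto simp: P_def)
    have n: "nonunits T = genid T {f}"
    proof
      show "genid T {f} \<subseteq> nonunits T" using fT by (intro genid_least nonunits_smod T') auto
      show "nonunits T \<subseteq> genid T {f}"
      proof
        fix z assume "z \<in> nonunits T"
        then obtain a b where ab: "z = a / b" "a \<in> P" "b \<in> S - P" unfolding nT by blast
        then obtain s where s: "s \<in> S" "a = f * s" using 3 genid_sdvd[OF R] by (auto simp: sdvd_def)
        have "s / b \<in> T" unfolding TL using loczI[OF R L(1) s(1) ab(3)] .
        moreover have "z = f * (s / b)" using ab s by simp
        ultimately show "z \<in> genid T {f}" unfolding genid_sdvd[OF RT] sdvd_def by blast
      qed
    qed
    have no: "\<not> (\<exists>Q. sprime T Q \<and> Q \<noteq> {0} \<and> Q \<noteq> nonunits T)"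
    proof
      assume "\<exists>Q. sprime T Q \<and> Q \<noteq> {0} \<and> Q \<noteq> nonunits T"
      then obtain Q where Q: "sprime T Q" "Q \<noteq> {0}" "Q \<noteq> nonunits T" by blast
      have Qm: "smod T Q" using sprime_smod[OF Q(1)] .
      have Qn: "Q \<subseteq> nonunits T" using sideal_nonunits[OF RT sprime_sideal[OF Q(1)] sprime_1[OF Q(1)]] .
      obtain h where h: "h \<in> Q" "h \<noteq> 0" using Q(2) smod_0[OF Qm] by blast
      then have "h \<in> T" using Qn nonunits_sub by blast
      then obtain u i where u: "u \<in> T" "u \<notin> nonunits T" "h = u * f ^ i" using dvr_factor[OF T'(1) N n _ h(2)] by blast
      have fi: "f ^ i \<in> T" "f \<in> T" using fT nonunits_sub sring_pow[OF RT] by blast+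
      have "f ^ i \<in> Q" using sprime_prime[OF Q(1) u(1) fi(1)] h u Qn by blast
      then have "f \<in> Q" using sprime_pow[OF RT Q(1) fi(2)] by blast
      then have "nonunits T \<subseteq> Q" unfolding n using genid_least[OF Qm, of "{f}"] by simp
      then show False using Q Qn by blast
    qed
    have "schain T 1 (\<lambda>i. if i = 0 then {0} else nonunits T)"
      using fT f0 nonunits_0[OF RT] sprime_zero[OF RT] nonunits_sprime[OF T'(1)] by (auto simp: schain_def)
    then have "kdim T = enat (card {f})" using kdim_le_1[OF T'(1) no] kdim_ge[of T 1] by (simp add: order_antisym)
    then show ?thesis unfolding sregular_def using T'(1) N n fT nonunits_sub by (intro conjI exI[of _ "{f}"]) auto
  qed
qed

end

text \<open>A model dominates the model of $I$ iff $I$ becomes principal in each of its points.\<close>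

definition desing :: "'f::field set \<Rightarrow> 'f set \<Rightarrow> 'f set \<Rightarrow> bool" where
  "desing D I J \<longleftrightarrow> (\<forall>T\<in>blowup D J. sregular T \<and> spr I T)"

context quadratic
begin

text \<open>Elements of A outside n are units in B, so the center of B on A lies inside n.\<close>

lemma T_in_center:
  assumes B: "slocal B" "T \<subseteq> B" and C: "C \<in> blowup S (nonunits S)" "sdom B C"
  shows "T \<subseteq> C"
proof -
  have Ax: "A = chart S (nonunits S) x" by (simp add: chart_adjoin)
  have "b / x \<in> B" if "b \<in> nonunits S" for b using chart_frac[OF that, of x S] AT B(2) by (auto simp: chart_adjoin)
  then have Ceq: "C = locz A (nonunits B \<inter> A)" unfolding Ax using center_unique[OF C x_nonunit x_neq_0] by blast
  have AB: "A \<subseteq> B" using AT B by blast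
  note P = locz_sdom(1)[OF chart_sring B(1) AB]
  show ?thesis unfolding Ceq
  proof (rule locz_least[OF chart_sring n_prime locz_sring[OF chart_sring P] locz_incl[OF chart_sring P]])
    fix e assume e: "e \<in> A - n"
    then have "inverse e \<in> B" "e \<noteq> 0" using unit_of_not_n B(2) by auto
    then have "e \<notin> nonunits B" by (auto simp: nonunits_def)
    then show "e \<notin> nonunits (locz A (nonunits B \<inter> A))" using locz_nonunits_int[OF chart_sring P] e by blast
  qed
qed

lemma weak_spr:
  assumes B: "slocal B" "T \<subseteq> B"
  shows "spr (weak r J) B \<longleftrightarrow> spr J B"
proof -
  have xr: "x ^ r \<noteq> 0" "inverse (x ^ r) \<noteq> 0" using x_neq_0 by auto
  have 1: "x ^ r * w \<in> genid B J" if "w \<in> weak r J" for w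
    using that genid_mono[OF B(2) order_refl] by (auto simp: weak_def)
  have 2: "j / x ^ r \<in> genid B (weak r J)" if "j \<in> J" for j
  proof -
    have "j / x ^ r \<in> weak r J" using that xr genid_in by (simp add: weak_def)
    then show ?thesis by (rule genid_in)
  qed
  show ?thesis
  proof
    assume "spr (weak r J) B"
    then show "spr J B" using spr_transfer[OF B(1) xr(2), of "weak r J" J] 1 2 by (simp add: field_simps)
  next
    assume "spr J B"
    then show "spr (weak r J) B" using spr_transfer[OF B(1) xr(1), of J "weak r J"] 1 2 by blast
  qed
qed

text \<open>Above $T$ the model of $J$ is replaced by that of $J_1$.\<close>

lemma desing_step:
  assumes J: "cofin S J" "desing S I J" and npr: "\<not> spr J S"
    and IH: "\<And>K. cofin T K \<Longrightarrow> desing T I K \<Longrightarrow> \<exists>J1. cofin T J1 \<and> desing T I J1 \<and> spr J1 B"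
    and B: "slocal B" "T \<subseteq> B"
  shows "\<exists>J'. cofin S J' \<and> desing S I J' \<and> spr J' B"
proof -
  obtain r q where q: "q \<in> polys_over S" "Polynomial.degree q \<le> r" "x ^ r * poly q t \<in> J" "q \<notin> polys_over (nonunits S)"
    and r: "\<And>j. j \<in> J \<Longrightarrow> j / x ^ r \<in> A" using cofin_order[OF J(1)] by blast
  note wc = weak_cofin[OF J(1) q(1,3,4) r]
  \<comment> \<open>Every point C of this model is a point of the model of J: it dominates some C1
    there, \<open>sregular_fibre\<close> puts C1 over the blowup of the maximal ideal,
    \<open>T_in_center\<close> then shows that C1 contains T, and minimality gives C1 = C.\<close>
  have "desing T I (weak r J)" unfolding desing_def
  proof
    fix C assume C: "C \<in> blowup T (weak r J)"
    note C' = blowupD[OF C]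
    have CS: "S \<subseteq> C" using C' ST by blast
    have "spr J C" using C' weak_spr by blast
    then obtain C1 where C1: "C1 \<in> blowup S J" "sdom C C1" using ex_center[OF C'(1) CS] by blast
    note C1' = blowupD[OF C1(1)]
    have reg: "sregular C1" "spr I C1" using J(2) C1(1) by (auto simp: desing_def)
    then have "spr (nonunits S) C1" using sregular_fibre[OF C1(1) _ npr] by blast
    then obtain C2 where C2: "C2 \<in> blowup S (nonunits S)" "sdom C1 C2" using ex_center[OF C1'(1,2)] by blast
    have "T \<subseteq> C2" using T_in_center[OF C'(1,2) C2(1) sdom_trans[OF C1(2) C2(2)]] .
    then have TC1: "T \<subseteq> C1" using sdom_sub[OF C2(2)] by blast
    then have "spr (weak r J) C1" using weak_spr C1' by blast
    then have "C1 = C" using blowup_min[OF C C1'(1) TC1 _ C1(2)] by blast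
    then show "sregular C \<and> spr I C" using reg by simp
  qed
  then obtain J1 where J1: "cofin T J1" "desing T I J1" "spr J1 B" using IH[OF wc] by blast
  obtain N J' where g: "cofin S J'" "\<And>f. f \<in> J' \<Longrightarrow> f / x ^ N \<in> J1" "\<And>w. w \<in> J1 \<Longrightarrow> x ^ N * w \<in> genid T J'"
    "\<And>B. B \<in> blowup S (nonunits S) \<Longrightarrow> B \<noteq> T \<Longrightarrow> \<exists>c. c \<noteq> 0 \<and> (\<forall>f\<in>J'. f / c \<in> genid B J) \<and> (\<forall>j\<in>J. c * j \<in> genid B J')"
    using glue[OF J(1) q r J1(1)] by metis
  have xN: "x ^ N \<noteq> 0" "inverse (x ^ N) \<noteq> 0" using x_neq_0 by auto
  have over_T: "spr J' C \<longleftrightarrow> spr J1 C" if C: "slocal C" "T \<subseteq> C" for C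
  proof -
    have 1: "f / x ^ N \<in> genid C J1" if "f \<in> J'" for f using g(2)[OF that] by (rule genid_in)
    have 2: "x ^ N * w \<in> genid C J'" if "w \<in> J1" for w using g(3)[OF that] genid_mono[OF C(2) order_refl] by blast
    show ?thesis
    proof
      assume "spr J' C"
      then show "spr J1 C" using spr_transfer[OF C(1) xN(1), of J' J1] 1 2 by blast
    next
      assume "spr J1 C"
      then show "spr J' C" using spr_transfer[OF C(1) xN(2), of J1 J'] 1 2 by (simp add: field_simps)
    qed
  qed
  have over_other: "spr J' C \<longleftrightarrow> spr J C" if C1: "C1 \<in> blowup S (nonunits S)" "C1 \<noteq> T" and C: "slocal C" "C1 \<subseteq> C" for C C1
  proof -
    obtain c where c: "c \<noteq> 0" "\<And>f. f \<in> J' \<Longrightarrow> f / c \<in> genid C1 J" "\<And>j. j \<in> J \<Longrightarrow> c * j \<in> genid C1 J'" using g(4)[OF C1] by blast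
    have c': "inverse c \<noteq> 0" using c by simp
    have 1: "f / c \<in> genid C J" if "f \<in> J'" for f using c(2)[OF that] genid_mono[OF C(2) order_refl] by blast
    have 2: "c * j \<in> genid C J'" if "j \<in> J" for j using c(3)[OF that] genid_mono[OF C(2) order_refl] by blast
    show ?thesis
    proof
      assume "spr J' C"
      then show "spr J C" using spr_transfer[OF C(1) c(1), of J' J] 1 2 by blast
    next
      assume "spr J C"
      then show "spr J' C" using spr_transfer[OF C(1) c', of J J'] 1 2 by (simp add: field_simps)
    qed
  qed
  \<comment> \<open>The maximal ideal is blown up as well. Each point of the new model then lies
    over one point C1 of that blowup, and the cases C1 = T and C1 distinct from T can be compared
    with J1 and J separately.\<close>
  define V where "V = {a * b | a b. a \<in> nonunits S \<and> b \<in> J'}"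
  have J'm: "smod S J'" "J' \<subseteq> S" using cofin_smod[OF g(1)] cofin_sub[OF g(1)] by auto
  have VS: "V \<subseteq> S" using J'm nonunits_sub[of S] by (auto simp: V_def intro!: sring_mult[OF R])
  obtain k l where kl: "x ^ k \<in> J'" "y ^ l \<in> J'" using cofin_pow[OF g(1) x_nonunit] cofin_pow[OF g(1) y_nonunit] by blast
  have "x * x ^ k \<in> V" "y * y ^ l \<in> V" unfolding V_def using kl x_nonunit y_nonunit by blast+
  then have "x ^ Suc k \<in> genid S V" "y ^ Suc l \<in> genid S V" by (auto intro: genid_in)
  then have cof: "cofin S (genid S V)" using cofinI[OF genid_sideal[OF R VS]] by blast
  have ne: "\<exists>a\<in>nonunits S. a \<noteq> 0" "\<exists>b\<in>J'. b \<noteq> 0" using x_nonunit x_neq_0 kl(1) power_not_zero[of x k] by blast+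
  have sprV: "spr V C \<longleftrightarrow> spr (nonunits S) C \<and> spr J' C" if "slocal C" for C
    unfolding V_def using spr_prod[OF slocal_sring[OF that] ne] .
  have "desing S I (genid S V)" unfolding desing_def blowup_genid
  proof
    fix C assume C: "C \<in> blowup S V"
    note C' = blowupD[OF C]
    have spr: "spr (nonunits S) C" "spr J' C" using sprV C' by auto
    obtain C1 where C1: "C1 \<in> blowup S (nonunits S)" "sdom C C1" using ex_center[OF C'(1,2) spr(1)] by blast
    note C1' = blowupD[OF C1(1)]
    show "sregular C \<and> spr I C"
    proof (cases "C1 = T")
      case True
      have TC: "T \<subseteq> C" using C1(2) True sdom_sub by blast
      then have "spr J1 C" using over_T C'(1) spr(2) by blast
      then obtain C2 where C2: "C2 \<in> blowup T J1" "sdom C C2" using ex_center[OF C'(1) TC] by blast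
      note C2' = blowupD[OF C2(1)]
      have "spr J' C2" using over_T C2' by blast
      moreover have "spr (nonunits S) C2" using T_spr spr_mono C2'(2) by blast
      ultimately have "spr V C2" using sprV C2' by blast
      moreover have "S \<subseteq> C2" using ST C2' by blast
      ultimately have "C2 = C" using blowup_min[OF C C2'(1)] C2(2) by blast
      then show ?thesis using J1(2) C2(1) by (auto simp: desing_def)
    next
      case False
      have "spr J C" using over_other[OF C1(1) False C'(1) sdom_sub[OF C1(2)]] spr by blast
      then obtain C2 where C2: "C2 \<in> blowup S J" "sdom C C2" using ex_center[OF C'(1,2)] by blast
      note C2' = blowupD[OF C2(1)]
      have reg: "sregular C2" "spr I C2" using J(2) C2(1) by (auto simp: desing_def)
      then have m: "spr (nonunits S) C2" using sregular_fibre[OF C2(1) _ npr] by blast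
      then obtain C3 where C3: "C3 \<in> blowup S (nonunits S)" "sdom C2 C3" using ex_center[OF C2'(1,2)] by blast
      have "C3 = C1" using blowup_unique[OF C3(1) C1(1) sdom_trans[OF C2(2) C3(2)] C1(2)] .
      then have "spr J' C2" using over_other[OF C1(1) False C2'(1)] sdom_sub[OF C3(2)] C2'(3) by blast
      then have "spr V C2" using sprV C2' m by blast
      then have "C2 = C" using blowup_min[OF C C2'(1,2)] C2(2) by blast
      then show ?thesis using reg by simp
    qed
  qed
  moreover have "spr (genid S V) B"
  proof -
    have "spr J' B" using over_T[OF B] J1(3) by blast
    moreover have "spr (nonunits S) B" using T_spr spr_mono B(2) by blast
    ultimately have "spr V B" using sprV B by blast
    then show ?thesis using spr_genid[OF B(1)] ST B(2) by blast
  qed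
  ultimately show ?thesis using cof by blast
qed

end

text \<open>The induction peels off the first quadratic transform and keeps J arbitrary, since above
  the transform J is replaced by its weak transform. At B the unit ideal is taken. If J is already
  principal in the current ring, J itself works; otherwise \<open>desing_step\<close>
  applies.\<close>

theorem desing_through:
  assumes "quadt\<^sup>*\<^sup>* D B" "\<exists>x y. regular2_frac D x y" "spr I B"
  shows "cofin D J \<Longrightarrow> desing D I J \<Longrightarrow> \<exists>J'. cofin D J' \<and> desing D I J' \<and> spr J' B"
  using assms
proof (induction arbitrary: J rule: converse_rtranclp_induct)
  case base
  then obtain x y where "regular2_frac B x y" by blast
  then interpret B: regular2_frac B x y .
  have "cofin B B" unfolding cofin_def sideal_def using B.smod_S B.R nonunits_sub[of B] sring_pow[OF B.R] by blast
  moreover have "desing B I B" unfolding desing_def using B.localization_regular blowupD(2) spr_mono[OF base(4)] by blast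
  moreover have "spr B B" unfolding spr_def using sring_1[OF B.R] by (intro bexI[of _ 1]) auto
  ultimately show ?case by blast
next
  case (step D T)
  then obtain u v where "regular2_frac D u v" by blast
  note uv = this
  have regT: "\<exists>x y. regular2_frac T x y" using quadt_regular[OF uv step.hyps(1)] .
  have "sdom B T" using quadts_regular[OF step.hyps(2) regT] by blast
  then have B: "slocal B" "T \<subseteq> B" by (auto simp: sdom_def)
  have TD: "D \<subseteq> T" using quadt_sdom[OF uv step.hyps(1)] sdom_sub by blast
  show ?case
  proof (cases "spr J D")
    case True
    then show ?thesis using step.prems spr_mono[of J D B] B(2) TD by blast
  next
    case False
    obtain x y n p where h: "regular2_frac D x y" "smaximal (adjoin D (y / x)) n" "T = locz (adjoin D (y / x)) n"
      "p \<in> polys_over D" "lead_coeff p = 1" "n = genid (adjoin D (y / x)) {x, poly p (y / x)}"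
      "regular2_frac T x (poly p (y / x))" "sdom T D" using quadt_obtain[OF uv step.hyps(1)] by metis
    have "quadratic D x y n p" using h unfolding quadratic_def quadratic_axioms_def by blast
    then interpret Q: quadratic D x y n p .
    show ?thesis using Q.desing_step[OF step.prems(1,2) False] step.IH[OF _ _ regT step.prems(4)] B unfolding h(3) by blast
  qed
qed

section \<open>The minimal desingularization\<close>

lemma minimal_desingularization_points:
  assumes D: "regular2_frac D x y" and I: "cofin D I" "1 \<notin> I" and J: "cofin D J" "1 \<notin> J"
    and N: "\<forall>T\<in>blowup D J. sregular T" "\<forall>T\<in>blowup D J. \<exists>S\<in>blowup D I. sdom T S"
    and min: "\<And>J'. cofin D J' \<Longrightarrow> 1 \<notin> J' \<Longrightarrow> \<forall>T\<in>blowup D J'. sregular T \<Longrightarrow>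
      \<forall>T\<in>blowup D J'. \<exists>S\<in>blowup D I. sdom T S \<Longrightarrow> \<forall>T\<in>blowup D J'. \<exists>S\<in>blowup D J. sdom T S"
  defines "dcp R \<equiv> \<exists>S\<in>blowup D I. kdim S = enat 2 \<and> sdom R S"
  shows "{T \<in> blowup D J. kdim T = enat 2} =
    {R. quadt\<^sup>*\<^sup>* D R \<and> dcp R \<and> (\<forall>R'. quadt\<^sup>*\<^sup>* D R' \<longrightarrow> dcp R' \<longrightarrow> R' \<subseteq> R \<longrightarrow> R' = R)}"
proof -
  interpret D: regular2_frac D x y by fact
  have Dreg: "\<exists>x y. regular2_frac D x y" using D by blast
  have dcp_iff: "dcp R \<longleftrightarrow> spr I R" if R: "regular2_frac R u v" "D \<subseteq> R" for R u v
  proof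
    assume "dcp R"
    then show "spr I R" unfolding dcp_def using blowupD(3) sdom_sub spr_mono by meson
  next
    assume "spr I R"
    moreover have "slocal R" using R regular2.loc regular2_frac.axioms(1) by blast
    ultimately obtain S where S: "S \<in> blowup D I" "sdom R S" using ex_center R(2) by blast
    then show "dcp R" unfolding dcp_def using D.dominated_kdim[OF R(1) S(2) blowupD(2)[OF S(1)]] by blast
  qed
  have reg: "\<exists>u v. regular2_frac R u v" "D \<subseteq> R" if "quadt\<^sup>*\<^sup>* D R" for R
    using quadts_regular[OF that Dreg] sdom_sub by auto
  have dJ: "desing D I J" unfolding desing_def using N blowupD(3) sdom_sub spr_mono by meson
  have key: "\<exists>S\<in>blowup D J. sdom R S" if R: "quadt\<^sup>*\<^sup>* D R" "dcp R" for R
  proof -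
    have "spr I R" using dcp_iff reg[OF R(1)] R(2) by blast
    then obtain J' where J': "cofin D J'" "desing D I J'" "spr J' R" using desing_through[OF R(1) Dreg _ J(1) dJ] by blast
    \<comment> \<open>The unit ideal would make D a point of its model, so I would be principal in
      D, against \<open>cofin_principal\<close>.\<close>
    have "1 \<notin> J'"
    proof
      assume "1 \<in> J'"
      then have "J' = D" using J'(1) sideal_1[OF D.R] by (simp add: cofin_def)
      moreover have "D \<in> blowup D D" unfolding blowup_def using D.loc sdom_sub sring_1[OF D.R] by (auto simp: spr_def intro!: bexI[of _ 1])
      ultimately have "spr I D" using J'(2) by (auto simp: desing_def)
      then show False using D.cofin_principal[OF I] by blast
    qed
    moreover have "\<forall>T\<in>blowup D J'. sregular T" using J'(2) by (simp add: desing_def)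
    moreover have "\<forall>T\<in>blowup D J'. \<exists>S\<in>blowup D I. sdom T S"
    proof
      fix T assume T: "T \<in> blowup D J'"
      then have "spr I T" using J'(2) by (simp add: desing_def)
      then show "\<exists>S\<in>blowup D I. sdom T S" using ex_center[OF blowupD(1,2)[OF T]] by blast
    qed
    ultimately have dom: "\<forall>T\<in>blowup D J'. \<exists>S\<in>blowup D J. sdom T S" using min J'(1) by blast
    have "slocal R" using reg(1)[OF R(1)] regular2.loc regular2_frac.axioms(1) by blast
    then obtain T where "T \<in> blowup D J'" "sdom R T" using ex_center reg(2)[OF R(1)] J'(3) by blast
    then show ?thesis using dom sdom_trans by blast
  qed
  have closed: "quadt\<^sup>*\<^sup>* D T \<and> dcp T \<and> (\<exists>u v. regular2_frac T u v)" if T: "T \<in> blowup D J" "kdim T = enat 2" for T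
  proof -
    obtain u v where uv: "regular2_frac T u v" using D.overring_regular2[OF _ blowupD(2)[OF T(1)] T(2)] N(1) T(1) by blast
    have "sdom T D" using D.overring_sdom[OF uv blowupD(2)[OF T(1)]] .
    then have "quadt\<^sup>*\<^sup>* D T" using factorization[OF Dreg uv] by blast
    moreover have "dcp T" using dcp_iff[OF uv blowupD(2)[OF T(1)]] dJ T(1) by (simp add: desing_def)
    ultimately show ?thesis using uv by blast
  qed
  show ?thesis
  proof (intro equalityI subsetI CollectI)
    fix R assume "R \<in> {T \<in> blowup D J. kdim T = enat 2}"
    then have R: "R \<in> blowup D J" "kdim R = enat 2" by auto
    obtain u v where uv: "regular2_frac R u v" using closed[OF R] by blast
    have "R' = R" if R': "quadt\<^sup>*\<^sup>* D R'" "dcp R'" "R' \<subseteq> R" for R'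
    proof -
      obtain S where S: "S \<in> blowup D J" "sdom R' S" using key[OF R'(1,2)] by blast
      obtain u' v' where uv': "regular2_frac R' u' v'" using reg(1)[OF R'(1)] by blast
      have "sdom R R'" using regular2_frac.overring_sdom[OF uv' uv R'(3)] .
      then have "sdom R S" using S sdom_trans by blast
      then have "R = S" using blowup_unique[OF R(1) S(1) sdom_refl[OF blowupD(1)[OF R(1)]]] by blast
      then show ?thesis using sdom_sub[OF S(2)] R'(3) by blast
    qed
    then show "quadt\<^sup>*\<^sup>* D R \<and> dcp R \<and> (\<forall>R'. quadt\<^sup>*\<^sup>* D R' \<longrightarrow> dcp R' \<longrightarrow> R' \<subseteq> R \<longrightarrow> R' = R)" using closed[OF R] by blast
  next
    fix R assume "R \<in> {R. quadt\<^sup>*\<^sup>* D R \<and> dcp R \<and> (\<forall>R'. quadt\<^sup>*\<^sup>* D R' \<longrightarrow> dcp R' \<longrightarrow> R' \<subseteq> R \<longrightarrow> R' = R)}"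
    then have R: "quadt\<^sup>*\<^sup>* D R" "dcp R" "\<And>R'. quadt\<^sup>*\<^sup>* D R' \<Longrightarrow> dcp R' \<Longrightarrow> R' \<subseteq> R \<Longrightarrow> R' = R" by auto
    obtain u v where uv: "regular2_frac R u v" using reg(1)[OF R(1)] by blast
    obtain S where S: "S \<in> blowup D J" "sdom R S" using key[OF R(1,2)] by blast
    have k: "kdim S = enat 2" using D.dominated_kdim[OF uv S(2) blowupD(2)[OF S(1)]] .
    have "S = R" using R(3) closed[OF S(1) k] sdom_sub[OF S(2)] by blast
    then show "R \<in> blowup D J \<and> kdim R = enat 2" using S k by simp
  qed
qed

definition sheight :: "'f::field set \<Rightarrow> 'f set \<Rightarrow> enat" where
  "sheight S p = Sup {enat n | n. \<exists>P. schain S n P \<and> P n = p}"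

text \<open>A nonzero prime strictly below p gives height at least two, and the dimension inequality
  for overrings of S gives the upper bound.\<close>

lemma (in regular2_frac) overring_sheight_2:
  assumes T: "sring T" "S \<subseteq> T" and p: "sprime T p"
  shows "sheight T p = enat 2 \<longleftrightarrow> (\<exists>P. sprime T P \<and> P \<noteq> {0} \<and> P \<subset> p)"
proof
  assume h: "sheight T p = enat 2"
  have "\<exists>n P. schain T n P \<and> P n = p \<and> n \<ge> 2"
  proof (rule ccontr)
    assume neg: "\<not> ?thesis"
    have "sheight T p \<le> enat 1" unfolding sheight_def
    proof (rule Sup_least)
      fix m assume "m \<in> {enat n | n. \<exists>P. schain T n P \<and> P n = p}"
      then obtain n P where "m = enat n" "schain T n P" "P n = p" by blast
      then show "m \<le> enat 1" using neg by (metis enat_ord_simps(1) not_less_eq_eq numeral_2_eq_2 One_nat_def)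
    qed
    then show False using h by simp
  qed
  then obtain n P where P: "schain T n P" "P n = p" "n \<ge> 2" by blast
  then obtain k where k: "n = Suc (Suc k)" by (metis add_2_eq_Suc le_Suc_ex)
  then have "sprime T (P k)" "sprime T (P (Suc k))" "P k \<subset> P (Suc k)" "P (Suc k) \<subset> p" using P by (auto simp: schain_def)
  note pr = this
  have "0 \<in> P k" using smod_0[OF sprime_smod[OF pr(1)]] .
  then have "P (Suc k) \<noteq> {0}" using pr(3) by auto
  then show "\<exists>P. sprime T P \<and> P \<noteq> {0} \<and> P \<subset> p" using pr(2,4) by (intro exI[of _ "P (Suc k)"] conjI)
next
  assume "\<exists>P. sprime T P \<and> P \<noteq> {0} \<and> P \<subset> p"
  then obtain P where P: "sprime T P" "P \<noteq> {0}" "P \<subset> p" by blast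
  have "{0} \<subset> P" using P smod_0[OF sprime_smod[OF P(1)]] by auto
  then have "schain T 2 (\<lambda>i. if i = 0 then {0} else if i = 1 then P else p)"
    using P p sprime_zero[OF T(1)] by (auto simp: schain_def less_Suc_eq numeral_2_eq_2)
  then have "enat 2 \<le> sheight T p" unfolding sheight_def
    by (intro Sup_upper CollectI exI[of _ 2] conjI refl exI[of _ "\<lambda>i. if i = 0 then {0} else if i = 1 then P else p"]) auto
  moreover have "sheight T p \<le> kdim T" unfolding sheight_def kdim_def by (intro Sup_subset_mono) blast
  ultimately show "sheight T p = enat 2" using overring_kdim_le[OF T] by simp
qed

section \<open>Transfer to a field type\<close>

text \<open>The bijection is onto a whole type of class \<open>field\<close>; that it respects zero,
  one and inverses follows from sums and products.\<close>

locale field_rep = field F for F :: "('a, 'b) ring_scheme" (structure) +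
  fixes h :: "'a \<Rightarrow> 'f::field"
  assumes bij: "bij_betw h (carrier F) UNIV"
    and h_mult: "a \<in> carrier F \<Longrightarrow> b \<in> carrier F \<Longrightarrow> h (a \<otimes> b) = h a * h b"
    and h_add: "a \<in> carrier F \<Longrightarrow> b \<in> carrier F \<Longrightarrow> h (a \<oplus> b) = h a + h b"
begin

lemma inj: "inj_on h (carrier F)" and surj: "h ` carrier F = UNIV"
  using bij by (auto simp: bij_betw_def)

lemma h_eq: "a \<in> carrier F \<Longrightarrow> b \<in> carrier F \<Longrightarrow> h a = h b \<longleftrightarrow> a = b"
  using inj by (auto simp: inj_on_def)

lemma h_zero: "h \<zero> = 0"
proof -
  have "h \<zero> = h \<zero> + h \<zero>" using h_add[of \<zero> \<zero>] by simp
  then show ?thesis by (metis add_cancel_right_right)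
qed

lemma h_one: "h \<one> = 1"
proof -
  have "h \<one> * h \<one> = h \<one>" using h_mult[of \<one> \<one>] by simp
  moreover have "h \<one> \<noteq> 0" using h_eq[of \<one> \<zero>] h_zero by simp
  ultimately show ?thesis by simp
qed

lemma h_minus: "a \<in> carrier F \<Longrightarrow> h (\<ominus> a) = - h a"
  using h_add[of a "\<ominus> a"] by (simp add: r_neg h_zero eq_neg_iff_add_eq_0 add.commute)

lemma h_inv: "a \<in> carrier F \<Longrightarrow> a \<noteq> \<zero> \<Longrightarrow> inv a \<in> carrier F \<and> h (inv a) = inverse (h a)"
proof -
  assume a: "a \<in> carrier F" "a \<noteq> \<zero>"
  then have u: "a \<in> Units F" by (simp add: field_Units)
  then have "h a * h (inv a) = 1" using h_mult[of a "inv a"] a by (simp add: h_one)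
  then show ?thesis using u by (metis Units_inv_closed inverse_unique)
qed

lemma h_mem: "a \<in> carrier F \<Longrightarrow> I \<subseteq> carrier F \<Longrightarrow> h a \<in> h ` I \<longleftrightarrow> a \<in> I"
  using inj_on_image_mem_iff[OF inj] by blast

lemma img_eq: "I \<subseteq> carrier F \<Longrightarrow> J \<subseteq> carrier F \<Longrightarrow> h ` I = h ` J \<longleftrightarrow> I = J"
  using inj_on_image_eq_iff[OF inj] by blast

lemma img_sub: "I \<subseteq> carrier F \<Longrightarrow> J \<subseteq> carrier F \<Longrightarrow> h ` I \<subseteq> h ` J \<longleftrightarrow> I \<subseteq> J"
  using h_mem by blast

lemma img_psub: "I \<subseteq> carrier F \<Longrightarrow> J \<subseteq> carrier F \<Longrightarrow> h ` I \<subset> h ` J \<longleftrightarrow> I \<subset> J"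
  using img_sub img_eq by (metis psubset_eq)

lemma ex_preimage: "I' \<subseteq> h ` S \<Longrightarrow> \<exists>I\<subseteq>S. h ` I = I'"
  unfolding subset_image_iff by blast

lemma preimage: obtains I where "I \<subseteq> carrier F" "h ` I = I'"
  using ex_preimage[of I' "carrier F"] surj by auto

lemma subring_tr: "subring S F \<longleftrightarrow> S \<subseteq> carrier F \<and> sring (h ` S)"
proof
  assume S: "subring S F"
  note E = subringE[OF S]
  have "h a - h b \<in> h ` S" "h a * h b \<in> h ` S" if "a \<in> S" "b \<in> S" for a b
  proof -
    have "h (a \<oplus> \<ominus> b) = h a - h b" "h (a \<otimes> b) = h a * h b" using that E(1) h_add h_minus h_mult by (auto simp: subset_iff)
    then show "h a - h b \<in> h ` S" "h a * h b \<in> h ` S" using that E(5,6,7) by (metis image_eqI)+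
  qed
  moreover have "1 \<in> h ` S" using E(3) h_one by (metis image_eqI)
  ultimately show "S \<subseteq> carrier F \<and> sring (h ` S)" using E(1) by (auto simp: sring_def)
next
  assume S: "S \<subseteq> carrier F \<and> sring (h ` S)"
  then have R: "sring (h ` S)" and SF: "\<And>a. a \<in> S \<Longrightarrow> a \<in> carrier F" by auto
  have mem: "a \<in> carrier F \<Longrightarrow> h a \<in> h ` S \<Longrightarrow> a \<in> S" for a using h_mem S by blast
  show "subring S F"
  proof (rule subringI)
    show "\<one> \<in> S" using mem[of \<one>] sring_1[OF R] h_one by simp
    show "\<ominus> a \<in> S" if "a \<in> S" for a using mem[of "\<ominus> a"] sring_minus[OF R] h_minus SF that by simp
    show "a \<otimes> b \<in> S" if "a \<in> S" "b \<in> S" for a b using mem[of "a \<otimes> b"] sring_mult[OF R] h_mult SF that by simp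
    show "a \<oplus> b \<in> S" if "a \<in> S" "b \<in> S" for a b using mem[of "a \<oplus> b"] sring_add[OF R] h_add SF that by simp
  qed (use S in blast)
qed

context
  fixes S assumes S: "subring S F"
begin

lemma SF: "S \<subseteq> carrier F" and RS: "sring (h ` S)"
  using S subring_tr by auto

lemma cringS: "cring (F \<restriction> S)"
  using subcring_iff[OF SF] subcringI'[OF S] by blast

lemma memS: "a \<in> S \<Longrightarrow> I \<subseteq> S \<Longrightarrow> h a \<in> h ` I \<longleftrightarrow> a \<in> I"
  using h_mem SF by blast

lemma ideal_tr: "ideal I (F \<restriction> S) \<longleftrightarrow> I \<subseteq> S \<and> sideal (h ` S) (h ` I)"
proof
  assume "ideal I (F \<restriction> S)"
  then interpret I: ideal I "F \<restriction> S" .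
  have IS: "I \<subseteq> S" using I.a_subset by simp
  then have IF: "\<And>a. a \<in> I \<Longrightarrow> a \<in> carrier F" using SF by blast
  have sg: "additive_subgroup I (F \<restriction> S)" by (rule I.additive_subgroup_axioms)
  have "\<zero> \<in> I" using additive_subgroup.zero_closed[OF sg] by simp
  then have "0 \<in> h ` I" using h_zero by (metis image_eqI)
  moreover have "h a + h b \<in> h ` I" if "a \<in> I" "b \<in> I" for a b
  proof -
    have "a \<oplus> b \<in> I" using additive_subgroup.a_closed[OF sg that] by simp
    then show ?thesis using h_add[OF IF[OF that(1)] IF[OF that(2)]] by (metis image_eqI)
  qed
  moreover have "h s * h a \<in> h ` I" if "s \<in> S" "a \<in> I" for s a
  proof -
    have "s \<otimes> a \<in> I" "s \<in> carrier F" using I.I_l_closed[of a s] SF that by auto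
    then show ?thesis using h_mult[OF _ IF[OF that(2)]] by (metis image_eqI)
  qed
  ultimately show "I \<subseteq> S \<and> sideal (h ` S) (h ` I)" using IS by (auto simp: sideal_def smod_def)
next
  assume h: "I \<subseteq> S \<and> sideal (h ` S) (h ` I)"
  then have IS: "I \<subseteq> S" and m: "smod (h ` S) (h ` I)" by (auto simp: sideal_def)
  then have IF: "\<And>a. a \<in> I \<Longrightarrow> a \<in> carrier F" and SF': "\<And>a. a \<in> S \<Longrightarrow> a \<in> carrier F" using SF by auto
  have mem: "a \<in> carrier F \<Longrightarrow> h a \<in> h ` I \<Longrightarrow> a \<in> I" for a using h_mem IF by blast
  interpret K: cring "F \<restriction> S" by (rule cringS)
  have mult: "s \<otimes> a \<in> I" if "s \<in> S" "a \<in> I" for s a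
    using mem[of "s \<otimes> a"] smod_mult[OF m, of "h s" "h a"] h_mult[of s a] IF SF' that by auto
  have "subgroup I (add_monoid (F \<restriction> S))"
  proof (rule subgroup.intro)
    show "I \<subseteq> carrier (add_monoid (F \<restriction> S))" using IS by simp
    show "\<one>\<^bsub>add_monoid (F \<restriction> S)\<^esub> \<in> I" using mem[of \<zero>] smod_0[OF m] h_zero by simp
    fix a assume a: "a \<in> I"
    \<comment> \<open>The negative in the restricted ring is reached as a multiple by -1, so closure
      of I under multiples by S suffices.\<close>
    have "\<ominus>\<^bsub>F \<restriction> S\<^esub> a = (\<ominus>\<^bsub>F \<restriction> S\<^esub> \<one>) \<otimes> a" using K.l_minus[of \<one> a] a IS K.one_closed K.l_one[of a] by auto
    moreover have "\<ominus>\<^bsub>F \<restriction> S\<^esub> \<one> \<in> S" using K.a_inv_closed[OF K.one_closed] by simp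
    ultimately show "inv\<^bsub>add_monoid (F \<restriction> S)\<^esub> a \<in> I" using mult a by (simp add: a_inv_def)
    fix b assume b: "b \<in> I"
    show "a \<otimes>\<^bsub>add_monoid (F \<restriction> S)\<^esub> b \<in> I"
      using mem[of "a \<oplus> b"] smod_add[OF m, of "h a" "h b"] h_add[of a b] IF a b by simp
  qed
  moreover have "a \<otimes> s \<in> I" if "s \<in> S" "a \<in> I" for s a using mult[OF that] m_comm[of a s] IF SF' that by simp
  ultimately show "ideal I (F \<restriction> S)" using mult K.ring_axioms by (intro idealI) auto
qed

lemma one_tr: "I \<subseteq> S \<Longrightarrow> 1 \<in> h ` I \<longleftrightarrow> \<one> \<in> I"
  using memS[of \<one> I] h_one subringE(3)[OF S] by simp

lemma ideal_ne: "ideal I (F \<restriction> S) \<Longrightarrow> S \<noteq> I \<longleftrightarrow> \<one> \<notin> I"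
  using ideal.one_imp_carrier[of I "F \<restriction> S"] subringE(3)[OF S] by auto

lemma prime_tr: "primeideal P (F \<restriction> S) \<longleftrightarrow> P \<subseteq> S \<and> sprime (h ` S) (h ` P)"
proof
  assume "primeideal P (F \<restriction> S)"
  then interpret P: primeideal P "F \<restriction> S" .
  have id: "ideal P (F \<restriction> S)" by (rule P.is_ideal)
  then have PS: "P \<subseteq> S" "sideal (h ` S) (h ` P)" using ideal_tr by auto
  have "1 \<notin> h ` P" using P.I_notcarr ideal_ne[OF id] one_tr[OF PS(1)] by simp
  moreover have "a \<in> P \<or> b \<in> P" if "a \<in> S" "b \<in> S" "h a * h b \<in> h ` P" for a b
  proof -
    have "h (a \<otimes> b) \<in> h ` P" using that h_mult SF by (simp add: subset_iff)
    then have "a \<otimes> b \<in> P" using h_mem[of "a \<otimes> b" P] that PS SF by blast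
    then show ?thesis using P.I_prime[of a b] that by simp
  qed
  then have "a' \<in> h ` P \<or> b' \<in> h ` P" if "a' \<in> h ` S" "b' \<in> h ` S" "a' * b' \<in> h ` P" for a' b'
    using that by blast
  ultimately show "P \<subseteq> S \<and> sprime (h ` S) (h ` P)" using PS unfolding sprime_def by blast
next
  assume h: "P \<subseteq> S \<and> sprime (h ` S) (h ` P)"
  then have PS: "P \<subseteq> S" and p: "sprime (h ` S) (h ` P)" by auto
  have id: "ideal P (F \<restriction> S)" using ideal_tr PS sprime_sideal[OF p] by blast
  show "primeideal P (F \<restriction> S)"
  proof (rule primeidealI[OF id cringS])
    show "carrier (F \<restriction> S) \<noteq> P" using ideal_ne[OF id] one_tr[OF PS] sprime_1[OF p] by simp
    fix a b assume ab: "a \<in> carrier (F \<restriction> S)" "b \<in> carrier (F \<restriction> S)" "a \<otimes>\<^bsub>F \<restriction> S\<^esub> b \<in> P"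
    then have "h (a \<otimes> b) \<in> h ` P" by simp
    then have "h a * h b \<in> h ` P" using ab h_mult SF by (simp add: subset_iff)
    then have "h a \<in> h ` P \<or> h b \<in> h ` P" using sprime_prime[OF p, of "h a" "h b"] ab by simp
    then show "a \<in> P \<or> b \<in> P" using ab memS[OF _ PS] by simp
  qed
qed

lemma maximal_tr: "maximalideal M (F \<restriction> S) \<longleftrightarrow> M \<subseteq> S \<and> smaximal (h ` S) (h ` M)"
proof
  assume "maximalideal M (F \<restriction> S)"
  then interpret M: maximalideal M "F \<restriction> S" .
  have id: "ideal M (F \<restriction> S)" by (rule M.is_ideal)
  then have MS: "M \<subseteq> S" "sideal (h ` S) (h ` M)" using ideal_tr by auto
  have "1 \<notin> h ` M" using M.I_notcarr ideal_ne[OF id] one_tr[OF MS(1)] by simp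
  moreover have "I' = h ` M" if I': "sideal (h ` S) I'" "h ` M \<subseteq> I'" "1 \<notin> I'" for I'
  proof -
    obtain I where I: "I \<subseteq> S" "h ` I = I'" using ex_preimage[OF sideal_sub[OF I'(1)]] by blast
    then have "ideal I (F \<restriction> S)" using ideal_tr I' by blast
    moreover have "M \<subseteq> I" using img_sub[of M I] I MS SF I' by auto
    ultimately have "I = M \<or> I = S" using M.I_maximal[of I] I by simp
    moreover have "I \<noteq> S" using I' I one_tr[OF I(1)] subringE(3)[OF S] by auto
    ultimately show ?thesis using I by blast
  qed
  ultimately show "M \<subseteq> S \<and> smaximal (h ` S) (h ` M)" using MS by (auto simp: smaximal_def)
next
  assume h: "M \<subseteq> S \<and> smaximal (h ` S) (h ` M)"
  then have MS: "M \<subseteq> S" and m: "sideal (h ` S) (h ` M)" "1 \<notin> h ` M"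
    "\<And>I. sideal (h ` S) I \<Longrightarrow> h ` M \<subseteq> I \<Longrightarrow> 1 \<notin> I \<Longrightarrow> I = h ` M" by (auto simp: smaximal_def)
  have id: "ideal M (F \<restriction> S)" using ideal_tr MS m by blast
  show "maximalideal M (F \<restriction> S)"
  proof (rule maximalidealI[OF id])
    show "carrier (F \<restriction> S) \<noteq> M" using ideal_ne[OF id] one_tr[OF MS] m by simp
    fix I assume I: "ideal I (F \<restriction> S)" "M \<subseteq> I" "I \<subseteq> carrier (F \<restriction> S)"
    have IS: "I \<subseteq> S" "sideal (h ` S) (h ` I)" using I(1) ideal_tr by auto
    show "I = M \<or> I = carrier (F \<restriction> S)"
    proof (cases "1 \<in> h ` I")
      case True
      then show ?thesis using ideal_ne[OF I(1)] one_tr[OF IS(1)] by auto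
    next
      case False
      then have "h ` I = h ` M" using m(3)[OF IS(2)] I(2) by blast
      then show ?thesis using img_eq[of I M] IS MS SF by auto
    qed
  qed
qed

lemma chain_tr: "prime_chain (F \<restriction> S) n P \<longleftrightarrow> (\<forall>i\<le>n. P i \<subseteq> S) \<and> schain (h ` S) n (\<lambda>i. h ` P i)"
proof -
  have e: "P i \<subset> P (Suc i) \<longleftrightarrow> h ` P i \<subset> h ` P (Suc i)" if "\<forall>i\<le>n. P i \<subseteq> S" "i < n" for i
    using img_psub[of "P i" "P (Suc i)"] that(1)[rule_format, of i] that(1)[rule_format, of "Suc i"] that(2) SF by simp
  have "(\<forall>i<n. P i \<subset> P (Suc i)) \<longleftrightarrow> (\<forall>i<n. h ` P i \<subset> h ` P (Suc i))" if "\<forall>i\<le>n. P i \<subseteq> S"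
    using e[OF that] by simp
  then show ?thesis unfolding prime_chain_def schain_def prime_tr by (meson order_refl)
qed

lemma chain_lift:
  assumes "schain (h ` S) n P'"
  shows "\<exists>P. prime_chain (F \<restriction> S) n P \<and> (\<forall>i\<le>n. P i \<subseteq> S \<and> h ` P i = P' i)"
proof -
  have "\<forall>i. \<exists>I. i \<le> n \<longrightarrow> I \<subseteq> S \<and> h ` I = P' i"
  proof (intro allI)
    fix i
    show "\<exists>I. i \<le> n \<longrightarrow> I \<subseteq> S \<and> h ` I = P' i"
    proof (cases "i \<le> n")
      case True
      then have "P' i \<subseteq> h ` S" using assms sprime_sub by (auto simp: schain_def)
      then show ?thesis using ex_preimage[of "P' i" S] by blast
    qed simp
  qed
  then obtain P where P: "\<And>i. i \<le> n \<Longrightarrow> P i \<subseteq> S \<and> h ` P i = P' i" by metis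
  then have "schain (h ` S) n (\<lambda>i. h ` P i)" using assms by (auto simp: schain_def)
  then show ?thesis using P chain_tr[of n P] by blast
qed

lemma dim_tr: "krull_dim (F \<restriction> S) = kdim (h ` S)"
proof -
  have "(\<exists>P. prime_chain (F \<restriction> S) n P) \<longleftrightarrow> (\<exists>P. schain (h ` S) n P)" for n
  proof
    assume "\<exists>P. prime_chain (F \<restriction> S) n P"
    then obtain P where "prime_chain (F \<restriction> S) n P" ..
    then show "\<exists>P. schain (h ` S) n P" using chain_tr[of n P] by (intro exI[of _ "\<lambda>i. h ` P i"]) simp
  next
    assume "\<exists>P. schain (h ` S) n P"
    then obtain P where "schain (h ` S) n P" ..
    from chain_lift[OF this] show "\<exists>P. prime_chain (F \<restriction> S) n P" by blast
  qed
  then show ?thesis by (simp add: krull_dim_def kdim_def)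
qed

lemma height_tr: "p \<subseteq> S \<Longrightarrow> height (F \<restriction> S) p = sheight (h ` S) (h ` p)"
proof -
  assume p: "p \<subseteq> S"
  have "(\<exists>P. prime_chain (F \<restriction> S) n P \<and> P n = p) \<longleftrightarrow> (\<exists>P. schain (h ` S) n P \<and> P n = h ` p)" for n
  proof
    assume "\<exists>P. schain (h ` S) n P \<and> P n = h ` p"
    then obtain P where "prime_chain (F \<restriction> S) n P" "P n \<subseteq> S" "h ` P n = h ` p" using chain_lift by (metis order_refl)
    then show "\<exists>P. prime_chain (F \<restriction> S) n P \<and> P n = p" using img_eq[of "P n" p] p SF by blast
  next
    assume "\<exists>P. prime_chain (F \<restriction> S) n P \<and> P n = p"
    then obtain P where "prime_chain (F \<restriction> S) n P" "P n = p" by blast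
    then show "\<exists>P. schain (h ` S) n P \<and> P n = h ` p" using chain_tr[of n P] by (intro exI[of _ "\<lambda>i. h ` P i"]) simp
  qed
  then show ?thesis by (simp add: height_def sheight_def)
qed

lemma genid_tr:
  assumes A: "A \<subseteq> S"
  shows "Idl\<^bsub>F \<restriction> S\<^esub> A \<subseteq> S" "h ` (Idl\<^bsub>F \<restriction> S\<^esub> A) = genid (h ` S) (h ` A)"
proof -
  interpret K: cring "F \<restriction> S" by (rule cringS)
  have id: "ideal (Idl\<^bsub>F \<restriction> S\<^esub> A) (F \<restriction> S)" using K.genideal_ideal A by simp
  then show IS: "Idl\<^bsub>F \<restriction> S\<^esub> A \<subseteq> S" using ideal_tr by blast
  have "A \<subseteq> Idl\<^bsub>F \<restriction> S\<^esub> A" using K.genideal_self A by simp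
  then have 1: "genid (h ` S) (h ` A) \<subseteq> h ` (Idl\<^bsub>F \<restriction> S\<^esub> A)"
    using id ideal_tr by (intro genid_least) (auto simp: sideal_def)
  have gs: "sideal (h ` S) (genid (h ` S) (h ` A))" using genid_sideal[OF RS] A by blast
  then obtain G where G: "G \<subseteq> S" "h ` G = genid (h ` S) (h ` A)" using ex_preimage[OF sideal_sub[OF gs]] by blast
  have "ideal G (F \<restriction> S)" using ideal_tr G gs by simp
  moreover have "A \<subseteq> G" using img_sub[of A G] G A SF genid_incl[of "h ` A" "h ` S"] by auto
  ultimately have "Idl\<^bsub>F \<restriction> S\<^esub> A \<subseteq> G" by (auto simp: genideal_def)
  then show "h ` (Idl\<^bsub>F \<restriction> S\<^esub> A) = genid (h ` S) (h ` A)" using 1 G by blast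
qed

lemma noeth_tr: "noetherian_ring (F \<restriction> S) \<longleftrightarrow> snoeth (h ` S)"
proof
  assume "noetherian_ring (F \<restriction> S)"
  then interpret N: noetherian_ring "F \<restriction> S" .
  show "snoeth (h ` S)" unfolding snoeth_def
  proof (intro allI impI)
    fix I' assume I': "sideal (h ` S) I'"
    obtain I where I: "I \<subseteq> S" "h ` I = I'" using ex_preimage[OF sideal_sub[OF I']] by blast
    then have "ideal I (F \<restriction> S)" using ideal_tr I' by blast
    then obtain A where "A \<subseteq> S" "finite A" "I = Idl\<^bsub>F \<restriction> S\<^esub> A" using N.finetely_gen by auto
    then show "\<exists>A. finite A \<and> A \<subseteq> h ` S \<and> I' = genid (h ` S) A" using I genid_tr by (intro exI[of _ "h ` A"]) auto
  qed
next
  assume N: "snoeth (h ` S)"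
  interpret K: cring "F \<restriction> S" by (rule cringS)
  show "noetherian_ring (F \<restriction> S)"
  proof (rule K.noetherian_ringI)
    fix I assume "ideal I (F \<restriction> S)"
    then have I: "I \<subseteq> S" "sideal (h ` S) (h ` I)" using ideal_tr by auto
    then obtain B where B: "finite B" "B \<subseteq> h ` S" "h ` I = genid (h ` S) B" using N by (auto simp: snoeth_def)
    obtain A where A: "A \<subseteq> S" "h ` A = B" using ex_preimage[of B S] B by blast
    have "finite A" using A B inj_on_subset[OF inj] SF finite_imageD by (metis subset_trans)
    moreover have "I = Idl\<^bsub>F \<restriction> S\<^esub> A" using genid_tr[OF A(1)] img_eq[of I "Idl\<^bsub>F \<restriction> S\<^esub> A"] A B I SF by auto
    ultimately show "\<exists>A\<subseteq>carrier (F \<restriction> S). finite A \<and> I = Idl\<^bsub>F \<restriction> S\<^esub> A" using A by auto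
  qed
qed

lemma local_tr:
  assumes L: "slocal (h ` S)"
  shows "local_ring (F \<restriction> S)" "max_ideal (F \<restriction> S) \<subseteq> S" "h ` max_ideal (F \<restriction> S) = nonunits (h ` S)"
proof -
  obtain M where M: "M \<subseteq> S" "h ` M = nonunits (h ` S)" using ex_preimage[OF nonunits_sub, of S] by blast
  have "smaximal (h ` S) (nonunits (h ` S))" unfolding smaximal_def
  proof (intro conjI allI impI)
    show "sideal (h ` S) (nonunits (h ` S))" "1 \<notin> nonunits (h ` S)" using nonunits_sideal[OF L] nonunits_1[OF RS] by auto
    show "I = nonunits (h ` S)" if "sideal (h ` S) I" "nonunits (h ` S) \<subseteq> I" "1 \<notin> I" for I
      using sideal_nonunits[OF RS that(1,3)] that(2) by blast
  qed
  then have mM: "maximalideal M (F \<restriction> S)" using maximal_tr[of M] M by simp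
  have "M' = M" if "maximalideal M' (F \<restriction> S)" for M'
  proof -
    have M': "M' \<subseteq> S" "smaximal (h ` S) (h ` M')" using that maximal_tr[of M'] by auto
    then have "h ` M' \<subseteq> nonunits (h ` S)" using sideal_nonunits[OF RS, of "h ` M'"] by (simp add: smaximal_def)
    then have "nonunits (h ` S) = h ` M'" using M'(2) nonunits_sideal[OF L] nonunits_1[OF RS] by (simp add: smaximal_def)
    then show ?thesis using M M' img_eq[of M' M] SF by auto
  qed
  note uniq = this
  have "\<exists>!M. maximalideal M (F \<restriction> S)" using mM uniq by (rule ex1I)
  moreover have "max_ideal (F \<restriction> S) = M" unfolding max_ideal_def using mM uniq by (rule the_equality)
  ultimately show "local_ring (F \<restriction> S)" "max_ideal (F \<restriction> S) \<subseteq> S" "h ` max_ideal (F \<restriction> S) = nonunits (h ` S)"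
    using cringS M by (auto simp: local_ring_def)
qed

text \<open>By the ascending chain condition every nonunit lies in some maximal ideal, and there is
  only one. Hence the nonunits are closed under addition.\<close>

lemma noeth_local_slocal:
  assumes L: "local_ring (F \<restriction> S)" and N: "snoeth (h ` S)"
  shows "slocal (h ` S)"
proof -
  obtain M where M: "maximalideal M (F \<restriction> S)" "\<And>M'. maximalideal M' (F \<restriction> S) \<Longrightarrow> M' = M" using L by (auto simp: local_ring_def)
  have Mid: "sideal (h ` S) (h ` M)" "1 \<notin> h ` M" using M(1) maximal_tr[of M] by (simp_all add: smaximal_def)
  have in_M: "a \<in> h ` M" if a: "a \<in> nonunits (h ` S)" for a
  proof -
    have aS: "a \<in> h ` S" using a nonunits_sub by blast
    have id: "sideal (h ` S) (genid (h ` S) {a})" using genid_sideal[OF RS, of "{a}"] aS by simp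
    have "1 \<notin> genid (h ` S) {a}"
    proof
      assume "1 \<in> genid (h ` S) {a}"
      then obtain s where "s \<in> h ` S" "1 = s * a" unfolding genid_single[OF RS] by blast
      then have "1 \<in> nonunits (h ` S)" using nonunits_mult[OF RS _ a, of s] by simp
      then show False using nonunits_1[OF RS] by blast
    qed
    then obtain M' where M': "smaximal (h ` S) M'" "genid (h ` S) {a} \<subseteq> M'" using ex_smaximal[OF RS N id] by blast
    have "M' \<subseteq> h ` S" using M'(1) by (auto simp: smaximal_def sideal_def)
    then obtain M1 where M1: "M1 \<subseteq> S" "h ` M1 = M'" using ex_preimage[of M' S] by blast
    have "maximalideal M1 (F \<restriction> S)" using maximal_tr[of M1] M1 M' by simp
    then have "M' = h ` M" using M(2) M1 by blast
    then show ?thesis using M'(2) genid_in[of a "{a}"] by blast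
  qed
  have "a + b \<in> nonunits (h ` S)" if "a \<in> nonunits (h ` S)" "b \<in> nonunits (h ` S)" for a b
    using smod_add[OF sideal_smod[OF Mid(1)] in_M[OF that(1)] in_M[OF that(2)]] sideal_nonunits[OF RS Mid] by blast
  then show ?thesis using RS by (auto simp: slocal_def)
qed

lemma regular_tr: "regular_local_ring (F \<restriction> S) \<longleftrightarrow> sregular (h ` S)"
proof
  assume r: "regular_local_ring (F \<restriction> S)"
  then have N: "snoeth (h ` S)" using noeth_tr by (auto simp: regular_local_ring_def)
  have L: "slocal (h ` S)" using noeth_local_slocal[OF _ N] r by (auto simp: regular_local_ring_def)
  obtain A where A: "A \<subseteq> S" "finite A" "enat (card A) = krull_dim (F \<restriction> S)" "max_ideal (F \<restriction> S) = Idl\<^bsub>F \<restriction> S\<^esub> A"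
    using r unfolding regular_local_ring_def by auto
  have "card (h ` A) = card A" using card_image inj_on_subset[OF inj] A SF by (metis subset_trans)
  then show "sregular (h ` S)" unfolding sregular_def
  proof (intro conjI exI[of _ "h ` A"] L N)
    show "h ` A \<subseteq> h ` S" "finite (h ` A)" "enat (card (h ` A)) = kdim (h ` S)" using A dim_tr \<open>card (h ` A) = card A\<close> by auto
    show "nonunits (h ` S) = genid (h ` S) (h ` A)" using local_tr(3)[OF L] genid_tr(2)[OF A(1)] A(4) by simp
  qed
next
  assume "sregular (h ` S)"
  then obtain B where L: "slocal (h ` S)" and N: "snoeth (h ` S)"
    and B: "B \<subseteq> h ` S" "finite B" "enat (card B) = kdim (h ` S)" "nonunits (h ` S) = genid (h ` S) B"
    by (auto simp: sregular_def)
  obtain A where A: "A \<subseteq> S" "h ` A = B" using ex_preimage[of B S] B by blast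
  have iA: "inj_on h A" using inj_on_subset[OF inj] A SF by blast
  have "max_ideal (F \<restriction> S) = Idl\<^bsub>F \<restriction> S\<^esub> A"
    using img_eq[of "max_ideal (F \<restriction> S)" "Idl\<^bsub>F \<restriction> S\<^esub> A"] local_tr(2,3)[OF L] genid_tr[OF A(1)] A B SF by auto
  then show "regular_local_ring (F \<restriction> S)" unfolding regular_local_ring_def
  proof (intro conjI exI[of _ A] local_tr(1)[OF L])
    show "noetherian_ring (F \<restriction> S)" using noeth_tr N by simp
    show "A \<subseteq> carrier (F \<restriction> S)" "finite A" "enat (card A) = krull_dim (F \<restriction> S)"
      using A B finite_image_iff[OF iA] card_image[OF iA] dim_tr by auto
  qed
qed

lemma h_pow: "a \<in> S \<Longrightarrow> h (a [^]\<^bsub>F \<restriction> S\<^esub> (k::nat)) = h a ^ k"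
proof (induction k)
  case 0
  interpret K: cring "F \<restriction> S" by (rule cringS)
  show ?case using h_one by simp
next
  case (Suc k)
  interpret K: cring "F \<restriction> S" by (rule cringS)
  have "a [^]\<^bsub>F \<restriction> S\<^esub> k \<in> S" using K.nat_pow_closed[of a k] Suc by simp
  then show ?case using Suc h_mult[of "a [^]\<^bsub>F \<restriction> S\<^esub> k" a] SF by (simp add: subset_iff mult.commute)
qed

lemma pow_in: "a \<in> S \<Longrightarrow> a [^]\<^bsub>F \<restriction> S\<^esub> (k::nat) \<in> S"
proof -
  interpret K: cring "F \<restriction> S" by (rule cringS)
  show "a \<in> S \<Longrightarrow> a [^]\<^bsub>F \<restriction> S\<^esub> (k::nat) \<in> S" using K.nat_pow_closed[of a k] by simp
qed

lemma prod_tr: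
  assumes I: "ideal I (F \<restriction> S)" and J: "ideal J (F \<restriction> S)"
  shows "I \<cdot>\<^bsub>F \<restriction> S\<^esub> J \<subseteq> S" "h ` (I \<cdot>\<^bsub>F \<restriction> S\<^esub> J) = genid (h ` S) {a * b | a b. a \<in> h ` I \<and> b \<in> h ` J}"
proof -
  interpret K: cring "F \<restriction> S" by (rule cringS)
  have id: "ideal (I \<cdot>\<^bsub>F \<restriction> S\<^esub> J) (F \<restriction> S)" using K.ideal_prod_is_ideal[OF I J] .
  then show PS: "I \<cdot>\<^bsub>F \<restriction> S\<^esub> J \<subseteq> S" using ideal_tr by blast
  have IJ: "I \<subseteq> carrier F" "J \<subseteq> carrier F" using I J ideal_tr SF by blast+
  show "h ` (I \<cdot>\<^bsub>F \<restriction> S\<^esub> J) = genid (h ` S) {a * b | a b. a \<in> h ` I \<and> b \<in> h ` J}" (is "_ = genid _ ?Q")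
  proof
    show "genid (h ` S) ?Q \<subseteq> h ` (I \<cdot>\<^bsub>F \<restriction> S\<^esub> J)"
    proof (rule genid_least)
      show "smod (h ` S) (h ` (I \<cdot>\<^bsub>F \<restriction> S\<^esub> J))" using id ideal_tr by (simp add: sideal_def)
      show "?Q \<subseteq> h ` (I \<cdot>\<^bsub>F \<restriction> S\<^esub> J)"
      proof clarsimp
        fix a b assume ab: "a \<in> I" "b \<in> J"
        then have "a \<otimes> b \<in> I \<cdot>\<^bsub>F \<restriction> S\<^esub> J" using ideal_prod.prod[of a I b J "F \<restriction> S"] by simp
        moreover have "h (a \<otimes> b) = h a * h b" using ab IJ h_mult by blast
        ultimately show "h a * h b \<in> h ` (I \<cdot>\<^bsub>F \<restriction> S\<^esub> J)" by (metis image_eqI)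
      qed
    qed
    have "h z \<in> genid (h ` S) ?Q" if "z \<in> I \<cdot>\<^bsub>F \<restriction> S\<^esub> J" for z
      using that
    proof (induction rule: ideal_prod.induct)
      case (prod i j)
      then have "h (i \<otimes> j) = h i * h j" using h_mult IJ by blast
      then show ?case using prod by (auto intro!: genid_in)
    next
      case (sum s1 s2)
      then have "h (s1 \<oplus> s2) = h s1 + h s2" using h_add PS SF by blast
      then show ?case using sum smod_add[OF genid_smod] by simp
    qed
    then show "h ` (I \<cdot>\<^bsub>F \<restriction> S\<^esub> J) \<subseteq> genid (h ` S) ?Q" by blast
  qed
qed

end

text \<open>Having 0 in P keeps the denominators nonzero, and there \<open>inv\<close> corresponds
  to \<open>inverse\<close>.\<close>

lemma loc_tr:
  assumes A: "A \<subseteq> carrier F" and P: "P \<subseteq> A" "0 \<in> h ` P"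
  shows "localize F A P \<subseteq> carrier F" "h ` localize F A P = locz (h ` A) (h ` P)"
proof -
  have z: "\<zero> \<in> P" using P h_mem[of \<zero> P] A h_zero by auto
  have inv: "inv y \<in> carrier F \<and> h (inv y) = inverse (h y)" if "y \<in> A - P" for y
    using that z A h_inv[of y] by auto
  show "localize F A P \<subseteq> carrier F" unfolding localize_def using A inv by blast
  have hx: "h (x \<otimes> inv y) = h x / h y" if "x \<in> A" "y \<in> A - P" for x y
    using inv[OF that(2)] that A h_mult[of x "inv y"] by (auto simp: divide_inverse)
  have d: "h ` (A - P) = h ` A - h ` P" using inj_on_image_set_diff[OF inj] A P by blast
  show "h ` localize F A P = locz (h ` A) (h ` P)"
  proof
    show "h ` localize F A P \<subseteq> locz (h ` A) (h ` P)"
    proof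
      fix w assume "w \<in> h ` localize F A P"
      then obtain x y where "w = h (x \<otimes> inv y)" "x \<in> A" "y \<in> A - P" unfolding localize_def by blast
      then show "w \<in> locz (h ` A) (h ` P)" unfolding locz_def d[symmetric] using hx by blast
    qed
    show "locz (h ` A) (h ` P) \<subseteq> h ` localize F A P"
    proof
      fix w assume "w \<in> locz (h ` A) (h ` P)"
      then obtain x y where xy: "w = h x / h y" "x \<in> A" "y \<in> A - P" unfolding locz_def d[symmetric] by blast
      then have "w = h (x \<otimes> inv y)" using hx by simp
      then show "w \<in> h ` localize F A P" unfolding localize_def using xy by blast
    qed
  qed
qed

lemma gen_tr:
  assumes H: "H \<subseteq> carrier F"
  shows "subring (generate_ring F H) F" "h ` generate_ring F H = ringgen (h ` H)"
proof -
  show sub: "subring (generate_ring F H) F" using generate_ring_is_subring[OF H] .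
  obtain G where G: "G \<subseteq> carrier F" "h ` G = ringgen (h ` H)" by (rule preimage)
  have "subring G F" using subring_tr G ringgen_sring by simp
  moreover have "H \<subseteq> G" using img_sub[OF H G(1)] G(2) ringgen_incl[of "h ` H"] by simp
  ultimately have "generate_ring F H \<subseteq> G" using generate_ring_min_subring1[OF H] by blast
  moreover have "ringgen (h ` H) \<subseteq> h ` generate_ring F H"
  proof (rule ringgen_least)
    show "sring (h ` generate_ring F H)" using sub subring_tr by blast
    show "h ` H \<subseteq> h ` generate_ring F H" using generate_ring.incl[of _ H F] by blast
  qed
  ultimately show "h ` generate_ring F H = ringgen (h ` H)" using G by blast
qed

lemma dom_tr:
  assumes S: "S \<subseteq> carrier F" "slocal (h ` S)" and T: "T \<subseteq> carrier F" "slocal (h ` T)"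
  shows "dominates F T S \<longleftrightarrow> sdom (h ` T) (h ` S)"
proof -
  have sub: "subring S F" "subring T F" using subring_tr S T slocal_sring by auto
  note LS = local_tr[OF sub(1) S(2)] and LT = local_tr[OF sub(2) T(2)]
  have "S \<subseteq> T \<longleftrightarrow> h ` S \<subseteq> h ` T" using img_sub S T by blast
  moreover have "max_ideal (F \<restriction> T) \<inter> S = max_ideal (F \<restriction> S) \<longleftrightarrow> nonunits (h ` T) \<inter> h ` S = nonunits (h ` S)"
  proof -
    have "h ` (max_ideal (F \<restriction> T) \<inter> S) = nonunits (h ` T) \<inter> h ` S"
      using inj_on_image_Int[OF inj subset_trans[OF LT(2) T(1)] S(1)] LT(3) by simp
    moreover have "max_ideal (F \<restriction> T) \<inter> S \<subseteq> carrier F" "max_ideal (F \<restriction> S) \<subseteq> carrier F" using LS(2) S(1) by auto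
    ultimately show ?thesis using img_eq[of "max_ideal (F \<restriction> T) \<inter> S" "max_ideal (F \<restriction> S)"] LS(3) by simp
  qed
  ultimately show ?thesis unfolding dominates_def sdom_iff using LS LT S T by simp
qed

text \<open>Regularity of S enters through \<open>overring_sheight_2\<close>, which translates the
  condition that the maximal ideal has height two.\<close>

lemma quad_tr:
  assumes S: "S \<subseteq> carrier F" and reg: "regular2_frac (h ` S) x y"
  shows "quadratic_transform F S T \<longleftrightarrow> T \<subseteq> carrier F \<and> quadt (h ` S) (h ` T)"
proof -
  interpret D: regular2_frac "h ` S" x y by fact
  have sub: "subring S F" using subring_tr S D.R by blast
  define m where "m = max_ideal (F \<restriction> S)"
  note L = local_tr[OF sub D.loc, folded m_def]
  have mid: "ideal m (F \<restriction> S)" using ideal_tr[OF sub] L D.loc nonunits_sideal by simp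
  define Q where "Q = {b * c | b c. b \<in> nonunits (h ` S) \<and> c \<in> nonunits (h ` S)}"
  have Q: "m \<cdot>\<^bsub>F \<restriction> S\<^esub> m \<subseteq> S" "h ` (m \<cdot>\<^bsub>F \<restriction> S\<^esub> m) = genid (h ` S) Q"
    using prod_tr[OF sub mid mid] L(3) by (auto simp: Q_def)
  define A where "A a = generate_ring F (S \<union> {x \<otimes> inv a | x. x \<in> m})" for a
  have a_iff: "a \<in> m - m \<cdot>\<^bsub>F \<restriction> S\<^esub> m \<longleftrightarrow> h a \<in> nonunits (h ` S) \<and> h a \<notin> genid (h ` S) Q" if "a \<in> carrier F" for a
    using h_mem[OF that, of m] h_mem[OF that, of "m \<cdot>\<^bsub>F \<restriction> S\<^esub> m"] L(2,3) Q S by auto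
  have A: "subring (A a) F" "h ` A a = chart (h ` S) (nonunits (h ` S)) (h a)" "h ` S \<subseteq> h ` A a"
    if a: "a \<in> carrier F" "h a \<notin> genid (h ` S) Q" for a
  proof -
    have "h a \<noteq> 0" using a smod_0[OF genid_smod] by metis
    then have a0: "inv a \<in> carrier F" "h (inv a) = inverse (h a)" using h_inv[OF a(1)] h_zero by auto
    have mF: "m \<subseteq> carrier F" using L S by blast
    have hm: "h ` {x \<otimes> inv a | x. x \<in> m} = {b / h a | b. b \<in> nonunits (h ` S)}"
    proof -
      have "h (b \<otimes> inv a) = h b / h a" if "b \<in> m" for b using a0 h_mult[of b "inv a"] that mF by (auto simp: divide_inverse)
      then show ?thesis unfolding L(3)[symmetric] by (auto simp: image_iff) metis+
    qed
    have H: "S \<union> {x \<otimes> inv a | x. x \<in> m} \<subseteq> carrier F" using S mF a0 by blast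
    show "subring (A a) F" unfolding A_def using gen_tr[OF H] by blast
    show hA: "h ` A a = chart (h ` S) (nonunits (h ` S)) (h a)" unfolding A_def gen_tr(2)[OF H] chart_def image_Un hm ..
    show "h ` S \<subseteq> h ` A a" unfolding hA by (rule chart_sub)
  qed
  have step: "(maximalideal n (F \<restriction> A a) \<and> height (F \<restriction> A a) n = 2 \<and> T = localize F (A a) n) \<longleftrightarrow>
     n \<subseteq> A a \<and> smaximal (h ` A a) (h ` n) \<and> (\<exists>P. sprime (h ` A a) P \<and> P \<noteq> {0} \<and> P \<subset> h ` n) \<and>
       T \<subseteq> carrier F \<and> h ` T = locz (h ` A a) (h ` n)"
    if a: "a \<in> carrier F" "h a \<notin> genid (h ` S) Q" for a n
  proof (cases "n \<subseteq> A a \<and> smaximal (h ` A a) (h ` n)")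
    case True
    have Ar: "sring (h ` A a)" "A a \<subseteq> carrier F" using A(1)[OF a] subring_tr by auto
    have np: "sprime (h ` A a) (h ` n)" using smaximal_sprime[OF Ar(1)] True by blast
    have ht: "height (F \<restriction> A a) n = 2 \<longleftrightarrow> (\<exists>P. sprime (h ` A a) P \<and> P \<noteq> {0} \<and> P \<subset> h ` n)"
      using height_tr[OF A(1)[OF a], of n] D.overring_sheight_2[OF Ar(1) A(3)[OF a] np] True by (simp add: numeral_eq_enat)
    have l: "localize F (A a) n \<subseteq> carrier F" "h ` localize F (A a) n = locz (h ` A a) (h ` n)"
      using loc_tr[OF Ar(2), of n] True smod_0[OF sprime_smod[OF np]] by auto
    have "T = localize F (A a) n \<longleftrightarrow> T \<subseteq> carrier F \<and> h ` T = locz (h ` A a) (h ` n)"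
      using img_eq[of T "localize F (A a) n"] l by auto
    then show ?thesis using maximal_tr[OF A(1)[OF a], of n] ht True by blast
  next
    case False
    then show ?thesis using maximal_tr[OF A(1)[OF a], of n] by blast
  qed
  show ?thesis
  proof
    assume "quadratic_transform F S T"
    then obtain a n where an: "a \<in> m - m \<cdot>\<^bsub>F \<restriction> S\<^esub> m" "maximalideal n (F \<restriction> A a) \<and> height (F \<restriction> A a) n = 2 \<and> T = localize F (A a) n"
      unfolding quadratic_transform_def Let_def m_def[symmetric] A_def[symmetric] by blast
    have aF: "a \<in> carrier F" using an L S by blast
    have ha: "h a \<in> nonunits (h ` S)" "h a \<notin> genid (h ` S) Q" using a_iff[OF aF] an(1) by auto
    have "n \<subseteq> A a \<and> smaximal (h ` A a) (h ` n) \<and> (\<exists>P. sprime (h ` A a) P \<and> P \<noteq> {0} \<and> P \<subset> h ` n) \<and>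
       T \<subseteq> carrier F \<and> h ` T = locz (h ` A a) (h ` n)" using step[OF aF ha(2), of n] an(2) by simp
    then show "T \<subseteq> carrier F \<and> quadt (h ` S) (h ` T)" unfolding quadt_def using ha unfolding A(2)[OF aF ha(2)] Q_def by blast
  next
    assume T: "T \<subseteq> carrier F \<and> quadt (h ` S) (h ` T)"
    then obtain a' n' where a': "a' \<in> nonunits (h ` S)" "a' \<notin> genid (h ` S) Q"
      "smaximal (chart (h ` S) (nonunits (h ` S)) a') n'" "\<exists>P. sprime (chart (h ` S) (nonunits (h ` S)) a') P \<and> P \<noteq> {0} \<and> P \<subset> n'"
      "h ` T = locz (chart (h ` S) (nonunits (h ` S)) a') n'" unfolding quadt_def Q_def by blast
    obtain a where a: "a \<in> carrier F" "h a = a'" using surj by (metis UNIV_I imageE)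
    have Aa: "h ` A a = chart (h ` S) (nonunits (h ` S)) a'" using A(2)[OF a(1)] a a' by simp
    obtain n where n: "n \<subseteq> A a" "h ` n = n'" using ex_preimage[of n' "A a"] a'(3) unfolding Aa[symmetric] smaximal_def sideal_def by blast
    have "maximalideal n (F \<restriction> A a) \<and> height (F \<restriction> A a) n = 2 \<and> T = localize F (A a) n"
      using step[OF a(1), of n] a a' n T unfolding Aa by simp
    moreover have "a \<in> m - m \<cdot>\<^bsub>F \<restriction> S\<^esub> m" using a_iff[OF a(1)] a a' by simp
    ultimately show "quadratic_transform F S T"
      unfolding quadratic_transform_def Let_def m_def[symmetric] A_def[symmetric] by blast
  qed
qed

lemma tree_tr:
  assumes D: "D \<subseteq> carrier F" and reg: "\<exists>x y. regular2_frac (h ` D) x y"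
  shows "R \<in> quadratic_tree F D \<longleftrightarrow> R \<subseteq> carrier F \<and> quadt\<^sup>*\<^sup>* (h ` D) (h ` R)"
proof
  assume "R \<in> quadratic_tree F D"
  then show "R \<subseteq> carrier F \<and> quadt\<^sup>*\<^sup>* (h ` D) (h ` R)"
  proof induction
    case base
    then show ?case using D by simp
  next
    case (step S T)
    then obtain x y where "regular2_frac (h ` S) x y" using quadts_regular reg by blast
    then have "T \<subseteq> carrier F \<and> quadt (h ` S) (h ` T)" using quad_tr step by blast
    then show ?case using step rtranclp.rtrancl_into_rtrancl[of quadt] by blast
  qed
next
  have "quadt\<^sup>*\<^sup>* D' R' \<Longrightarrow> D' = h ` D \<Longrightarrow> \<forall>R. R \<subseteq> carrier F \<longrightarrow> h ` R = R' \<longrightarrow> R \<in> quadratic_tree F D" for D' R'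
  proof (induction rule: rtranclp_induct)
    case base
    then show ?case using img_eq D quadratic_tree.base by metis
  next
    case (step S' T')
    show ?case
    proof (intro allI impI)
      fix T assume T: "T \<subseteq> carrier F" "h ` T = T'"
      obtain S where S: "S \<subseteq> carrier F" "h ` S = S'" by (rule preimage)
      then have S1: "S \<in> quadratic_tree F D" using step by blast
      obtain x y where "regular2_frac (h ` S) x y" using quadts_regular[of D' S'] reg step S by blast
      then have "quadratic_transform F S T" using quad_tr[OF S(1)] T step.hyps(2) S(2) by blast
      then show "T \<in> quadratic_tree F D" using quadratic_tree.step S1 by blast
    qed
  qed
  then show "R \<subseteq> carrier F \<and> quadt\<^sup>*\<^sup>* (h ` D) (h ` R) \<Longrightarrow> R \<in> quadratic_tree F D" by blast
qed

text \<open>Since h is a bijection, pulling back along it matches the sets of subrings of the field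
  type with those of F.\<close>

definition points :: "'f set set \<Rightarrow> 'a set set" where
  "points M = {S. S \<subseteq> carrier F \<and> h ` S \<in> M}"

lemma chart_tr:
  assumes D: "D \<subseteq> carrier F" and a: "\<And>i. i \<le> n \<Longrightarrow> a i \<in> D - {\<zero>}" and i: "i \<le> n"
  shows "subring (affine_chart F D n a i) F" "h ` affine_chart F D n a i = chart (h ` D) (h ` a ` {..n}) (h (a i))"
proof -
  have aF: "j \<le> n \<Longrightarrow> a j \<in> carrier F" for j using a D by blast
  have ai: "inv (a i) \<in> carrier F" "h (inv (a i)) = inverse (h (a i))" using h_inv[of "a i"] a[OF i] aF[OF i] by auto
  have H: "D \<union> {a j \<otimes> inv (a i) | j. j \<le> n} \<subseteq> carrier F" using D aF ai by blast
  have "h ` {a j \<otimes> inv (a i) | j. j \<le> n} = {b / h (a i) | b. b \<in> h ` a ` {..n}}"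
  proof -
    have "h (a j \<otimes> inv (a i)) = h (a j) / h (a i)" if "j \<le> n" for j using ai h_mult[of "a j"] aF[OF that] by (auto simp: divide_inverse)
    then show ?thesis by (auto simp: image_iff) metis+
  qed
  then show "subring (affine_chart F D n a i) F" "h ` affine_chart F D n a i = chart (h ` D) (h ` a ` {..n}) (h (a i))"
    unfolding affine_chart_def chart_def using gen_tr[OF H] by (auto simp: image_Un)
qed

lemma charts_points:
  assumes D: "D \<subseteq> carrier F" and a: "\<And>i. i \<le> n \<Longrightarrow> a i \<in> D - {\<zero>}"
  shows "{localize F (affine_chart F D n a i) \<pp> | i \<pp>. i \<le> n \<and> primeideal \<pp> (F \<restriction> affine_chart F D n a i)} =
    points (blowup (h ` D) (h ` a ` {..n}))" (is "?L = _")
proof (intro equalityI subsetI)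
  fix S assume "S \<in> ?L"
  then obtain i p where ip: "i \<le> n" "primeideal p (F \<restriction> affine_chart F D n a i)" "S = localize F (affine_chart F D n a i) p" by blast
  have c: "subring (affine_chart F D n a i) F" "h ` affine_chart F D n a i = chart (h ` D) (h ` a ` {..n}) (h (a i))"
    using chart_tr[of D n a i] D a ip(1) by auto
  have p: "p \<subseteq> affine_chart F D n a i" "sprime (h ` affine_chart F D n a i) (h ` p)" using prime_tr[OF c(1)] ip by auto
  have l: "S \<subseteq> carrier F" "h ` S = locz (h ` affine_chart F D n a i) (h ` p)"
    unfolding ip(3) using loc_tr[OF subringE(1)[OF c(1)] p(1)] smod_0[OF sprime_smod[OF p(2)]] by auto
  have "a i \<in> carrier F" "a i \<noteq> \<zero>" using a[OF ip(1)] D by auto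
  then have "h (a i) \<noteq> 0" using h_eq[of "a i" \<zero>] h_zero by simp
  moreover have "h (a i) \<in> h ` a ` {..n}" using ip(1) by blast
  ultimately have "h ` S \<in> blowup (h ` D) (h ` a ` {..n})" using p(2) unfolding blowup_charts l(2) unfolding c(2) by blast
  then show "S \<in> points (blowup (h ` D) (h ` a ` {..n}))" using l(1) by (simp add: points_def)
next
  fix S assume "S \<in> points (blowup (h ` D) (h ` a ` {..n}))"
  then have S: "S \<subseteq> carrier F" "h ` S \<in> blowup (h ` D) (h ` a ` {..n})" by (auto simp: points_def)
  then obtain i p' where ip: "i \<le> n" "sprime (chart (h ` D) (h ` a ` {..n}) (h (a i))) p'" "h ` S = locz (chart (h ` D) (h ` a ` {..n}) (h (a i))) p'"
    unfolding blowup_charts by blast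
  have c: "subring (affine_chart F D n a i) F" "h ` affine_chart F D n a i = chart (h ` D) (h ` a ` {..n}) (h (a i))"
    using chart_tr[of D n a i] D a ip(1) by auto
  obtain p where p: "p \<subseteq> affine_chart F D n a i" "h ` p = p'" using ex_preimage[of p' "affine_chart F D n a i"] sprime_sub[OF ip(2)] unfolding c(2) by blast
  have "primeideal p (F \<restriction> affine_chart F D n a i)" using prime_tr[OF c(1)] p ip(2) unfolding c(2) by blast
  moreover have "S = localize F (affine_chart F D n a i) p"
    using img_eq[OF S(1), of "localize F (affine_chart F D n a i) p"] loc_tr[OF subringE(1)[OF c(1)] p(1)] smod_0[OF sprime_smod[OF ip(2)]] p(2) ip(3) c(2) by simp
  ultimately show "S \<in> ?L" using ip(1) by blast
qed

text \<open>Being primary with radical the maximal ideal amounts to being proper and containing a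
  power of every nonunit. Conversely, a finite generating set is numbered after removing 0 from it,
  because the definition of a model asks for nonzero generators.\<close>

lemma model_tr:
  assumes D: "D \<subseteq> carrier F" and reg: "regular2_frac (h ` D) x y"
  shows "projective_model F D M \<longleftrightarrow> (\<exists>J. cofin (h ` D) J \<and> 1 \<notin> J \<and> M = points (blowup (h ` D) J))"
proof -
  interpret B: regular2_frac "h ` D" x y by fact
  have sub: "subring D F" using subring_tr D B.R by blast
  note L = local_tr[OF sub B.loc]
  show ?thesis
  proof
    assume "projective_model F D M"
    then obtain n a where a: "\<And>i. i \<le> n \<Longrightarrow> a i \<in> D - {\<zero>}"
      and pr: "primary_ideal (F \<restriction> D) (Idl\<^bsub>F \<restriction> D\<^esub> (a ` {..n}))"
      and rad: "radical (F \<restriction> D) (Idl\<^bsub>F \<restriction> D\<^esub> (a ` {..n})) = max_ideal (F \<restriction> D)"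
      and M: "M = {localize F (affine_chart F D n a i) \<pp> | i \<pp>. i \<le> n \<and> primeideal \<pp> (F \<restriction> affine_chart F D n a i)}"
      unfolding projective_model_def by blast
    have aD: "a ` {..n} \<subseteq> D" using a by blast
    note G = genid_tr[OF sub aD]
    define I where "I = Idl\<^bsub>F \<restriction> D\<^esub> (a ` {..n})"
    have I: "I \<subseteq> D" "h ` I = genid (h ` D) (h ` a ` {..n})" using G by (auto simp: I_def)
    have "cofin (h ` D) (h ` I)" unfolding cofin_def
    proof (intro conjI ballI)
      show "sideal (h ` D) (h ` I)" unfolding I(2) using genid_sideal[OF B.R image_mono[OF aD]] .
      fix z assume "z \<in> nonunits (h ` D)"
      then obtain z' where z': "z' \<in> max_ideal (F \<restriction> D)" "z = h z'" using L(3) by blast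
      then obtain k :: nat where k: "z' \<in> D" "z' [^]\<^bsub>F \<restriction> D\<^esub> k \<in> I" using rad unfolding radical_def I_def by auto
      then have "h (z' [^]\<^bsub>F \<restriction> D\<^esub> k) \<in> h ` I" by blast
      then show "\<exists>k. z ^ k \<in> h ` I" using h_pow[OF sub k(1)] z' by auto
    qed
    moreover have "1 \<notin> h ` I"
    proof
      assume "1 \<in> h ` I"
      then have "\<one> \<in> I" using one_tr[OF sub I(1)] by blast
      moreover have "ideal I (F \<restriction> D)" using pr by (simp add: primary_ideal_def I_def)
      ultimately have "I = D" using ideal_ne[OF sub] by blast
      then show False using pr by (simp add: primary_ideal_def I_def)
    qed
    moreover have "M = points (blowup (h ` D) (h ` I))" unfolding M I(2) blowup_genid by (rule charts_points[OF D a])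
    ultimately show "\<exists>J. cofin (h ` D) J \<and> 1 \<notin> J \<and> M = points (blowup (h ` D) J)" by blast
  next
    assume "\<exists>J. cofin (h ` D) J \<and> 1 \<notin> J \<and> M = points (blowup (h ` D) J)"
    then obtain J where J: "cofin (h ` D) J" "1 \<notin> J" and M: "M = points (blowup (h ` D) J)" by blast
    have Jid: "sideal (h ` D) J" using J by (simp add: cofin_def)
    then have Jm: "smod (h ` D) J" and JD: "J \<subseteq> h ` D" by (auto simp: sideal_def)
    obtain G0 where G0: "finite G0" "J = genid (h ` D) G0" using B.noeth Jid by (auto simp: snoeth_def)
    define G where "G = G0 - {0}"
    have GJ: "J = genid (h ` D) G"
    proof
      show "genid (h ` D) G \<subseteq> J" unfolding G0(2) G_def by (rule genid_mono) auto
      have "G0 \<subseteq> genid (h ` D) G" using genid_incl[of G "h ` D"] smod_0[OF genid_smod[of "h ` D" G]] by (auto simp: G_def)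
      then show "J \<subseteq> genid (h ` D) G" unfolding G0(2) using genid_least[OF genid_smod] by blast
    qed
    obtain l where "x ^ l \<in> J" using cofin_pow[OF J(1) B.x_nonunit] by blast
    then have "J \<noteq> {0}" using power_not_zero[OF B.x_neq_0] by blast
    then have "G \<noteq> {}" using GJ genid_empty by metis
    moreover have "finite G" using G0 by (simp add: G_def)
    ultimately obtain k g where kg: "G = g ` {i::nat. i < k}" "k \<noteq> 0" using finite_imp_nat_seg_image_inj_on[of G] by auto
    then obtain n where "k = Suc n" by (metis not0_implies_Suc)
    then have g: "G = g ` {..n}" using kg(1) by (simp add: less_Suc_eq_le atMost_def)
    have "\<exists>a. a \<in> D - {\<zero>} \<and> h a = g i" if i: "i \<le> n" for i
    proof -
      have gi: "g i \<in> G" using g i by blast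
      then have "g i \<in> h ` D" "g i \<noteq> 0" using JD genid_incl[of G "h ` D"] GJ by (auto simp: G_def)
      then show ?thesis using h_zero by auto
    qed
    then obtain a where a: "\<And>i. i \<le> n \<Longrightarrow> a i \<in> D - {\<zero>} \<and> h (a i) = g i" by metis
    have hG: "h ` a ` {..n} = G" unfolding g using a by force
    have aD: "a ` {..n} \<subseteq> D" using a by blast
    note Ga = genid_tr[OF sub aD]
    define I where "I = Idl\<^bsub>F \<restriction> D\<^esub> (a ` {..n})"
    have I: "I \<subseteq> D" "h ` I = J" using Ga by (auto simp: I_def hG GJ)
    have Iid: "ideal I (F \<restriction> D)" using ideal_tr[OF sub] I Jid by blast
    have mem: "b \<in> D \<Longrightarrow> b \<in> I \<longleftrightarrow> h b \<in> J" for b using memS[OF sub _ I(1)] I(2) by blast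
    have "primary_ideal (F \<restriction> D) I" unfolding primary_ideal_def
    proof (intro conjI ballI impI Iid)
      show "I \<noteq> carrier (F \<restriction> D)" using ideal_ne[OF sub Iid] one_tr[OF sub I(1)] I(2) J(2) by auto
      fix u v assume uv: "u \<in> carrier (F \<restriction> D)" "v \<in> carrier (F \<restriction> D)" "u \<otimes>\<^bsub>F \<restriction> D\<^esub> v \<in> I"
      then have uvD: "u \<in> D" "v \<in> D" "u \<in> carrier F" "v \<in> carrier F" using D by auto
      have "u \<otimes> v \<in> I" using uv(3) by simp
      then have "h (u \<otimes> v) \<in> J" using I(2) by blast
      then have huv: "h u * h v \<in> J" using h_mult[OF uvD(3,4)] by simp
      show "u \<in> I \<or> (\<exists>k::nat. v [^]\<^bsub>F \<restriction> D\<^esub> k \<in> I)"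
      proof (cases "h v \<in> nonunits (h ` D)")
        case True
        then obtain k where "h v ^ k \<in> J" using cofin_pow[OF J(1)] by blast
        then have "v [^]\<^bsub>F \<restriction> D\<^esub> k \<in> I" using mem[OF pow_in[OF sub uvD(2)]] h_pow[OF sub uvD(2)] by simp
        then show ?thesis by blast
      next
        case False
        then have "inverse (h v) \<in> h ` D" "h v \<noteq> 0" using unit_inverse[OF imageI[OF uvD(2), of h]] by auto
        then have "inverse (h v) * (h u * h v) \<in> J" using smod_mult[OF Jm _ huv] by blast
        moreover have "inverse (h v) * (h u * h v) = h u" using \<open>h v \<noteq> 0\<close> by simp
        ultimately have "h u \<in> J" by simp
        then show ?thesis using mem[OF uvD(1)] by blast
      qed
    qed
    moreover have "radical (F \<restriction> D) I = max_ideal (F \<restriction> D)"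
    proof -
      have "z \<in> radical (F \<restriction> D) I \<longleftrightarrow> z \<in> max_ideal (F \<restriction> D)" if z: "z \<in> D" for z
      proof -
        have "z \<in> radical (F \<restriction> D) I \<longleftrightarrow> (\<exists>k::nat. h z ^ k \<in> J)"
          unfolding radical_def using z mem[OF pow_in[OF sub z]] h_pow[OF sub z] by auto
        also have "\<dots> \<longleftrightarrow> h z \<in> nonunits (h ` D)"
        proof
          assume "\<exists>k::nat. h z ^ k \<in> J"
          then obtain k where "h z ^ k \<in> J" by blast
          then have "h z ^ k \<in> nonunits (h ` D)" using sideal_nonunits[OF B.R Jid J(2)] by blast
          then show "h z \<in> nonunits (h ` D)" using unit_pow[OF B.loc, of "h z" k] z by blast
        qed (use cofin_pow[OF J(1)] in blast)
        also have "\<dots> \<longleftrightarrow> z \<in> max_ideal (F \<restriction> D)" unfolding L(3)[symmetric] using memS[OF sub z L(2)] .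
        finally show ?thesis .
      qed
      moreover have "radical (F \<restriction> D) I \<subseteq> D" by (auto simp: radical_def)
      ultimately show ?thesis using L(2) by blast
    qed
    moreover have "M = {localize F (affine_chart F D n a i) \<pp> | i \<pp>. i \<le> n \<and> primeideal \<pp> (F \<restriction> affine_chart F D n a i)}"
      using charts_points[OF D, of n a] a unfolding M GJ blowup_genid hG by simp
    ultimately show "projective_model F D M" unfolding projective_model_def I_def using a by blast
  qed
qed

end

section \<open>The theorem for a field represented by a type\<close>

lemma sregular_regular2:
  assumes S: "sregular S" "kdim S = enat 2" "quot_full S"
  shows "\<exists>x y. regular2_frac S x y"
proof -
  have S': "slocal S" "snoeth S" using S by (auto simp: sregular_def)
  obtain A where A: "card A = 2" "nonunits S = genid S A" using S by (auto simp: sregular_def)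
  then obtain x y where "A = {x, y}" by (auto simp: card_2_iff)
  moreover have "\<exists>P. sprime S P \<and> P \<noteq> {0} \<and> P \<noteq> nonunits S"
    using kdim_le_1[OF S'(1)] S(2) by fastforce
  ultimately have "regular2_frac S x y" using A S' S(3) by unfold_locales auto
  then show ?thesis by blast
qed

context field_rep
begin

lemma quot_full_tr:
  assumes S: "S \<subseteq> carrier F" and fr: "fractions F S = carrier F"
  shows "quot_full (h ` S)"
  unfolding quot_full_def
proof
  fix z
  obtain w where w: "w \<in> carrier F" "h w = z" using surj by (metis UNIV_I imageE)
  then obtain a b where ab: "w = a \<otimes> inv b" "a \<in> S" "b \<in> S - {\<zero>}" unfolding fr[symmetric] fractions_def by blast
  then have b: "b \<in> carrier F" "b \<noteq> \<zero>" and a: "a \<in> carrier F" using S by auto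
  then have "z = h a / h b" using h_inv[OF b] h_mult[of a "inv b"] w ab by (simp add: divide_inverse)
  moreover have "h b \<noteq> 0" using h_eq[of b \<zero>] b h_zero by simp
  ultimately show "\<exists>a\<in>h ` S. \<exists>b\<in>h ` S. b \<noteq> 0 \<and> z = a / b" using ab by blast
qed

lemma pointsD:
  assumes "T \<in> points (blowup D' J)"
  shows "T \<subseteq> carrier F" "h ` T \<in> blowup D' J" "subring T F" "slocal (h ` T)"
  using assms blowupD(1)[of "h ` T"] subring_tr slocal_sring by (auto simp: points_def)

lemma model_dominates_tr:
  "model_dominates F (points (blowup D' J)) (points (blowup D' I)) \<longleftrightarrow>
     (\<forall>T\<in>blowup D' J. \<exists>S\<in>blowup D' I. sdom T S)"
proof
  assume m: "model_dominates F (points (blowup D' J)) (points (blowup D' I))"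
  show "\<forall>T\<in>blowup D' J. \<exists>S\<in>blowup D' I. sdom T S"
  proof
    fix T' assume T': "T' \<in> blowup D' J"
    obtain T where T: "T \<subseteq> carrier F" "h ` T = T'" by (rule preimage)
    then have Tp: "T \<in> points (blowup D' J)" using T' by (simp add: points_def)
    then obtain S where S: "S \<in> points (blowup D' I)" "dominates F T S" using m unfolding model_dominates_def by blast
    then have "sdom T' (h ` S)" using dom_tr[OF pointsD(1,4)[OF S(1)] pointsD(1,4)[OF Tp]] T by simp
    then show "\<exists>S\<in>blowup D' I. sdom T' S" using pointsD(2)[OF S(1)] by blast
  qed
next
  assume d: "\<forall>T\<in>blowup D' J. \<exists>S\<in>blowup D' I. sdom T S"
  show "model_dominates F (points (blowup D' J)) (points (blowup D' I))" unfolding model_dominates_def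
  proof
    fix T assume T: "T \<in> points (blowup D' J)"
    then obtain S' where S': "S' \<in> blowup D' I" "sdom (h ` T) S'" using pointsD(2)[OF T] d by blast
    obtain S where S: "S \<subseteq> carrier F" "h ` S = S'" by (rule preimage)
    then have Sp: "S \<in> points (blowup D' I)" using S' by (simp add: points_def)
    then have "dominates F T S" using dom_tr[OF pointsD(1,4)[OF Sp] pointsD(1,4)[OF T]] S S' by simp
    then show "\<exists>S\<in>points (blowup D' I). dominates F T S" using Sp by blast
  qed
qed

lemma nonsingular_tr: "nonsingular_model F (points (blowup D' J)) \<longleftrightarrow> (\<forall>T\<in>blowup D' J. sregular T)"
proof
  assume m: "nonsingular_model F (points (blowup D' J))"
  show "\<forall>T\<in>blowup D' J. sregular T"
  proof
    fix T' assume T': "T' \<in> blowup D' J"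
    obtain T where T: "T \<subseteq> carrier F" "h ` T = T'" by (rule preimage)
    then have Tp: "T \<in> points (blowup D' J)" using T' by (simp add: points_def)
    then show "sregular T'" using m regular_tr[OF pointsD(3)[OF Tp]] T by (auto simp: nonsingular_model_def)
  qed
next
  assume r: "\<forall>T\<in>blowup D' J. sregular T"
  show "nonsingular_model F (points (blowup D' J))" unfolding nonsingular_model_def
  proof
    fix T assume T: "T \<in> points (blowup D' J)"
    then show "regular_local_ring (F \<restriction> T)" using r regular_tr[OF pointsD(3)[OF T]] pointsD(2)[OF T] by simp
  qed
qed

lemma closed_points_tr: "closed_points F (points (blowup D' J)) = points {T \<in> blowup D' J. kdim T = enat 2}"
proof -
  have "krull_dim (F \<restriction> T) = 2 \<longleftrightarrow> kdim (h ` T) = enat 2" if "T \<in> points (blowup D' J)" for T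
    using dim_tr[OF pointsD(3)[OF that]] by (simp add: numeral_eq_enat)
  then show ?thesis by (auto simp: closed_points_def points_def)
qed

theorem minimal_desingularization_tree:
  assumes D: "subring D F" "fractions F D = carrier F" "regular_local_ring (F \<restriction> D)" "krull_dim (F \<restriction> D) = 2"
    and M: "projective_model F D M" and N: "minimal_desingularization F D M N"
  shows "closed_points F N =
    {R \<in> quadratic_tree F D. dominates_closed_point F M R \<and>
       (\<forall>R' \<in> quadratic_tree F D. dominates_closed_point F M R' \<and> R' \<subseteq> R \<longrightarrow> R' = R)}"
proof -
  have DF: "D \<subseteq> carrier F" by (rule subringE(1)[OF D(1)])
  have "kdim (h ` D) = enat 2" using D(4) dim_tr[OF D(1)] by (simp add: numeral_eq_enat)
  then obtain x y where B: "regular2_frac (h ` D) x y"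
    using sregular_regular2[OF _ _ quot_full_tr[OF DF D(2)]] D(3) regular_tr[OF D(1)] by blast
  have ex: "\<exists>x y. regular2_frac (h ` D) x y" using B by blast
  note model = model_tr[OF DF B]
  obtain I where I: "cofin (h ` D) I" "1 \<notin> I" "M = points (blowup (h ` D) I)" using M model by blast
  have des: "desingularization F D M N'"
    if "cofin (h ` D) J" "1 \<notin> J" "N' = points (blowup (h ` D) J)" "\<forall>T\<in>blowup (h ` D) J. sregular T"
      "\<forall>T\<in>blowup (h ` D) J. \<exists>S\<in>blowup (h ` D) I. sdom T S" for J N'
    unfolding desingularization_def that(3) I(3) nonsingular_tr model_dominates_tr using that model by blast
  have "projective_model F D N" using N by (simp add: minimal_desingularization_def desingularization_def)
  then obtain J where J: "cofin (h ` D) J" "1 \<notin> J" "N = points (blowup (h ` D) J)" using model by blast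
  have NJ: "\<forall>T\<in>blowup (h ` D) J. sregular T" "\<forall>T\<in>blowup (h ` D) J. \<exists>S\<in>blowup (h ` D) I. sdom T S"
    using N unfolding minimal_desingularization_def desingularization_def J(3) I(3) nonsingular_tr model_dominates_tr by auto
  have min: "\<forall>T\<in>blowup (h ` D) J'. \<exists>S\<in>blowup (h ` D) J. sdom T S"
    if "cofin (h ` D) J'" "1 \<notin> J'" "\<forall>T\<in>blowup (h ` D) J'. sregular T"
      "\<forall>T\<in>blowup (h ` D) J'. \<exists>S\<in>blowup (h ` D) I. sdom T S" for J'
  proof -
    have "model_dominates F (points (blowup (h ` D) J')) N"
      using N des[OF that(1,2) refl that(3,4)] unfolding minimal_desingularization_def by blast
    then show ?thesis unfolding J(3) model_dominates_tr .
  qed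
  define dcp where "dcp R \<longleftrightarrow> (\<exists>S\<in>blowup (h ` D) I. kdim S = enat 2 \<and> sdom R S)" for R
  have main: "{T\<in>blowup (h ` D) J. kdim T = enat 2} = {R. quadt\<^sup>*\<^sup>* (h ` D) R \<and> dcp R \<and>
      (\<forall>R'. quadt\<^sup>*\<^sup>* (h ` D) R' \<longrightarrow> dcp R' \<longrightarrow> R' \<subseteq> R \<longrightarrow> R' = R)}"
    unfolding dcp_def by (rule minimal_desingularization_points[OF B I(1,2) J(1,2) NJ min])
  note tree = tree_tr[OF DF ex]
  have dom: "dominates_closed_point F M R \<longleftrightarrow> dcp (h ` R)" if R: "R \<in> quadratic_tree F D" for R
  proof -
    have R': "R \<subseteq> carrier F" "slocal (h ` R)" using R tree quadts_regular[OF _ ex] sdom_slocal by blast+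
    have e: "dominates F R S \<longleftrightarrow> sdom (h ` R) (h ` S)" if "S \<in> points (blowup (h ` D) I)" for S
      using dom_tr[OF pointsD(1,4)[OF that] R'] .
    show ?thesis
    proof
      assume "dominates_closed_point F M R"
      then obtain S where S: "S \<subseteq> carrier F" "h ` S \<in> blowup (h ` D) I" "kdim (h ` S) = enat 2" "dominates F R S"
        unfolding dominates_closed_point_def I(3) closed_points_tr unfolding points_def by blast
      then have "sdom (h ` R) (h ` S)" using e[of S] by (simp add: points_def)
      then show "dcp (h ` R)" using S unfolding dcp_def by (intro bexI[of _ "h ` S"] conjI)
    next
      assume "dcp (h ` R)"
      then obtain S' where S': "S' \<in> blowup (h ` D) I" "kdim S' = enat 2" "sdom (h ` R) S'" unfolding dcp_def by blast
      obtain S where S: "S \<subseteq> carrier F" "h ` S = S'" by (rule preimage)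
      then have "dominates F R S" using e[of S] S' by (simp add: points_def)
      then show "dominates_closed_point F M R"
        unfolding dominates_closed_point_def I(3) closed_points_tr unfolding points_def using S S' by blast
    qed
  qed
  have "R \<in> closed_points F N \<longleftrightarrow> R \<in> quadratic_tree F D \<and> dominates_closed_point F M R \<and>
       (\<forall>R' \<in> quadratic_tree F D. dominates_closed_point F M R' \<and> R' \<subseteq> R \<longrightarrow> R' = R)" for R
  proof -
    have "R \<in> closed_points F N \<longleftrightarrow> R \<subseteq> carrier F \<and> h ` R \<in> {T\<in>blowup (h ` D) J. kdim T = enat 2}"
      unfolding J(3) closed_points_tr unfolding points_def by blast
    also have "\<dots> \<longleftrightarrow> R \<in> quadratic_tree F D \<and> dcp (h ` R) \<and>
        (\<forall>R'. quadt\<^sup>*\<^sup>* (h ` D) R' \<longrightarrow> dcp R' \<longrightarrow> R' \<subseteq> h ` R \<longrightarrow> R' = h ` R)" unfolding main using tree[of R] by blast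
    also have "\<dots> \<longleftrightarrow> R \<in> quadratic_tree F D \<and> dcp (h ` R) \<and>
       (\<forall>R' \<in> quadratic_tree F D. dcp (h ` R') \<and> R' \<subseteq> R \<longrightarrow> R' = R)" (is "_ \<and> _ \<and> ?P \<longleftrightarrow> _ \<and> _ \<and> ?Q")
    proof (intro conj_cong refl iffI ballI impI allI)
      assume RQ: "R \<in> quadratic_tree F D"
      have RF: "R \<subseteq> carrier F" using RQ tree by blast
      { fix R' assume a: ?P "R' \<in> quadratic_tree F D" "dcp (h ` R') \<and> R' \<subseteq> R"
        then have R'F: "R' \<subseteq> carrier F" "quadt\<^sup>*\<^sup>* (h ` D) (h ` R')" using tree[of R'] by auto
        then have "h ` R' = h ` R" using a by (meson image_mono)
        then show "R' = R" using img_eq[OF R'F(1) RF] by simp }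
      { fix R' assume a: ?Q "quadt\<^sup>*\<^sup>* (h ` D) R'" "dcp R'" "R' \<subseteq> h ` R"
        obtain R1 where R1: "R1 \<subseteq> R" "h ` R1 = R'" using ex_preimage[OF a(4)] by blast
        then have "R1 \<in> quadratic_tree F D" using tree[of R1] RF a(2) by blast
        then show "R' = h ` R" using a(1,3) R1 by blast }
    qed
    also have "\<dots> \<longleftrightarrow> R \<in> quadratic_tree F D \<and> dominates_closed_point F M R \<and>
       (\<forall>R' \<in> quadratic_tree F D. dominates_closed_point F M R' \<and> R' \<subseteq> R \<longrightarrow> R' = R)" using dom by blast
    finally show ?thesis .
  qed
  then show ?thesis by blast
qed

end

text \<open>A field given by a record need not be the image of a type of class $\mathit{field}$, and types cannot
  depend on it. But one type suffices: if the theorem has a counterexample over the carrier type at hand, then a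
  fixed choice of one can be turned into a type, and the theorem for field types refutes it. The
  field with two elements serves when there is nothing to choose.\<close>

definition counterexample :: "('a, 'b) ring_scheme \<Rightarrow> bool" where
  "counterexample F \<longleftrightarrow> field F \<and> (\<exists>D M N. subring D F \<and> fractions F D = carrier F \<and>
     regular_local_ring (F \<restriction> D) \<and> krull_dim (F \<restriction> D) = 2 \<and> projective_model F D M \<and>
     minimal_desingularization F D M N \<and> closed_points F N \<noteq>
    {R \<in> quadratic_tree F D. dominates_closed_point F M R \<and>
       (\<forall>R' \<in> quadratic_tree F D. dominates_closed_point F M R' \<and> R' \<subseteq> R \<longrightarrow> R' = R)})"

definition gf2 :: "('a + bool) ring" where
  "gf2 = \<lparr>carrier = range Inr, monoid.mult = \<lambda>x y. Inr (projr x \<and> projr y), monoid.one = Inr True,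
     ring.zero = Inr False, ring.add = \<lambda>x y. Inr (projr x \<noteq> projr y)\<rparr>"

lemma gf2_field: "field (gf2 :: ('a + bool) ring)"
proof (rule cring.cring_fieldI)
  show "cring (gf2 :: ('a + bool) ring)"
  proof (rule cringI)
    show "abelian_group (gf2 :: ('a + bool) ring)"
      by (rule abelian_groupI) (auto simp: gf2_def)
    show "Group.comm_monoid (gf2 :: ('a + bool) ring)"
      by (rule comm_monoidI) (auto simp: gf2_def)
  qed (auto simp: gf2_def)
  have "x \<in> Units gf2 \<longleftrightarrow> x = Inr True" for x :: "'a + bool"
    by (cases x) (simp_all add: gf2_def Units_def image_iff ex_bool_eq)
  moreover have "x \<in> carrier gf2 - {\<zero>\<^bsub>gf2\<^esub>} \<longleftrightarrow> x = Inr True" for x :: "'a + bool"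
    by (cases x) (simp_all add: gf2_def image_iff)
  ultimately show "Units (gf2 :: ('a + bool) ring) = carrier gf2 - {\<zero>\<^bsub>gf2\<^esub>}" by blast
qed

text \<open>The carrier type is a sum because \<open>'a\<close> alone may be too small for any
  field: \<open>Inl\<close> embeds a counterexample, and \<open>Inr\<close> holds the field with two
  elements. The dummy argument records \<open>'b\<close>, on which the choice depends.\<close>

definition fld_ring :: "'b itself \<Rightarrow> ('a + bool) ring" where
  "fld_ring _ = (SOME K. field K \<and> ((\<exists>F :: ('a, 'b) ring_scheme. counterexample F) \<longrightarrow>
     (\<exists>F :: ('a, 'b) ring_scheme. counterexample F \<and> K = image_ring Inl F)))"

lemma fld_ring:
  "field (fld_ring TYPE('b) :: ('a + bool) ring)"
  "counterexample (F :: ('a, 'b) ring_scheme) \<Longrightarrow>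
     \<exists>F :: ('a, 'b) ring_scheme. counterexample F \<and> (fld_ring TYPE('b) :: ('a + bool) ring) = image_ring Inl F"
proof -
  have "\<exists>K :: ('a + bool) ring. field K \<and> ((\<exists>F :: ('a, 'b) ring_scheme. counterexample F) \<longrightarrow>
     (\<exists>F :: ('a, 'b) ring_scheme. counterexample F \<and> K = image_ring Inl F))"
  proof (cases "\<exists>F :: ('a, 'b) ring_scheme. counterexample F")
    case True
    then obtain F :: "('a, 'b) ring_scheme" where F: "counterexample F" by blast
    then have "field F" by (simp add: counterexample_def)
    then have "field (image_ring Inl F :: ('a + bool) ring)" by (rule field.inj_imp_image_ring_is_field) simp
    then show ?thesis using F by blast
  qed (use gf2_field in blast)
  from someI_ex[OF this]
  show "field (fld_ring TYPE('b) :: ('a + bool) ring)"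
  "counterexample (F :: ('a, 'b) ring_scheme) \<Longrightarrow>
     \<exists>F :: ('a, 'b) ring_scheme. counterexample F \<and> (fld_ring TYPE('b) :: ('a + bool) ring) = image_ring Inl F"
    unfolding fld_ring_def by blast+
qed

typedef ('a, 'b) fld = "carrier (fld_ring TYPE('b) :: ('a + bool) ring)"
proof -
  interpret field "fld_ring TYPE('b) :: ('a + bool) ring" by (rule fld_ring)
  show ?thesis using zero_closed by blast
qed

instantiation fld :: (type, type) field
begin

definition "0 = (Abs_fld \<zero>\<^bsub>fld_ring TYPE('b)\<^esub> :: ('a, 'b) fld)"
definition "1 = (Abs_fld \<one>\<^bsub>fld_ring TYPE('b)\<^esub> :: ('a, 'b) fld)"
definition "a + b = (Abs_fld (Rep_fld a \<oplus>\<^bsub>fld_ring TYPE('b)\<^esub> Rep_fld b) :: ('a, 'b) fld)"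
definition "a * b = (Abs_fld (Rep_fld a \<otimes>\<^bsub>fld_ring TYPE('b)\<^esub> Rep_fld b) :: ('a, 'b) fld)"
definition "- a = (Abs_fld (\<ominus>\<^bsub>fld_ring TYPE('b)\<^esub> Rep_fld a) :: ('a, 'b) fld)"
definition "a - b = (a + - b :: ('a, 'b) fld)"
definition "inverse a = (if a = 0 then 0 else Abs_fld (inv\<^bsub>fld_ring TYPE('b)\<^esub> Rep_fld a) :: ('a, 'b) fld)"
definition "a div b = (a * inverse b :: ('a, 'b) fld)"

instance
proof
  interpret field "fld_ring TYPE('b) :: ('a + bool) ring" by (rule fld_ring)
  note R = Rep_fld[where ?'a = 'a and ?'b = 'b]
  note rep [simp] = Abs_fld_inverse[where ?'a = 'a and ?'b = 'b]
  note inj = Rep_fld_inject[where ?'a = 'a and ?'b = 'b, symmetric]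
  have z: "Rep_fld (0 :: ('a, 'b) fld) = \<zero>\<^bsub>fld_ring TYPE('b)\<^esub>" by (simp add: zero_fld_def)
  have o: "Rep_fld (1 :: ('a, 'b) fld) = \<one>\<^bsub>fld_ring TYPE('b)\<^esub>" by (simp add: one_fld_def)
  have a: "Rep_fld (a + b) = Rep_fld a \<oplus>\<^bsub>fld_ring TYPE('b)\<^esub> Rep_fld b" for a b :: "('a, 'b) fld" by (simp add: plus_fld_def R)
  have m: "Rep_fld (a * b) = Rep_fld a \<otimes>\<^bsub>fld_ring TYPE('b)\<^esub> Rep_fld b" for a b :: "('a, 'b) fld" by (simp add: times_fld_def R)
  have u: "Rep_fld (- a) = \<ominus>\<^bsub>fld_ring TYPE('b)\<^esub> Rep_fld a" for a :: "('a, 'b) fld" by (simp add: uminus_fld_def R)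
  fix a b c :: "('a, 'b) fld"
  show "a * b * c = a * (b * c)" by (simp add: inj m m_assoc R)
  show "a * b = b * a" by (simp add: inj m m_comm R)
  show "1 * a = a" by (simp add: inj m o R)
  show "a + b + c = a + (b + c)" by (simp add: inj a a_assoc R)
  show "a + b = b + a" by (simp add: inj a a_comm R)
  show "0 + a = a" by (simp add: inj a z R)
  show "- a + a = 0" by (simp add: inj a z u l_neg R)
  show "a - b = a + - b" by (simp add: minus_fld_def)
  show "(a + b) * c = a * c + b * c" by (simp add: inj a m l_distr R)
  show "(0 :: ('a, 'b) fld) \<noteq> 1" by (simp add: inj z o)
  show "inverse (0 :: ('a, 'b) fld) = 0" by (simp add: inverse_fld_def)
  show "a div b = a * inverse b" by (simp add: divide_fld_def)
  show "inverse a * a = 1" if "a \<noteq> 0"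
  proof -
    have "Rep_fld a \<in> Units (fld_ring TYPE('b))" using that R[of a] by (simp add: inj z field_Units)
    then show ?thesis using that by (simp add: inverse_fld_def inj m o Units_inv_closed Units_l_inv)
  qed
qed

end

text \<open>The field behind the type is some chosen counterexample G, possibly different from F.
  The embedding \<open>Inl\<close> followed by \<open>Abs_fld\<close> represents G, so the theorem
  for represented fields refutes it.\<close>

lemma no_counterexample: "\<not> counterexample (F :: ('a, 'b) ring_scheme)"
proof
  assume "counterexample F"
  then obtain G :: "('a, 'b) ring_scheme" where G: "counterexample G"
    and K: "(fld_ring TYPE('b) :: ('a + bool) ring) = image_ring Inl G" using fld_ring(2) by blast
  have fG: "field G" using G by (simp add: counterexample_def)
  define h where "h a = (Abs_fld (Inl a) :: ('a, 'b) fld)" for a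
  have iso: "Inl \<in> ring_iso G (fld_ring TYPE('b) :: ('a + bool) ring)"
    unfolding K by (rule inj_imp_image_ring_iso) simp
  have A: "bij_betw Abs_fld (carrier (fld_ring TYPE('b))) (UNIV :: ('a, 'b) fld set)"
    by (rule bij_betw_byWitness[of _ Rep_fld]) (auto simp: Abs_fld_inverse Rep_fld_inverse Rep_fld)
  have bij: "bij_betw h (carrier G) UNIV"
    using bij_betw_trans[of Inl "carrier G", OF _ A] iso by (simp add: ring_iso_def h_def[abs_def] comp_def)
  have cl: "Inl a \<in> carrier (fld_ring TYPE('b))" if "a \<in> carrier G" for a
    using iso that by (auto simp: ring_iso_def ring_hom_def)
  have "field_rep G h"
  proof (intro field_rep.intro fG field_rep_axioms.intro bij)
    fix a b assume ab: "a \<in> carrier G" "b \<in> carrier G"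
    then show "h (a \<otimes>\<^bsub>G\<^esub> b) = h a * h b" "h (a \<oplus>\<^bsub>G\<^esub> b) = h a + h b"
      using iso cl by (auto simp: h_def times_fld_def plus_fld_def Abs_fld_inverse ring_iso_def ring_hom_def)
  qed
  then show False using field_rep.minimal_desingularization_tree G unfolding counterexample_def by blast
qed

theorem theorem5p3:
  fixes F :: "('a, 'b) ring_scheme" and D :: "'a set" and M N :: "'a set set"
  assumes "field F"
    and "subring D F"
    and "fractions F D = carrier F"
    and "regular_local_ring (F \<restriction> D)"
    and "krull_dim (F \<restriction> D) = 2"
    and "projective_model F D M"
    and "normal_model F M"
    and "minimal_desingularization F D M N"
  shows "closed_points F N =
    {R \<in> quadratic_tree F D. dominates_closed_point F M R \<and>
       (\<forall>R' \<in> quadratic_tree F D. dominates_closed_point F M R' \<and> R' \<subseteq> R \<longrightarrow> R' = R)}"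
  using no_counterexample[of F] assms unfolding counterexample_def by blast

end
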